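(* Let $M,N$ be positive integers with $MN\ge 2$, let $\Omega\subset\mathbf{C}$ be a domain, and let \[ H(z,y_1,y_2)=\alpha_{M+1,0}(z)\,y_1^{M+1}+\alpha_{0,N+1}(z)\,y_2^{N+1}+\sum_{(i,j)\in I}\alpha_{ij}(z)\,y_1^iy_2^j, \qquad I=\{(i,j)\in\mathbf{N}^2:\ i(N+1)+j(M+1)<(N+1)(M+1)\}, \] where all $\alpha_{ij}$ are analytic on $\Omega$. Consider the Hamiltonian system \[ y_1'=\frac{\partial H}{\partial y_2}=(N+1)\alpha_{0,N+1}(z)y_2^N+\sum_{(i,j)\in I}j\alpha_{ij}(z)y_1^iy_2^{j-1},\qquad y_2'=-\frac{\partial H}{\partial y_1}=-(M+1)\alpha_{M+1,0}(z)y_1^M-\sum_{(i,j)\in I}i\alpha_{ij}(z)y_1^{i-1}y_2^{j}. \] Let $\Phi=\{z_0\in\Omega:\alpha_{M+1,0}(z_0)=0\}\cup\{z_0\in\Omega:\alpha_{0,N+1}(z_0)=0\}$. Suppose that at every point $z_0\in\Omega\setminus\Phi$ the system admits formal series solutions \[ y_1(z)=\sum_{k=-N-1}^{\infty}c_{1,k}(z-z_0)^{\frac{k}{MN-1}},\qquad y_2(z)=\sum_{k=-M-1}^{\infty}c_{2,k}(z-z_0)^{\frac{k}{MN-1}} \] for every pair of values $(c_{1,-N-1},c_{2,-M-1})$ satisfying \[ c_{1,-N-1}^{MN-1}=-\left(\alpha_{0,N+1}(z_0)\,\alpha_{M+1,0}(z_0)^N\,(MN-1)^{N+1}\right)^{-1},\qquad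 c_{2,-M-1}=(MN-1)\,\alpha_{M+1,0}(z_0)\,c_{1,-N-1}^M. \] Let $\gamma\subset\Omega$ be a curve of finite length with endpoint $z_\infty\in\Omega\setminus\Phi$ such that a solution $(y_1,y_2)$ of the system can be analytically continued along $\gamma$ up to, but not including, $z_\infty$ (and cannot be analytically continued to $z_\infty$). Then, with $d=\gcd\{M+1,N+1,MN-1\}$, the solution is represented near $z_\infty$ by series \[ y_1(z)=\sum_{k=-\frac{N+1}{d}}^{\infty}C_{1,k}(z-z_\infty)^{\frac{kd}{MN-1}},\qquad y_2(z)=\sum_{k=-\frac{M+1}{d}}^{\infty}C_{2,k}(z-z_\infty)^{\frac{kd}{MN-1}}, \] convergent in some punctured, branched neighbourhood of $z_\infty$.
   Context: $\mathbf{N}$ includes $0$. A formal series solution means a formal series in powers of $(z-z_0)^{1/(MN-1)}$ which, after expanding the coefficients $\alpha_{ij}$ in Taylor series at $z_0$, satisfies the system identically as formal series. Singularities at points of $\Omega\setminus\Phi$ are called movable. *)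

theory Defs
  imports "HOL-Complex_Analysis.Complex_Analysis" "HOL-Computational_Algebra.Formal_Laurent_Series"
begin

definition idxI :: "nat \<Rightarrow> nat \<Rightarrow> (nat \<times> nat) set" where
  "idxI M N = {(i, j). i * (N + 1) + j * (M + 1) < (N + 1) * (M + 1)}"

text \<open>Right-hand sides dH/dy2 and -dH/dy1, written over an arbitrary commutative ring,
  with coefficients a i j (so they can be evaluated both on complex numbers and on
  formal Laurent series). For j = 0 (resp. i = 0) the term carries the factor j (resp. i) = 0.\<close>
definition rhs1 :: "(nat \<Rightarrow> nat \<Rightarrow> 'a::comm_ring_1) \<Rightarrow> nat \<Rightarrow> nat \<Rightarrow> 'a \<Rightarrow> 'a \<Rightarrow> 'a" where
  "rhs1 a M N y1 y2 = of_nat (N + 1) * a 0 (N + 1) * y2 ^ N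
     + (\<Sum>(i, j)\<in>idxI M N. of_nat j * a i j * y1 ^ i * y2 ^ (j - 1))"

definition rhs2 :: "(nat \<Rightarrow> nat \<Rightarrow> 'a::comm_ring_1) \<Rightarrow> nat \<Rightarrow> nat \<Rightarrow> 'a \<Rightarrow> 'a \<Rightarrow> 'a" where
  "rhs2 a M N y1 y2 = - (of_nat (M + 1) * a (M + 1) 0 * y1 ^ M)
     - (\<Sum>(i, j)\<in>idxI M N. of_nat i * a i j * y1 ^ (i - 1) * y2 ^ j)"

definition Phi :: "(nat \<Rightarrow> nat \<Rightarrow> complex \<Rightarrow> complex) \<Rightarrow> nat \<Rightarrow> nat \<Rightarrow> complex set \<Rightarrow> complex set" where
  "Phi \<alpha> M N \<Omega> = {z0 \<in> \<Omega>. \<alpha> (M + 1) 0 z0 = 0} \<union> {z0 \<in> \<Omega>. \<alpha> 0 (N + 1) z0 = 0}"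

text \<open>Taylor series of f at z0, rewritten in the variable t = (z - z0)^(1/p):
  the coefficient of t^k is the (k/p)-th Taylor coefficient if p divides k, else 0.\<close>
definition taylor_in_root :: "nat \<Rightarrow> (complex \<Rightarrow> complex) \<Rightarrow> complex \<Rightarrow> complex fls" where
  "taylor_in_root p f z0 = fps_to_fls (Abs_fps (\<lambda>k. if p dvd k
      then (deriv ^^ (k div p)) f z0 / fact (k div p) else 0))"

text \<open>Formal series solution at z0 in powers of t = (z-z0)^(1/p), p = MN-1.
  Since d/dz = (1/(p t^(p-1))) d/dt, the system reads
  d Y/dt = p t^(p-1) * RHS(Taylor coefficients, Y1, Y2).
  The series y1 starts at exponent -(N+1) with coefficient c1, y2 at -(M+1) with c2.\<close>
definition formal_solution ::
  "(nat \<Rightarrow> nat \<Rightarrow> complex \<Rightarrow> complex) \<Rightarrow> nat \<Rightarrow> nat \<Rightarrow> complex \<Rightarrow> complex \<Rightarrow> complex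
     \<Rightarrow> complex fls \<Rightarrow> complex fls \<Rightarrow> bool" where
  "formal_solution \<alpha> M N z0 c1 c2 Y1 Y2 \<longleftrightarrow>
     (let p = M * N - 1; A = (\<lambda>i j. taylor_in_root p (\<alpha> i j) z0) in
       (\<forall>k < - int (N + 1). fls_nth Y1 k = 0) \<and> fls_nth Y1 (- int (N + 1)) = c1 \<and>
       (\<forall>k < - int (M + 1). fls_nth Y2 k = 0) \<and> fls_nth Y2 (- int (M + 1)) = c2 \<and>
       fls_deriv Y1 = of_nat p * fls_X ^ (p - 1) * rhs1 A M N Y1 Y2 \<and>
       fls_deriv Y2 = of_nat p * fls_X ^ (p - 1) * rhs2 A M N Y1 Y2)"

definition finite_length :: "(real \<Rightarrow> complex) \<Rightarrow> bool" where
  "finite_length \<gamma> \<longleftrightarrow> (\<exists>L. \<forall>n (t :: nat \<Rightarrow> real).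
      t 0 = 0 \<and> t n = 1 \<and> (\<forall>i<n. t i \<le> t (Suc i)) \<longrightarrow>
      (\<Sum>i<n. norm (\<gamma> (t (Suc i)) - \<gamma> (t i))) \<le> L)"

definition continuation_along ::
  "(nat \<Rightarrow> nat \<Rightarrow> complex \<Rightarrow> complex) \<Rightarrow> nat \<Rightarrow> nat \<Rightarrow> complex set \<Rightarrow> (real \<Rightarrow> complex)
    \<Rightarrow> (real \<Rightarrow> real) \<Rightarrow> (real \<Rightarrow> complex \<Rightarrow> complex) \<Rightarrow> (real \<Rightarrow> complex \<Rightarrow> complex) \<Rightarrow> bool" where
  "continuation_along \<alpha> M N \<Omega> \<gamma> r u v \<longleftrightarrow>
     (\<forall>t\<in>{0..<1}. r t > 0 \<and> ball (\<gamma> t) (r t) \<subseteq> \<Omega> \<and>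
        u t holomorphic_on ball (\<gamma> t) (r t) \<and> v t holomorphic_on ball (\<gamma> t) (r t) \<and>
        (\<forall>z\<in>ball (\<gamma> t) (r t).
           (u t has_field_derivative rhs1 (\<lambda>i j. \<alpha> i j z) M N (u t z) (v t z)) (at z) \<and>
           (v t has_field_derivative rhs2 (\<lambda>i j. \<alpha> i j z) M N (u t z) (v t z)) (at z))) \<and>
     (\<forall>t\<in>{0..<1}. \<exists>\<delta>>0. \<forall>s\<in>{0..<1}. \<bar>s - t\<bar> < \<delta> \<longrightarrow>
        \<gamma> s \<in> ball (\<gamma> t) (r t) \<and>
        (\<forall>z\<in>ball (\<gamma> s) (r s) \<inter> ball (\<gamma> t) (r t). u s z = u t z \<and> v s z = v t z))"

definition continuable_to_end ::
  "(real \<Rightarrow> complex) \<Rightarrow> (real \<Rightarrow> real) \<Rightarrow> (real \<Rightarrow> complex \<Rightarrow> complex) \<Rightarrow> (real \<Rightarrow> complex \<Rightarrow> complex) \<Rightarrow> bool" where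
  "continuable_to_end \<gamma> r u v \<longleftrightarrow>
     (\<exists>\<rho>>0. \<exists>f g. f holomorphic_on ball (\<gamma> 1) \<rho> \<and> g holomorphic_on ball (\<gamma> 1) \<rho> \<and>
        (\<exists>\<delta>>0. \<forall>s\<in>{0..<1}. 1 - \<delta> < s \<longrightarrow>
           (\<forall>z\<in>ball (\<gamma> s) (r s) \<inter> ball (\<gamma> 1) \<rho>. u s z = f z \<and> v s z = g z)))"

end

theory Submission
  imports Defs
begin

text \<open>
  In the coordinates \<open>y\<^sub>1 = \<tau>\<^sup>-\<^sup>n\<close>, \<open>y\<^sub>2 = w \<tau>\<^sup>-\<^sup>m\<close> one has \<open>\<tau>\<^sup>K H = h(z, \<tau>, w)\<close> with \<open>h\<close> polynomial in \<open>\<tau>\<close> and \<open>w\<close>,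
  and the solutions that become infinite are those for which \<open>w\<close> approaches a root \<open>c\<close> of \<open>h(z, 0, w)\<close>.
  Near each root a polynomial \<open>P\<close> in \<open>\<tau>\<close> is computed for which \<open>w = P(z, \<tau>)\<close> is invariant up to order \<open>\<tau>\<^sup>K\<^sup>+\<^sup>q\<close>.
  The only obstruction is a resonance at order \<open>K\<close>, which would produce logarithms and which the formal
  solutions rule out. The quantity \<open>W = (h(z, \<tau>, w) - h(z, \<tau>, P)) / \<tau>\<^sup>K\<close> then grows at most linearly along the
  solution. Averaging \<open>ln (1 + |W|)\<close> over the branches of \<open>\<tau>\<close> and glueing it to \<open>ln (1 + |H|)\<close> away from the roots
  gives a function that stays bounded along a path of finite length, whereas \<open>|y\<^sub>1| + |y\<^sub>2|\<close> tends to infinity because the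
  solution cannot be continued. Hence \<open>\<nu> = (w - P) / \<tau>\<^sup>K\<close> stays bounded, and \<open>(z, \<nu>)\<close> solves a system that is regular
  in the independent variable \<open>\<tau>\<close> up to \<open>\<tau> = 0\<close>. There \<open>z - z\<^sub>\<infinity>\<close> has a zero of order \<open>q\<close>, so its \<open>q\<close>-th root
  is a local coordinate in which \<open>y\<^sub>1\<close> and \<open>y\<^sub>2\<close> are Laurent series.
\<close>

section \<open>Holomorphic differential equations in two unknowns\<close>

text \<open>Near a root \<open>H\<close> itself is of no use: along a solution its derivative is its
  explicit \<open>z\<close>-derivative, which may be of order \<open>\<tau>^(-K)\<close> while
  \<open>H\<close> stays moderate. Subtracting \<open>h(z, \<tau>, P) / \<tau>^K\<close> removes
  this growth, and the \<open>q\<close> orders of invariance beyond \<open>K\<close> pay for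
  \<open>\<tau>' = O(\<tau>^(1-q))\<close>. The resonance arises because a term
  \<open>c \<tau>^k\<close> in \<open>P\<close> changes the defect by
  \<open>(K - k) h_w c \<tau>^k\<close> to leading order; a defect left at \<open>k = K\<close>
  would make \<open>W\<close> grow like a logarithm along a truncated formal solution, where it is
  meromorphic. As \<open>y1\<close> fixes \<open>\<tau>\<close> only up to an \<open>n\<close>-th
  root of unity, \<open>W\<close> is not a function of the state until it is symmetrised. The
  glueing is delicate: its transition variable moves at speed \<open>|\<tau>|^(-q)\<close>, and it
  works because the glued functions differ there by \<open>O(|\<tau>|^q)\<close>, thanks to the
  divisibility of \<open>h(z, \<tau>, P)\<close> by \<open>\<tau>^q\<close>. All estimates are
  Lipschitz conditions at single points, so a merely rectifiable path can be treated as it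
  stands.\<close>

definition hol3 :: "(complex \<Rightarrow> complex \<Rightarrow> complex \<Rightarrow> complex) \<Rightarrow> complex set \<Rightarrow> complex set \<Rightarrow> complex set \<Rightarrow> bool" where
  "hol3 F A B C \<longleftrightarrow> continuous_on (A \<times> B \<times> C) (\<lambda>(t, x, y). F t x y) \<and>
     (\<forall>S e f g. open S \<longrightarrow> e holomorphic_on S \<longrightarrow> f holomorphic_on S \<longrightarrow> g holomorphic_on S \<longrightarrow>
        e ` S \<subseteq> A \<longrightarrow> f ` S \<subseteq> B \<longrightarrow> g ` S \<subseteq> C \<longrightarrow> (\<lambda>s. F (e s) (f s) (g s)) holomorphic_on S)"

text \<open>\<open>hol3\<close> stands in for holomorphy in three variables. Its sets are usually
  closed balls, on whose boundary holomorphy has no direct meaning, so it is tested by substituting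
  holomorphic functions on open sets; joint continuity supplies bounds on compact sets.\<close>

lemma hol3_subst:
  assumes "hol3 F A B C" "open S" "e holomorphic_on S" "f holomorphic_on S" "g holomorphic_on S"
    "\<And>s. s \<in> S \<Longrightarrow> e s \<in> A" "\<And>s. s \<in> S \<Longrightarrow> f s \<in> B" "\<And>s. s \<in> S \<Longrightarrow> g s \<in> C"
  shows "(\<lambda>s. F (e s) (f s) (g s)) holomorphic_on S"
  by (rule hol3_def[THEN iffD1, OF assms(1), THEN conjunct2, rule_format]) (use assms in auto)

text \<open>Cauchy's estimate on circles of radius \<open>R\<close> about the points of the smaller
  ball bounds the derivative by \<open>B / R\<close>, and that ball is convex. The factor 3 keeps
  the closed discs, which reach distance \<open>2 * R\<close> from the centre, inside the open
  ball.\<close>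

lemma holomorphic_lipschitz_cball:
  assumes f: "f holomorphic_on ball x0 (3 * R)" and R: "R > 0"
    and b: "\<And>x. x \<in> ball x0 (3 * R) \<Longrightarrow> norm (f x) \<le> B"
    and x: "x \<in> cball x0 R" "y \<in> cball x0 R"
  shows "norm (f x - f y) \<le> B / R * norm (x - y)"
proof (rule field_differentiable_bound[OF convex_cball])
  fix z assume z: "z \<in> cball x0 R"
  have sub: "cball z R \<subseteq> ball x0 (3 * R)"
  proof
    fix w assume "w \<in> cball z R"
    then have "dist x0 w \<le> R + R"
      using z dist_triangle[of x0 w z] by simp
    then show "w \<in> ball x0 (3 * R)" using R by simp
  qed
  have "z \<in> ball x0 (3 * R)" using z R by simp
  then show "(f has_field_derivative deriv f z) (at z within cball x0 R)"
    using f holomorphic_derivI open_ball by blast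
  have "norm ((deriv ^^ 1) f z) \<le> fact 1 * B / R ^ 1"
  proof (rule Cauchy_inequality)
    show "f holomorphic_on ball z R" using f sub ball_subset_cball holomorphic_on_subset by (meson subset_trans)
    show "continuous_on (cball z R) f" using f sub holomorphic_on_imp_continuous_on holomorphic_on_subset by blast
    show "norm (f x) \<le> B" if "norm (z - x) = R" for x
      using that sub by (intro b) (auto simp: dist_norm subset_iff)
  qed (use R in auto)
  then show "norm (deriv f z) \<le> B / R" by simp
qed (use x in auto)

text \<open>The bound comes from compactness. For the Lipschitz constant the two state variables are
  moved one at a time, through the intermediate point \<open>(x', y)\<close>, so that the
  one-variable estimate applies to each.\<close>

lemma hol3_bounded_lipschitz:
  assumes F: "hol3 F (cball t0 r) (cball x0 (3 * R1)) (cball y0 (3 * R2))"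
    and R: "R1 > 0" "R2 > 0"
  obtains B L where "B \<ge> 0" "L \<ge> 0"
    "\<And>t x y. t \<in> cball t0 r \<Longrightarrow> x \<in> cball x0 (3 * R1) \<Longrightarrow> y \<in> cball y0 (3 * R2) \<Longrightarrow> norm (F t x y) \<le> B"
    "\<And>t x y x' y'. t \<in> cball t0 r \<Longrightarrow> x \<in> cball x0 R1 \<Longrightarrow> x' \<in> cball x0 R1 \<Longrightarrow>
       y \<in> cball y0 R2 \<Longrightarrow> y' \<in> cball y0 R2 \<Longrightarrow>
       norm (F t x y - F t x' y') \<le> L * (norm (x - x') + norm (y - y'))"
proof -
  let ?D = "cball t0 r \<times> cball x0 (3 * R1) \<times> cball y0 (3 * R2)"
  have "compact ((\<lambda>(t, x, y). F t x y) ` ?D)"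
    using F unfolding hol3_def by (intro compact_continuous_image compact_Times compact_cball) auto
  then obtain B0 where B0: "\<And>z. z \<in> (\<lambda>(t, x, y). F t x y) ` ?D \<Longrightarrow> norm z \<le> B0"
    by (meson compact_imp_bounded bounded_iff)
  define B where "B = max B0 0"
  have B: "norm (F t x y) \<le> B" if "t \<in> cball t0 r" "x \<in> cball x0 (3 * R1)" "y \<in> cball y0 (3 * R2)" for t x y
  proof -
    have "F t x y \<in> (\<lambda>(t, x, y). F t x y) ` ?D"
      by (rule image_eqI[of _ _ "(t, x, y)"]) (use that in auto)
    then show ?thesis using B0 unfolding B_def by fastforce
  qed
  have B_nn: "B \<ge> 0" unfolding B_def by simp
  define L where "L = B / R1 + B / R2"
  have L_nn: "L \<ge> 0" unfolding L_def using B_nn R by simp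
  show ?thesis
  proof (rule that[OF B_nn L_nn B], assumption+)
    fix t x y x' y' assume t: "t \<in> cball t0 r" and x: "x \<in> cball x0 R1" "x' \<in> cball x0 R1"
      and y: "y \<in> cball y0 R2" "y' \<in> cball y0 R2"
    have y3: "y \<in> cball y0 (3 * R2)" "x' \<in> cball x0 (3 * R1)" using y x R by auto
    have "norm (F t x y - F t x' y) \<le> B / R1 * norm (x - x')"
    proof (rule holomorphic_lipschitz_cball)
      show "(\<lambda>x. F t x y) holomorphic_on ball x0 (3 * R1)"
        by (rule hol3_subst[OF F]) (use t y3 in \<open>auto intro!: holomorphic_intros\<close>)
    qed (use R x t y3 B in auto)
    moreover have "norm (F t x' y - F t x' y') \<le> B / R2 * norm (y - y')"
    proof (rule holomorphic_lipschitz_cball)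
      show "(\<lambda>y. F t x' y) holomorphic_on ball y0 (3 * R2)"
        by (rule hol3_subst[OF F]) (use t y3 in \<open>auto intro!: holomorphic_intros\<close>)
    qed (use R y t y3 B in auto)
    ultimately have "norm (F t x y - F t x' y') \<le> B / R1 * norm (x - x') + B / R2 * norm (y - y')"
      using norm_triangle_ineq[of "F t x y - F t x' y" "F t x' y - F t x' y'"] by simp
    also have "\<dots> \<le> L * norm (x - x') + L * norm (y - y')"
      unfolding L_def using B_nn R by (intro add_mono mult_right_mono) auto
    finally show "norm (F t x y - F t x' y') \<le> L * (norm (x - x') + norm (y - y'))"
      by (simp add: algebra_simps)
  qed
qed

section \<open>Picard iteration with a uniform radius, and local uniqueness\<close>

lemma derivative_bound_ball:
  fixes f f' :: "complex \<Rightarrow> complex"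
  assumes d: "\<And>s. s \<in> ball c \<rho> \<Longrightarrow> (f has_field_derivative f' s) (at s)"
    and C: "\<And>s. s \<in> ball c \<rho> \<Longrightarrow> norm (f' s) \<le> C" and t: "t \<in> ball c \<rho>"
  shows "norm (f t - f c) \<le> \<rho> * C"
proof -
  have \<rho>: "\<rho> > 0" using t by (metis ball_eq_empty empty_iff not_le)
  have C0: "0 \<le> C" using order_trans[OF norm_ge_zero C[of c]] \<rho> by simp
  have "norm (f t - f c) \<le> C * norm (t - c)"
    by (rule field_differentiable_bound[OF convex_ball[of c \<rho>], of f f'])
       (use C t \<rho> d in \<open>auto intro: has_field_derivative_at_within\<close>)
  also have "\<dots> \<le> C * \<rho>" using t C0 by (intro mult_left_mono) (auto simp: dist_norm norm_minus_commute)
  finally show ?thesis by (simp add: mult.commute)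
qed

text \<open>The Picard operator uses complex primitives, which exist on a disc, so all iterates are
  holomorphic and so is their uniform limit. In \<open>4 * (\<rho> * L) \<le> 1\<close> one factor 2
  is there because both components enter the Lipschitz bound, the other makes the contraction factor
  \<open>1/2\<close>.\<close>

lemma picard_core:
  fixes F G :: "complex \<Rightarrow> complex \<Rightarrow> complex \<Rightarrow> complex"
  assumes \<rho>: "\<rho> > 0" and L: "L \<ge> 0" and B: "B \<ge> 0"
    and holF: "\<And>f g. f holomorphic_on ball t1 \<rho> \<Longrightarrow> g holomorphic_on ball t1 \<rho> \<Longrightarrow>
        (\<And>t. t \<in> ball t1 \<rho> \<Longrightarrow> f t \<in> cball x1 r1) \<Longrightarrow> (\<And>t. t \<in> ball t1 \<rho> \<Longrightarrow> g t \<in> cball y1 r2) \<Longrightarrow>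
        (\<lambda>t. F t (f t) (g t)) holomorphic_on ball t1 \<rho>"
    and holG: "\<And>f g. f holomorphic_on ball t1 \<rho> \<Longrightarrow> g holomorphic_on ball t1 \<rho> \<Longrightarrow>
        (\<And>t. t \<in> ball t1 \<rho> \<Longrightarrow> f t \<in> cball x1 r1) \<Longrightarrow> (\<And>t. t \<in> ball t1 \<rho> \<Longrightarrow> g t \<in> cball y1 r2) \<Longrightarrow>
        (\<lambda>t. G t (f t) (g t)) holomorphic_on ball t1 \<rho>"
    and bd: "\<And>t x y. t \<in> ball t1 \<rho> \<Longrightarrow> x \<in> cball x1 r1 \<Longrightarrow> y \<in> cball y1 r2 \<Longrightarrow>
        norm (F t x y) \<le> B \<and> norm (G t x y) \<le> B"
    and lip: "\<And>t x y x' y'. t \<in> ball t1 \<rho> \<Longrightarrow> x \<in> cball x1 r1 \<Longrightarrow> x' \<in> cball x1 r1 \<Longrightarrow>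
        y \<in> cball y1 r2 \<Longrightarrow> y' \<in> cball y1 r2 \<Longrightarrow>
        norm (F t x y - F t x' y') \<le> L * (norm (x - x') + norm (y - y')) \<and>
        norm (G t x y - G t x' y') \<le> L * (norm (x - x') + norm (y - y'))"
    and small: "\<rho> * B \<le> r1" "\<rho> * B \<le> r2" "4 * (\<rho> * L) \<le> 1"
  shows "\<exists>f g. f holomorphic_on ball t1 \<rho> \<and> g holomorphic_on ball t1 \<rho> \<and> f t1 = x1 \<and> g t1 = y1 \<and>
     (\<forall>t\<in>ball t1 \<rho>. f t \<in> cball x1 r1 \<and> g t \<in> cball y1 r2 \<and>
        (f has_field_derivative F t (f t) (g t)) (at t) \<and> (g has_field_derivative G t (f t) (g t)) (at t))"
proof -
  let ?S = "ball t1 \<rho>"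
  have "\<exists>H. H t1 = x \<and> (\<forall>t\<in>?S. (H has_field_derivative h t) (at t))" if "h holomorphic_on ?S" for h and x :: complex
  proof -
    obtain H where H: "\<And>t. t \<in> ?S \<Longrightarrow> (H has_field_derivative h t) (at t)"
      using holomorphic_convex_primitive'[OF convex_ball open_ball \<open>h holomorphic_on ?S\<close>]
      by (metis at_within_open open_ball)
    show ?thesis
    proof (rule exI[of _ "\<lambda>t. H t - H t1 + x"], intro conjI ballI)
      show "H t1 - H t1 + x = x" by simp
      show "((\<lambda>t. H t - H t1 + x) has_field_derivative h t) (at t)" if "t \<in> ?S" for t
        using H[OF that] by (auto intro!: derivative_eq_intros)
    qed
  qed
  \<comment> \<open>\<open>I h x\<close> is the primitive of \<open>h\<close> with value
    \<open>x\<close> at the centre, chosen for all \<open>h\<close> and \<open>x\<close> at once so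
    that the iteration can be written as a map.\<close>
  then obtain I where I0: "\<And>h x. h holomorphic_on ?S \<Longrightarrow> I h x t1 = x"
    and I1: "\<And>h x t. h holomorphic_on ?S \<Longrightarrow> t \<in> ?S \<Longrightarrow> (I h x has_field_derivative h t) (at t)"
    by metis
  have Ihol: "I h x holomorphic_on ?S" if "h holomorphic_on ?S" for h x
    using I1[OF that] by (meson field_differentiable_at_within field_differentiable_def holomorphic_onI)
  have Idiff: "norm (I h x t - I h' x t) \<le> \<rho> * C"
    if h: "h holomorphic_on ?S" "h' holomorphic_on ?S" and t: "t \<in> ?S"
      and C: "\<And>s. s \<in> ?S \<Longrightarrow> norm (h s - h' s) \<le> C" for h h' x t C
  proof -
    have "norm ((\<lambda>t. I h x t - I h' x t) t - (\<lambda>t. I h x t - I h' x t) t1) \<le> \<rho> * C"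
      by (rule derivative_bound_ball[where f' = "\<lambda>s. h s - h' s", OF _ C t]) (intro DERIV_diff I1 h, assumption+)
    then show ?thesis using I0[OF h(1)] I0[OF h(2)] by simp
  qed
  have Ibd: "norm (I h x t - x) \<le> \<rho> * C"
    if h: "h holomorphic_on ?S" and t: "t \<in> ?S" and C: "\<And>s. s \<in> ?S \<Longrightarrow> norm (h s) \<le> C" for h x t C
    using derivative_bound_ball[where f' = h and f = "I h x", OF I1[OF h] C t] I0[OF h] by simp
  define stp where "stp = (\<lambda>(f, g). (I (\<lambda>t. F t (f t) (g t)) x1, I (\<lambda>t. G t (f t) (g t)) y1))"
  define fs where "fs n = fst ((stp ^^ n) (\<lambda>_. x1, \<lambda>_. y1))" for n
  define gs where "gs n = snd ((stp ^^ n) (\<lambda>_. x1, \<lambda>_. y1))" for n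
  have fs0: "fs 0 = (\<lambda>_. x1)" "gs 0 = (\<lambda>_. y1)" unfolding fs_def gs_def by auto
  have fsS: "fs (Suc n) = I (\<lambda>t. F t (fs n t) (gs n t)) x1" "gs (Suc n) = I (\<lambda>t. G t (fs n t) (gs n t)) y1" for n
    unfolding fs_def gs_def stp_def by (auto simp: case_prod_unfold)
  have r: "0 \<le> r1" "0 \<le> r2" using small \<rho> B by (auto intro: order_trans[rotated])
  have inv: "fs n holomorphic_on ?S \<and> gs n holomorphic_on ?S \<and> (\<forall>t\<in>?S. fs n t \<in> cball x1 r1 \<and> gs n t \<in> cball y1 r2)" for n
  proof (induction n)
    case 0 then show ?case using r by (simp add: fs0)
  next
    case (Suc n)
    have hF: "(\<lambda>t. F t (fs n t) (gs n t)) holomorphic_on ?S" using Suc by (intro holF) auto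
    have hG: "(\<lambda>t. G t (fs n t) (gs n t)) holomorphic_on ?S" using Suc by (intro holG) auto
    have "norm (fs (Suc n) t - x1) \<le> \<rho> * B \<and> norm (gs (Suc n) t - y1) \<le> \<rho> * B" if "t \<in> ?S" for t
      unfolding fsS using Ibd[OF hF that] Ibd[OF hG that] bd Suc by auto
    then show ?case using Ihol[OF hF] Ihol[OF hG] small
      unfolding fsS by (fastforce simp: dist_norm norm_minus_commute)
  qed
  have hF: "(\<lambda>t. F t (fs n t) (gs n t)) holomorphic_on ?S" for n using inv by (intro holF) auto
  have hG: "(\<lambda>t. G t (fs n t) (gs n t)) holomorphic_on ?S" for n using inv by (intro holG) auto
  have half: "\<rho> * (L * (a + a)) \<le> a / 2" if "a \<ge> 0" for a
  proof -
    have "(4 * (\<rho> * L)) * a \<le> 1 * a" using small(3) that by (intro mult_right_mono) auto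
    then show ?thesis by (simp add: algebra_simps)
  qed
  define c where "c = \<rho> * B"
  have c: "c \<ge> 0" using \<rho> B unfolding c_def by simp
  have dn: "\<forall>t\<in>?S. norm (fs (Suc n) t - fs n t) \<le> c * (1/2)^n \<and> norm (gs (Suc n) t - gs n t) \<le> c * (1/2)^n" for n
  proof (induction n)
    case 0
    show ?case
    proof
      fix t assume t: "t \<in> ?S"
      show "norm (fs (Suc 0) t - fs 0 t) \<le> c * (1/2)^0 \<and> norm (gs (Suc 0) t - gs 0 t) \<le> c * (1/2)^0"
        unfolding fsS using Ibd[OF hF t, of 0 B x1] Ibd[OF hG t, of 0 B y1] bd inv[of 0] c_def by (auto simp: fs0)
    qed
  next
    case (Suc n)
    show ?case
    proof
      fix t assume t: "t \<in> ?S"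
      have e: "norm (F s (fs (Suc n) s) (gs (Suc n) s) - F s (fs n s) (gs n s)) \<le> L * (c * (1/2)^n + c * (1/2)^n) \<and>
        norm (G s (fs (Suc n) s) (gs (Suc n) s) - G s (fs n s) (gs n s)) \<le> L * (c * (1/2)^n + c * (1/2)^n)" if s: "s \<in> ?S" for s
      proof -
        have "L * (norm (fs (Suc n) s - fs n s) + norm (gs (Suc n) s - gs n s)) \<le> L * (c * (1/2)^n + c * (1/2)^n)"
          using Suc s L by (intro mult_left_mono add_mono) auto
        then show ?thesis using lip[OF s, of "fs (Suc n) s" "fs n s" "gs (Suc n) s" "gs n s"] inv[of n] inv[of "Suc n"] s by force
      qed
      have "norm (fs (Suc (Suc n)) t - fs (Suc n) t) \<le> \<rho> * (L * (c * (1/2)^n + c * (1/2)^n))"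
        by (subst fsS(1)[of "Suc n"], subst fsS(1)[of n], rule Idiff[OF hF hF t]) (use e in auto)
      moreover have "norm (gs (Suc (Suc n)) t - gs (Suc n) t) \<le> \<rho> * (L * (c * (1/2)^n + c * (1/2)^n))"
        by (subst fsS(2)[of "Suc n"], subst fsS(2)[of n], rule Idiff[OF hG hG t]) (use e in auto)
      moreover have "\<rho> * (L * (c * (1/2)^n + c * (1/2)^n)) \<le> c * (1/2)^Suc n"
        using half[of "c * (1/2)^n"] c by simp
      ultimately show "norm (fs (Suc (Suc n)) t - fs (Suc n) t) \<le> c * (1/2)^Suc n \<and>
        norm (gs (Suc (Suc n)) t - gs (Suc n) t) \<le> c * (1/2)^Suc n" by linarith
    qed
  qed
  have sm: "summable (\<lambda>n. c * (1/2::real)^n)" by (intro summable_mult summable_geometric) auto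
  have tele: "h 0 t + (\<Sum>i<n. h (Suc i) t - h i t) = h n t" for h :: "nat \<Rightarrow> complex \<Rightarrow> complex" and n t
    by (simp add: sum_lessThan_telescope[of "\<lambda>i. h i t"])
  have lim: "\<exists>l. uniform_limit ?S h l sequentially" if "\<And>n t. t \<in> ?S \<Longrightarrow> norm (h (Suc n) t - h n t) \<le> c * (1/2)^n"
    for h :: "nat \<Rightarrow> complex \<Rightarrow> complex"
  proof -
    have "uniform_limit ?S (\<lambda>n t. \<Sum>i<n. h (Suc i) t - h i t) (\<lambda>t. \<Sum>i. h (Suc i) t - h i t) sequentially"
      by (rule Weierstrass_m_test[OF _ sm]) (use that in auto)
    then have "uniform_limit ?S (\<lambda>n t. h 0 t + (\<Sum>i<n. h (Suc i) t - h i t)) (\<lambda>t. h 0 t + (\<Sum>i. h (Suc i) t - h i t)) sequentially"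
      by (intro uniform_limit_intros) 
    then show ?thesis unfolding tele by blast
  qed
  obtain f where f: "uniform_limit ?S fs f sequentially" using lim[of fs] dn by blast
  obtain g where g: "uniform_limit ?S gs g sequentially" using lim[of gs] dn by blast
  have hol: "l holomorphic_on ?S" if "uniform_limit ?S h l sequentially" "\<And>n. h n holomorphic_on ?S" for h l
  proof (rule holomorphic_uniform_sequence[OF open_ball that(2)])
    fix x assume "x \<in> ?S"
    then obtain d where "d > 0" "cball x d \<subseteq> ?S" using open_ball open_contains_cball by blast
    then show "\<exists>d>0. cball x d \<subseteq> ?S \<and> uniform_limit (cball x d) h l sequentially"
      using that(1) uniform_limit_on_subset by blast
  qed
  have fh: "f holomorphic_on ?S" using hol[OF f] inv by blast
  have gh: "g holomorphic_on ?S" using hol[OF g] inv by blast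
  have ptf: "(\<lambda>n. fs n t) \<longlonglongrightarrow> f t" and ptg: "(\<lambda>n. gs n t) \<longlonglongrightarrow> g t" if "t \<in> ?S" for t
    using tendsto_uniform_limitI[OF f that] tendsto_uniform_limitI[OF g that] by auto
  have fr: "f t \<in> cball x1 r1" and gr: "g t \<in> cball y1 r2" if t: "t \<in> ?S" for t
    using closed_sequentially[OF closed_cball _ ptf[OF t], of x1 r1] closed_sequentially[OF closed_cball _ ptg[OF t], of y1 r2]
      inv t by auto
  have hF': "(\<lambda>t. F t (f t) (g t)) holomorphic_on ?S" using fh gh fr gr by (intro holF) auto
  have hG': "(\<lambda>t. G t (f t) (g t)) holomorphic_on ?S" using fh gh fr gr by (intro holG) auto
  \<comment> \<open>The iterates \<open>fs (Suc n)\<close> tend to \<open>f\<close> and, by the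
    Lipschitz bound on the integrands, also to the image of the limit pair; hence the limit is a
    fixed point.\<close>
  have eqs: "f t = I (\<lambda>t. F t (f t) (g t)) x1 t \<and> g t = I (\<lambda>t. G t (f t) (g t)) y1 t" if t: "t \<in> ?S" for t
  proof -
    have ev: "\<forall>\<^sub>F n in sequentially. norm (fs (Suc n) t - I (\<lambda>t. F t (f t) (g t)) x1 t) \<le> \<epsilon> \<and>
       norm (gs (Suc n) t - I (\<lambda>t. G t (f t) (g t)) y1 t) \<le> \<epsilon>" if \<epsilon>: "\<epsilon> > 0" for \<epsilon>
    proof -
      have "\<forall>\<^sub>F n in sequentially. (\<forall>s\<in>?S. dist (fs n s) (f s) < \<epsilon>) \<and> (\<forall>s\<in>?S. dist (gs n s) (g s) < \<epsilon>)"
        using uniform_limitD[OF f \<epsilon>] uniform_limitD[OF g \<epsilon>] by (rule eventually_conj)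
      then show ?thesis
      proof eventually_elim
        case (elim n)
        have e: "norm (F s (fs n s) (gs n s) - F s (f s) (g s)) \<le> L * (\<epsilon> + \<epsilon>) \<and>
            norm (G s (fs n s) (gs n s) - G s (f s) (g s)) \<le> L * (\<epsilon> + \<epsilon>)" if s: "s \<in> ?S" for s
        proof -
          have "L * (norm (fs n s - f s) + norm (gs n s - g s)) \<le> L * (\<epsilon> + \<epsilon>)"
            using elim s L by (intro mult_left_mono add_mono) (auto simp: dist_norm intro: less_imp_le)
          then show ?thesis using lip[OF s, of "fs n s" "f s" "gs n s" "g s"] inv[of n] s fr gr by force
        qed
        have "norm (fs (Suc n) t - I (\<lambda>t. F t (f t) (g t)) x1 t) \<le> \<rho> * (L * (\<epsilon> + \<epsilon>))"
          by (subst fsS(1)[of n], rule Idiff[OF hF hF' t]) (use e in auto)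
        moreover have "norm (gs (Suc n) t - I (\<lambda>t. G t (f t) (g t)) y1 t) \<le> \<rho> * (L * (\<epsilon> + \<epsilon>))"
          by (subst fsS(2)[of n], rule Idiff[OF hG hG' t]) (use e in auto)
        ultimately show ?case using half[of \<epsilon>] \<epsilon> by linarith
      qed
    qed
    have key: "h \<longlonglongrightarrow> l" if "\<And>\<epsilon>. \<epsilon> > 0 \<Longrightarrow> \<forall>\<^sub>F n in sequentially. norm (h n - l) \<le> \<epsilon>" for h :: "nat \<Rightarrow> complex" and l
      unfolding tendsto_iff dist_norm
    proof (intro allI impI)
      fix \<epsilon> :: real assume "\<epsilon> > 0"
      then show "\<forall>\<^sub>F n in sequentially. norm (h n - l) < \<epsilon>"
        using that[of "\<epsilon> / 2"] by (auto elim!: eventually_mono)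
    qed
    have "(\<lambda>n. fs (Suc n) t) \<longlonglongrightarrow> I (\<lambda>t. F t (f t) (g t)) x1 t"
      by (rule key, rule eventually_mono[OF ev]) auto
    moreover have "(\<lambda>n. gs (Suc n) t) \<longlonglongrightarrow> I (\<lambda>t. G t (f t) (g t)) y1 t"
      by (rule key, rule eventually_mono[OF ev]) auto
    ultimately show ?thesis using LIMSEQ_Suc[OF ptf[OF t]] LIMSEQ_Suc[OF ptg[OF t]] LIMSEQ_unique by blast
  qed
  show ?thesis
  proof (intro exI conjI ballI)
    fix t assume t: "t \<in> ?S"
    have "eventually (\<lambda>s. s \<in> ?S) (nhds t)" by (rule eventually_nhds_in_open[OF open_ball t])
    then have "eventually (\<lambda>s. f s = I (\<lambda>t. F t (f t) (g t)) x1 s) (nhds t)" "eventually (\<lambda>s. g s = I (\<lambda>t. G t (f t) (g t)) y1 s) (nhds t)"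
      using eqs by (auto elim: eventually_mono)
    then show "(f has_field_derivative F t (f t) (g t)) (at t)" "(g has_field_derivative G t (f t) (g t)) (at t)"
      using I1[OF hF' t, of x1] I1[OF hG' t, of y1] by (auto simp: DERIV_cong_ev)
    show "f t \<in> cball x1 r1" "g t \<in> cball y1 r2" using fr gr t by auto
  next
    show "f t1 = x1" "g t1 = y1" using eqs[of t1] \<rho> I0[OF hF'] I0[OF hG'] by auto
  qed (use fh gh in auto)
qed

text \<open>The point is that one \<open>\<rho>\<close> serves all initial data in the halved balls.
  This carries a bounded solution across the endpoint of the path, and later it lets solutions
  started at small \<open>\<tau>\<close> reach \<open>\<tau> = 0\<close>.\<close>

lemma picard_uniform:
  fixes F G :: "complex \<Rightarrow> complex \<Rightarrow> complex \<Rightarrow> complex"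
  assumes F: "hol3 F (cball t0 r) (cball x0 (3 * R1)) (cball y0 (3 * R2))"
    and G: "hol3 G (cball t0 r) (cball x0 (3 * R1)) (cball y0 (3 * R2))"
    and R: "r > 0" "R1 > 0" "R2 > 0"
  shows "\<exists>\<rho>>0. \<forall>t1\<in>cball t0 (r / 2). \<forall>x1\<in>cball x0 (R1 / 2). \<forall>y1\<in>cball y0 (R2 / 2).
     \<exists>f g. f holomorphic_on ball t1 \<rho> \<and> g holomorphic_on ball t1 \<rho> \<and> f t1 = x1 \<and> g t1 = y1 \<and>
     (\<forall>t\<in>ball t1 \<rho>. t \<in> cball t0 r \<and> f t \<in> cball x0 R1 \<and> g t \<in> cball y0 R2 \<and>
        (f has_field_derivative F t (f t) (g t)) (at t) \<and> (g has_field_derivative G t (f t) (g t)) (at t))"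
proof -
  obtain B1 L1 where 1: "B1 \<ge> 0" "L1 \<ge> 0"
    "\<And>t x y. t \<in> cball t0 r \<Longrightarrow> x \<in> cball x0 (3 * R1) \<Longrightarrow> y \<in> cball y0 (3 * R2) \<Longrightarrow> norm (F t x y) \<le> B1"
    "\<And>t x y x' y'. t \<in> cball t0 r \<Longrightarrow> x \<in> cball x0 R1 \<Longrightarrow> x' \<in> cball x0 R1 \<Longrightarrow>
       y \<in> cball y0 R2 \<Longrightarrow> y' \<in> cball y0 R2 \<Longrightarrow>
       norm (F t x y - F t x' y') \<le> L1 * (norm (x - x') + norm (y - y'))"
    using hol3_bounded_lipschitz[OF F R(2,3)] by metis
  obtain B2 L2 where 2: "B2 \<ge> 0" "L2 \<ge> 0"
    "\<And>t x y. t \<in> cball t0 r \<Longrightarrow> x \<in> cball x0 (3 * R1) \<Longrightarrow> y \<in> cball y0 (3 * R2) \<Longrightarrow> norm (G t x y) \<le> B2"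
    "\<And>t x y x' y'. t \<in> cball t0 r \<Longrightarrow> x \<in> cball x0 R1 \<Longrightarrow> x' \<in> cball x0 R1 \<Longrightarrow>
       y \<in> cball y0 R2 \<Longrightarrow> y' \<in> cball y0 R2 \<Longrightarrow>
       norm (G t x y - G t x' y') \<le> L2 * (norm (x - x') + norm (y - y'))"
    using hol3_bounded_lipschitz[OF G R(2,3)] by metis
  define B where "B = B1 + B2 + 1"
  define L where "L = L1 + L2 + 1"
  have BL: "B > 0" "L > 0" "B1 \<le> B" "B2 \<le> B" "L1 \<le> L" "L2 \<le> L" using 1 2 unfolding B_def L_def by auto
  \<comment> \<open>Data in the halved balls leave the distances \<open>r / 2\<close>,
    \<open>R1 / 2\<close> and \<open>R2 / 2\<close> to move in; the last entry is the contraction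
    condition.\<close>
  define \<rho> where "\<rho> = min (r / 2) (min (R1 / 2 / B) (min (R2 / 2 / B) (1 / (4 * L))))"
  have \<rho>: "\<rho> > 0" unfolding \<rho>_def using BL R by auto
  have \<rho>r: "\<rho> \<le> r / 2" unfolding \<rho>_def by simp
  have "\<rho> \<le> R1 / 2 / B" "\<rho> \<le> R2 / 2 / B" "\<rho> \<le> 1 / (4 * L)" unfolding \<rho>_def by auto
  then have sm: "\<rho> * B \<le> R1 / 2" "\<rho> * B \<le> R2 / 2" "4 * (\<rho> * L) \<le> 1" using BL by (simp_all add: field_simps)
  show ?thesis
  proof (intro exI[of _ \<rho>] conjI ballI)
    fix t1 x1 y1 assume t1: "t1 \<in> cball t0 (r / 2)" and x1: "x1 \<in> cball x0 (R1 / 2)" and y1: "y1 \<in> cball y0 (R2 / 2)"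
    have st: "t \<in> cball t0 r" if "t \<in> ball t1 \<rho>" for t
      using that t1 \<rho>r dist_triangle[of t0 t t1] by auto
    have sx: "x \<in> cball x0 R1" if "x \<in> cball x1 (R1 / 2)" for x
      using that x1 dist_triangle[of x0 x x1] by auto
    have sy: "y \<in> cball y0 R2" if "y \<in> cball y1 (R2 / 2)" for y
      using that y1 dist_triangle[of y0 y y1] by auto
    have big: "x \<in> cball x0 (3 * R1)" if "x \<in> cball x0 R1" for x using that R by auto
    have big': "y \<in> cball y0 (3 * R2)" if "y \<in> cball y0 R2" for y using that R by auto
    have "\<exists>f g. f holomorphic_on ball t1 \<rho> \<and> g holomorphic_on ball t1 \<rho> \<and> f t1 = x1 \<and> g t1 = y1 \<and>
     (\<forall>t\<in>ball t1 \<rho>. f t \<in> cball x1 (R1 / 2) \<and> g t \<in> cball y1 (R2 / 2) \<and>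
        (f has_field_derivative F t (f t) (g t)) (at t) \<and> (g has_field_derivative G t (f t) (g t)) (at t))"
    proof (rule picard_core[OF \<rho>, of L B])
      show "norm (F t x y) \<le> B \<and> norm (G t x y) \<le> B"
        if "t \<in> ball t1 \<rho>" "x \<in> cball x1 (R1 / 2)" "y \<in> cball y1 (R2 / 2)" for t x y
        using 1(3)[OF st big[OF sx] big'[OF sy]] 2(3)[OF st big[OF sx] big'[OF sy]] that BL by fastforce
      fix t x y x' y' assume a: "t \<in> ball t1 \<rho>" "x \<in> cball x1 (R1 / 2)" "x' \<in> cball x1 (R1 / 2)"
          "y \<in> cball y1 (R2 / 2)" "y' \<in> cball y1 (R2 / 2)"
      have "L1 * (norm (x - x') + norm (y - y')) \<le> L * (norm (x - x') + norm (y - y'))"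
        "L2 * (norm (x - x') + norm (y - y')) \<le> L * (norm (x - x') + norm (y - y'))"
        using BL by (intro mult_right_mono; simp)+
      then show "norm (F t x y - F t x' y') \<le> L * (norm (x - x') + norm (y - y')) \<and>
        norm (G t x y - G t x' y') \<le> L * (norm (x - x') + norm (y - y'))"
        using 1(4)[OF st[OF a(1)] sx[OF a(2)] sx[OF a(3)] sy[OF a(4)] sy[OF a(5)]]
          2(4)[OF st[OF a(1)] sx[OF a(2)] sx[OF a(3)] sy[OF a(4)] sy[OF a(5)]] by linarith
    next
      fix f g assume h: "f holomorphic_on ball t1 \<rho>" "g holomorphic_on ball t1 \<rho>"
        "\<And>t. t \<in> ball t1 \<rho> \<Longrightarrow> f t \<in> cball x1 (R1 / 2)" "\<And>t. t \<in> ball t1 \<rho> \<Longrightarrow> g t \<in> cball y1 (R2 / 2)"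
      show "(\<lambda>t. F t (f t) (g t)) holomorphic_on ball t1 \<rho>" "(\<lambda>t. G t (f t) (g t)) holomorphic_on ball t1 \<rho>"
        by (rule hol3_subst[OF F], use h st sx sy big big' in \<open>auto intro!: holomorphic_intros\<close>)
           (rule hol3_subst[OF G], use h st sx sy big big' in \<open>auto intro!: holomorphic_intros\<close>)
    qed (use BL sm in auto)
    then show "\<exists>f g. f holomorphic_on ball t1 \<rho> \<and> g holomorphic_on ball t1 \<rho> \<and> f t1 = x1 \<and> g t1 = y1 \<and>
     (\<forall>t\<in>ball t1 \<rho>. t \<in> cball t0 r \<and> f t \<in> cball x0 R1 \<and> g t \<in> cball y0 R2 \<and>
        (f has_field_derivative F t (f t) (g t)) (at t) \<and> (g has_field_derivative G t (f t) (g t)) (at t))"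
      using st sx sy by blast
  qed (rule \<rho>)
qed

text \<open>At the point \<open>s\<close> of a small closed ball where the two solutions are
  farthest apart, the mean value estimate bounds their distance by half of itself. Equality near
  \<open>t1\<close> is all that is wanted, since the identity theorem extends it.\<close>

lemma ode_unique_near:
  fixes F G :: "complex \<Rightarrow> complex \<Rightarrow> complex \<Rightarrow> complex"
  assumes F: "hol3 F (cball t0 r) (cball x0 (3 * R1)) (cball y0 (3 * R2))"
    and G: "hol3 G (cball t0 r) (cball x0 (3 * R1)) (cball y0 (3 * R2))"
    and R: "R1 > 0" "R2 > 0"
    and t1: "t1 \<in> ball t0 r" "f t1 \<in> ball x0 R1" "g t1 \<in> ball y0 R2" and eq: "f' t1 = f t1" "g' t1 = g t1"
    and e: "e > 0"
    and d: "\<And>t. t \<in> ball t1 e \<Longrightarrow> (f has_field_derivative F t (f t) (g t)) (at t)"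
      "\<And>t. t \<in> ball t1 e \<Longrightarrow> (g has_field_derivative G t (f t) (g t)) (at t)"
      "\<And>t. t \<in> ball t1 e \<Longrightarrow> (f' has_field_derivative F t (f' t) (g' t)) (at t)"
      "\<And>t. t \<in> ball t1 e \<Longrightarrow> (g' has_field_derivative G t (f' t) (g' t)) (at t)"
  shows "\<exists>\<epsilon>>0. \<forall>t\<in>ball t1 \<epsilon>. f t = f' t \<and> g t = g' t"
proof -
  obtain B1 L1 where 1: "B1 \<ge> 0" "L1 \<ge> 0"
    "\<And>t x y. t \<in> cball t0 r \<Longrightarrow> x \<in> cball x0 (3 * R1) \<Longrightarrow> y \<in> cball y0 (3 * R2) \<Longrightarrow> norm (F t x y) \<le> B1"
    "\<And>t x y x' y'. t \<in> cball t0 r \<Longrightarrow> x \<in> cball x0 R1 \<Longrightarrow> x' \<in> cball x0 R1 \<Longrightarrow>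
       y \<in> cball y0 R2 \<Longrightarrow> y' \<in> cball y0 R2 \<Longrightarrow>
       norm (F t x y - F t x' y') \<le> L1 * (norm (x - x') + norm (y - y'))"
    using hol3_bounded_lipschitz[OF F R] by metis
  obtain B2 L2 where 2: "B2 \<ge> 0" "L2 \<ge> 0"
    "\<And>t x y. t \<in> cball t0 r \<Longrightarrow> x \<in> cball x0 (3 * R1) \<Longrightarrow> y \<in> cball y0 (3 * R2) \<Longrightarrow> norm (G t x y) \<le> B2"
    "\<And>t x y x' y'. t \<in> cball t0 r \<Longrightarrow> x \<in> cball x0 R1 \<Longrightarrow> x' \<in> cball x0 R1 \<Longrightarrow>
       y \<in> cball y0 R2 \<Longrightarrow> y' \<in> cball y0 R2 \<Longrightarrow>
       norm (G t x y - G t x' y') \<le> L2 * (norm (x - x') + norm (y - y'))"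
    using hol3_bounded_lipschitz[OF G R] by metis
  have t1e: "t1 \<in> ball t1 e" using e by simp
  have cont: "isCont f t1" "isCont g t1" "isCont f' t1" "isCont g' t1"
    using d[OF t1e] DERIV_isCont by blast+
  have ev: "\<forall>\<^sub>F t in nhds t1. h t \<in> ball c R" if "isCont h t1" "h t1 \<in> ball c R" for h :: "complex \<Rightarrow> complex" and c R
    using that by (intro topological_tendstoD[of h "h t1"]) (auto simp: isCont_def tendsto_at_iff_tendsto_nhds)
  have "\<forall>\<^sub>F t in nhds t1. f t \<in> ball x0 R1 \<and> g t \<in> ball y0 R2 \<and> f' t \<in> ball x0 R1 \<and> g' t \<in> ball y0 R2 \<and> t \<in> ball t0 r \<and> t \<in> ball t1 e"
    using cont t1 eq e by (intro eventually_conj ev eventually_nhds_in_open) auto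
  then obtain \<epsilon>0 where \<epsilon>0: "\<epsilon>0 > 0" "\<And>t. t \<in> ball t1 \<epsilon>0 \<Longrightarrow> f t \<in> cball x0 R1 \<and> g t \<in> cball y0 R2 \<and> f' t \<in> cball x0 R1 \<and> g' t \<in> cball y0 R2 \<and> t \<in> cball t0 r \<and> t \<in> ball t1 e"
    unfolding eventually_nhds_metric by (metis (no_types, lifting) dist_commute mem_ball mem_cball less_imp_le)
  define L where "L = L1 + L2 + 1"
  have L: "L > 0" using 1 2 unfolding L_def by simp
  define \<epsilon> where "\<epsilon> = min (\<epsilon>0 / 2) (1 / (4 * L))"
  have \<epsilon>: "\<epsilon> > 0" "\<epsilon> < \<epsilon>0" "4 * (\<epsilon> * L) \<le> 1" 
  proof -
    show "\<epsilon> > 0" "\<epsilon> < \<epsilon>0" unfolding \<epsilon>_def using \<epsilon>0 L by auto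
    have "\<epsilon> \<le> 1 / (4 * L)" unfolding \<epsilon>_def by simp
    then show "4 * (\<epsilon> * L) \<le> 1" using L by (simp add: field_simps)
  qed
  let ?D = "\<lambda>t. norm (f t - f' t) + norm (g t - g' t)"
  have inb: "t \<in> ball t1 \<epsilon>0" if "t \<in> cball t1 \<epsilon>" for t using that \<epsilon> by auto
  have cd: "continuous_on (cball t1 \<epsilon>) ?D"
    using \<epsilon>0 inb d by (intro continuous_intros continuous_at_imp_continuous_on ballI) (meson DERIV_isCont)+
  obtain s where s: "s \<in> cball t1 \<epsilon>" "\<And>t. t \<in> cball t1 \<epsilon> \<Longrightarrow> ?D t \<le> ?D s"
    using continuous_attains_sup[OF compact_cball _ cd] \<epsilon> by (metis centre_in_cball empty_iff less_imp_le)
  have bnd: "norm ((f s - f' s) - (f t1 - f' t1)) \<le> (L * ?D s) * norm (s - t1)" 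
    "norm ((g s - g' s) - (g t1 - g' t1)) \<le> (L * ?D s) * norm (s - t1)"
  proof -
    have LD: "L1 * ?D t \<le> L * ?D s" "L2 * ?D t \<le> L * ?D s" if "t \<in> cball t1 \<epsilon>" for t
      using s(2)[OF that] 1 2 unfolding L_def by (intro mult_mono; simp)+
    show "norm ((f s - f' s) - (f t1 - f' t1)) \<le> (L * ?D s) * norm (s - t1)"
    proof (rule field_differentiable_bound[OF convex_cball])
      fix t assume t: "t \<in> cball t1 \<epsilon>"
      show "((\<lambda>t. f t - f' t) has_field_derivative F t (f t) (g t) - F t (f' t) (g' t)) (at t within cball t1 \<epsilon>)"
        using \<epsilon>0(2)[OF inb[OF t]] d by (intro DERIV_diff) (auto intro: has_field_derivative_at_within)
      have "norm (F t (f t) (g t) - F t (f' t) (g' t)) \<le> L1 * ?D t"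
        using \<epsilon>0(2)[OF inb[OF t]] by (intro 1(4)) auto
      then show "norm (F t (f t) (g t) - F t (f' t) (g' t)) \<le> L * ?D s" using LD[OF t] by linarith
    qed (use s \<epsilon> in auto)
    show "norm ((g s - g' s) - (g t1 - g' t1)) \<le> (L * ?D s) * norm (s - t1)"
    proof (rule field_differentiable_bound[OF convex_cball])
      fix t assume t: "t \<in> cball t1 \<epsilon>"
      show "((\<lambda>t. g t - g' t) has_field_derivative G t (f t) (g t) - G t (f' t) (g' t)) (at t within cball t1 \<epsilon>)"
        using \<epsilon>0(2)[OF inb[OF t]] d by (intro DERIV_diff) (auto intro: has_field_derivative_at_within)
      have "norm (G t (f t) (g t) - G t (f' t) (g' t)) \<le> L2 * ?D t"
        using \<epsilon>0(2)[OF inb[OF t]] by (intro 2(4)) auto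
      then show "norm (G t (f t) (g t) - G t (f' t) (g' t)) \<le> L * ?D s" using LD[OF t] by linarith
    qed (use s \<epsilon> in auto)
  qed
  have "(L * ?D s) * norm (s - t1) \<le> (L * ?D s) * \<epsilon>"
    using s L by (intro mult_left_mono) (auto simp: dist_norm norm_minus_commute)
  then have "?D s \<le> 2 * ((L * ?D s) * \<epsilon>)" using bnd eq by simp
  also have "\<dots> = (4 * (\<epsilon> * L)) * (?D s / 2)" by (simp add: algebra_simps)
  also have "\<dots> \<le> 1 * (?D s / 2)" using \<epsilon> by (intro mult_right_mono) auto
  finally have "?D s \<le> 0" by simp
  then have "f t = f' t \<and> g t = g' t" if "t \<in> ball t1 \<epsilon>" for t
    using s(2)[of t] that norm_ge_zero[of "f t - f' t"] norm_ge_zero[of "g t - g' t"]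
    by (smt (verit) ball_subset_cball eq_iff_diff_eq_0 norm_le_zero_iff subsetD)
  then show ?thesis using \<epsilon> by blast
qed

section \<open>Propagation along a path\<close>

text \<open>Real induction: the supremum of the initial segment on which \<open>A\<close> holds
  cannot lie below \<open>x\<close>, since \<open>left\<close> puts it into the segment and
  \<open>right\<close> then moves beyond it.\<close>

lemma real_induct_atLeastLessThan:
  fixes A :: "real \<Rightarrow> bool"
  assumes base: "A s0"
    and right: "\<And>t. s0 \<le> t \<Longrightarrow> t < b \<Longrightarrow> A t \<Longrightarrow> \<exists>\<delta>>0. \<forall>s. t < s \<and> s < t + \<delta> \<and> s < b \<longrightarrow> A s"
    and left: "\<And>t. s0 < t \<Longrightarrow> t < b \<Longrightarrow> (\<And>s. s0 \<le> s \<Longrightarrow> s < t \<Longrightarrow> A s) \<Longrightarrow> A t"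
    and x: "s0 \<le> x" "x < b"
  shows "A x"
proof (rule ccontr)
  assume nA: "\<not> A x"
  define S where "S = {s. s0 \<le> s \<and> s \<le> x \<and> (\<forall>s'. s0 \<le> s' \<and> s' \<le> s \<longrightarrow> A s')}"
  have s0S: "s0 \<in> S" using base x unfolding S_def by (auto simp: order_antisym)
  have bd: "bdd_above S" unfolding S_def by (rule bdd_aboveI[of _ x]) auto
  define c where "c = Sup S"
  have c1: "s0 \<le> c" unfolding c_def using s0S bd by (rule cSup_upper)
  have c2: "c \<le> x" unfolding c_def
  proof (rule cSup_least)
    show "S \<noteq> {}" using s0S by blast
    show "s \<le> x" if "s \<in> S" for s using that unfolding S_def by blast
  qed
  note c = c1 c2
  have below: "A s" if s: "s0 \<le> s" "s < c" for s
  proof -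
    have "S \<noteq> {}" using s0S by blast
    then obtain s' where "s' \<in> S" "s < s'" using s(2) less_cSup_iff[OF _ bd, of s] unfolding c_def by blast
    then show ?thesis using s(1) unfolding S_def by simp
  qed
  have "A c"
  proof (cases "c = s0")
    case False then show ?thesis using left[of c] c x below by auto
  qed (use base in simp)
  then have "c < x" using nA c by (metis order_le_less)
  obtain \<delta> where \<delta>: "\<delta> > 0" "\<And>s. c < s \<Longrightarrow> s < c + \<delta> \<Longrightarrow> s < b \<Longrightarrow> A s"
    using right[OF c(1) _ \<open>A c\<close>] c x by auto
  define y where "y = min x (c + \<delta> / 2)"
  have y: "c < y" "y < c + \<delta>" "y \<le> x" unfolding y_def using \<delta> \<open>c < x\<close> by auto
  have "A s'" if "s0 \<le> s'" "s' \<le> y" for s'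
    using below[of s'] \<open>A c\<close> \<delta>(2)[of s'] that y x by (cases "s' < c"; cases "s' = c") auto
  then have "y \<in> S" unfolding S_def using y c by auto
  then have "y \<le> c" unfolding c_def using bd by (rule cSup_upper)
  then show False using y by simp
qed

text \<open>Rectifiable replacement for Gronwall's inequality: no differentiability of the path is needed.\<close>

lemma bounded_along_finite_length:
  fixes \<phi> :: "real \<Rightarrow> real" and \<gamma> :: "real \<Rightarrow> complex"
  assumes len: "finite_length \<gamma>" and s0: "0 \<le> s0" "s0 < 1" and C: "C \<ge> 0"
    and calm: "\<And>t. s0 \<le> t \<Longrightarrow> t < 1 \<Longrightarrow>
       \<exists>\<delta>>0. \<forall>s. s0 \<le> s \<and> s < 1 \<and> \<bar>s - t\<bar> < \<delta> \<longrightarrow> \<bar>\<phi> s - \<phi> t\<bar> \<le> C * norm (\<gamma> s - \<gamma> t)"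
  shows "\<exists>B. \<forall>s. s0 \<le> s \<and> s < 1 \<longrightarrow> \<phi> s \<le> B"
proof -
  obtain L where L: "\<And>n (t :: nat \<Rightarrow> real). t 0 = 0 \<Longrightarrow> t n = 1 \<Longrightarrow> (\<And>i. i < n \<Longrightarrow> t i \<le> t (Suc i)) \<Longrightarrow>
      (\<Sum>i<n. norm (\<gamma> (t (Suc i)) - \<gamma> (t i))) \<le> L"
    using len unfolding finite_length_def by metis
  \<comment> \<open>\<open>A s\<close> keeps a partition of \<open>[0, s]\<close> whose polygon
    controls the increase of \<open>\<phi>\<close>. Carrying the partition itself allows one step to
    be appended at a time, so no length function has to be defined on subintervals.\<close>
  define A where "A s \<longleftrightarrow> (\<exists>n (t :: nat \<Rightarrow> real). t 0 = 0 \<and> t n = s \<and> (\<forall>i<n. t i \<le> t (Suc i)) \<and>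
      \<phi> s - \<phi> s0 \<le> C * (\<Sum>i<n. norm (\<gamma> (t (Suc i)) - \<gamma> (t i))))" for s
  have ext: "A s" if "A t" "t \<le> s" "\<phi> s - \<phi> t \<le> C * norm (\<gamma> s - \<gamma> t)" for s t
  proof -
    obtain n p where p: "p 0 = 0" "p n = t" "\<And>i. i < n \<Longrightarrow> p i \<le> p (Suc i)"
      "\<phi> t - \<phi> s0 \<le> C * (\<Sum>i<n. norm (\<gamma> (p (Suc i)) - \<gamma> (p i)))"
      using \<open>A t\<close> unfolding A_def by blast
    let ?p = "p(Suc n := s)"
    have "(\<Sum>i<Suc n. norm (\<gamma> (?p (Suc i)) - \<gamma> (?p i))) =
        (\<Sum>i<n. norm (\<gamma> (p (Suc i)) - \<gamma> (p i))) + norm (\<gamma> s - \<gamma> t)"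
      using p(2) by simp
    then have "\<phi> s - \<phi> s0 \<le> C * (\<Sum>i<Suc n. norm (\<gamma> (?p (Suc i)) - \<gamma> (?p i)))"
      using p(4) that(3) by (simp add: distrib_left)
    moreover have "?p i \<le> ?p (Suc i)" if "i < Suc n" for i
      using p(2,3) that \<open>t \<le> s\<close> by (cases "i = n") auto
    moreover have "?p 0 = 0" "?p (Suc n) = s" using p(1) by auto
    ultimately show ?thesis unfolding A_def by blast
  qed
  have all: "A s" if "s0 \<le> s" "s < 1" for s
  proof (rule real_induct_atLeastLessThan[of A s0 1 s])
    show "A s0" unfolding A_def
      by (rule exI[of _ "Suc 0"], rule exI[of _ "\<lambda>i. if i = 0 then 0 else s0"]) (use s0 C in auto)
  next
    fix t assume t: "s0 \<le> t" "t < 1" "A t"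
    then obtain \<delta> where "\<delta> > 0" "\<And>s. s0 \<le> s \<Longrightarrow> s < 1 \<Longrightarrow> \<bar>s - t\<bar> < \<delta> \<Longrightarrow> \<bar>\<phi> s - \<phi> t\<bar> \<le> C * norm (\<gamma> s - \<gamma> t)"
      using calm by metis
    note \<delta> = this
    have "A s" if "t < s" "s < t + \<delta>" "s < 1" for s
      using \<delta>(2)[of s] that t by (intro ext[OF t(3), of s]) auto
    then show "\<exists>\<delta>>0. \<forall>s. t < s \<and> s < t + \<delta> \<and> s < 1 \<longrightarrow> A s" using \<delta>(1) by blast
  next
    fix t assume t: "s0 < t" "t < 1" and A: "\<And>s. s0 \<le> s \<Longrightarrow> s < t \<Longrightarrow> A s"
    then obtain \<delta> where \<delta>: "\<delta> > 0" "\<And>s. s0 \<le> s \<Longrightarrow> s < 1 \<Longrightarrow> \<bar>s - t\<bar> < \<delta> \<Longrightarrow> \<bar>\<phi> s - \<phi> t\<bar> \<le> C * norm (\<gamma> s - \<gamma> t)"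
      using calm[of t] by auto
    define s where "s = max s0 (t - \<delta> / 2)"
    have s: "s0 \<le> s" "s < t" "\<bar>s - t\<bar> < \<delta>" unfolding s_def using t \<delta>(1) by auto
    show "A t" using ext[OF A[OF s(1,2)]] \<delta>(2)[OF s(1) _ s(3)] s t by (auto simp: norm_minus_commute)
  qed (use that in auto)
  show ?thesis
  proof (intro exI allI impI)
    fix s assume s: "s0 \<le> s \<and> s < 1"
    then obtain n p where p: "p 0 = 0" "p n = s" "\<And>i. i < n \<Longrightarrow> p i \<le> p (Suc i)"
      "\<phi> s - \<phi> s0 \<le> C * (\<Sum>i<n. norm (\<gamma> (p (Suc i)) - \<gamma> (p i)))"
      using all unfolding A_def by blast
    \<comment> \<open>The bound \<open>L\<close> is for partitions of the whole
      \<open>[0, 1]\<close>, so the partition is completed by the point 1.\<close>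
    let ?p = "p(Suc n := 1)"
    have "(\<Sum>i<n. norm (\<gamma> (p (Suc i)) - \<gamma> (p i))) \<le> (\<Sum>i<Suc n. norm (\<gamma> (?p (Suc i)) - \<gamma> (?p i)))"
      by simp
    also have "\<dots> \<le> L"
      by (rule L) (use p s in \<open>auto simp: less_Suc_eq\<close>)
    finally have "C * (\<Sum>i<n. norm (\<gamma> (p (Suc i)) - \<gamma> (p i))) \<le> C * L" using C by (rule mult_left_mono)
    then show "\<phi> s \<le> \<phi> s0 + C * L" using p(4) by linarith
  qed
qed

section \<open>The identity theorem along an analytic continuation\<close>

lemma eq_on_ball_if_eq_near:
  fixes f g :: "complex \<Rightarrow> complex"
  assumes "f holomorphic_on S" "g holomorphic_on S" "open S" "connected S" "x \<in> S" "\<epsilon> > 0"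
    and "\<And>z. z \<in> ball x \<epsilon> \<Longrightarrow> z \<in> S \<Longrightarrow> f z = g z" and "z \<in> S"
  shows "f z = g z"
proof (rule analytic_continuation_open[of "ball x \<epsilon> \<inter> S" S f g])
  show "ball x \<epsilon> \<inter> S \<noteq> {}" using assms by (metis IntI centre_in_ball empty_iff)
qed (use assms in auto)

text \<open>Agreement of the germs is an open and closed condition on the parameter: for
  neighbouring parameters the identity theorem on a disc inside \<open>V\<close> transfers it in
  both directions, which is the equivalence in \<open>key\<close>.\<close>

lemma continuation_identity:
  assumes cont: "continuation_along \<alpha> M N \<Omega> \<gamma> r u v" and \<gamma>: "path \<gamma>"
    and s0: "0 \<le> s0" "s0 < 1" and V: "open V" "f holomorphic_on V" "g holomorphic_on V"
    and \<gamma>V: "\<And>s. s0 \<le> s \<Longrightarrow> s < 1 \<Longrightarrow> \<gamma> s \<in> V"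
    and init: "\<exists>\<epsilon>>0. \<forall>z\<in>ball (\<gamma> s0) \<epsilon>. u s0 z = f z \<and> v s0 z = g z"
    and s: "s0 \<le> s" "s < 1"
  shows "\<exists>\<epsilon>>0. \<forall>z\<in>ball (\<gamma> s) \<epsilon>. u s z = f z \<and> v s z = g z"
proof -
  define A where "A s \<longleftrightarrow> (\<exists>\<epsilon>>0. \<forall>z\<in>ball (\<gamma> s) \<epsilon>. u s z = f z \<and> v s z = g z)" for s
  have key: "\<exists>\<delta>>0. \<forall>s. s0 \<le> s \<and> s < 1 \<and> \<bar>s - t\<bar> < \<delta> \<longrightarrow> (A s \<longleftrightarrow> A t)" if t: "s0 \<le> t" "t < 1" for t
  proof -
    have t01: "t \<in> {0..<1}" using t s0 by auto
    have hol: "r t > 0" "u t holomorphic_on ball (\<gamma> t) (r t)" "v t holomorphic_on ball (\<gamma> t) (r t)"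
      and rpos: "\<And>s. s \<in> {0..<1} \<Longrightarrow> r s > 0"
      using cont t01 unfolding continuation_along_def by auto
    obtain \<delta>1 where \<delta>1: "\<delta>1 > 0" "\<And>s. s \<in> {0..<1} \<Longrightarrow> \<bar>s - t\<bar> < \<delta>1 \<Longrightarrow>
        \<gamma> s \<in> ball (\<gamma> t) (r t) \<and> (\<forall>z\<in>ball (\<gamma> s) (r s) \<inter> ball (\<gamma> t) (r t). u s z = u t z \<and> v s z = v t z)"
      using cont t01 unfolding continuation_along_def by meson
    obtain \<rho>0 where \<rho>0: "\<rho>0 > 0" "ball (\<gamma> t) \<rho>0 \<subseteq> V" using V(1) \<gamma>V[OF t] open_contains_ball by blast
    define \<rho> where "\<rho> = min \<rho>0 (r t)"
    have \<rho>: "\<rho> > 0" "ball (\<gamma> t) \<rho> \<subseteq> V" "ball (\<gamma> t) \<rho> \<subseteq> ball (\<gamma> t) (r t)"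
      unfolding \<rho>_def using \<rho>0 hol(1) by auto
    have h: "u t holomorphic_on ball (\<gamma> t) \<rho>" "v t holomorphic_on ball (\<gamma> t) \<rho>"
       "f holomorphic_on ball (\<gamma> t) \<rho>" "g holomorphic_on ball (\<gamma> t) \<rho>"
      using hol V \<rho> holomorphic_on_subset by blast+
    have "continuous_on {0..1} \<gamma>" using \<gamma> unfolding path_def .
    then obtain \<delta>2 where \<delta>2: "\<delta>2 > 0" "\<And>s. s \<in> {0..1} \<Longrightarrow> \<bar>s - t\<bar> < \<delta>2 \<Longrightarrow> dist (\<gamma> s) (\<gamma> t) < \<rho>"
      unfolding continuous_on_iff using t01 \<rho>(1) by (fastforce simp: dist_real_def)
    have eqv: "A s \<longleftrightarrow> A t" if s: "s0 \<le> s" "s < 1" "\<bar>s - t\<bar> < min \<delta>1 \<delta>2" for s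
    proof -
      have s01: "s \<in> {0..<1}" using s s0 by auto
      have sb: "\<gamma> s \<in> ball (\<gamma> t) \<rho>" using \<delta>2(2)[of s] s s01 by (auto simp: dist_commute)
      have ag: "u s z = u t z \<and> v s z = v t z" if "z \<in> ball (\<gamma> s) (r s)" "z \<in> ball (\<gamma> t) \<rho>" for z
        using \<delta>1(2)[OF s01] s that \<rho> by auto
      have up: "\<forall>z\<in>ball (\<gamma> t) \<rho>. u t z = f z \<and> v t z = g z"
        if x: "x \<in> ball (\<gamma> t) \<rho>" "\<epsilon> > 0" "\<And>z. z \<in> ball x \<epsilon> \<Longrightarrow> z \<in> ball (\<gamma> t) \<rho> \<Longrightarrow> u t z = f z \<and> v t z = g z" for x \<epsilon>
        using eq_on_ball_if_eq_near[OF h(1) h(3) open_ball connected_ball x(1,2)]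
          eq_on_ball_if_eq_near[OF h(2) h(4) open_ball connected_ball x(1,2)] x(3) by blast
      show ?thesis
      proof
        assume "A s"
        then obtain \<epsilon> where \<epsilon>: "\<epsilon> > 0" "\<And>z. z \<in> ball (\<gamma> s) \<epsilon> \<Longrightarrow> u s z = f z \<and> v s z = g z" unfolding A_def by blast
        have "\<forall>z\<in>ball (\<gamma> t) \<rho>. u t z = f z \<and> v t z = g z"
        proof (rule up[OF sb, of "min \<epsilon> (r s)"])
          show "min \<epsilon> (r s) > 0" using \<epsilon>(1) rpos[OF s01] by simp
          show "u t z = f z \<and> v t z = g z" if "z \<in> ball (\<gamma> s) (min \<epsilon> (r s))" "z \<in> ball (\<gamma> t) \<rho>" for z
            using \<epsilon>(2)[of z] ag[of z] that by simp
        qed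
        then show "A t" unfolding A_def using \<rho> by blast
      next
        assume "A t"
        then obtain \<epsilon> where \<epsilon>: "\<epsilon> > 0" "\<And>z. z \<in> ball (\<gamma> t) \<epsilon> \<Longrightarrow> u t z = f z \<and> v t z = g z" unfolding A_def by blast
        have eq: "\<forall>z\<in>ball (\<gamma> t) \<rho>. u t z = f z \<and> v t z = g z"
          by (rule up[of "\<gamma> t" \<epsilon>]) (use \<epsilon> \<rho> in auto)
        obtain \<epsilon>' where "\<epsilon>' > 0" "ball (\<gamma> s) \<epsilon>' \<subseteq> ball (\<gamma> t) \<rho>" using sb open_ball open_contains_ball by blast
        then show "A s" unfolding A_def using eq ag rpos[OF s01]
          by (intro exI[of _ "min \<epsilon>' (r s)"]) (auto simp: subset_iff)
      qed
    qed
    then show ?thesis using \<delta>1(1) \<delta>2(1) by (intro exI[of _ "min \<delta>1 \<delta>2"]) auto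
  qed
  have "A s"
  proof (rule real_induct_atLeastLessThan[of A s0 1 s])
    show "A s0" using init unfolding A_def .
  next
    fix t assume t: "s0 \<le> t" "t < 1" "A t"
    then obtain \<delta> where "\<delta> > 0" "\<And>s. s0 \<le> s \<and> s < 1 \<and> \<bar>s - t\<bar> < \<delta> \<Longrightarrow> A s" using key by meson
    then show "\<exists>\<delta>>0. \<forall>s. t < s \<and> s < t + \<delta> \<and> s < 1 \<longrightarrow> A s"
      using t by (intro exI[of _ \<delta>]) auto
  next
    fix t assume t: "s0 < t" "t < 1" and A: "\<And>s. s0 \<le> s \<Longrightarrow> s < t \<Longrightarrow> A s"
    then obtain \<delta> where \<delta>: "\<delta> > 0" "\<And>s. s0 \<le> s \<and> s < 1 \<and> \<bar>s - t\<bar> < \<delta> \<Longrightarrow> A s \<Longrightarrow> A t"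
      using key[of t] by auto
    define s where "s = max s0 (t - \<delta> / 2)"
    have s: "s0 \<le> s" "s < t" "\<bar>s - t\<bar> < \<delta>" unfolding s_def using t \<delta>(1) by auto
    show "A t" using \<delta>(2)[of s] A s t by auto
  qed (use s in auto)
  then show ?thesis unfolding A_def .
qed

section \<open>Polynomials in one variable with holomorphic coefficients\<close>

text \<open>The class in which the invariant surfaces are built. Being polynomial in
  \<open>\<tau>\<close>, its members can be divided exactly by powers of \<open>\<tau>\<close>, and
  no convergence question in two variables arises. Values outside \<open>U\<close> are left
  free.\<close>

definition PH :: "complex set \<Rightarrow> (complex \<Rightarrow> complex \<Rightarrow> complex) \<Rightarrow> bool" where
  "PH U f \<longleftrightarrow> (\<exists>L (c :: nat \<Rightarrow> complex \<Rightarrow> complex). (\<forall>k. c k holomorphic_on U) \<and>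
     (\<forall>z\<in>U. \<forall>\<tau>. f z \<tau> = (\<Sum>k<L. c k z * \<tau> ^ k)))"

definition dz :: "(complex \<Rightarrow> complex \<Rightarrow> complex) \<Rightarrow> complex \<Rightarrow> complex \<Rightarrow> complex" where
  "dz f z \<tau> = deriv (\<lambda>x. f x \<tau>) z"

definition dt :: "(complex \<Rightarrow> complex \<Rightarrow> complex) \<Rightarrow> complex \<Rightarrow> complex \<Rightarrow> complex" where
  "dt f z \<tau> = deriv (f z) \<tau>"

lemma PH_I:
  assumes "\<And>k. c k holomorphic_on U" "\<And>z \<tau>. z \<in> U \<Longrightarrow> f z \<tau> = (\<Sum>k<L. c k z * \<tau> ^ k)"
  shows "PH U f"
  unfolding PH_def using assms by blast

lemma PH_E:
  assumes "PH U f"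
  obtains L c where "\<And>k. c k holomorphic_on U" "\<And>z \<tau>. z \<in> U \<Longrightarrow> f z \<tau> = (\<Sum>k<L. c k z * \<tau> ^ k)"
  using assms unfolding PH_def by blast

text \<open>Padding with zero coefficients lets two functions be written with a common number of
  terms.\<close>

lemma PH_E_padded:
  assumes "PH U f"
  obtains L c where "\<And>k. c k holomorphic_on U"
    "\<And>z \<tau> L'. z \<in> U \<Longrightarrow> L \<le> L' \<Longrightarrow> f z \<tau> = (\<Sum>k<L'. c k z * \<tau> ^ k)"
proof -
  obtain L c where c: "\<And>k. c k holomorphic_on U" "\<And>z \<tau>. z \<in> U \<Longrightarrow> f z \<tau> = (\<Sum>k<L. c k z * \<tau> ^ k)"
    using PH_E[OF assms] by metis
  define c' where "c' k = (if k < L then c k else (\<lambda>_. 0))" for k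
  show ?thesis
  proof (rule that[of c' L])
    show "c' k holomorphic_on U" for k unfolding c'_def using c(1) by auto
    show "f z \<tau> = (\<Sum>k<L'. c' k z * \<tau> ^ k)" if "z \<in> U" "L \<le> L'" for z \<tau> L'
    proof -
      have "(\<Sum>k<L'. c' k z * \<tau> ^ k) = (\<Sum>k<L. c k z * \<tau> ^ k)"
        by (rule sum.mono_neutral_cong_right) (use that in \<open>auto simp: c'_def\<close>)
      then show ?thesis using c(2)[OF that(1)] by simp
    qed
  qed
qed

lemma PH_cong: "PH U f \<Longrightarrow> (\<And>z \<tau>. z \<in> U \<Longrightarrow> g z \<tau> = f z \<tau>) \<Longrightarrow> PH U g"
  by (elim PH_E, rule PH_I) auto

lemma PH_coeff: "c holomorphic_on U \<Longrightarrow> PH U (\<lambda>z \<tau>. c z)"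
  by (rule PH_I[of "\<lambda>_. c" _ _ 1]) auto

lemma PH_const: "PH U (\<lambda>z \<tau>. c)"
  by (rule PH_coeff) simp

lemma PH_add:
  assumes "PH U f" "PH U g"
  shows "PH U (\<lambda>z \<tau>. f z \<tau> + g z \<tau>)"
proof -
  obtain L c where c: "\<And>k. c k holomorphic_on U" "\<And>z \<tau> L'. z \<in> U \<Longrightarrow> L \<le> L' \<Longrightarrow> f z \<tau> = (\<Sum>k<L'. c k z * \<tau> ^ k)"
    using PH_E_padded[OF assms(1)] by metis
  obtain L2 c2 where c2: "\<And>k. c2 k holomorphic_on U" "\<And>z \<tau> L'. z \<in> U \<Longrightarrow> L2 \<le> L' \<Longrightarrow> g z \<tau> = (\<Sum>k<L'. c2 k z * \<tau> ^ k)"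
    using PH_E_padded[OF assms(2)] by metis
  show ?thesis
  proof (rule PH_I[of "\<lambda>k z. c k z + c2 k z" _ _ "max L L2"])
    show "f z \<tau> + g z \<tau> = (\<Sum>k<max L L2. (c k z + c2 k z) * \<tau> ^ k)" if "z \<in> U" for z \<tau>
      using c(2)[OF that, of "max L L2"] c2(2)[OF that, of "max L L2"] by (simp add: sum.distrib distrib_right)
  qed (use c c2 in \<open>auto intro!: holomorphic_intros\<close>)
qed

lemma PH_sum: "(\<And>x. x \<in> I \<Longrightarrow> PH U (F x)) \<Longrightarrow> PH U (\<lambda>z \<tau>. \<Sum>x\<in>I. F x z \<tau>)"
  by (induction I rule: infinite_finite_induct) (auto intro: PH_add PH_const)

lemma PH_scale:
  assumes "c holomorphic_on U" "PH U f"
  shows "PH U (\<lambda>z \<tau>. c z * f z \<tau>)"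
proof -
  obtain L a where a: "\<And>k. a k holomorphic_on U" "\<And>z \<tau>. z \<in> U \<Longrightarrow> f z \<tau> = (\<Sum>k<L. a k z * \<tau> ^ k)"
    using PH_E[OF assms(2)] by metis
  show ?thesis
    by (rule PH_I[of "\<lambda>k z. c z * a k z" _ _ L])
       (use a assms in \<open>auto intro!: holomorphic_intros simp: sum_distrib_left mult.assoc\<close>)
qed

lemma PH_shift:
  assumes "PH U f"
  shows "PH U (\<lambda>z \<tau>. \<tau> * f z \<tau>)"
proof -
  obtain L a where a: "\<And>k. a k holomorphic_on U" "\<And>z \<tau>. z \<in> U \<Longrightarrow> f z \<tau> = (\<Sum>k<L. a k z * \<tau> ^ k)"
    using PH_E[OF assms] by metis
  show ?thesis
  proof (rule PH_I[of "\<lambda>k. case k of 0 \<Rightarrow> (\<lambda>_. 0) | Suc k \<Rightarrow> a k" _ _ "Suc L"])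
    show "\<tau> * f z \<tau> = (\<Sum>k<Suc L. (case k of 0 \<Rightarrow> (\<lambda>_. 0) | Suc k \<Rightarrow> a k) z * \<tau> ^ k)" if "z \<in> U" for z \<tau>
      unfolding sum.lessThan_Suc_shift using a(2)[OF that] by (simp add: sum_distrib_left mult_ac)
  qed (use a in \<open>auto split: nat.splits\<close>)
qed

lemma PH_tau_power_mult: "PH U f \<Longrightarrow> PH U (\<lambda>z \<tau>. \<tau> ^ k * f z \<tau>)"
  by (induction k) (auto dest: PH_shift simp: mult.assoc)

lemma PH_mult:
  assumes "PH U f" "PH U g"
  shows "PH U (\<lambda>z \<tau>. f z \<tau> * g z \<tau>)"
proof -
  obtain L a where a: "\<And>k. a k holomorphic_on U" "\<And>z \<tau>. z \<in> U \<Longrightarrow> f z \<tau> = (\<Sum>k<L. a k z * \<tau> ^ k)"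
    using PH_E[OF assms(1)] by metis
  have "PH U (\<lambda>z \<tau>. \<Sum>k<L. a k z * (\<tau> ^ k * g z \<tau>))"
    using a assms(2) by (intro PH_sum PH_scale PH_tau_power_mult)
  then show ?thesis
    by (rule PH_cong) (simp add: a(2) sum_distrib_right mult.assoc)
qed

lemma PH_tau: "PH U (\<lambda>z \<tau>. \<tau>)"
  using PH_shift[OF PH_const[of U 1]] by simp

lemma PH_power: "PH U f \<Longrightarrow> PH U (\<lambda>z \<tau>. f z \<tau> ^ k)"
  by (induction k) (auto intro: PH_mult PH_const)

lemma PH_uminus: "PH U f \<Longrightarrow> PH U (\<lambda>z \<tau>. - f z \<tau>)"
  using PH_mult[OF PH_const[of U "- 1"], of f] by simp

lemma PH_diff: "PH U f \<Longrightarrow> PH U g \<Longrightarrow> PH U (\<lambda>z \<tau>. f z \<tau> - g z \<tau>)"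
  using PH_add[OF _ PH_uminus, of U f g] by simp

lemmas PH_intros = PH_const PH_add PH_mult PH_power PH_tau PH_diff PH_uminus PH_sum

text \<open>The partial derivatives are taken term by term. They are characterised through the chain
  rule along arbitrary curves \<open>Z\<close>, \<open>T\<close>, the form in which solutions are
  inserted later, so no derivative of a map of two variables is needed.\<close>

lemma PH_partials:
  assumes "open U" "PH U f"
  obtains f1 f2 where "PH U f1" "PH U f2"
    "\<And>Z T Z' T' s. (Z has_field_derivative Z') (at s) \<Longrightarrow> (T has_field_derivative T') (at s) \<Longrightarrow> Z s \<in> U \<Longrightarrow>
       ((\<lambda>s. f (Z s) (T s)) has_field_derivative f1 (Z s) (T s) * Z' + f2 (Z s) (T s) * T') (at s)"
proof -
  obtain L a where a: "\<And>k. a k holomorphic_on U" "\<And>z \<tau>. z \<in> U \<Longrightarrow> f z \<tau> = (\<Sum>k<L. a k z * \<tau> ^ k)"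
    using PH_E[OF assms(2)] by metis
  define f1 where "f1 z \<tau> = (\<Sum>k<L. deriv (a k) z * \<tau> ^ k)" for z \<tau>
  define f2 where "f2 z \<tau> = (\<Sum>k<L. a k z * (of_nat k * \<tau> ^ (k - 1)))" for z \<tau> :: complex
  show ?thesis
  proof (rule that[of f1 f2])
    show "PH U f1" unfolding f1_def using a assms by (intro PH_intros PH_coeff holomorphic_deriv)
    show "PH U f2" unfolding f2_def using a assms by (intro PH_intros PH_coeff)
    fix Z T Z' T' s
    assume Z: "(Z has_field_derivative Z') (at s)" and T: "(T has_field_derivative T') (at s)" and zs: "Z s \<in> U"
    have "(a k has_field_derivative deriv (a k) (Z s)) (at (Z s))" for k
      using a(1) assms(1) zs holomorphic_derivI by blast
    then have D: "((\<lambda>s. a k (Z s)) has_field_derivative deriv (a k) (Z s) * Z') (at s)" for k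
      using DERIV_chain2 Z by blast
    have "((\<lambda>s. \<Sum>k<L. a k (Z s) * T s ^ k) has_field_derivative
       (\<Sum>k<L. deriv (a k) (Z s) * Z' * T s ^ k + (of_nat k * T s ^ (k - 1) * T') * a k (Z s))) (at s)"
    proof (intro DERIV_sum DERIV_mult D)
      show "((\<lambda>s. T s ^ k) has_field_derivative of_nat k * T s ^ (k - 1) * T') (at s)" for k
        using T by (auto intro!: derivative_eq_intros simp: mult_ac)
    qed
    also have "(\<Sum>k<L. deriv (a k) (Z s) * Z' * T s ^ k + (of_nat k * T s ^ (k - 1) * T') * a k (Z s)) =
       f1 (Z s) (T s) * Z' + f2 (Z s) (T s) * T'"
      unfolding f1_def f2_def sum_distrib_right sum.distrib[symmetric] by (intro sum.cong) (auto simp: algebra_simps)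
    finally have "((\<lambda>s. \<Sum>k<L. a k (Z s) * T s ^ k) has_field_derivative f1 (Z s) (T s) * Z' + f2 (Z s) (T s) * T') (at s)" .
    moreover have "eventually (\<lambda>s. f (Z s) (T s) = (\<Sum>k<L. a k (Z s) * T s ^ k)) (nhds s)"
    proof -
      have "(Z \<longlongrightarrow> Z s) (nhds s)" using DERIV_isCont[OF Z] by (simp add: isCont_def tendsto_at_iff_tendsto_nhds)
      then have "eventually (\<lambda>s. Z s \<in> U) (nhds s)" using assms(1) zs by (rule topological_tendstoD)
      then show ?thesis by eventually_elim (use a in auto)
    qed
    ultimately show "((\<lambda>s. f (Z s) (T s)) has_field_derivative f1 (Z s) (T s) * Z' + f2 (Z s) (T s) * T') (at s)"
      by (simp add: DERIV_cong_ev)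
  qed
qed

lemma
  assumes "open U" "PH U f"
  shows PH_dz: "PH U (dz f)" and PH_dt: "PH U (dt f)"
    and PH_chain: "\<And>Z T Z' T' s. (Z has_field_derivative Z') (at s) \<Longrightarrow> (T has_field_derivative T') (at s) \<Longrightarrow> Z s \<in> U \<Longrightarrow>
       ((\<lambda>s. f (Z s) (T s)) has_field_derivative dz f (Z s) (T s) * Z' + dt f (Z s) (T s) * T') (at s)"
proof -
  obtain f1 f2 where f: "PH U f1" "PH U f2"
    "\<And>Z T Z' T' s. (Z has_field_derivative Z') (at s) \<Longrightarrow> (T has_field_derivative T') (at s) \<Longrightarrow> Z s \<in> U \<Longrightarrow>
       ((\<lambda>s. f (Z s) (T s)) has_field_derivative f1 (Z s) (T s) * Z' + f2 (Z s) (T s) * T') (at s)"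
    by (rule PH_partials[OF assms]) (rule that)
  have 1: "dz f z \<tau> = f1 z \<tau>" if "z \<in> U" for z \<tau>
    unfolding dz_def using f(3)[of "\<lambda>s. s" 1 z "\<lambda>_. \<tau>" 0] that by (intro DERIV_imp_deriv) simp
  have 2: "dt f z \<tau> = f2 z \<tau>" if "z \<in> U" for z \<tau>
    unfolding dt_def using f(3)[of "\<lambda>_. z" 0 \<tau> "\<lambda>s. s" 1] that by (intro DERIV_imp_deriv) simp
  show "PH U (dz f)" by (rule PH_cong[OF f(1)]) (rule 1)
  show "PH U (dt f)" by (rule PH_cong[OF f(2)]) (rule 2)
  show "((\<lambda>s. f (Z s) (T s)) has_field_derivative dz f (Z s) (T s) * Z' + dt f (Z s) (T s) * T') (at s)"
    if "(Z has_field_derivative Z') (at s)" "(T has_field_derivative T') (at s)" "Z s \<in> U" for Z T Z' T' s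
    using f(3)[OF that] 1 2 that(3) by simp
qed

lemma PH_holomorphic:
  assumes "open U" "PH U f" "open S" "Z holomorphic_on S" "T holomorphic_on S" "\<And>s. s \<in> S \<Longrightarrow> Z s \<in> U"
  shows "(\<lambda>s. f (Z s) (T s)) holomorphic_on S"
proof -
  have "(\<lambda>s. f (Z s) (T s)) field_differentiable at s" if "s \<in> S" for s
    using PH_chain[OF assms(1,2) holomorphic_derivI[OF assms(4,3) that] holomorphic_derivI[OF assms(5,3) that] assms(6)[OF that]]
    unfolding field_differentiable_def by blast
  then show ?thesis by (simp add: field_differentiable_at_within holomorphic_onI)
qed

lemma PH_at0: "open U \<Longrightarrow> PH U f \<Longrightarrow> (\<lambda>z. f z 0) holomorphic_on U"
  by (rule PH_holomorphic[of U f U "\<lambda>z. z" "\<lambda>_. 0"]) (auto intro!: holomorphic_intros)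

lemma PH_continuous:
  assumes "PH U f"
  shows "continuous_on (U \<times> UNIV) (\<lambda>(z, \<tau>). f z \<tau>)"
proof -
  obtain L a where a: "\<And>k. a k holomorphic_on U" "\<And>z \<tau>. z \<in> U \<Longrightarrow> f z \<tau> = (\<Sum>k<L. a k z * \<tau> ^ k)"
    using PH_E[OF assms] by metis
  have "continuous_on (U \<times> UNIV) (\<lambda>x. \<Sum>k<L. a k (fst x) * snd x ^ k)"
    by (intro continuous_intros continuous_on_compose2[OF holomorphic_on_imp_continuous_on[OF a(1)]]) auto
  then show ?thesis
    by (rule continuous_on_eq) (use a in auto)
qed

lemma PH_isCont:
  assumes "PH U f" "z \<in> U"
  shows "isCont (f z) \<tau>"
proof -
  obtain L a where "\<And>\<tau>. f z \<tau> = (\<Sum>k<L. a k z * \<tau> ^ k)" using assms by (metis PH_E)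
  then have "f z = (\<lambda>\<tau>. \<Sum>k<L. a k z * \<tau> ^ k)" by blast
  then show ?thesis by (simp add: continuous_intros)
qed

section \<open>Exact division by powers of \<open>\<tau>\<close>\<close>

lemma PH_divide_tau:
  assumes "PH U f" "\<And>z. z \<in> U \<Longrightarrow> f z 0 = 0"
  obtains g where "PH U g" "\<And>z \<tau>. z \<in> U \<Longrightarrow> f z \<tau> = \<tau> * g z \<tau>"
proof -
  obtain L a where a: "\<And>k. a k holomorphic_on U" "\<And>z \<tau> L'. z \<in> U \<Longrightarrow> L \<le> L' \<Longrightarrow> f z \<tau> = (\<Sum>k<L'. a k z * \<tau> ^ k)"
    using PH_E_padded[OF assms(1)] by metis
  define g where "g z \<tau> = (\<Sum>k<L. a (Suc k) z * \<tau> ^ k)" for z \<tau>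
  have "a 0 z = 0" if "z \<in> U" for z
    using a(2)[OF that, of "Suc L" 0] assms(2)[OF that] unfolding sum.lessThan_Suc_shift by simp
  then have "f z \<tau> = \<tau> * g z \<tau>" if "z \<in> U" for z \<tau>
    using a(2)[OF that, of "Suc L" \<tau>] that unfolding g_def sum.lessThan_Suc_shift
    by (simp add: sum_distrib_left mult_ac)
  moreover have "PH U g" unfolding g_def by (rule PH_I[of "\<lambda>k. a (Suc k)"]) (use a in auto)
  ultimately show ?thesis using that by blast
qed

text \<open>On \<open>\<tau>^j\<close> the operator \<open>K - \<tau> d/d\<tau>\<close> is
  multiplication by \<open>K - j\<close>, which is nonzero for \<open>j < q \<le> K\<close>; so no
  coefficient of \<open>f\<close> below order \<open>q\<close> survives. It is applied to the
  restriction of \<open>h\<close> to a surface.\<close>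

lemma PH_euler_divisible:
  assumes U: "open U" and "PH U f" "PH U r" "q \<le> K"
    and "\<And>z \<tau>. z \<in> U \<Longrightarrow> of_nat K * f z \<tau> - \<tau> * dt f z \<tau> = \<tau> ^ q * r z \<tau>"
  shows "\<exists>f'. PH U f' \<and> (\<forall>z\<in>U. \<forall>\<tau>. f z \<tau> = \<tau> ^ q * f' z \<tau>)"
  using assms(2-5)
proof (induction q arbitrary: f r)
  case 0
  then show ?case by (intro exI[of _ f]) auto
next
  case (Suc q)
  have "\<exists>f'. PH U f' \<and> (\<forall>z\<in>U. \<forall>\<tau>. f z \<tau> = \<tau> ^ q * f' z \<tau>)"
    by (rule Suc.IH[of f "\<lambda>z \<tau>. \<tau> * r z \<tau>"]) (use Suc.prems PH_shift in auto)
  then obtain f' where f': "PH U f'" "\<And>z \<tau>. z \<in> U \<Longrightarrow> f z \<tau> = \<tau> ^ q * f' z \<tau>" by blast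
  have "f' z 0 = 0" if z: "z \<in> U" for z
  proof -
    have d: "dt f z \<tau> = of_nat q * \<tau> ^ (q - 1) * f' z \<tau> + \<tau> ^ q * dt f' z \<tau>" for \<tau>
    proof -
      have "((\<lambda>\<tau>. f' z \<tau>) has_field_derivative dz f' z \<tau> * 0 + dt f' z \<tau> * 1) (at \<tau>)"
        by (rule PH_chain[OF U f'(1), of "\<lambda>_. z" 0 \<tau> "\<lambda>s. s" 1]) (use z in auto)
      then have "((\<lambda>\<tau>. \<tau> ^ q * f' z \<tau>) has_field_derivative of_nat q * \<tau> ^ (q - 1) * f' z \<tau> + \<tau> ^ q * dt f' z \<tau>) (at \<tau>)"
        by (auto intro!: derivative_eq_intros)
      moreover have "f z = (\<lambda>\<tau>. \<tau> ^ q * f' z \<tau>)" using f'(2)[OF z] by blast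
      ultimately show ?thesis unfolding dt_def[of f] by (simp only: DERIV_imp_deriv)
    qed
    \<comment> \<open>Cancelling \<open>\<tau>^q\<close> is possible only off 0; continuity then
      gives \<open>(K - q) f'(z, 0) = 0\<close>, and in the induction step
      \<open>q < K\<close>.\<close>
    have e: "of_nat (K - q) * f' z \<tau> - \<tau> * dt f' z \<tau> - \<tau> * r z \<tau> = 0" if "\<tau> \<noteq> 0" for \<tau>
    proof -
      have "\<tau> * (of_nat q * \<tau> ^ (q - 1)) = of_nat q * \<tau> ^ q" by (cases q) auto
      then have "\<tau> * dt f z \<tau> = of_nat q * \<tau> ^ q * f' z \<tau> + \<tau> * (\<tau> ^ q * dt f' z \<tau>)"
        unfolding d by (metis (no_types, lifting) distrib_left mult.assoc)
      then have "\<tau> ^ q * (of_nat (K - q) * f' z \<tau> - \<tau> * dt f' z \<tau> - \<tau> * r z \<tau>) = 0"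
        using Suc.prems(4)[OF z, of \<tau>] Suc.prems(3) f'(2)[OF z, of \<tau>] by (simp add: of_nat_diff algebra_simps)
      then show ?thesis using that by simp
    qed
    have "PH U (\<lambda>z \<tau>. of_nat (K - q) * f' z \<tau> - \<tau> * dt f' z \<tau> - \<tau> * r z \<tau>)"
      using f'(1) Suc.prems PH_dt[OF U f'(1)] by (intro PH_intros)
    then have "isCont (\<lambda>\<tau>. of_nat (K - q) * f' z \<tau> - \<tau> * dt f' z \<tau> - \<tau> * r z \<tau>) 0"
      using z by (rule PH_isCont)
    then have "((\<lambda>\<tau>. of_nat (K - q) * f' z \<tau> - \<tau> * dt f' z \<tau> - \<tau> * r z \<tau>) \<longlongrightarrow> of_nat (K - q) * f' z 0) (at 0)"
      by (simp add: isCont_def)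
    moreover have "((\<lambda>\<tau>. of_nat (K - q) * f' z \<tau> - \<tau> * dt f' z \<tau> - \<tau> * r z \<tau>) \<longlongrightarrow> 0) (at 0)"
      using e by (intro tendsto_eventually) (auto simp: eventually_at_filter)
    ultimately have "of_nat (K - q) * f' z 0 = 0" using tendsto_unique[OF at_neq_bot] by blast
    then show ?thesis using Suc.prems(3) by simp
  qed
  then obtain g where "PH U g" "\<And>z \<tau>. z \<in> U \<Longrightarrow> f' z \<tau> = \<tau> * g z \<tau>" using PH_divide_tau[OF f'(1)] by metis
  then show ?case using f'(2) by (intro exI[of _ g]) auto
qed

section \<open>Weighted coordinates\<close>

text \<open>The divided difference \<open>(x^j - y^j) / (x - y)\<close>, written so as to make sense
  on the diagonal.\<close>

definition dd :: "nat \<Rightarrow> complex \<Rightarrow> complex \<Rightarrow> complex" where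
  "dd j x y = (\<Sum>i<j. y ^ (j - Suc i) * x ^ i)"

lemma power_diff_dd: "x ^ j - y ^ j = (x - y) * dd j x y"
  unfolding dd_def by (rule power_diff_sumr2)

lemma dd_same: "dd j x x = of_nat j * x ^ (j - 1)"
proof -
  have "dd j x x = (\<Sum>i<j. x ^ (j - 1))"
    unfolding dd_def by (intro sum.cong refl) (simp add: power_add[symmetric])
  then show ?thesis by simp
qed

lemma dd_minus_diagonal: "dd j x y - of_nat j * x ^ (j - 1) = (y - x) * (\<Sum>i<j. dd (j - Suc i) y x * x ^ i)"
proof -
  have "dd j x y - dd j x x = (\<Sum>i<j. (y ^ (j - Suc i) - x ^ (j - Suc i)) * x ^ i)"
    unfolding dd_def by (simp add: sum_subtractf[symmetric] left_diff_distrib)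
  also have "\<dots> = (y - x) * (\<Sum>i<j. dd (j - Suc i) y x * x ^ i)"
    unfolding power_diff_dd sum_distrib_left by (simp add: mult.assoc)
  finally show ?thesis by (simp add: dd_same)
qed

text \<open>Dividing the exponents by \<open>d\<close> replaces the root variable of order
  \<open>M N - 1\<close> by its \<open>d\<close>-th power. In this variable \<open>n\<close> and
  \<open>m\<close> are the pole orders of \<open>y1\<close> and \<open>y2\<close>, \<open>q\<close>
  is the order of vanishing of \<open>z - z0\<close>, and \<open>K\<close> is the common weight of
  the two leading terms of \<open>H\<close>.\<close>

locale weights =
  fixes M N d n m q K :: nat
  assumes M_pos: "M > 0" and N_pos: "N > 0" and d_pos: "d > 0" and Suc_N: "N + 1 = d * n" and Suc_M: "M + 1 = d * m"
    and MN_q: "M * N - 1 = d * q" and q_pos: "q > 0" and K_eq: "K = n * (M + 1)"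
begin

lemma n_pos: "n > 0" and m_pos: "m > 0"
  using Suc_N Suc_M by (auto intro: Nat.gr0I)

lemma K_eq': "K = m * (N + 1)"
  using K_eq unfolding Suc_N Suc_M by (simp only: mult_ac)

lemma dK: "d * K = (M + 1) * (N + 1)"
  using K_eq Suc_N by (simp add: algebra_simps)

text \<open>This is \<open>(M + 1)(N + 1) = (M N - 1) + (N + 1) + (M + 1)\<close> divided by
  \<open>d\<close>. It sets the time scale: after the weights of both unknowns are taken from that
  of \<open>H\<close>, a power \<open>\<tau>^q\<close> remains.\<close>

lemma K_split: "K = q + n + m"
proof -
  have "M * N \<ge> 1" using M_pos N_pos by simp
  then have "(M + 1) * (N + 1) = (M * N - 1) + (N + 1) + (M + 1)" by (simp add: algebra_simps)
  then have "d * K = d * (q + n + m)" unfolding dK MN_q Suc_N Suc_M by (simp add: algebra_simps)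
  then show ?thesis using d_pos by simp
qed

text \<open>Leading and lower monomials of \<open>H\<close> under one index set; the leading ones
  are those with surplus exponent \<open>ew\<close> equal to 0.\<close>

definition J :: "(nat \<times> nat) set" where
  "J = insert (M + 1, 0) (insert (0, N + 1) (idxI M N))"

definition ew :: "nat \<Rightarrow> nat \<Rightarrow> nat" where
  "ew i j = K - (i * n + j * m)"

lemma idxI_weight:
  assumes "(i, j) \<in> idxI M N" shows "i * n + j * m < K"
proof -
  have "d * (i * n + j * m) = i * (N + 1) + j * (M + 1)" using Suc_N Suc_M by (simp add: algebra_simps)
  also have "\<dots> < d * K" using assms unfolding idxI_def dK by (simp add: mult.commute)
  finally show ?thesis by simp
qed

lemma J_weight:
  assumes "(i, j) \<in> J" shows "i * n + j * m \<le> K"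
proof -
  have "(M + 1) * n + 0 * m = K" "0 * n + (N + 1) * m = K" using K_eq K_eq' by (simp_all only: mult_ac)
  then show ?thesis using assms unfolding J_def by (auto dest: idxI_weight)
qed

lemma J_ew: "(i, j) \<in> J \<Longrightarrow> i * n + j * m + ew i j = K"
  using J_weight[of i j] unfolding ew_def by simp

lemma finite_idxI: "finite (idxI M N)"
proof (rule finite_subset)
  show "idxI M N \<subseteq> {..K} \<times> {..K}"
  proof clarify
    fix i j assume "(i, j) \<in> idxI M N"
    then have "i * n + j * m < K" by (rule idxI_weight)
    moreover have "i \<le> i * n" "j \<le> j * m" using n_pos m_pos by auto
    ultimately have "i \<le> K" "j \<le> K" by linarith+
    then show "i \<in> {..K} \<and> j \<in> {..K}" by simp
  qed
qed simp

lemma finite_J: "finite J"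
  unfolding J_def using finite_idxI by simp

lemma J_not_idxI: "(M + 1, 0) \<notin> idxI M N" "(0, N + 1) \<notin> idxI M N" "(M + 1, 0) \<noteq> (0, N + 1)"
  unfolding idxI_def by auto

lemma ew_top: "ew (M + 1) 0 = 0" "ew 0 (N + 1) = 0"
  unfolding ew_def using K_eq K_eq' by (auto simp: mult.commute)

lemma J_sum: "(\<Sum>(i, j)\<in>J. f i j) = f (M + 1) 0 + (f 0 (N + 1) + (\<Sum>(i, j)\<in>idxI M N. f i j))"
  unfolding J_def using finite_idxI J_not_idxI by simp

lemma J_sum_zero:
  fixes f g :: "nat \<Rightarrow> nat \<Rightarrow> complex"
  shows "(\<Sum>(i, j)\<in>J. f i j * 0 ^ ew i j * g i j) = f (M + 1) 0 * g (M + 1) 0 + f 0 (N + 1) * g 0 (N + 1)"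
proof -
  have "(\<Sum>(i, j)\<in>idxI M N. f i j * 0 ^ ew i j * g i j) = 0"
    by (rule sum.neutral) (auto simp: ew_def dest: idxI_weight)
  then show ?thesis unfolding J_sum ew_top by simp
qed

text \<open>\<open>hh\<close> is \<open>\<tau>^K H\<close> in the coordinates
  \<open>(\<tau>, w)\<close>, \<open>hw\<close> and \<open>ht\<close> are its derivatives in
  \<open>w\<close> and \<open>\<tau>\<close>, \<open>hi\<close> is \<open>y1\<close> times the
  derivative of \<open>H\<close> in \<open>y1\<close>, rescaled likewise, and \<open>Dh\<close>
  weights every monomial by its order in \<open>1/\<tau>\<close>. The coefficients form a parameter
  because the sums are also evaluated on the derivatives of the \<open>\<alpha> i j\<close>.\<close>

definition hh :: "(nat \<Rightarrow> nat \<Rightarrow> complex) \<Rightarrow> complex \<Rightarrow> complex \<Rightarrow> complex" where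
  "hh a \<tau> w = (\<Sum>(i, j)\<in>J. a i j * \<tau> ^ ew i j * w ^ j)"
definition hw where "hw a \<tau> w = (\<Sum>(i, j)\<in>J. (of_nat j * a i j) * \<tau> ^ ew i j * w ^ (j - 1) :: complex)"
definition ht where "ht a \<tau> w = (\<Sum>(i, j)\<in>J. (of_nat (ew i j) * a i j) * \<tau> ^ (ew i j - 1) * w ^ j :: complex)"
definition Dh where "Dh a \<tau> w = (\<Sum>(i, j)\<in>J. (of_nat (i * n + j * m) * a i j) * \<tau> ^ ew i j * w ^ j :: complex)"
definition hi where "hi a \<tau> w = (\<Sum>(i, j)\<in>J. (of_nat i * a i j) * \<tau> ^ ew i j * w ^ j :: complex)"

text \<open>Divided differences in \<open>w\<close>. They split the factor \<open>x - y\<close> off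
  a difference without a division; \<open>hh_dd2\<close> is the second divided difference of
  \<open>hh\<close> with the node \<open>x\<close> doubled.\<close>

definition hh_dd where "hh_dd a \<tau> x y = (\<Sum>(i, j)\<in>J. a i j * \<tau> ^ ew i j * dd j x y :: complex)"
definition hw_dd where "hw_dd a \<tau> x y = (\<Sum>(i, j)\<in>J. (of_nat j * a i j) * \<tau> ^ ew i j * dd (j - 1) x y :: complex)"
definition ht_dd where "ht_dd a \<tau> x y = (\<Sum>(i, j)\<in>J. (of_nat (ew i j) * a i j) * \<tau> ^ (ew i j - 1) * dd j x y :: complex)"
definition Dh_dd where "Dh_dd a \<tau> x y = (\<Sum>(i, j)\<in>J. (of_nat (i * n + j * m) * a i j) * \<tau> ^ ew i j * dd j x y :: complex)"
definition hh_dd2 where "hh_dd2 a \<tau> x y = (\<Sum>(i, j)\<in>J. a i j * \<tau> ^ ew i j * (\<Sum>i<j. dd (j - Suc i) y x * x ^ i) :: complex)"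

lemma sum_diff_dd:
  fixes c :: "nat \<Rightarrow> nat \<Rightarrow> complex"
  shows "(\<Sum>(i, j)\<in>J. c i j * x ^ e i j) - (\<Sum>(i, j)\<in>J. c i j * y ^ e i j) = (x - y) * (\<Sum>(i, j)\<in>J. c i j * dd (e i j) x y)"
  unfolding sum_subtractf[symmetric] sum_distrib_left
  by (intro sum.cong refl) (auto simp: right_diff_distrib[symmetric] power_diff_dd mult_ac)

lemma hh_diff: "hh a \<tau> x - hh a \<tau> y = (x - y) * hh_dd a \<tau> x y"
  unfolding hh_def hh_dd_def by (rule sum_diff_dd)
lemma hw_diff: "hw a \<tau> x - hw a \<tau> y = (x - y) * hw_dd a \<tau> x y"
  unfolding hw_def hw_dd_def by (rule sum_diff_dd)
lemma ht_diff: "ht a \<tau> x - ht a \<tau> y = (x - y) * ht_dd a \<tau> x y"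
  unfolding ht_def ht_dd_def by (rule sum_diff_dd)
lemma Dh_diff: "Dh a \<tau> x - Dh a \<tau> y = (x - y) * Dh_dd a \<tau> x y"
  unfolding Dh_def Dh_dd_def by (rule sum_diff_dd)

lemma hh_dd_diff: "hh_dd a \<tau> x y - hw a \<tau> x = (y - x) * hh_dd2 a \<tau> x y"
proof -
  have "a i j * \<tau> ^ ew i j * dd j x y - of_nat j * a i j * \<tau> ^ ew i j * x ^ (j - 1) =
    (y - x) * (a i j * \<tau> ^ ew i j * (\<Sum>i<j. dd (j - Suc i) y x * x ^ i))" for i j
  proof -
    have "a i j * \<tau> ^ ew i j * dd j x y - of_nat j * a i j * \<tau> ^ ew i j * x ^ (j - 1) =
      a i j * \<tau> ^ ew i j * (dd j x y - of_nat j * x ^ (j - 1))" by (simp add: algebra_simps)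
    then show ?thesis unfolding dd_minus_diagonal by (simp add: mult_ac)
  qed
  then show ?thesis unfolding hh_dd_def hw_def hh_dd2_def sum_subtractf[symmetric] sum_distrib_left[of "y - x"]
    by (intro sum.cong refl) (simp only: case_prod_unfold)
qed

text \<open>Euler's relation: in every monomial the order in \<open>1/\<tau>\<close> and the surplus
  exponent add up to \<open>K\<close>.\<close>

lemma Dh_eq: "Dh a \<tau> w = of_nat K * hh a \<tau> w - \<tau> * ht a \<tau> w"
proof -
  have "of_nat (i * n + j * m) * a i j * \<tau> ^ ew i j * w ^ j =
     of_nat K * (a i j * \<tau> ^ ew i j * w ^ j) - \<tau> * (of_nat (ew i j) * a i j * \<tau> ^ (ew i j - 1) * w ^ j)"
    if "(i, j) \<in> J" for i j
  proof -
    have "\<tau> * (of_nat (ew i j) * a i j * \<tau> ^ (ew i j - 1) * w ^ j) = of_nat (ew i j) * (a i j * \<tau> ^ ew i j * w ^ j)"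
      by (cases "ew i j") (auto simp: algebra_simps)
    moreover have "complex_of_nat K = of_nat (i * n + j * m) + of_nat (ew i j)"
      using J_ew[OF that] by (metis of_nat_add)
    ultimately show ?thesis by (simp add: algebra_simps)
  qed
  then show ?thesis unfolding Dh_def hh_def ht_def sum_distrib_left sum_subtractf[symmetric]
    by (intro sum.cong refl) auto
qed

text \<open>The weight of a monomial is shared between \<open>y1\<close> and \<open>y2\<close>. In
  this form \<open>Dh\<close> is recognised as the right-hand side of the equation for
  \<open>w\<close>, into which both Hamiltonian equations enter.\<close>

lemma Dh_eq_hi: "Dh a \<tau> w = of_nat n * hi a \<tau> w + of_nat m * (w * hw a \<tau> w)"
proof -
  have "of_nat (i * n + j * m) * a i j * \<tau> ^ ew i j * w ^ j =
     of_nat n * (of_nat i * a i j * \<tau> ^ ew i j * w ^ j) + of_nat m * (w * (of_nat j * a i j * \<tau> ^ ew i j * w ^ (j - 1)))"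
    for i j
    by (cases j) (auto simp: algebra_simps)
  then show ?thesis unfolding Dh_def hi_def hw_def sum_distrib_left sum.distrib[symmetric]
    by (intro sum.cong refl) auto
qed

lemma hh_zero: "hh a 0 w = a (M + 1) 0 + a 0 (N + 1) * w ^ (N + 1)"
  unfolding hh_def J_sum_zero by simp

lemma hw_zero: "hw a 0 w = of_nat (N + 1) * a 0 (N + 1) * w ^ N"
  unfolding hw_def J_sum_zero by simp

lemma Dh_zero: "Dh a 0 w = of_nat K * hh a 0 w"
  unfolding Dh_eq by simp

lemma Dh_dd_zero: "Dh_dd a 0 w w = of_nat K * hw a 0 w"
  unfolding Dh_dd_def J_sum_zero hw_zero dd_same using K_eq' by simp

section \<open>The Hamiltonian system in weighted coordinates\<close>

definition Hm :: "(nat \<Rightarrow> nat \<Rightarrow> complex) \<Rightarrow> complex \<Rightarrow> complex \<Rightarrow> complex" where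
  "Hm a y1 y2 = (\<Sum>(i, j)\<in>J. a i j * y1 ^ i * y2 ^ j)"

lemma rhs1_J: "rhs1 a M N y1 y2 = (\<Sum>(i, j)\<in>J. of_nat j * a i j * y1 ^ i * y2 ^ (j - 1))"
  unfolding rhs1_def J_sum by simp

lemma rhs2_J: "rhs2 a M N y1 y2 = - (\<Sum>(i, j)\<in>J. of_nat i * a i j * y1 ^ (i - 1) * y2 ^ j)"
  unfolding rhs2_def J_sum by simp

context
  fixes \<tau> y1 y2 w :: complex
  assumes t: "\<tau> ^ n * y1 = 1" and w: "w = y2 * \<tau> ^ m"
begin

lemma weighted_monomial: "\<tau> ^ (i * n + j * m + e) * (y1 ^ i * y2 ^ j) = \<tau> ^ e * w ^ j"
proof -
  have "\<tau> ^ (i * n + j * m + e) * (y1 ^ i * y2 ^ j) = (\<tau> ^ n * y1) ^ i * (\<tau> ^ e * (y2 * \<tau> ^ m) ^ j)"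
    by (simp add: power_add power_mult_distrib power_mult[symmetric] mult_ac)
  then show ?thesis using t w by simp
qed

lemma Hm_hh: "\<tau> ^ K * Hm a y1 y2 = hh a \<tau> w"
  unfolding Hm_def hh_def sum_distrib_left
proof (intro sum.cong refl, clarify)
  fix i j assume "(i, j) \<in> J"
  then show "\<tau> ^ K * (a i j * y1 ^ i * y2 ^ j) = a i j * \<tau> ^ ew i j * w ^ j"
    using weighted_monomial[of i j "ew i j"] J_ew by (simp add: mult_ac)
qed

lemma rhs1_hw: "\<tau> ^ (K - m) * rhs1 a M N y1 y2 = hw a \<tau> w"
  unfolding rhs1_J hw_def sum_distrib_left
proof (intro sum.cong refl, clarify)
  fix i j assume J: "(i, j) \<in> J"
  show "\<tau> ^ (K - m) * (of_nat j * a i j * y1 ^ i * y2 ^ (j - 1)) = of_nat j * a i j * \<tau> ^ ew i j * w ^ (j - 1)"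
  \<comment> \<open>For \<open>j = 0\<close> the term vanishes through its factor. Otherwise
    \<open>K - m\<close> is the exact exponent, and no truncated subtraction interferes.\<close>
  proof (cases j)
    case (Suc k)
    then have "K - m = i * n + k * m + ew i j" using J_ew[OF J] by simp
    then show ?thesis using weighted_monomial[of i k "ew i j"] Suc by (simp add: mult_ac)
  qed simp
qed

lemma rhs2_hi: "\<tau> ^ (K - n) * rhs2 a M N y1 y2 = - hi a \<tau> w"
proof -
  have "\<tau> ^ (K - n) * (\<Sum>(i, j)\<in>J. of_nat i * a i j * y1 ^ (i - 1) * y2 ^ j) = hi a \<tau> w"
    unfolding hi_def sum_distrib_left
  proof (intro sum.cong refl, clarify)
    fix i j assume J: "(i, j) \<in> J"
    show "\<tau> ^ (K - n) * (of_nat i * a i j * y1 ^ (i - 1) * y2 ^ j) = of_nat i * a i j * \<tau> ^ ew i j * w ^ j"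
    proof (cases i)
      case (Suc k)
      then have "K - n = k * n + j * m + ew i j" using J_ew[OF J] by simp
      then show ?thesis using weighted_monomial[of k j "ew i j"] Suc by (simp add: mult_ac)
    qed simp
  qed
  then show ?thesis unfolding rhs2_J by simp
qed

end

end

locale hamiltonian = weights +
  fixes \<alpha> :: "nat \<Rightarrow> nat \<Rightarrow> complex \<Rightarrow> complex" and U :: "complex set"
  assumes U: "open U" and hol\<alpha>: "\<And>i j. (i, j) \<in> J \<Longrightarrow> \<alpha> i j holomorphic_on U"
    and lead: "\<And>z. z \<in> U \<Longrightarrow> \<alpha> (M + 1) 0 z \<noteq> 0" "\<And>z. z \<in> U \<Longrightarrow> \<alpha> 0 (N + 1) z \<noteq> 0"
begin

abbreviation A :: "complex \<Rightarrow> nat \<Rightarrow> nat \<Rightarrow> complex" where "A z \<equiv> (\<lambda>i j. \<alpha> i j z)"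
abbreviation A' :: "complex \<Rightarrow> nat \<Rightarrow> nat \<Rightarrow> complex" where "A' z \<equiv> (\<lambda>i j. deriv (\<alpha> i j) z)"

lemma hol\<alpha>': "(i, j) \<in> J \<Longrightarrow> deriv (\<alpha> i j) holomorphic_on U"
  by (intro holomorphic_deriv hol\<alpha> U)

lemma PH_dd: "PH U f \<Longrightarrow> PH U g \<Longrightarrow> PH U (\<lambda>z \<tau>. dd j (f z \<tau>) (g z \<tau>))"
  unfolding dd_def by (intro PH_intros)

lemma PH_J: "(\<And>i j. (i, j) \<in> J \<Longrightarrow> PH U (\<lambda>z \<tau>. F i j z \<tau>)) \<Longrightarrow> PH U (\<lambda>z \<tau>. \<Sum>(i, j)\<in>J. F i j z \<tau>)"
  by (rule PH_cong[OF PH_sum[of J U "\<lambda>x z \<tau>. F (fst x) (snd x) z \<tau>"]]) (auto simp: case_prod_unfold)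

lemma PH_hh:
  assumes "PH U f"
  shows "PH U (\<lambda>z \<tau>. hh (A z) \<tau> (f z \<tau>))" "PH U (\<lambda>z \<tau>. hw (A z) \<tau> (f z \<tau>))"
    "PH U (\<lambda>z \<tau>. ht (A z) \<tau> (f z \<tau>))" "PH U (\<lambda>z \<tau>. Dh (A z) \<tau> (f z \<tau>))"
  using assms unfolding hh_def hw_def ht_def Dh_def
  by (auto intro!: PH_J PH_intros PH_coeff holomorphic_intros hol\<alpha>)

lemma PH_hh_dd:
  assumes "PH U f" "PH U g"
  shows "PH U (\<lambda>z \<tau>. hw_dd (A z) \<tau> (f z \<tau>) (g z \<tau>))" "PH U (\<lambda>z \<tau>. Dh_dd (A z) \<tau> (f z \<tau>) (g z \<tau>))"
  using assms unfolding hw_dd_def Dh_dd_def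
  by (auto intro!: PH_J PH_intros PH_coeff holomorphic_intros hol\<alpha> PH_dd)

lemma hh_chain:
  assumes Z: "(Z has_field_derivative Z') (at s)" and T: "(T has_field_derivative T') (at s)"
    and X: "(X has_field_derivative X') (at s)" and zs: "Z s \<in> U"
  shows "((\<lambda>s. hh (A (Z s)) (T s) (X s)) has_field_derivative
    hh (A' (Z s)) (T s) (X s) * Z' + ht (A (Z s)) (T s) (X s) * T' + hw (A (Z s)) (T s) (X s) * X') (at s)"
proof -
  have a: "((\<lambda>s. \<alpha> i j (Z s)) has_field_derivative deriv (\<alpha> i j) (Z s) * Z') (at s)" if "(i, j) \<in> J" for i j
    using holomorphic_derivI[OF hol\<alpha>[OF that] U zs] Z DERIV_chain2 by blast
  have "((\<lambda>s. \<Sum>x\<in>J. \<alpha> (fst x) (snd x) (Z s) * T s ^ ew (fst x) (snd x) * X s ^ snd x) has_field_derivative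
     (\<Sum>x\<in>J. deriv (\<alpha> (fst x) (snd x)) (Z s) * T s ^ ew (fst x) (snd x) * X s ^ snd x * Z' +
        (of_nat (ew (fst x) (snd x)) * \<alpha> (fst x) (snd x) (Z s)) * T s ^ (ew (fst x) (snd x) - 1) * X s ^ snd x * T' +
        (of_nat (snd x) * \<alpha> (fst x) (snd x) (Z s)) * T s ^ ew (fst x) (snd x) * X s ^ (snd x - 1) * X')) (at s)"
    using a T X by (intro DERIV_sum) (auto intro!: derivative_eq_intros simp: algebra_simps)
  then show ?thesis
    unfolding hh_def ht_def hw_def case_prod_unfold sum_distrib_right sum.distrib[symmetric] .
qed

text \<open>Defect of \<open>w = P(z, \<tau>)\<close> as an invariant surface of the flow in the coordinates \<open>(z, \<tau>, w)\<close>.\<close>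

definition Eop :: "(complex \<Rightarrow> complex \<Rightarrow> complex) \<Rightarrow> complex \<Rightarrow> complex \<Rightarrow> complex" where
  "Eop P z \<tau> = of_nat n * \<tau> ^ q * dz P z \<tau> - \<tau> * dt P z \<tau> * hw (A z) \<tau> (P z \<tau>) + Dh (A z) \<tau> (P z \<tau>)"

lemma PH_Eop: "PH U P \<Longrightarrow> PH U (Eop P)"
proof -
  assume P: "PH U P"
  have "PH U (\<lambda>z \<tau>. of_nat n * \<tau> ^ q * dz P z \<tau> - \<tau> * dt P z \<tau> * hw (A z) \<tau> (P z \<tau>) + Dh (A z) \<tau> (P z \<tau>))"
    by (intro PH_intros PH_hh P PH_dz PH_dt U)
  then show "PH U (Eop P)" by (rule PH_cong) (simp add: Eop_def)
qed

text \<open>Adding \<open>c \<tau>^k\<close> to \<open>P\<close> changes the coefficient of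
  \<open>\<tau>^k\<close> in the defect by \<open>(K - k) h_w c\<close>: the \<open>K\<close> comes
  from \<open>Dh\<close>, whose \<open>w\<close>-derivative at \<open>\<tau> = 0\<close> is
  \<open>K h_w\<close>, and the \<open>- k\<close> from the term with \<open>\<tau> dt P\<close>. So
  one order is gained unless \<open>k = K\<close>.\<close>

lemma Eop_step:
  assumes P: "PH U P" and P0: "\<And>z. z \<in> U \<Longrightarrow> P z 0 = w0 z"
    and w0: "\<And>z. z \<in> U \<Longrightarrow> hh (A z) 0 (w0 z) = 0"
    and r: "PH U r" and E: "\<And>z \<tau>. z \<in> U \<Longrightarrow> Eop P z \<tau> = \<tau> ^ k * r z \<tau>"
    and k: "k > 0" "k \<noteq> K"
  shows "\<exists>P' r'. PH U P' \<and> PH U r' \<and> (\<forall>z\<in>U. P' z 0 = w0 z) \<and> (\<forall>z\<in>U. \<forall>\<tau>. Eop P' z \<tau> = \<tau> ^ Suc k * r' z \<tau>)"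
proof -
  have P0h: "w0 holomorphic_on U" using PH_at0[OF U P] P0 by (simp cong: holomorphic_cong)
  \<comment> \<open>Both leading coefficients are nonzero, hence the root \<open>w0 z\<close> is
    nonzero and simple, and \<open>c\<close> below is well defined and holomorphic.\<close>
  have nz: "hw (A z) 0 (w0 z) \<noteq> 0" if "z \<in> U" for z
  proof -
    have "w0 z \<noteq> 0" using w0[OF that] lead(1)[OF that] unfolding hh_zero by auto
    then show ?thesis unfolding hw_zero using lead(2)[OF that] by (simp del: of_nat_Suc of_nat_add)
  qed
  define c where "c z = - (r z 0 / ((of_nat K - of_nat k) * hw (A z) 0 (w0 z)))" for z
  have Kk: "of_nat K - of_nat k \<noteq> (0::complex)" using k by simp
  have hc: "c holomorphic_on U"
    unfolding c_def hw_zero using nz unfolding hw_zero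
    by (intro holomorphic_intros PH_at0[OF U r] hol\<alpha> P0h) (use Kk in \<open>auto simp: J_def\<close>)
  define P' where "P' z \<tau> = P z \<tau> + c z * \<tau> ^ k" for z \<tau>
  have P': "PH U P'" unfolding P'_def by (intro PH_intros P PH_coeff hc)
  have P'0: "P' z 0 = w0 z" if "z \<in> U" for z using P0[OF that] k unfolding P'_def by simp
  have Pz: "((\<lambda>z. P z \<tau>) has_field_derivative dz P z \<tau>) (at z)"
    and Pt: "(P z has_field_derivative dt P z \<tau>) (at \<tau>)" if "z \<in> U" for z \<tau>
    using PH_chain[OF U P, of "\<lambda>s. s" 1 z "\<lambda>_. \<tau>" 0] PH_chain[OF U P, of "\<lambda>_. z" 0 \<tau> "\<lambda>s. s" 1] that by auto
  have dzP': "dz P' z \<tau> = dz P z \<tau> + deriv c z * \<tau> ^ k" if "z \<in> U" for z \<tau>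
    unfolding dz_def[of P'] P'_def using Pz[OF that] holomorphic_derivI[OF hc U that]
    by (intro DERIV_imp_deriv) (auto intro!: derivative_eq_intros)
  have dtP': "dt P' z \<tau> = dt P z \<tau> + c z * (of_nat k * \<tau> ^ (k - 1))" if "z \<in> U" for z \<tau>
    unfolding dt_def[of P'] P'_def using Pt[OF that]
    by (intro DERIV_imp_deriv) (auto intro!: derivative_eq_intros)
  define r1 where "r1 z \<tau> = r z \<tau> + of_nat n * \<tau> ^ q * deriv c z - of_nat k * c z * hw (A z) \<tau> (P' z \<tau>)
      - \<tau> * dt P z \<tau> * c z * hw_dd (A z) \<tau> (P' z \<tau>) (P z \<tau>) + c z * Dh_dd (A z) \<tau> (P' z \<tau>) (P z \<tau>)" for z \<tau>
  have r1: "PH U r1" unfolding r1_def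
    by (intro PH_intros r PH_coeff hc holomorphic_deriv holomorphic_intros U PH_hh PH_hh_dd P P' PH_dt)
  have E': "Eop P' z \<tau> = \<tau> ^ k * r1 z \<tau>" if z: "z \<in> U" for z \<tau>
  proof -
    have x: "P' z \<tau> - P z \<tau> = c z * \<tau> ^ k" unfolding P'_def by simp
    have 1: "hw (A z) \<tau> (P' z \<tau>) = hw (A z) \<tau> (P z \<tau>) + c z * \<tau> ^ k * hw_dd (A z) \<tau> (P' z \<tau>) (P z \<tau>)"
      using hw_diff[of "A z" \<tau> "P' z \<tau>" "P z \<tau>"] x by (simp add: algebra_simps)
    have 2: "Dh (A z) \<tau> (P' z \<tau>) = Dh (A z) \<tau> (P z \<tau>) + c z * \<tau> ^ k * Dh_dd (A z) \<tau> (P' z \<tau>) (P z \<tau>)"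
      using Dh_diff[of "A z" \<tau> "P' z \<tau>" "P z \<tau>"] x by (simp add: algebra_simps)
    have 3: "\<tau> * (of_nat k * \<tau> ^ (k - 1)) = of_nat k * \<tau> ^ k" using k by (cases k) auto
    have "\<tau> * dt P' z \<tau> = \<tau> * dt P z \<tau> + c z * (\<tau> * (of_nat k * \<tau> ^ (k - 1)))"
      unfolding dtP'[OF z] by (simp add: algebra_simps)
    then have 4: "\<tau> * dt P' z \<tau> = \<tau> * dt P z \<tau> + c z * (of_nat k * \<tau> ^ k)" unfolding 3 .
    have "Eop P' z \<tau> = of_nat n * \<tau> ^ q * (dz P z \<tau> + deriv c z * \<tau> ^ k)
        - \<tau> * dt P z \<tau> * hw (A z) \<tau> (P' z \<tau>) - c z * (of_nat k * \<tau> ^ k) * hw (A z) \<tau> (P' z \<tau>) + Dh (A z) \<tau> (P' z \<tau>)"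
      unfolding Eop_def dzP'[OF z] 4 by (simp add: algebra_simps)
    also have "\<dots> = Eop P z \<tau> + \<tau> ^ k * (of_nat n * \<tau> ^ q * deriv c z - \<tau> * dt P z \<tau> * c z * hw_dd (A z) \<tau> (P' z \<tau>) (P z \<tau>)
       - of_nat k * c z * hw (A z) \<tau> (P' z \<tau>) + c z * Dh_dd (A z) \<tau> (P' z \<tau>) (P z \<tau>))"
      unfolding Eop_def 2 using 1 by (simp add: algebra_simps)
    also have "\<dots> = \<tau> ^ k * r1 z \<tau>" unfolding E[OF z] r1_def by (simp add: algebra_simps)
    finally show ?thesis .
  qed
  have "r1 z 0 = 0" if z: "z \<in> U" for z
  proof -
    have "r1 z 0 = r z 0 + c z * ((of_nat K - of_nat k) * hw (A z) 0 (w0 z))"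
      unfolding r1_def P'0[OF z] P0[OF z] Dh_dd_zero using q_pos by (simp add: algebra_simps)
    also have "\<dots> = 0" unfolding c_def using nz[OF z] Kk by simp
    finally show ?thesis .
  qed
  then obtain r' where "PH U r'" "\<And>z \<tau>. z \<in> U \<Longrightarrow> r1 z \<tau> = \<tau> * r' z \<tau>" using PH_divide_tau[OF r1] by metis
  then show ?thesis using P' P'0 E' by (intro exI[of _ P'] exI[of _ r']) auto
qed

text \<open>At order \<open>K\<close> no correction has any effect, so the coefficient must vanish
  by itself, which is what \<open>resonance\<close> provides. Beyond \<open>K\<close> the recursion
  goes on as before.\<close>

lemma Eop_exists:
  assumes w0: "w0 holomorphic_on U" "\<And>z. z \<in> U \<Longrightarrow> hh (A z) 0 (w0 z) = 0"
    and resonance: "\<And>P r z. PH U P \<Longrightarrow> PH U r \<Longrightarrow> (\<And>z. z \<in> U \<Longrightarrow> P z 0 = w0 z) \<Longrightarrow>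
       (\<And>z \<tau>. z \<in> U \<Longrightarrow> Eop P z \<tau> = \<tau> ^ K * r z \<tau>) \<Longrightarrow> z \<in> U \<Longrightarrow> r z 0 = 0"
  shows "\<exists>P r. PH U P \<and> PH U r \<and> (\<forall>z\<in>U. P z 0 = w0 z) \<and> (\<forall>z\<in>U. \<forall>\<tau>. Eop P z \<tau> = \<tau> ^ Suc k * r z \<tau>)"
proof (induction k)
  case 0
  let ?P = "\<lambda>z \<tau>::complex. w0 z"
  have P: "PH U ?P" by (rule PH_coeff[OF w0(1)])
  have "Eop ?P z 0 = 0" if "z \<in> U" for z
    unfolding Eop_def Dh_zero w0(2)[OF that] using q_pos by simp
  then obtain r where "PH U r" "\<And>z \<tau>. z \<in> U \<Longrightarrow> Eop ?P z \<tau> = \<tau> * r z \<tau>"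
    using PH_divide_tau[OF PH_Eop[OF P]] by metis
  then show ?case using P by (intro exI[of _ ?P] exI[of _ r]) auto
next
  case (Suc k)
  then obtain P r where P: "PH U P" "PH U r" "\<And>z. z \<in> U \<Longrightarrow> P z 0 = w0 z" "\<And>z \<tau>. z \<in> U \<Longrightarrow> Eop P z \<tau> = \<tau> ^ Suc k * r z \<tau>"
    by blast
  show ?case
  proof (cases "Suc k = K")
    case True
    then have "r z 0 = 0" if "z \<in> U" for z
      using resonance[OF P(1,2) P(3) _ that] P(4) by blast
    then obtain r' where "PH U r'" "\<And>z \<tau>. z \<in> U \<Longrightarrow> r z \<tau> = \<tau> * r' z \<tau>" using PH_divide_tau[OF P(2)] by metis
    then show ?thesis using P by (intro exI[of _ P] exI[of _ r']) auto
  next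
    case False
    show ?thesis by (rule Eop_step[OF P(1) P(3) w0(2) P(2) P(4)]) (use False in auto)
  qed
qed

end

section \<open>Truncated formal solutions\<close>

lemma taylor_in_root_compose: "taylor_in_root p f z0 = fps_to_fls (fps_expansion f z0 oo fps_X ^ p)"
  unfolding taylor_in_root_def
  by (intro arg_cong[of _ _ fps_to_fls] fps_ext) (simp only: fps_nth_compose_X_power fps_expansion_def fps_nth_Abs_fps)

lemma fps_to_fls_sum: "fps_to_fls (\<Sum>x\<in>I. f x) = (\<Sum>x\<in>I. fps_to_fls (f x))"
  by (induction I rule: infinite_finite_induct) auto

lemma fps_to_fls_of_nat': "fps_to_fls (of_nat n :: complex fps) = of_nat n"
  by (induction n) auto

lemma fls_shift_regular:
  assumes "\<forall>k < - int n. fls_nth Y k = 0"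
  shows "Y * fls_X ^ n = fps_to_fls (Abs_fps (\<lambda>k. fls_nth Y (int k - int n)))"
  unfolding fls_X_power_times_conv_shift
  by (rule fls_eqI) (use assms in auto)

lemma dvd_mult_diff:
  fixes x :: "'a :: comm_ring_1"
  assumes "x dvd a - a'" "x dvd b - b'"
  shows "x dvd a * b - a' * b'"
proof -
  have "a * b - a' * b' = a * (b - b') + (a - a') * b'" by (simp add: algebra_simps)
  then show ?thesis using assms by (simp only: dvd_add dvd_mult dvd_mult2)
qed

lemma dvd_power_diff:
  fixes x :: "'a :: comm_ring_1"
  assumes "x dvd a - a'"
  shows "x dvd a ^ n - a' ^ n"
  by (induction n) (auto intro: dvd_mult_diff assms)

text \<open>The shifted series is the expansion of \<open>f t / t^L\<close>, which is therefore
  continuous at 0 and so bounded near it.\<close>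

lemma bounded_if_fps_X_power_dvd:
  fixes f :: "complex \<Rightarrow> complex"
  assumes f: "f has_fps_expansion F" and F: "fps_X ^ L dvd F"
  shows "\<exists>C. eventually (\<lambda>t. norm (f t) \<le> C * norm t ^ L) (at 0)"
proof (cases "F = 0")
  case True
  then have "eventually (\<lambda>t. f t = 0) (nhds 0)" using f has_fps_expansion_0_iff by blast
  then have "eventually (\<lambda>t. f t = 0) (at 0)" unfolding eventually_at_filter by (rule eventually_mono) simp
  then show ?thesis by (intro exI[of _ 0]) (auto elim: eventually_mono)
next
  case False
  then have "L \<le> subdegree F" using F by (simp add: fps_dvd_iff)
  from has_fps_expansion_shift[OF f this refl]
  have "isCont (\<lambda>x. if x = 0 then fps_nth F L else f x / x ^ L) 0"
    using has_fps_expansion_imp_continuous[where A = UNIV] by blast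
  then have "((\<lambda>x. if x = 0 then fps_nth F L else f x / x ^ L) \<longlongrightarrow> fps_nth F L) (at 0)"
    by (simp add: isCont_def)
  then have "((\<lambda>x. norm (if x = 0 then fps_nth F L else f x / x ^ L)) \<longlongrightarrow> norm (fps_nth F L)) (at 0)"
    by (rule tendsto_norm)
  then have "eventually (\<lambda>x. norm (if x = 0 then fps_nth F L else f x / x ^ L) < norm (fps_nth F L) + 1) (at 0)"
    by (rule order_tendstoD) simp
  moreover have "eventually (\<lambda>x::complex. x \<noteq> 0) (at 0)" by (simp add: eventually_at_filter)
  ultimately have "eventually (\<lambda>t. norm (f t) \<le> (norm (fps_nth F L) + 1) * norm t ^ L) (at 0)"
    by eventually_elim (auto simp: norm_divide norm_power divide_simps mult.commute intro: less_imp_le)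
  then show ?thesis by blast
qed

lemma has_fps_expansion_cutoff:
  "(\<lambda>t. \<Sum>k<L. fps_nth F k * t ^ k) has_fps_expansion fps_cutoff L (F :: complex fps)"
proof -
  have "(\<lambda>t. \<Sum>k<L. fps_nth F k * t ^ k) has_fps_expansion (\<Sum>k<L. fps_const (fps_nth F k) * fps_X ^ k)"
    by (intro fps_expansion_intros)
  also have "(\<Sum>k<L. fps_const (fps_nth F k) * fps_X ^ k) = fps_cutoff L F"
    by (rule fps_ext) (simp add: fps_sum_nth if_distrib[of "\<lambda>x. _ * x"] cong: if_cong)
  finally show ?thesis .
qed

context weights
begin

lemma p_pos: "M * N - 1 > 0" and p_eq: "M * N - 1 = d * q"
  using MN_q d_pos q_pos by auto

lemma power_monomial:
  fixes X Y1 Y2 :: "'a :: comm_ring_1"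
  assumes "e = a * i + b * j + c"
  shows "X ^ e * (Y1 ^ i * Y2 ^ j) = X ^ c * ((Y1 * X ^ a) ^ i * (Y2 * X ^ b) ^ j)"
  unfolding assms by (simp add: power_add power_mult power_mult_distrib mult_ac)

text \<open>Here \<open>X\<close> is the root variable, in which \<open>\<tau>\<close> behaves like
  \<open>X^d\<close>. Once the poles are multiplied away, the monomial \<open>(i, j)\<close> keeps a
  surplus \<open>X^(d * ew i j)\<close>, which is moved into its coefficient; nothing with a
  negative exponent is left.\<close>

lemma rhs_weight:
  fixes X Y1 Y2 A B :: "'a :: comm_ring_1"
  assumes A: "Y1 * X ^ (N + 1) = A" and B: "Y2 * X ^ (M + 1) = B"
  shows "X ^ (N + 1 + d * q) * rhs1 T M N Y1 Y2 = rhs1 (\<lambda>i j. T i j * X ^ (d * ew i j)) M N A B" (is ?A)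
    and "X ^ (M + 1 + d * q) * rhs2 T M N Y1 Y2 = rhs2 (\<lambda>i j. T i j * X ^ (d * ew i j)) M N A B" (is ?B)
proof -
  have mono: "X ^ (d * (i * n + j * m + e)) * (Y1 ^ i * Y2 ^ j) = X ^ (d * e) * (A ^ i * B ^ j)" for i j e
  proof -
    have "d * (i * n + j * m + e) = (N + 1) * i + (M + 1) * j + d * e"
      unfolding Suc_N Suc_M by (simp add: algebra_simps)
    then show ?thesis unfolding A[symmetric] B[symmetric] by (rule power_monomial)
  qed
  have t1: "X ^ (N + 1 + d * q) * (of_nat j * T i j * Y1 ^ i * Y2 ^ (j - 1)) =
     of_nat j * (T i j * X ^ (d * ew i j)) * A ^ i * B ^ (j - 1)" if J: "(i, j) \<in> J" for i j
  proof (cases j)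
    case (Suc k)
    have "N + 1 + d * q = d * (n + q)" unfolding Suc_N by (simp add: algebra_simps)
    moreover have "n + q = i * n + k * m + ew i j" using J_ew[OF J] Suc K_split by simp
    ultimately have "X ^ (N + 1 + d * q) * (Y1 ^ i * Y2 ^ k) = X ^ (d * ew i j) * (A ^ i * B ^ k)"
      using mono[of i k "ew i j"] by simp
    then have "of_nat j * T i j * (X ^ (N + 1 + d * q) * (Y1 ^ i * Y2 ^ k)) = of_nat j * T i j * (X ^ (d * ew i j) * (A ^ i * B ^ k))"
      by (rule arg_cong)
    then show ?thesis unfolding Suc by (simp only: mult_ac diff_Suc_1)
  qed simp
  have t2: "X ^ (M + 1 + d * q) * (of_nat i * T i j * Y1 ^ (i - 1) * Y2 ^ j) =
     of_nat i * (T i j * X ^ (d * ew i j)) * A ^ (i - 1) * B ^ j" if J: "(i, j) \<in> J" for i j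
  proof (cases i)
    case (Suc k)
    have "M + 1 + d * q = d * (m + q)" unfolding Suc_M by (simp add: algebra_simps)
    moreover have "m + q = k * n + j * m + ew i j" using J_ew[OF J] Suc K_split by simp
    ultimately have "X ^ (M + 1 + d * q) * (Y1 ^ k * Y2 ^ j) = X ^ (d * ew i j) * (A ^ k * B ^ j)"
      using mono[of k j "ew i j"] by simp
    then have "of_nat i * T i j * (X ^ (M + 1 + d * q) * (Y1 ^ k * Y2 ^ j)) = of_nat i * T i j * (X ^ (d * ew i j) * (A ^ k * B ^ j))"
      by (rule arg_cong)
    then show ?thesis unfolding Suc by (simp only: mult_ac diff_Suc_1)
  qed simp
  show ?A unfolding rhs1_J sum_distrib_left using t1 by (intro sum.cong refl) auto
  have "X ^ (M + 1 + d * q) * (\<Sum>(i, j)\<in>J. of_nat i * T i j * Y1 ^ (i - 1) * Y2 ^ j) =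
     (\<Sum>(i, j)\<in>J. of_nat i * (T i j * X ^ (d * ew i j)) * A ^ (i - 1) * B ^ j)"
    unfolding sum_distrib_left using t2 by (intro sum.cong refl) auto
  then show ?B unfolding rhs2_J by (simp only: mult_minus_right)
qed

lemma fps_to_fls_rhs:
  "fps_to_fls (rhs1 T M N A B) = rhs1 (\<lambda>i j. fps_to_fls (T i j)) M N (fps_to_fls A) (fps_to_fls B)"
  "fps_to_fls (rhs2 T M N A B) = rhs2 (\<lambda>i j. fps_to_fls (T i j)) M N (fps_to_fls A) (fps_to_fls (B :: complex fps))"
  unfolding rhs1_J rhs2_J fps_to_fls_uminus fps_to_fls_sum
  by (simp_all only: case_prod_unfold fls_times_fps_to_fls fps_to_fls_power fps_to_fls_of_nat')

lemma rhs_dvd_diff: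
  fixes x :: "'a :: comm_ring_1"
  assumes "x dvd a - a'" "x dvd b - b'"
  shows "x dvd rhs1 T M N a b - rhs1 T M N a' b'" "x dvd rhs2 T M N a b - rhs2 T M N a' b'"
proof -
  have 1: "x dvd c * a ^ i * b ^ j - c * a' ^ i * b' ^ j" for c i j
    using assms by (intro dvd_mult_diff dvd_power_diff) auto
  show "x dvd rhs1 T M N a b - rhs1 T M N a' b'"
    unfolding rhs1_J sum_subtractf[symmetric] using 1 by (intro dvd_sum) auto
  have "x dvd (\<Sum>(i, j)\<in>J. of_nat i * T i j * a ^ (i - 1) * b ^ j) - (\<Sum>(i, j)\<in>J. of_nat i * T i j * a' ^ (i - 1) * b' ^ j)"
    unfolding sum_subtractf[symmetric] using 1 by (intro dvd_sum) auto
  then show "x dvd rhs2 T M N a b - rhs2 T M N a' b'"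
    unfolding rhs2_J by (simp only: minus_diff_minus dvd_minus_iff)
qed

text \<open>In terms of \<open>fps_X * fps_deriv\<close> the system has power series on both sides,
  so the effect of a truncation can be expressed as divisibility by a power of
  \<open>fps_X\<close>.\<close>

lemma formal_solution_fps:
  assumes "formal_solution \<alpha> M N z0 c1 c2 Y1 Y2"
  defines "T \<equiv> (\<lambda>i j. (fps_expansion (\<alpha> i j) z0 oo fps_X ^ (d * q)) * fps_X ^ (d * ew i j))"
  shows "\<exists>A B :: complex fps. fps_nth A 0 = c1 \<and> fps_nth B 0 = c2 \<and>
     fps_X * fps_deriv A = of_nat (N + 1) * A + of_nat (d * q) * rhs1 T M N A B \<and>
     fps_X * fps_deriv B = of_nat (M + 1) * B + of_nat (d * q) * rhs2 T M N A B"
proof -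
  let ?T = "\<lambda>i j. taylor_in_root (d * q) (\<alpha> i j) z0"
  have s: "\<forall>k < - int (N + 1). fls_nth Y1 k = 0" "fls_nth Y1 (- int (N + 1)) = c1"
       "\<forall>k < - int (M + 1). fls_nth Y2 k = 0" "fls_nth Y2 (- int (M + 1)) = c2"
       "fls_deriv Y1 = of_nat (d * q) * fls_X ^ (d * q - 1) * rhs1 ?T M N Y1 Y2"
       "fls_deriv Y2 = of_nat (d * q) * fls_X ^ (d * q - 1) * rhs2 ?T M N Y1 Y2"
    using assms(1) unfolding formal_solution_def p_eq Let_def by blast+
  define A where "A = Abs_fps (\<lambda>k. fls_nth Y1 (int k - int (N + 1)))"
  define B where "B = Abs_fps (\<lambda>k. fls_nth Y2 (int k - int (M + 1)))"
  have A: "Y1 * fls_X ^ (N + 1) = fps_to_fls A" unfolding A_def by (rule fls_shift_regular[OF s(1)])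
  have B: "Y2 * fls_X ^ (M + 1) = fps_to_fls B" unfolding B_def by (rule fls_shift_regular[OF s(3)])
  have TT: "(\<lambda>i j. ?T i j * fls_X ^ (d * ew i j)) = (\<lambda>i j. fps_to_fls (T i j))"
    unfolding T_def taylor_in_root_compose fls_times_fps_to_fls fps_to_fls_power by simp
  have gen: "fps_X * fps_deriv C = of_nat (Suc k) * C + of_nat (d * q) * R"
    if C: "Y * fls_X ^ Suc k = fps_to_fls C" and dY: "fls_deriv Y = of_nat (d * q) * fls_X ^ (d * q - 1) * S"
      and R: "fls_X ^ (Suc k + d * q) * S = fps_to_fls R" for Y S :: "complex fls" and C R k
  proof -
    have "fps_to_fls (fps_X * fps_deriv C) = fls_X * fls_deriv (Y * fls_X ^ Suc k)"
      unfolding C by (simp add: fls_times_fps_to_fls fls_deriv_fps_to_fls)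
    also have "\<dots> = of_nat (Suc k) * (Y * fls_X ^ Suc k) + fls_X * fls_X ^ Suc k * fls_deriv Y"
      unfolding fls_deriv_mult fls_deriv_power by (simp add: algebra_simps)
    also have "fls_X * fls_X ^ Suc k * fls_deriv Y = of_nat (d * q) * (fls_X ^ Suc (Suc k + (d * q - 1)) * S)"
      unfolding dY by (simp only: power_add power_Suc mult_ac)
    also have "Suc (Suc k + (d * q - 1)) = Suc k + d * q" using d_pos q_pos by simp
    finally have "fps_to_fls (fps_X * fps_deriv C) = fps_to_fls (of_nat (Suc k) * C + of_nat (d * q) * R)"
      unfolding C R by (simp only: fps_to_fls_plus fls_times_fps_to_fls fps_to_fls_of_nat')
    then show ?thesis by (simp only: fps_to_fls_eq_iff)
  qed
  have "fps_X * fps_deriv A = of_nat (N + 1) * A + of_nat (d * q) * rhs1 T M N A B"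
    using gen[OF A[unfolded Suc_eq_plus1[symmetric]] s(5), of "rhs1 T M N A B"] rhs_weight(1)[OF A B, of ?T]
    unfolding TT fps_to_fls_rhs by simp
  moreover have "fps_X * fps_deriv B = of_nat (M + 1) * B + of_nat (d * q) * rhs2 T M N A B"
    using gen[OF B[unfolded Suc_eq_plus1[symmetric]] s(6), of "rhs2 T M N A B"] rhs_weight(2)[OF A B, of ?T]
    unfolding TT fps_to_fls_rhs by simp
  moreover have "fps_nth A 0 = c1" "fps_nth B 0 = c2" unfolding A_def B_def using s by auto
  ultimately show ?thesis by blast
qed

end

context hamiltonian
begin

text \<open>The coefficients along \<open>z = z0 + t^(d q)\<close>, with the surplus powers of
  \<open>t\<close> absorbed.\<close>

definition atw :: "complex \<Rightarrow> complex \<Rightarrow> nat \<Rightarrow> nat \<Rightarrow> complex" where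
  "atw z0 t = (\<lambda>i j. A (z0 + t ^ (d * q)) i j * t ^ (d * ew i j))"

text \<open>Nothing is known about convergence of the formal series. A truncation is a polynomial
  and solves the system up to \<open>O(t^L)\<close>, with \<open>L\<close> at one's
  disposal.\<close>

lemma approximate_solution:
  assumes z0: "z0 \<in> U" and sol: "formal_solution \<alpha> M N z0 c1 c2 Y1 Y2" and L: "L > 0"
  shows "\<exists>fA fB C. fA holomorphic_on UNIV \<and> fB holomorphic_on UNIV \<and> fA 0 = c1 \<and> fB 0 = c2 \<and>
    eventually (\<lambda>t. norm (t * deriv fA t - of_nat (N + 1) * fA t - of_nat (d * q) * rhs1 (atw z0 t) M N (fA t) (fB t)) \<le> C * norm t ^ L \<and>
      norm (t * deriv fB t - of_nat (M + 1) * fB t - of_nat (d * q) * rhs2 (atw z0 t) M N (fA t) (fB t)) \<le> C * norm t ^ L) (at 0)"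
proof -
  define T where "T = (\<lambda>i j. (fps_expansion (\<alpha> i j) z0 oo fps_X ^ (d * q)) * fps_X ^ (d * ew i j))"
  obtain FA FB where F: "fps_nth FA 0 = c1" "fps_nth FB 0 = c2"
     "fps_X * fps_deriv FA = of_nat (N + 1) * FA + of_nat (d * q) * rhs1 T M N FA FB"
     "fps_X * fps_deriv FB = of_nat (M + 1) * FB + of_nat (d * q) * rhs2 T M N FA FB"
    using formal_solution_fps[OF sol] unfolding T_def by blast
  define GA where "GA = fps_cutoff L FA"
  define GB where "GB = fps_cutoff L FB"
  define fA where "fA t = (\<Sum>k<L. fps_nth FA k * t ^ k)" for t
  define fB where "fB t = (\<Sum>k<L. fps_nth FB k * t ^ k)" for t
  have eA: "fA has_fps_expansion GA" and eB: "fB has_fps_expansion GB"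
    unfolding fA_def[abs_def] fB_def[abs_def] GA_def GB_def by (rule has_fps_expansion_cutoff)+
  \<comment> \<open>\<open>fps_X * fps_deriv\<close> preserves divisibility by
    \<open>fps_X ^ L\<close>; the bare derivative would lose one order.\<close>
  have cut: "fps_X ^ L dvd fps_cutoff L F - F" "fps_X ^ L dvd fps_X * fps_deriv (fps_cutoff L F) - fps_X * fps_deriv F"
    for F :: "complex fps"
  proof -
    have e: "fps_cutoff L F - F = fps_X ^ L * (- fps_shift L F)"
      using fps_shift_cutoff'[of L F] by (simp add: algebra_simps)
    then show "fps_X ^ L dvd fps_cutoff L F - F" by (metis dvd_triv_left)
    have "fps_X * fps_deriv (fps_cutoff L F) - fps_X * fps_deriv F = fps_X * fps_deriv (fps_cutoff L F - F)"
      by (simp add: algebra_simps)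
    also have "\<dots> = fps_X * (fps_deriv (fps_X ^ L) * (- fps_shift L F)) + fps_X ^ L * (fps_X * fps_deriv (- fps_shift L F))"
      unfolding e by (simp add: algebra_simps)
    also have "fps_deriv (fps_X ^ L) = of_nat L * (fps_X :: complex fps) ^ (L - 1)"
      unfolding fps_deriv_power' by simp
    also have "fps_X * (of_nat L * fps_X ^ (L - 1) * (- fps_shift L F)) = fps_X ^ L * (of_nat L * (- fps_shift L F))"
      using L by (cases L) (simp_all add: algebra_simps)
    finally have "fps_X * fps_deriv (fps_cutoff L F) - fps_X * fps_deriv F =
      fps_X ^ L * (of_nat L * (- fps_shift L F) + fps_X * fps_deriv (- fps_shift L F))" by (simp only: distrib_left)
    then show "fps_X ^ L dvd fps_X * fps_deriv (fps_cutoff L F) - fps_X * fps_deriv F" by (metis dvd_triv_left)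
  qed
  have res: "fps_X ^ L dvd fps_X * fps_deriv (fps_cutoff L F) - of_nat k * fps_cutoff L F - of_nat p * R GA GB"
    if "fps_X * fps_deriv F = of_nat k * F + of_nat p * R FA FB" "fps_X ^ L dvd R GA GB - R FA FB"
    for F :: "complex fps" and k p :: nat and R :: "complex fps \<Rightarrow> complex fps \<Rightarrow> complex fps"
  proof -
    have "fps_X * fps_deriv (fps_cutoff L F) - of_nat k * fps_cutoff L F - of_nat p * R GA GB =
      (fps_X * fps_deriv (fps_cutoff L F) - fps_X * fps_deriv F) - of_nat k * (fps_cutoff L F - F) - of_nat p * (R GA GB - R FA FB)"
      unfolding that(1) by (simp add: algebra_simps)
    then show ?thesis using cut[of F] that(2) by (simp only: dvd_diff dvd_mult)
  qed
  have dGA: "fps_X ^ L dvd GA - FA" "fps_X ^ L dvd GB - FB" unfolding GA_def GB_def using cut by auto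
  have resA: "fps_X ^ L dvd fps_X * fps_deriv GA - of_nat (N + 1) * GA - of_nat (d * q) * rhs1 T M N GA GB"
    using res[where R = "rhs1 T M N", OF F(3) rhs_dvd_diff(1)[OF dGA]] unfolding GA_def .
  have resB: "fps_X ^ L dvd fps_X * fps_deriv GB - of_nat (M + 1) * GB - of_nat (d * q) * rhs2 T M N GA GB"
    using res[where R = "rhs2 T M N", OF F(4) rhs_dvd_diff(2)[OF dGA]] unfolding GB_def .
  have eT: "(\<lambda>t. atw z0 t i j) has_fps_expansion T i j" if "(i, j) \<in> J" for i j
  proof -
    have "\<alpha> i j analytic_on {z0}" using hol\<alpha>[OF that] U z0 analytic_at by blast
    then have "(\<lambda>x. \<alpha> i j (z0 + x)) has_fps_expansion fps_expansion (\<alpha> i j) z0"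
      by (rule analytic_at_imp_has_fps_expansion)
    from has_fps_expansion_compose[OF this has_fps_expansion_fps_X_power[of "d * q"]]
    have "(\<lambda>t. \<alpha> i j (z0 + t ^ (d * q))) has_fps_expansion (fps_expansion (\<alpha> i j) z0 oo fps_X ^ (d * q))"
      using d_pos q_pos by (simp add: o_def)
    then show ?thesis unfolding atw_def T_def by (intro fps_expansion_intros)
  qed
  have const: "(\<lambda>t::complex. of_nat k) has_fps_expansion of_nat k" for k
    using has_fps_expansion_const[of "of_nat k"] by (simp add: fps_of_nat)
  have eR1: "(\<lambda>t. rhs1 (atw z0 t) M N (fA t) (fB t)) has_fps_expansion rhs1 T M N GA GB"
    unfolding rhs1_J case_prod_unfold using eT
    by (intro fps_expansion_intros const eA eB) auto
  have eR2: "(\<lambda>t. rhs2 (atw z0 t) M N (fA t) (fB t)) has_fps_expansion rhs2 T M N GA GB"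
    unfolding rhs2_J case_prod_unfold using eT
    by (intro fps_expansion_intros const eA eB) auto
  have xA: "(\<lambda>t. t * deriv fA t - of_nat (N + 1) * fA t - of_nat (d * q) * rhs1 (atw z0 t) M N (fA t) (fB t))
      has_fps_expansion (fps_X * fps_deriv GA - of_nat (N + 1) * GA - of_nat (d * q) * rhs1 T M N GA GB)"
    by (intro has_fps_expansion_diff has_fps_expansion_mult has_fps_expansion_deriv has_fps_expansion_fps_X const eA eR1)
  have xB: "(\<lambda>t. t * deriv fB t - of_nat (M + 1) * fB t - of_nat (d * q) * rhs2 (atw z0 t) M N (fA t) (fB t))
      has_fps_expansion (fps_X * fps_deriv GB - of_nat (M + 1) * GB - of_nat (d * q) * rhs2 T M N GA GB)"
    by (intro has_fps_expansion_diff has_fps_expansion_mult has_fps_expansion_deriv has_fps_expansion_fps_X const eB eR2)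
  obtain C1 C2 where C1: "eventually (\<lambda>t. norm (t * deriv fA t - of_nat (N + 1) * fA t - of_nat (d * q) * rhs1 (atw z0 t) M N (fA t) (fB t)) \<le> C1 * norm t ^ L) (at 0)"
    and C2: "eventually (\<lambda>t. norm (t * deriv fB t - of_nat (M + 1) * fB t - of_nat (d * q) * rhs2 (atw z0 t) M N (fA t) (fB t)) \<le> C2 * norm t ^ L) (at 0)"
    using bounded_if_fps_X_power_dvd[OF xA resA] bounded_if_fps_X_power_dvd[OF xB resB] by blast
  have mono: "C1 * norm t ^ L \<le> max C1 C2 * norm t ^ L" "C2 * norm t ^ L \<le> max C1 C2 * norm t ^ L" for t :: complex
    by (intro mult_right_mono; simp)+
  have "eventually (\<lambda>t. norm (t * deriv fA t - of_nat (N + 1) * fA t - of_nat (d * q) * rhs1 (atw z0 t) M N (fA t) (fB t)) \<le> max C1 C2 * norm t ^ L \<and>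
      norm (t * deriv fB t - of_nat (M + 1) * fB t - of_nat (d * q) * rhs2 (atw z0 t) M N (fA t) (fB t)) \<le> max C1 C2 * norm t ^ L) (at 0)"
    using C1 C2 by eventually_elim (use mono order_trans in blast)
  moreover have "fA holomorphic_on UNIV" "fB holomorphic_on UNIV"
    unfolding fA_def[abs_def] fB_def[abs_def] by (intro holomorphic_intros)+
  moreover have "fA 0 = c1" "fB 0 = c2"
    using has_fps_expansion_imp_0_eq_fps_nth_0[OF eA] has_fps_expansion_imp_0_eq_fps_nth_0[OF eB] F L
    unfolding GA_def GB_def by auto
  ultimately show ?thesis by blast
qed

end

section \<open>The resonance condition\<close>

text \<open>\<open>W = g / t^k\<close> is meromorphic. At a pole of order \<open>e > 0\<close> the
  quantity \<open>t W'\<close> would be about \<open>- e W\<close>, which the bound forbids, as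
  \<open>lm\<close> is bounded and the error is \<open>O(t (1 + |W|))\<close>. So \<open>W\<close>
  is holomorphic, \<open>t W'\<close> tends to 0, and with it \<open>lm\<close>. A nonzero
  \<open>l0\<close> would be the coefficient of a logarithm.\<close>

lemma no_logarithm:
  fixes g D lm :: "complex \<Rightarrow> complex"
  assumes \<epsilon>: "\<epsilon> > 0" and g: "g holomorphic_on ball 0 \<epsilon>" and lm: "(lm \<longlongrightarrow> l0) (at 0)"
    and D: "\<And>t. t \<in> ball 0 \<epsilon> \<Longrightarrow> t \<noteq> 0 \<Longrightarrow> ((\<lambda>t. g t / t ^ k) has_field_derivative D t) (at t)"
    and bound: "eventually (\<lambda>t. norm (t * D t - lm t) \<le> C * norm t * (1 + norm (g t / t ^ k))) (at 0)"
  shows "l0 = 0"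
proof -
  have evb: "eventually (\<lambda>t. t \<in> ball 0 \<epsilon>) (at (0::complex))" "eventually (\<lambda>t. t \<noteq> 0) (at (0::complex))"
    using eventually_nhds_in_open[of "ball 0 \<epsilon>" "0::complex"] \<epsilon>
    by (auto simp: eventually_at_filter elim: eventually_mono)
  \<comment> \<open>\<open>e\<close> is the pole order that is still possible. For
    \<open>e > 0\<close> the identity says \<open>h 0 = 0\<close> and lowers it; for
    \<open>e = 0\<close> the convention \<open>0 ^ 0 = 1\<close> makes it say
    \<open>l0 = 0\<close>.\<close>
  have key: "of_nat e * h 0 + 0 ^ e * l0 = 0"
    if h: "h holomorphic_on ball 0 \<epsilon>" and gh: "\<And>t. t \<in> ball 0 \<epsilon> \<Longrightarrow> g t = t ^ j * h t" and e: "k = j + e" for h j e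
  proof -
    have dh: "(h has_field_derivative deriv h t) (at t)" if "t \<in> ball 0 \<epsilon>" for t
      using h that open_ball holomorphic_derivI by blast
    have Deq: "t ^ e * (t * D t) = t * deriv h t - of_nat e * h t" if t: "t \<in> ball 0 \<epsilon>" "t \<noteq> 0" for t
    proof -
      have "((\<lambda>t. h t / t ^ e) has_field_derivative (deriv h t * t ^ e - h t * (of_nat e * t ^ (e - 1))) / (t ^ e * t ^ e)) (at t)"
        using dh[OF t(1)] t(2) by (auto intro!: derivative_eq_intros)
      moreover have "eventually (\<lambda>s. g s / s ^ k = h s / s ^ e) (nhds t)"
      proof -
        have "eventually (\<lambda>s. s \<in> ball 0 \<epsilon> - {0}) (nhds t)"
          by (rule eventually_nhds_in_open) (use t in auto)
        then show ?thesis by eventually_elim (simp add: gh e power_add)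
      qed
      ultimately have "((\<lambda>t. g t / t ^ k) has_field_derivative (deriv h t * t ^ e - h t * (of_nat e * t ^ (e - 1))) / (t ^ e * t ^ e)) (at t)"
        by (simp add: DERIV_cong_ev)
      then have "D t = (deriv h t * t ^ e - h t * (of_nat e * t ^ (e - 1))) / (t ^ e * t ^ e)"
        using D[OF t] DERIV_unique by blast
      then have "t ^ e * D t = deriv h t - h t * (of_nat e * t ^ (e - 1)) / t ^ e"
        using t(2) by (simp add: field_simps)
      then have "t * (t ^ e * D t) = t * deriv h t - t * (h t * (of_nat e * t ^ (e - 1)) / t ^ e)"
        by (simp only: right_diff_distrib)
      also have "t * (h t * (of_nat e * t ^ (e - 1)) / t ^ e) = of_nat e * h t"
        using t(2) by (cases e) auto
      finally show ?thesis by (simp only: mult_ac)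
    qed
    have hc: "isCont h 0" "isCont (deriv h) 0"
      using h \<epsilon> holomorphic_deriv[OF h open_ball] holomorphic_on_imp_continuous_on continuous_on_eq_continuous_at[OF open_ball]
      by (metis centre_in_ball)+
    have l1: "((\<lambda>t. t * deriv h t - of_nat e * h t - t ^ e * lm t) \<longlongrightarrow> 0 * deriv h 0 - of_nat e * h 0 - 0 ^ e * l0) (at 0)"
      using hc lm by (intro tendsto_intros) (auto simp: isCont_def)
    have l2: "((\<lambda>t. C * norm t * (norm t ^ e + norm (h t))) \<longlongrightarrow> C * norm (0::complex) * (norm (0::complex) ^ e + norm (h 0))) (at 0)"
      using hc by (intro tendsto_intros) (auto simp: isCont_def)
    have ev: "eventually (\<lambda>t. norm (t * deriv h t - of_nat e * h t - t ^ e * lm t) \<le> C * norm t * (norm t ^ e + norm (h t))) (at 0)"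
      using bound evb
    proof eventually_elim
      case (elim t)
      have "t * deriv h t - of_nat e * h t - t ^ e * lm t = t ^ e * (t * D t - lm t)"
        using Deq[OF elim(2,3)] by (simp add: algebra_simps)
      then have "norm (t * deriv h t - of_nat e * h t - t ^ e * lm t) = norm t ^ e * norm (t * D t - lm t)"
        by (simp add: norm_mult norm_power)
      also have "\<dots> \<le> norm t ^ e * (C * norm t * (1 + norm (g t / t ^ k)))"
        using elim(1) by (intro mult_left_mono) auto
      also have "\<dots> = C * norm t * (norm t ^ e + norm t ^ e * norm (g t / t ^ k))" by (simp add: algebra_simps)
      also have "norm t ^ e * norm (g t / t ^ k) = norm (h t)"
        using elim gh[OF elim(2)] by (simp add: e power_add norm_mult norm_divide norm_power)
      finally show ?case .
    qed
    have "norm (0 * deriv h 0 - of_nat e * h 0 - 0 ^ e * l0) \<le> C * norm (0::complex) * (norm (0::complex) ^ e + norm (h 0))"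
      by (rule tendsto_le[OF _ l2 tendsto_norm[OF l1] ev]) simp
    then have "- (of_nat e * h 0 + 0 ^ e * l0) = 0" by simp
    then show ?thesis by (simp only: neg_equal_0_iff_equal)
  qed
  have "\<exists>h. h holomorphic_on ball 0 \<epsilon> \<and> (\<forall>t\<in>ball 0 \<epsilon>. g t = t ^ j * h t)" if "j \<le> k" for j
    using that
  proof (induction j)
    case 0
    then show ?case using g by (intro exI[of _ g]) auto
  next
    case (Suc j)
    then obtain h where h: "h holomorphic_on ball 0 \<epsilon>" "\<And>t. t \<in> ball 0 \<epsilon> \<Longrightarrow> g t = t ^ j * h t" by auto
    obtain e where e: "k = j + Suc e" using Suc.prems by (metis add_Suc_shift le_Suc_ex)
    have "of_nat (Suc e) * h 0 = 0" using key[OF h e] by simp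
    then have h0: "h 0 = 0" by (simp only: mult_eq_0_iff of_nat_eq_0_iff) simp
    let ?h = "\<lambda>z. if z = 0 then deriv h 0 else (h z - h 0) / (z - 0)"
    have "?h holomorphic_on ball 0 \<epsilon>" by (rule pole_lemma_open[OF h(1) open_ball])
    moreover have "g t = t ^ Suc j * ?h t" if "t \<in> ball 0 \<epsilon>" for t
      using h(2)[OF that] h0 by auto
    ultimately show ?case by blast
  qed
  then obtain h where "h holomorphic_on ball 0 \<epsilon>" "\<And>t. t \<in> ball 0 \<epsilon> \<Longrightarrow> g t = t ^ k * h t" by blast
  from key[OF this, of 0] show ?thesis by simp
qed

section \<open>The rate of change of the deviation \<open>W\<close> from a surface\<close>

lemma divide_shift:
  fixes T X Y R :: complex
  assumes "T * X = Y * R" "T \<noteq> 0" "R \<noteq> 0"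
  shows "X / (R * R) = Y / (R * T)"
proof -
  have "X * (R * T) = (T * X) * R" by (simp add: mult_ac)
  then have "X * (R * T) = Y * (R * R)" unfolding assms(1) by (simp add: mult_ac)
  then show ?thesis using assms(2,3) by (simp add: frac_eq_eq)
qed

context weights
begin

lemma scaled_coefficients:
  assumes "\<And>i j. b i j = a i j * t ^ (d * ew i j)"
  shows "hw b \<sigma> w = hw a (t ^ d * \<sigma>) w" "hi b \<sigma> w = hi a (t ^ d * \<sigma>) w"
  unfolding hw_def hi_def assms
  by (intro sum.cong refl; clarsimp simp: power_mult power_mult_distrib)+

end

context hamiltonian
begin

lemma holomorphic_A:
  assumes "Z holomorphic_on S" "\<And>s. s \<in> S \<Longrightarrow> Z s \<in> U" "(i, j) \<in> J"
  shows "(\<lambda>s. \<alpha> i j (Z s)) holomorphic_on S" "(\<lambda>s. deriv (\<alpha> i j) (Z s)) holomorphic_on S"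
  using holomorphic_on_compose_gen[OF assms(1) hol\<alpha>[OF assms(3)]] holomorphic_on_compose_gen[OF assms(1) hol\<alpha>'[OF assms(3)]] assms(2)
  by (auto simp: o_def image_subset_iff)

lemma holomorphic_sums:
  assumes Z: "Z holomorphic_on S" "\<And>s. s \<in> S \<Longrightarrow> Z s \<in> U" and T: "T holomorphic_on S" and X: "X holomorphic_on S"
  shows "(\<lambda>s. hh (A (Z s)) (T s) (X s)) holomorphic_on S" "(\<lambda>s. hw (A (Z s)) (T s) (X s)) holomorphic_on S"
    "(\<lambda>s. Dh (A (Z s)) (T s) (X s)) holomorphic_on S"
  unfolding hh_def hw_def Dh_def case_prod_unfold
  by (intro holomorphic_intros T X holomorphic_A(1)[OF Z]; simp)+

lemma holomorphic_dd_sums: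
  assumes Z: "Z holomorphic_on S" "\<And>s. s \<in> S \<Longrightarrow> Z s \<in> U" and T: "T holomorphic_on S" and X: "X holomorphic_on S"
    and Y: "Y holomorphic_on S"
  shows "(\<lambda>s. hh_dd (A (Z s)) (T s) (X s) (Y s)) holomorphic_on S" "(\<lambda>s. hw_dd (A (Z s)) (T s) (X s) (Y s)) holomorphic_on S"
    "(\<lambda>s. ht_dd (A (Z s)) (T s) (X s) (Y s)) holomorphic_on S" "(\<lambda>s. hh_dd2 (A (Z s)) (T s) (X s) (Y s)) holomorphic_on S"
    "(\<lambda>s. hh_dd (A' (Z s)) (T s) (X s) (Y s)) holomorphic_on S"
  unfolding hh_dd_def hw_dd_def ht_dd_def hh_dd2_def dd_def case_prod_unfold
  by (intro holomorphic_intros T X Y holomorphic_A[OF Z]; simp)+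

text \<open>The numerator of the derivative of \<open>W\<close> is sorted into a part made of
  differences between \<open>w\<close> and \<open>P\<close>, a multiple of \<open>Eop P\<close>, and
  multiples of the defects \<open>n \<tau>^q \<tau>' + \<tau> z' h_w\<close> and
  \<open>n \<tau>^q w' + z' Dh\<close> of the two weighted equations, which appear here written
  out.\<close>

lemma surface_deviation_algebra:
  fixes nn Tq T Z' T' X' zx zp tx tp wx wp hx hp Pz Pt Kc :: complex
  assumes "nn * Tq \<noteq> 0"
  shows "T * ((zx * Z' + tx * T' + wx * X') - (zp * Z' + tp * T' + wp * (Pz * Z' + Pt * T'))) - Kc * T' * (hx - hp)
    = T * Z' * ((zx - zp) + Pz * (wx - wp)) + T' * (nn * Tq * Pz - T * Pt * wp + (Kc * hp - T * tp))
      + ((nn * Tq * X' + Z' * (Kc * hx - T * tx)) * T * wx - (nn * Tq * T' + T * Z' * wx) * (Kc * hx - T * tx)) / (nn * Tq)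
      - Pz * (nn * Tq * T' + T * Z' * wx)"
proof -
  have "(nn * Tq * X' + Z' * (Kc * hx - T * tx)) * T * wx - (nn * Tq * T' + T * Z' * wx) * (Kc * hx - T * tx)
     = (nn * Tq) * (X' * T * wx - T' * (Kc * hx - T * tx))" by (simp add: algebra_simps)
  then have "((nn * Tq * X' + Z' * (Kc * hx - T * tx)) * T * wx - (nn * Tq * T' + T * Z' * wx) * (Kc * hx - T * tx)) / (nn * Tq)
     = X' * T * wx - T' * (Kc * hx - T * tx)" using assms by (metis nonzero_mult_div_cancel_left)
  then show ?thesis by (simp add: algebra_simps)
qed

text \<open>Along an exact solution the defects \<open>e1\<close> and \<open>e2\<close> vanish.\<close>

lemma surface_deviation_deriv:
  assumes P: "PH U P" and Z: "(Z has_field_derivative Z') (at s)" and T: "(T has_field_derivative T') (at s)"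
    and X: "(X has_field_derivative X') (at s)" and zs: "Z s \<in> U" and Ts: "T s \<noteq> 0"
    and e1: "e1 = of_nat n * T s ^ q * T' + T s * Z' * hw (A (Z s)) (T s) (X s)"
    and e2: "e2 = of_nat n * T s ^ q * X' + Z' * Dh (A (Z s)) (T s) (X s)"
  shows "((\<lambda>s. (hh (A (Z s)) (T s) (X s) - hh (A (Z s)) (T s) (P (Z s) (T s))) / T s ^ K) has_field_derivative
    (T s * Z' * ((X s - P (Z s) (T s)) * (hh_dd (A' (Z s)) (T s) (X s) (P (Z s) (T s))
         + dz P (Z s) (T s) * hw_dd (A (Z s)) (T s) (X s) (P (Z s) (T s))))
       + T' * Eop P (Z s) (T s)
       + (e2 * T s * hw (A (Z s)) (T s) (X s) - e1 * Dh (A (Z s)) (T s) (X s)) / (of_nat n * T s ^ q)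
       - dz P (Z s) (T s) * e1) / T s ^ (K + 1)) (at s)"
proof -
  let ?a = "A (Z s)" and ?P = "P (Z s) (T s)" and ?Pz = "dz P (Z s) (T s)" and ?Pt = "dt P (Z s) (T s)"
  note D1 = hh_chain[OF Z T X zs]
  note DP = PH_chain[OF U P Z T zs]
  note D2 = hh_chain[OF Z T DP zs]
  let ?F' = "(hh (A' (Z s)) (T s) (X s) * Z' + ht ?a (T s) (X s) * T' + hw ?a (T s) (X s) * X')
     - (hh (A' (Z s)) (T s) ?P * Z' + ht ?a (T s) ?P * T' + hw ?a (T s) ?P * (?Pz * Z' + ?Pt * T'))"
  have TK: "((\<lambda>s. T s ^ K) has_field_derivative of_nat K * T s ^ (K - 1) * T') (at s)"
    using T by (auto intro!: derivative_eq_intros)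
  have "((\<lambda>s. (hh (A (Z s)) (T s) (X s) - hh (A (Z s)) (T s) (P (Z s) (T s))) / T s ^ K) has_field_derivative
     (?F' * T s ^ K - (hh ?a (T s) (X s) - hh ?a (T s) ?P) * (of_nat K * T s ^ (K - 1) * T')) / (T s ^ K * T s ^ K)) (at s)"
    by (rule DERIV_divide[OF DERIV_diff[OF D1 D2] TK]) (use Ts in simp)
  also have "(?F' * T s ^ K - (hh ?a (T s) (X s) - hh ?a (T s) ?P) * (of_nat K * T s ^ (K - 1) * T')) / (T s ^ K * T s ^ K)
     = (T s * ?F' - of_nat K * T' * (hh ?a (T s) (X s) - hh ?a (T s) ?P)) / T s ^ (K + 1)"
  proof -
    have "T s * T s ^ (K - 1) = T s ^ K" using power_minus_mult[of K "T s"] K_split q_pos by (simp add: mult.commute)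
    moreover have "T s * (f * T s ^ K - h * (k * T1 * T')) = T s * f * T s ^ K - k * T' * h * (T s * T1)" for f h k T1
      by (simp add: algebra_simps)
    ultimately have "T s * (f * T s ^ K - h * (of_nat K * T s ^ (K - 1) * T')) = (T s * f - of_nat K * T' * h) * T s ^ K" for f h
      by (simp only: left_diff_distrib)
    then have "(f * T s ^ K - h * (of_nat K * T s ^ (K - 1) * T')) / (T s ^ K * T s ^ K) = (T s * f - of_nat K * T' * h) / T s ^ (K + 1)" for f h
      using Ts unfolding power_add power_one_right by (intro divide_shift) auto
    then show ?thesis .
  qed
  also have "T s * ?F' - of_nat K * T' * (hh ?a (T s) (X s) - hh ?a (T s) ?P) =
     T s * Z' * ((hh (A' (Z s)) (T s) (X s) - hh (A' (Z s)) (T s) ?P) + ?Pz * (hw ?a (T s) (X s) - hw ?a (T s) ?P))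
       + T' * Eop P (Z s) (T s)
       + (e2 * T s * hw ?a (T s) (X s) - e1 * Dh ?a (T s) (X s)) / (of_nat n * T s ^ q) - ?Pz * e1"
    unfolding Eop_def Dh_eq e1 e2 by (rule surface_deviation_algebra) (use Ts n_pos in auto)
  also have "(hh (A' (Z s)) (T s) (X s) - hh (A' (Z s)) (T s) ?P) + ?Pz * (hw ?a (T s) (X s) - hw ?a (T s) ?P) =
     (X s - ?P) * (hh_dd (A' (Z s)) (T s) (X s) ?P + ?Pz * hw_dd ?a (T s) (X s) ?P)"
    unfolding hh_diff hw_diff by (simp add: algebra_simps)
  finally show ?thesis .
qed

end

lemma isCont_bounded_at:
  fixes f :: "complex \<Rightarrow> complex"
  assumes "isCont f 0"
  shows "\<exists>C. C \<ge> 0 \<and> eventually (\<lambda>t. norm (f t) \<le> C) (at 0)"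
proof -
  have "((\<lambda>t. norm (f t)) \<longlongrightarrow> norm (f 0)) (at 0)" using assms by (intro tendsto_norm) (simp add: isCont_def)
  then have "eventually (\<lambda>t. norm (f t) < norm (f 0) + 1) (at 0)" by (rule order_tendstoD) simp
  then have "eventually (\<lambda>t. norm (f t) \<le> norm (f 0) + 1) (at 0)" by (rule eventually_mono) simp
  moreover have "norm (f 0) + 1 \<ge> 0" by (simp add: add_nonneg_nonneg)
  ultimately show ?thesis by blast
qed

lemma divide_power_Suc:
  fixes t x y s :: complex
  assumes "t * x = s * y" "s \<noteq> 0"
  shows "t * (x / s ^ (k + 1)) = y / s ^ k"
proof -
  have "t * (x / s ^ (k + 1)) = (t * x) / (s * s ^ k)" by simp
  then show ?thesis unfolding assms(1) using assms(2) by simp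
qed

lemma norm_sum3_le:
  fixes x a b c :: complex
  assumes "x = a + b + c" "norm a \<le> A" "norm b \<le> B" "norm c \<le> C"
  shows "norm x \<le> A + B + C"
  using assms norm_triangle_ineq[of a b] norm_triangle_ineq[of "a + b" c] by simp

lemma exists_nth_root:
  fixes c :: complex
  assumes "c \<noteq> 0" "n > 0"
  shows "\<exists>z. z ^ n = c"
  using assms by (intro exI[of _ "exp (Ln c / of_nat n)"]) (simp add: exp_of_nat_mult[symmetric])

context hamiltonian
begin

text \<open>With \<open>c1 = \<sigma>0^(-n)\<close> and \<open>c2 = w0 \<sigma>0^(-m)\<close> the
  condition on \<open>c2\<close> becomes \<open>\<sigma>0^q = p a / w0\<close>, because
  \<open>n M = q + m\<close>; the condition on \<open>c1\<close> then follows from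
  \<open>a + b w0^(N+1) = 0\<close>. So each root belongs to some formal solution, which is why
  these are needed for all admissible \<open>c1\<close>.\<close>

lemma leading_coefficients_exist:
  assumes w0: "hh (A z0) 0 w0 = 0" and z0: "z0 \<in> U"
  obtains \<sigma>0 where "\<sigma>0 \<noteq> 0" "w0 \<noteq> 0"
    "inverse (\<sigma>0 ^ n) ^ (M * N - 1) = - inverse (\<alpha> 0 (N + 1) z0 * \<alpha> (M + 1) 0 z0 ^ N * of_nat (M * N - 1) ^ (N + 1))"
    "w0 / \<sigma>0 ^ m = of_nat (M * N - 1) * \<alpha> (M + 1) 0 z0 * inverse (\<sigma>0 ^ n) ^ M"
proof -
  define a where "a = \<alpha> (M + 1) 0 z0"
  define b where "b = \<alpha> 0 (N + 1) z0"
  define p :: complex where "p = of_nat (M * N - 1)"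
  have ab: "a \<noteq> 0" "b \<noteq> 0" unfolding a_def b_def using lead z0 by auto
  have p: "p \<noteq> 0" unfolding p_def using p_pos by simp
  have root: "a + b * w0 ^ (N + 1) = 0" using w0 unfolding hh_zero a_def b_def .
  have w0nz: "w0 \<noteq> 0" using root ab by auto
  obtain \<sigma>0 where \<sigma>0: "\<sigma>0 ^ q = p * a / w0" using exists_nth_root[of "p * a / w0" q] q_pos p ab w0nz by auto
  have \<sigma>nz: "\<sigma>0 \<noteq> 0"
  proof
    assume "\<sigma>0 = 0"
    then have "p * a / w0 = 0" using \<sigma>0 q_pos by (simp add: zero_power)
    then show False using p ab w0nz by simp
  qed
  have "inverse (\<sigma>0 ^ n) ^ (M * N - 1) = inverse ((\<sigma>0 ^ q) ^ (N + 1))"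
    unfolding MN_q Suc_N power_inverse power_mult[symmetric] by (simp only: mult_ac)
  also have "(\<sigma>0 ^ q) ^ (N + 1) = p ^ (N + 1) * a ^ (N + 1) / w0 ^ (N + 1)"
    unfolding \<sigma>0 by (simp add: power_divide power_mult_distrib)
  also have "\<dots> = - (b * a ^ N * p ^ (N + 1))"
  proof -
    have "a = - (b * w0 ^ (N + 1))" using root by (simp add: eq_neg_iff_add_eq_0)
    then have "p ^ (N + 1) * a ^ (N + 1) = - (b * a ^ N * p ^ (N + 1)) * w0 ^ (N + 1)"
      by (metis (no_types, lifting) mult.assoc mult.commute mult_minus_left power_Suc Suc_eq_plus1)
    then show ?thesis using w0nz by (simp add: field_simps)
  qed
  finally have 1: "inverse (\<sigma>0 ^ n) ^ (M * N - 1) = - inverse (b * a ^ N * p ^ (N + 1))" by simp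
  have nM: "n * M = q + m" using K_eq K_split by simp
  have "inverse (\<sigma>0 ^ n) ^ M = inverse (\<sigma>0 ^ q * \<sigma>0 ^ m)"
    unfolding power_inverse power_mult[symmetric] nM power_add ..
  then have 2: "w0 / \<sigma>0 ^ m = p * a * inverse (\<sigma>0 ^ n) ^ M"
    unfolding \<sigma>0 using p ab w0nz \<sigma>nz by (simp add: field_simps)
  show ?thesis by (rule that[OF \<sigma>nz w0nz 1[unfolded a_def b_def p_def] 2[unfolded a_def b_def p_def]])
qed

lemma hh_dd_zero: "hh_dd a 0 w w = hw a 0 w"
  unfolding hh_dd_def hw_zero J_sum_zero dd_same by (simp add: dd_def)

text \<open>Along a truncated formal solution \<open>t W'\<close> is \<open>lm\<close> up to
  \<open>O(t (1 + |W|))\<close>, and \<open>lm 0\<close> is a nonzero multiple of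
  \<open>r z0 0\<close>. As \<open>W\<close> is meromorphic in \<open>t\<close>,
  \<open>no_logarithm\<close> makes \<open>lm 0\<close> vanish.\<close>

lemma resonance_vanishes:
  assumes z0: "z0 \<in> U" and P: "PH U P" and r: "PH U r" and E: "\<And>z \<tau>. z \<in> U \<Longrightarrow> Eop P z \<tau> = \<tau> ^ K * r z \<tau>"
    and w0: "hh (A z0) 0 (P z0 0) = 0"
    and formal: "\<And>c1 c2. c1 ^ (M * N - 1) = - inverse (\<alpha> 0 (N + 1) z0 * \<alpha> (M + 1) 0 z0 ^ N * of_nat (M * N - 1) ^ (N + 1)) \<Longrightarrow>
        c2 = of_nat (M * N - 1) * \<alpha> (M + 1) 0 z0 * c1 ^ M \<Longrightarrow> \<exists>Y1 Y2. formal_solution \<alpha> M N z0 c1 c2 Y1 Y2"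
  shows "r z0 0 = 0"
proof -
  define w0 where "w0 = P z0 0"
  obtain \<sigma>0 where \<sigma>0: "\<sigma>0 \<noteq> 0" "w0 \<noteq> 0"
    "inverse (\<sigma>0 ^ n) ^ (M * N - 1) = - inverse (\<alpha> 0 (N + 1) z0 * \<alpha> (M + 1) 0 z0 ^ N * of_nat (M * N - 1) ^ (N + 1))"
    "w0 / \<sigma>0 ^ m = of_nat (M * N - 1) * \<alpha> (M + 1) 0 z0 * inverse (\<sigma>0 ^ n) ^ M"
    using leading_coefficients_exist[OF w0[folded w0_def] z0] by metis
  obtain Y1 Y2 where Y: "formal_solution \<alpha> M N z0 (inverse (\<sigma>0 ^ n)) (w0 / \<sigma>0 ^ m) Y1 Y2"
    using formal[OF \<sigma>0(3,4)] by blast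
  define p :: complex where "p = of_nat (d * q)"
  \<comment> \<open>\<open>W\<close> contains a division by \<open>S t ^ K\<close>, of order
    \<open>t^(d K)\<close>; the one extra order turns the contribution of the residuals into
    \<open>O(t)\<close>.\<close>
  define L where "L = d * K + 1"
  obtain fA fB C where f: "fA holomorphic_on UNIV" "fB holomorphic_on UNIV" "fA 0 = inverse (\<sigma>0 ^ n)" "fB 0 = w0 / \<sigma>0 ^ m"
    and resid: "eventually (\<lambda>t. norm (t * deriv fA t - of_nat (N + 1) * fA t - p * rhs1 (atw z0 t) M N (fA t) (fB t)) \<le> C * norm t ^ L \<and>
      norm (t * deriv fB t - of_nat (M + 1) * fB t - p * rhs2 (atw z0 t) M N (fA t) (fB t)) \<le> C * norm t ^ L) (at 0)"
    using approximate_solution[OF z0 Y, of L] unfolding L_def p_def by auto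
  define r1 where "r1 t = t * deriv fA t - of_nat (N + 1) * fA t - p * rhs1 (atw z0 t) M N (fA t) (fB t)" for t
  define r2 where "r2 t = t * deriv fB t - of_nat (M + 1) * fB t - p * rhs2 (atw z0 t) M N (fA t) (fB t)" for t
  define Z where "Z t = z0 + t ^ (d * q)" for t
  have dq: "d * q > 0" using d_pos q_pos by simp
  have Z0: "Z 0 = z0" unfolding Z_def using dq by simp
  have cfA: "continuous_on UNIV fA" and cZ: "continuous_on UNIV Z"
    using holomorphic_on_imp_continuous_on[OF f(1)] unfolding Z_def[abs_def] by (auto intro!: continuous_intros)
  have "open (Z -` U \<inter> (\<lambda>t. fA t * \<sigma>0 ^ n) -` (- \<real>\<^sub>\<le>\<^sub>0))"
    by (intro open_Int open_vimage U) (auto simp: open_Compl intro!: continuous_intros cfA cZ)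
  moreover have "0 \<in> Z -` U \<inter> (\<lambda>t. fA t * \<sigma>0 ^ n) -` (- \<real>\<^sub>\<le>\<^sub>0)" using z0 Z0 \<sigma>0(1) f(3) by simp
  ultimately obtain \<epsilon> where \<epsilon>: "\<epsilon> > 0" "ball 0 \<epsilon> \<subseteq> Z -` U \<inter> (\<lambda>t. fA t * \<sigma>0 ^ n) -` (- \<real>\<^sub>\<le>\<^sub>0)"
    using open_contains_ball by blast
  let ?B = "ball (0::complex) \<epsilon>"
  have ZU: "Z t \<in> U" and slit: "fA t * \<sigma>0 ^ n \<notin> \<real>\<^sub>\<le>\<^sub>0" if "t \<in> ?B" for t using \<epsilon>(2) that by auto
  \<comment> \<open>As \<open>y1\<close> is \<open>fA t\<close> divided by \<open>t^(d n)\<close>,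
    the matching branch of \<open>\<tau>\<close> is \<open>t^d \<sigma>\<close> with
    \<open>\<sigma>^n fA = 1\<close>. The slit keeps the logarithm holomorphic, and it vanishes at
    \<open>t = 0\<close>, so that \<open>\<sigma> 0 = \<sigma>0\<close>.\<close>
  define \<sigma> where "\<sigma> t = \<sigma>0 * exp (- (Ln (fA t * \<sigma>0 ^ n) / of_nat n))" for t
  have nn: "of_nat n \<noteq> (0::complex)" using n_pos by simp
  have fAnz: "fA t \<noteq> 0" if "t \<in> ?B" for t using slit[OF that] by auto
  have \<sigma>A: "\<sigma> t ^ n * fA t = 1" if t: "t \<in> ?B" for t
  proof -
    have "\<sigma> t ^ n = \<sigma>0 ^ n * exp (of_nat n * (- (Ln (fA t * \<sigma>0 ^ n) / of_nat n)))"
      unfolding \<sigma>_def power_mult_distrib exp_of_nat_mult by simp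
    also have "of_nat n * (- (Ln (fA t * \<sigma>0 ^ n) / of_nat n)) = - Ln (fA t * \<sigma>0 ^ n)" using nn by simp
    also have "exp (- Ln (fA t * \<sigma>0 ^ n)) = inverse (fA t * \<sigma>0 ^ n)"
      using fAnz[OF t] \<sigma>0(1) by (simp add: exp_minus)
    finally show ?thesis using fAnz[OF t] \<sigma>0(1) by (simp add: field_simps)
  qed
  have \<sigma>_0: "\<sigma> 0 = \<sigma>0" unfolding \<sigma>_def f(3) using \<sigma>0(1) by simp
  have \<sigma>nz: "\<sigma> t \<noteq> 0" for t unfolding \<sigma>_def using \<sigma>0(1) by simp
  have h\<sigma>: "\<sigma> holomorphic_on ?B" unfolding \<sigma>_def[abs_def]
    by (intro holomorphic_intros holomorphic_on_subset[OF f(1)]) (use slit nn in auto)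
  have hZ: "Z holomorphic_on ?B" unfolding Z_def[abs_def] by (intro holomorphic_intros)
  have hfA: "fA holomorphic_on ?B" and hfB: "fB holomorphic_on ?B" using f holomorphic_on_subset by blast+
  define S where "S t = t ^ d * \<sigma> t" for t
  define w where "w t = fB t * \<sigma> t ^ m" for t
  have hS: "S holomorphic_on ?B" unfolding S_def[abs_def] by (intro holomorphic_intros h\<sigma>)
  have hw': "w holomorphic_on ?B" unfolding w_def[abs_def] by (intro holomorphic_intros h\<sigma> hfB)
  have hP: "(\<lambda>t. P (Z t) (S t)) holomorphic_on ?B" by (rule PH_holomorphic[OF U P open_ball hZ hS ZU])
  have hr: "(\<lambda>t. r (Z t) (S t)) holomorphic_on ?B" by (rule PH_holomorphic[OF U r open_ball hZ hS ZU])
  have hPz: "(\<lambda>t. dz P (Z t) (S t)) holomorphic_on ?B" by (rule PH_holomorphic[OF U PH_dz[OF U P] open_ball hZ hS ZU])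
  have S0: "S 0 = 0" "w 0 = w0" unfolding S_def w_def \<sigma>_0 f(4) using d_pos \<sigma>0(1) by auto
  define Q where "Q t = P (Z t) (S t)" for t
  have Q0: "Q 0 = w0" unfolding Q_def Z0 S0 w0_def ..
  define HD where "HD t = hh_dd (A (Z t)) (S t) (w t) (Q t)" for t
  define b1 where "b1 t = hh_dd (A' (Z t)) (S t) (w t) (Q t) + dz P (Z t) (S t) * hw_dd (A (Z t)) (S t) (w t) (Q t)" for t
  define HW where "HW t = hw (A (Z t)) (S t) (w t)" for t
  define DH where "DH t = Dh (A (Z t)) (S t) (w t)" for t
  have hQ: "Q holomorphic_on ?B" unfolding Q_def[abs_def] by (rule hP)
  have hHD: "HD holomorphic_on ?B" unfolding HD_def[abs_def] by (rule holomorphic_dd_sums(1)[OF hZ ZU hS hw' hQ])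
  have hb1: "b1 holomorphic_on ?B" unfolding b1_def[abs_def]
    by (rule holomorphic_on_add[OF holomorphic_dd_sums(5)[OF hZ ZU hS hw' hQ]
          holomorphic_on_mult[OF hPz holomorphic_dd_sums(2)[OF hZ ZU hS hw' hQ]]])
  have hHW: "HW holomorphic_on ?B" unfolding HW_def[abs_def] by (rule holomorphic_sums(2)[OF hZ ZU hS hw'])
  have hDH: "DH holomorphic_on ?B" unfolding DH_def[abs_def] by (rule holomorphic_sums(3)[OF hZ ZU hS hw'])
  have HD0: "HD 0 \<noteq> 0" and HW0: "HW 0 = HD 0"
  proof -
    show "HW 0 = HD 0" unfolding HW_def HD_def Z0 S0 Q0 hh_dd_zero ..
    have "HW 0 = of_nat (N + 1) * \<alpha> 0 (N + 1) z0 * w0 ^ N" unfolding HW_def Z0 S0 hw_zero ..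
    moreover have "of_nat (N + 1) * \<alpha> 0 (N + 1) z0 * w0 ^ N \<noteq> 0"
      using lead(2)[OF z0] \<sigma>0(2) by (simp del: of_nat_Suc of_nat_add)
    ultimately show "HD 0 \<noteq> 0" using \<open>HW 0 = HD 0\<close> by simp
  qed
  have cont: "isCont h 0" if "h holomorphic_on ?B" for h
    using that \<epsilon>(1) holomorphic_on_imp_continuous_on continuous_on_eq_continuous_at[OF open_ball] by (metis centre_in_ball)
  \<comment> \<open>\<open>g\<close> is \<open>t^(d K) W\<close>: dividing by
    \<open>\<sigma> t ^ K\<close> instead of \<open>S t ^ K\<close> keeps it holomorphic at
    0.\<close>
  define g where "g t = (hh (A (Z t)) (S t) (w t) - hh (A (Z t)) (S t) (Q t)) / \<sigma> t ^ K" for t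
  have hg: "g holomorphic_on ?B" unfolding g_def[abs_def]
    by (rule holomorphic_on_divide[OF holomorphic_on_diff[OF holomorphic_sums(1)[OF hZ ZU hS hw'] holomorphic_sums(1)[OF hZ ZU hS hQ]]
          holomorphic_on_power[OF h\<sigma>]]) (simp_all add: \<sigma>nz)
  have gS: "g t / t ^ (d * K) = (hh (A (Z t)) (S t) (w t) - hh (A (Z t)) (S t) (Q t)) / S t ^ K" for t
    unfolding g_def S_def power_mult power_mult_distrib by (simp add: mult.commute)
  \<comment> \<open>\<open>E1\<close> and \<open>E2\<close> collect what multiplies the residuals
    \<open>r1\<close> and \<open>r2\<close> in the derivative of \<open>W\<close>; of them only
    boundedness at 0 is used. \<open>lm\<close> is the contribution of \<open>Eop P\<close> with
    \<open>d\<tau>/dt\<close> replaced by its residual-free part.\<close>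
  define E1 where "E1 t = - (\<sigma> t ^ n * r (Z t) (S t) * S t ^ K) / of_nat n
      - of_nat m * w t * \<sigma> t ^ n * HW t / of_nat n + \<sigma> t ^ n * DH t / of_nat n + dz P (Z t) (S t) * S t ^ q * \<sigma> t ^ n" for t
  define E2 where "E2 t = \<sigma> t ^ m * HW t" for t
  define lm where "lm t = - (p / of_nat n) * (HW t / \<sigma> t ^ q) * r (Z t) (S t)" for t
  define D where "D t = (p * t ^ (d * q) * (g t / t ^ (d * K)) * (b1 t / HD t) + lm t + (E1 t * r1 t + E2 t * r2 t) / S t ^ K) / t" for t
  have "(HD \<longlongrightarrow> HD 0) (nhds 0)" using cont[OF hHD] by (simp add: isCont_def tendsto_at_iff_tendsto_nhds)
  then have "eventually (\<lambda>t. HD t \<noteq> 0) (nhds 0)" using HD0 by (rule tendsto_imp_eventually_ne)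
  then obtain e0 where e0: "e0 > 0" "\<And>t. dist t 0 < e0 \<Longrightarrow> HD t \<noteq> 0" unfolding eventually_nhds_metric by blast
  define \<epsilon>' where "\<epsilon>' = min e0 \<epsilon>"
  have \<epsilon>': "\<epsilon>' > 0" "\<epsilon>' \<le> \<epsilon>" "\<And>t. t \<in> ball 0 \<epsilon>' \<Longrightarrow> HD t \<noteq> 0"
    using e0 \<epsilon>(1) unfolding \<epsilon>'_def by auto
  have deriv: "((\<lambda>t. g t / t ^ (d * K)) has_field_derivative D t) (at t)" if t: "t \<in> ball 0 \<epsilon>'" "t \<noteq> 0" for t
  proof -
    have tB: "t \<in> ?B" using t \<epsilon>' by auto
    have dA: "(fA has_field_derivative deriv fA t) (at t)" and dB: "(fB has_field_derivative deriv fB t) (at t)"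
      using f(1,2) holomorphic_derivI[OF _ open_UNIV] by blast+
    define s1 where "s1 = - (\<sigma> t * deriv fA t * \<sigma> t ^ n / of_nat n)"
    have ds: "(\<sigma> has_field_derivative s1) (at t)"
    proof -
      have "(\<sigma> has_field_derivative \<sigma>0 * (exp (- (Ln (fA t * \<sigma>0 ^ n) / of_nat n)) * - ((deriv fA t * \<sigma>0 ^ n) / (fA t * \<sigma>0 ^ n) / of_nat n))) (at t)"
        unfolding \<sigma>_def[abs_def] using dA slit[OF tB] nn fAnz[OF tB] \<sigma>0(1)
        by (auto intro!: derivative_eq_intros simp: field_simps)
      moreover have "\<sigma>0 * (exp (- (Ln (fA t * \<sigma>0 ^ n) / of_nat n)) * - ((deriv fA t * \<sigma>0 ^ n) / (fA t * \<sigma>0 ^ n) / of_nat n)) = s1"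
      proof -
        have "(deriv fA t * \<sigma>0 ^ n) / (fA t * \<sigma>0 ^ n) = deriv fA t * \<sigma> t ^ n"
          using \<sigma>A[OF tB] fAnz[OF tB] \<sigma>0(1) by (simp add: field_simps)
        then show ?thesis unfolding s1_def \<sigma>_def by simp
      qed
      ultimately show ?thesis by simp
    qed
    have Snz: "S t \<noteq> 0" unfolding S_def using t(2) \<sigma>nz by simp
    define S1 where "S1 = of_nat d * t ^ (d - 1) * \<sigma> t + t ^ d * s1"
    define w1 where "w1 = deriv fB t * \<sigma> t ^ m + fB t * (of_nat m * \<sigma> t ^ (m - 1) * s1)"
    define Z1 where "Z1 = p * t ^ (d * q - 1)"
    have dS: "(S has_field_derivative S1) (at t)" unfolding S_def[abs_def] S1_def
      using ds by (auto intro!: derivative_eq_intros)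
    have dw: "(w has_field_derivative w1) (at t)" unfolding w_def[abs_def] w1_def
      using ds dB by (auto intro!: derivative_eq_intros simp: mult_ac)
    have dZ: "(Z has_field_derivative Z1) (at t)" unfolding Z_def[abs_def] Z1_def p_def
      by (auto intro!: derivative_eq_intros)
    have tZ1: "t * Z1 = p * t ^ (d * q)" unfolding Z1_def using dq by (cases "d * q") auto
    have tS1: "of_nat n * (t * S1) = - (S t * \<sigma> t ^ n * (p * rhs1 (atw z0 t) M N (fA t) (fB t) + r1 t))"
    proof -
      have "t * (of_nat d * t ^ (d - 1) * \<sigma> t) = of_nat d * S t" unfolding S_def using d_pos by (cases d) auto
      then have "of_nat n * (t * S1) = of_nat n * of_nat d * S t - S t * \<sigma> t ^ n * (t * deriv fA t)"
        unfolding S1_def s1_def S_def using nn by (simp add: algebra_simps)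
      also have "of_nat n * of_nat d * S t = S t * \<sigma> t ^ n * (of_nat (N + 1) * fA t)"
        using \<sigma>A[OF tB] Suc_N by (simp add: mult_ac)
      finally show ?thesis unfolding r1_def by (simp add: algebra_simps)
    qed
    have K_m: "K - m = q + n" "K - n = q + m" using K_split by auto
    have sc: "hw (atw z0 t) (\<sigma> t) (w t) = HW t" "hi (atw z0 t) (\<sigma> t) (w t) = hi (A (Z t)) (S t) (w t)"
      using scaled_coefficients[of "atw z0 t" "A (Z t)" t "\<sigma> t" "w t"] unfolding atw_def Z_def HW_def S_def by auto
    have R1: "\<sigma> t ^ q * \<sigma> t ^ n * rhs1 (atw z0 t) M N (fA t) (fB t) = HW t"
      using rhs1_hw[OF \<sigma>A[OF tB] w_def, of "atw z0 t"] unfolding K_m sc power_add .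
    have R2: "\<sigma> t ^ q * \<sigma> t ^ m * rhs2 (atw z0 t) M N (fA t) (fB t) = - hi (A (Z t)) (S t) (w t)"
      using rhs2_hi[OF \<sigma>A[OF tB] w_def, of "atw z0 t"] unfolding K_m sc power_add .
    have Sq: "S t ^ q = t ^ (d * q) * \<sigma> t ^ q" unfolding S_def by (simp add: power_mult_distrib power_mult)
    have DHeq: "DH t = of_nat n * hi (A (Z t)) (S t) (w t) + of_nat m * (w t * HW t)"
      unfolding DH_def HW_def by (rule Dh_eq_hi)
    \<comment> \<open>The defects of the weighted equations in the parameter \<open>t\<close>. By
      \<open>te1\<close> and \<open>te2\<close> they are combinations of \<open>r1\<close> and
      \<open>r2\<close>, with a factor \<open>S t ^ q\<close> that cancels the denominator
      below.\<close>
    define e1 where "e1 = of_nat n * S t ^ q * S1 + S t * Z1 * HW t"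
    define e2 where "e2 = of_nat n * S t ^ q * w1 + Z1 * DH t"
    have te1: "t * e1 = - (S t ^ q * S t * \<sigma> t ^ n * r1 t)"
    proof -
      have "t * e1 = S t ^ q * (of_nat n * (t * S1)) + S t * (t * Z1) * HW t" unfolding e1_def by (simp add: algebra_simps)
      also have "\<dots> = - (S t ^ q * S t * \<sigma> t ^ n * r1 t)
         - t ^ (d * q) * S t * p * (\<sigma> t ^ q * \<sigma> t ^ n * rhs1 (atw z0 t) M N (fA t) (fB t)) + S t * (p * t ^ (d * q)) * HW t"
        unfolding tS1 tZ1 Sq by (simp add: algebra_simps)
      finally show ?thesis unfolding R1 by simp
    qed
    have tw1: "of_nat n * (t * w1) = p * (of_nat n * \<sigma> t ^ m * rhs2 (atw z0 t) M N (fA t) (fB t)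
         - of_nat m * w t * \<sigma> t ^ n * rhs1 (atw z0 t) M N (fA t) (fB t)) + of_nat n * \<sigma> t ^ m * r2 t - of_nat m * w t * \<sigma> t ^ n * r1 t"
    proof -
      have "fB t * (of_nat m * \<sigma> t ^ (m - 1) * \<sigma> t) = of_nat m * w t" unfolding w_def using m_pos by (cases m) auto
      then have e: "of_nat n * (fB t * (of_nat m * \<sigma> t ^ (m - 1) * s1)) = - (of_nat m * w t * deriv fA t * \<sigma> t ^ n)"
        unfolding s1_def using nn by (simp add: algebra_simps) (metis mult.assoc mult.commute)
      have "of_nat n * (t * w1) = of_nat n * \<sigma> t ^ m * (t * deriv fB t) + t * (of_nat n * (fB t * (of_nat m * \<sigma> t ^ (m - 1) * s1)))"
        unfolding w1_def by (simp add: algebra_simps)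
      also have "\<dots> = of_nat n * \<sigma> t ^ m * (t * deriv fB t) - of_nat m * w t * \<sigma> t ^ n * (t * deriv fA t)"
        unfolding e by (simp add: algebra_simps)
      also have "t * deriv fB t = of_nat (M + 1) * fB t + p * rhs2 (atw z0 t) M N (fA t) (fB t) + r2 t" unfolding r2_def by simp
      also have "t * deriv fA t = of_nat (N + 1) * fA t + p * rhs1 (atw z0 t) M N (fA t) (fB t) + r1 t" unfolding r1_def by simp
      finally have "of_nat n * (t * w1) = of_nat n * of_nat (M + 1) * w t - of_nat m * of_nat (N + 1) * w t * (\<sigma> t ^ n * fA t)
         + p * (of_nat n * \<sigma> t ^ m * rhs2 (atw z0 t) M N (fA t) (fB t)
         - of_nat m * w t * \<sigma> t ^ n * rhs1 (atw z0 t) M N (fA t) (fB t)) + of_nat n * \<sigma> t ^ m * r2 t - of_nat m * w t * \<sigma> t ^ n * r1 t"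
        unfolding w_def by (simp add: algebra_simps)
      \<comment> \<open>Both products equal \<open>K\<close>, so the linear terms
        \<open>(M + 1) fB\<close> and \<open>(N + 1) fA\<close> drop out of the equation for
        \<open>w\<close>.\<close>
      moreover have "of_nat n * of_nat (M + 1) = (of_nat m * of_nat (N + 1) :: complex)"
        using K_eq K_eq' by (metis of_nat_mult)
      ultimately show ?thesis using \<sigma>A[OF tB] by simp
    qed
    have te2: "t * e2 = S t ^ q * (of_nat n * \<sigma> t ^ m * r2 t - of_nat m * w t * \<sigma> t ^ n * r1 t)"
    proof -
      have "t * e2 = S t ^ q * (of_nat n * (t * w1)) + (t * Z1) * DH t" unfolding e2_def by (simp add: algebra_simps)
      also have "\<dots> = S t ^ q * (of_nat n * \<sigma> t ^ m * r2 t - of_nat m * w t * \<sigma> t ^ n * r1 t)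
         + t ^ (d * q) * p * (of_nat n * (\<sigma> t ^ q * \<sigma> t ^ m * rhs2 (atw z0 t) M N (fA t) (fB t))
           - of_nat m * w t * (\<sigma> t ^ q * \<sigma> t ^ n * rhs1 (atw z0 t) M N (fA t) (fB t))) + (p * t ^ (d * q)) * DH t"
        unfolding tw1 tZ1 Sq by (simp add: algebra_simps)
      finally show ?thesis unfolding R1 R2 DHeq by (simp add: algebra_simps)
    qed
    have "((\<lambda>t. g t / t ^ (d * K)) has_field_derivative
      (S t * Z1 * ((w t - Q t) * b1 t) + S1 * Eop P (Z t) (S t)
       + (e2 * S t * HW t - e1 * DH t) / (of_nat n * S t ^ q) - dz P (Z t) (S t) * e1) / S t ^ (K + 1)) (at t)"
      unfolding gS unfolding Q_def b1_def HW_def DH_def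
      by (rule surface_deviation_deriv[OF P dZ dS dw ZU[OF tB] Snz]) (simp_all add: e1_def e2_def HW_def DH_def)
    moreover have "(S t * Z1 * ((w t - Q t) * b1 t) + S1 * Eop P (Z t) (S t)
       + (e2 * S t * HW t - e1 * DH t) / (of_nat n * S t ^ q) - dz P (Z t) (S t) * e1) / S t ^ (K + 1) = D t"
    proof -
      have HDnz: "HD t \<noteq> 0" using \<epsilon>'(3) t by simp
      \<comment> \<open>The root is simple, so \<open>HD t\<close> is nonzero and
        \<open>(w - P) / \<tau>^K\<close> can be expressed through \<open>W\<close>.\<close>
      have del: "(w t - Q t) / S t ^ K = (g t / t ^ (d * K)) / HD t"
        unfolding gS hh_diff HD_def[symmetric] using HDnz by simp
      have EE: "Eop P (Z t) (S t) = S t ^ K * r (Z t) (S t)" by (rule E[OF ZU[OF tB]])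
      let ?num = "S t * Z1 * ((w t - Q t) * b1 t) + S1 * Eop P (Z t) (S t)
         + (e2 * S t * HW t - e1 * DH t) / (of_nat n * S t ^ q) - dz P (Z t) (S t) * e1"
      have "t * ?num = S t * (t * Z1) * ((w t - Q t) * b1 t) + (of_nat n * (t * S1)) / of_nat n * (S t ^ K * r (Z t) (S t))
         + ((t * e2) * S t * HW t - (t * e1) * DH t) / (of_nat n * S t ^ q) - dz P (Z t) (S t) * (t * e1)"
        unfolding EE using nn by (simp add: algebra_simps add_divide_distrib diff_divide_distrib)
      also have "((t * e2) * S t * HW t - (t * e1) * DH t) / (of_nat n * S t ^ q) =
         S t * ((of_nat n * \<sigma> t ^ m * r2 t - of_nat m * w t * \<sigma> t ^ n * r1 t) * HW t + \<sigma> t ^ n * r1 t * DH t) / of_nat n"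
        unfolding te1 te2 using Snz nn by (simp add: field_simps)
      also have "S t * (t * Z1) * ((w t - Q t) * b1 t) + (of_nat n * (t * S1)) / of_nat n * (S t ^ K * r (Z t) (S t))
         + S t * ((of_nat n * \<sigma> t ^ m * r2 t - of_nat m * w t * \<sigma> t ^ n * r1 t) * HW t + \<sigma> t ^ n * r1 t * DH t) / of_nat n
         - dz P (Z t) (S t) * (t * e1)
         = S t * (p * t ^ (d * q) * ((w t - Q t) * b1 t) + - (p / of_nat n) * (\<sigma> t ^ n * rhs1 (atw z0 t) M N (fA t) (fB t)) * r (Z t) (S t) * S t ^ K
           + (E1 t * r1 t + E2 t * r2 t))"
        unfolding tS1 tZ1 te1 E1_def E2_def using nn by (simp add: field_simps)
      also have "\<sigma> t ^ n * rhs1 (atw z0 t) M N (fA t) (fB t) = HW t / \<sigma> t ^ q"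
        using R1 \<sigma>nz[of t] by (simp add: field_simps)
      finally have "t * ?num = S t * (p * t ^ (d * q) * ((w t - Q t) * b1 t) + lm t * S t ^ K + (E1 t * r1 t + E2 t * r2 t))"
        unfolding lm_def .
      from divide_power_Suc[OF this Snz, of K]
      have "t * (?num / S t ^ (K + 1)) = (p * t ^ (d * q) * ((w t - Q t) * b1 t) + lm t * S t ^ K + (E1 t * r1 t + E2 t * r2 t)) / S t ^ K" .
      also have "\<dots> = p * t ^ (d * q) * ((w t - Q t) / S t ^ K) * b1 t + lm t + (E1 t * r1 t + E2 t * r2 t) / S t ^ K"
        using Snz by (simp add: field_simps)
      also have "\<dots> = t * D t" unfolding del D_def using t(2) by simp
      finally show ?thesis using t(2) by (simp only: mult_cancel_left) blast
    qed
    ultimately show ?thesis by simp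
  qed
  have hE1: "E1 holomorphic_on ?B" and hE2: "E2 holomorphic_on ?B" and hlm: "lm holomorphic_on ?B"
    unfolding E1_def[abs_def] E2_def[abs_def] lm_def[abs_def]
    by (intro holomorphic_intros h\<sigma> hr hS hw' hHW hDH hPz; simp add: nn \<sigma>nz)+
  have lim: "(lm \<longlongrightarrow> lm 0) (at 0)" using cont[OF hlm] by (simp add: isCont_def)
  have "isCont (\<lambda>t. b1 t / HD t) 0" using cont[OF hb1] cont[OF hHD] HD0 by (intro continuous_intros)
  then obtain C1 where C1: "C1 \<ge> 0" "eventually (\<lambda>t. norm (b1 t / HD t) \<le> C1) (at 0)" using isCont_bounded_at by blast
  have "isCont (\<lambda>t. E1 t / \<sigma> t ^ K) 0" "isCont (\<lambda>t. E2 t / \<sigma> t ^ K) 0"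
    using cont[OF hE1] cont[OF hE2] cont[OF h\<sigma>] \<sigma>nz by (intro continuous_intros; simp)+
  then obtain C2 C3 where C2: "C2 \<ge> 0" "eventually (\<lambda>t. norm (E1 t / \<sigma> t ^ K) \<le> C2) (at 0)"
     and C3: "C3 \<ge> 0" "eventually (\<lambda>t. norm (E2 t / \<sigma> t ^ K) \<le> C3) (at 0)" using isCont_bounded_at by meson
  have ev1: "eventually (\<lambda>t::complex. norm t \<le> 1 \<and> t \<noteq> 0) (at 0)"
    unfolding eventually_at by (intro exI[of _ 1]) auto
  have bound: "eventually (\<lambda>t. norm (t * D t - lm t) \<le> (norm p * C1 + (C2 + C3) * \<bar>C\<bar>) * norm t * (1 + norm (g t / t ^ (d * K)))) (at 0)"
    using C1(2) C2(2) C3(2) ev1 resid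
  proof eventually_elim
    case (elim t)
    have r12: "norm (r1 t) \<le> \<bar>C\<bar> * norm t ^ L" "norm (r2 t) \<le> \<bar>C\<bar> * norm t ^ L"
    proof -
      have "C * norm t ^ L \<le> \<bar>C\<bar> * norm t ^ L" by (intro mult_right_mono) auto
      then show "norm (r1 t) \<le> \<bar>C\<bar> * norm t ^ L" "norm (r2 t) \<le> \<bar>C\<bar> * norm t ^ L" using elim(5) unfolding r1_def r2_def by linarith+
    qed
    have "norm t ^ (d * q) \<le> norm t ^ 1" using elim dq by (intro power_decreasing) auto
    then have tq: "norm t ^ (d * q) \<le> norm t" by simp
    have e1: "norm (p * t ^ (d * q) * (g t / t ^ (d * K)) * (b1 t / HD t)) \<le> norm p * norm t * norm (g t / t ^ (d * K)) * C1"
      unfolding norm_mult norm_power using elim(1) tq C1(1) by (intro mult_mono mult_nonneg_nonneg) auto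
    have rS: "norm ((E * rr) / S t ^ K) \<le> CC * (\<bar>C\<bar> * norm t)"
      if "norm (E / \<sigma> t ^ K) \<le> CC" "norm rr \<le> \<bar>C\<bar> * norm t ^ L" "CC \<ge> 0" for E rr CC
    proof -
      have "(E * rr) / S t ^ K = (E / \<sigma> t ^ K) * (rr / t ^ (d * K))"
        unfolding S_def by (simp add: power_mult_distrib power_mult)
      moreover have "norm (rr / t ^ (d * K)) \<le> \<bar>C\<bar> * norm t"
        using that(2) elim(4) unfolding L_def by (simp add: norm_divide norm_power field_simps)
      ultimately show ?thesis using that by (simp only: norm_mult) (intro mult_mono; simp)
    qed
    have c: "t * (x / t) = x" for x using elim(4) by simp
    have r: "x + l + (y + z) - l = x + y + z" for x y z l :: complex by simp
    have "t * D t - lm t = p * t ^ (d * q) * (g t / t ^ (d * K)) * (b1 t / HD t) + (E1 t * r1 t) / S t ^ K + (E2 t * r2 t) / S t ^ K"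
      unfolding D_def c add_divide_distrib[of "E1 t * r1 t"] by (rule r)
    then have "norm (t * D t - lm t) \<le> norm p * norm t * norm (g t / t ^ (d * K)) * C1 + C2 * (\<bar>C\<bar> * norm t) + C3 * (\<bar>C\<bar> * norm t)"
      by (rule norm_sum3_le[OF _ e1 rS[OF elim(2) r12(1) C2(1)] rS[OF elim(3) r12(2) C3(1)]])
    also have "\<dots> \<le> (norm p * C1 + (C2 + C3) * \<bar>C\<bar>) * norm t * (1 + norm (g t / t ^ (d * K)))"
    proof -
      have "0 \<le> norm p * C1 * norm t" "0 \<le> (C2 + C3) * \<bar>C\<bar> * norm t * norm (g t / t ^ (d * K))"
        using C1(1) C2(1) C3(1) by (intro mult_nonneg_nonneg; simp)+
      then show ?thesis by (simp add: algebra_simps)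
    qed
    finally show ?case .
  qed
  have "lm 0 = 0"
    by (rule no_logarithm[OF \<epsilon>'(1) holomorphic_on_subset[OF hg] lim deriv bound]) (use \<epsilon>'(2) in auto)
  then have "HW 0 * r z0 0 = 0" unfolding lm_def Z0 S0 using nn dq \<sigma>nz[of 0] by (simp add: p_def)
  then show ?thesis using HD0 HW0 by simp
qed

end

section \<open>Pointwise Lipschitz estimates\<close>

text \<open>A Lipschitz condition at the single point \<open>z\<close>, with prescribed constant and
  unspecified neighbourhood. It covers \<open>ln (1 + |f|)\<close> and cutoffs, which need not be
  differentiable, and it suffices for summation along a rectifiable path.\<close>

definition calm :: "(complex \<Rightarrow> real) \<Rightarrow> complex \<Rightarrow> real \<Rightarrow> bool" where
  "calm f z C \<longleftrightarrow> eventually (\<lambda>x. \<bar>f x - f z\<bar> \<le> C * norm (x - z)) (nhds z)"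

lemma calm_cong:
  assumes "calm g z C" "eventually (\<lambda>x. f x = g x) (nhds z)"
  shows "calm f z C"
proof -
  have "f z = g z" using assms(2) by (rule eventually_nhds_x_imp_x)
  then show ?thesis using assms unfolding calm_def by (auto elim: eventually_elim2)
qed

lemma calm_mono: "calm f z C \<Longrightarrow> C \<le> C' \<Longrightarrow> calm f z C'"
  unfolding calm_def by (erule eventually_mono) (meson mult_right_mono norm_ge_zero order_trans)

lemma calm_sum:
  assumes "\<And>i. i \<in> I \<Longrightarrow> calm (f i) z C"
  shows "calm (\<lambda>x. \<Sum>i\<in>I. f i x) z (of_nat (card I) * C)"
proof (cases "finite I")
  case True
  have "eventually (\<lambda>x. \<forall>i\<in>I. \<bar>f i x - f i z\<bar> \<le> C * norm (x - z)) (nhds z)"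
    using assms True unfolding calm_def by (simp add: eventually_ball_finite)
  then show ?thesis unfolding calm_def
  proof eventually_elim
    case (elim x)
    have "\<bar>(\<Sum>i\<in>I. f i x) - (\<Sum>i\<in>I. f i z)\<bar> \<le> (\<Sum>i\<in>I. \<bar>f i x - f i z\<bar>)"
      unfolding sum_subtractf[symmetric] by (rule sum_abs)
    also have "\<dots> \<le> (\<Sum>i\<in>I. C * norm (x - z))" using elim by (intro sum_mono) auto
    finally show ?case by simp
  qed
qed (simp add: calm_def)

text \<open>The rate \<open>D\<close> of the cutoff is multiplied by the gap \<open>E\<close>
  between the two functions at \<open>z\<close>, so \<open>D\<close> may be arbitrarily large as
  long as \<open>D * E\<close> stays bounded.\<close>

lemma calm_blend:
  assumes f: "calm f1 z C1" "calm f2 z C2" and cu: "calm cu z D" "\<And>x. 0 \<le> cu x \<and> cu x \<le> 1"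
    and E: "\<bar>f2 z - f1 z\<bar> \<le> E" and DE: "D * E \<le> C3" and nn: "D \<ge> 0" "C1 \<ge> 0" "C2 \<ge> 0"
  shows "calm (\<lambda>x. f1 x + cu x * (f2 x - f1 x)) z (C1 + C2 + C3)"
  using f cu(1) unfolding calm_def
proof eventually_elim
  case (elim x)
  have "(f1 x + cu x * (f2 x - f1 x)) - (f1 z + cu z * (f2 z - f1 z)) =
    (1 - cu x) * (f1 x - f1 z) + cu x * (f2 x - f2 z) + (cu x - cu z) * (f2 z - f1 z)" by (simp add: algebra_simps)
  moreover have "\<bar>(1 - cu x) * (f1 x - f1 z)\<bar> \<le> 1 * (C1 * norm (x - z))"
    unfolding abs_mult using cu(2)[of x] elim by (intro mult_mono) auto
  moreover have "\<bar>cu x * (f2 x - f2 z)\<bar> \<le> 1 * (C2 * norm (x - z))"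
    unfolding abs_mult using cu(2)[of x] elim by (intro mult_mono) auto
  moreover have "\<bar>(cu x - cu z) * (f2 z - f1 z)\<bar> \<le> (D * norm (x - z)) * E"
    unfolding abs_mult using elim E nn by (intro mult_mono) auto
  moreover have "(D * norm (x - z)) * E \<le> C3 * norm (x - z)"
    using mult_right_mono[OF DE norm_ge_zero[of "x - z"]] by (simp add: mult_ac)
  ultimately show ?case by (simp add: algebra_simps)
qed

lemma eventually_norm_diff_le:
  assumes f: "(f has_field_derivative f') (at z)" and C: "norm f' < C"
  shows "eventually (\<lambda>x. norm (f x - f z) \<le> C * norm (x - z)) (nhds z)"
proof -
  have "((\<lambda>x. norm ((f x - f z) / (x - z))) \<longlongrightarrow> norm f') (at z)"
    using f unfolding has_field_derivative_iff by (rule tendsto_norm)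
  then have "eventually (\<lambda>x. norm ((f x - f z) / (x - z)) < C) (at z)" using C by (rule order_tendstoD)
  then show ?thesis unfolding eventually_at_filter
    by eventually_elim (auto simp: norm_divide divide_simps split: if_splits)
qed

text \<open>For \<open>a < b\<close> the derivative of the logarithm is estimated at
  \<open>1 + a\<close>, which the third hypothesis keeps above \<open>(1 + b) / 2\<close>; hence the
  factor 2.\<close>

lemma ln_norm_diff_le:
  fixes a b :: real
  assumes "a \<ge> 0" "b \<ge> 0" "\<bar>a - b\<bar> \<le> (1 + b) / 2"
  shows "\<bar>ln (1 + a) - ln (1 + b)\<bar> \<le> 2 * \<bar>a - b\<bar> / (1 + b)"
proof (cases "a \<ge> b")
  case True
  have "ln (1 + a) - ln (1 + b) \<le> (a - b) / (1 + b)"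
    using ln_diff_le[of "1 + a" "1 + b"] assms by simp
  also have "\<dots> \<le> 2 * (a - b) / (1 + b)" using True assms by (intro divide_right_mono) auto
  finally show ?thesis using True assms by simp
next
  case False
  have "ln (1 + b) - ln (1 + a) \<le> (b - a) / (1 + a)"
    using ln_diff_le[of "1 + b" "1 + a"] assms by simp
  also have "\<dots> \<le> (b - a) / ((1 + b) / 2)"
    by (rule frac_le) (use False assms in \<open>auto simp: field_simps\<close>)
  also have "\<dots> = 2 * (b - a) / (1 + b)" by simp
  finally have "ln (1 + b) - ln (1 + a) \<le> 2 * (b - a) / (1 + b)" .
  moreover have "ln (1 + a) \<le> ln (1 + b)" "\<bar>a - b\<bar> = b - a" using False assms by auto
  ultimately show ?thesis by simp
qed

text \<open>Growth at most linear in \<open>1 + |f|\<close> becomes a Lipschitz bound for the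
  logarithm. The step from \<open>C\<close> to \<open>C + 1\<close> makes the bound on the
  derivative strict, and the 2 is that of \<open>ln_norm_diff_le\<close>.\<close>

lemma calm_ln:
  assumes f: "(f has_field_derivative f') (at z)" and C: "norm f' \<le> C * (1 + norm (f z))" "C \<ge> 0"
  shows "calm (\<lambda>x. ln (1 + norm (f x))) z (2 * (C + 1))"
proof -
  have p: "1 + norm (f z) > 0" by (simp add: add_pos_nonneg)
  have "norm f' < (C + 1) * (1 + norm (f z))" using C p by (simp add: algebra_simps)
  from eventually_norm_diff_le[OF f this]
  have 1: "eventually (\<lambda>x. norm (f x - f z) \<le> (C + 1) * (1 + norm (f z)) * norm (x - z)) (nhds z)" .
  have "eventually (\<lambda>x. x \<in> ball z (1 / (2 * (C + 1)))) (nhds z)"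
    using C(2) by (intro eventually_nhds_in_open) auto
  with 1 show ?thesis unfolding calm_def
  proof eventually_elim
    case (elim x)
    have "(C + 1) * norm (x - z) \<le> 1 / 2"
      using elim(2) C(2) by (simp add: dist_norm norm_minus_commute field_simps)
    then have "(1 + norm (f z)) * ((C + 1) * norm (x - z)) \<le> (1 + norm (f z)) * (1 / 2)"
      using p by (intro mult_left_mono) auto
    then have s: "\<bar>norm (f x) - norm (f z)\<bar> \<le> (1 + norm (f z)) / 2"
      using elim(1) norm_triangle_ineq3[of "f x" "f z"] by (simp add: mult_ac)
    have "\<bar>ln (1 + norm (f x)) - ln (1 + norm (f z))\<bar> \<le> 2 * \<bar>norm (f x) - norm (f z)\<bar> / (1 + norm (f z))"
      using ln_norm_diff_le[OF _ _ s] by simp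
    also have "\<dots> \<le> 2 * ((C + 1) * (1 + norm (f z)) * norm (x - z)) / (1 + norm (f z))"
      using elim(1) norm_triangle_ineq3[of "f x" "f z"] p by (intro divide_right_mono mult_left_mono) auto
    also have "\<dots> = 2 * (C + 1) * norm (x - z)" using p by simp
    finally show ?case .
  qed
qed

text \<open>Equal to 1 up to \<open>e\<close> and to 0 from \<open>2 * e\<close> on; linear in
  between, as no smoothness is asked for.\<close>

definition cutoff :: "real \<Rightarrow> real \<Rightarrow> real" where
  "cutoff e x = max 0 (min 1 (2 - x / e))"

lemma cutoff_bounds: "0 \<le> cutoff e x" "cutoff e x \<le> 1"
  unfolding cutoff_def by auto

lemma cutoff_1: "e > 0 \<Longrightarrow> x \<le> e \<Longrightarrow> cutoff e x = 1"
  unfolding cutoff_def by (auto simp: field_simps)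

lemma cutoff_0: "e > 0 \<Longrightarrow> x \<ge> 2 * e \<Longrightarrow> cutoff e x = 0"
  unfolding cutoff_def by (auto simp: field_simps)

lemma cutoff_lipschitz:
  assumes "e > 0" shows "\<bar>cutoff e x - cutoff e y\<bar> \<le> \<bar>x - y\<bar> / e"
proof -
  have "\<bar>cutoff e x - cutoff e y\<bar> \<le> \<bar>(2 - x / e) - (2 - y / e)\<bar>"
    unfolding cutoff_def by (auto simp: max_def min_def)
  also have "\<dots> = \<bar>x - y\<bar> / e" using assms by (simp add: diff_divide_distrib[symmetric] abs_minus_commute)
  finally show ?thesis .
qed

lemma calm_cutoff:
  assumes f: "(f has_field_derivative f') (at z)" and C: "norm f' < C" and e: "e > 0"
  shows "calm (\<lambda>x. cutoff e (norm (f x))) z (C / e)"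
  unfolding calm_def using eventually_norm_diff_le[OF f C]
proof eventually_elim
  case (elim x)
  have "\<bar>cutoff e (norm (f x)) - cutoff e (norm (f z))\<bar> \<le> \<bar>norm (f x) - norm (f z)\<bar> / e" by (rule cutoff_lipschitz[OF e])
  also have "\<dots> \<le> C * norm (x - z) / e"
    using elim norm_triangle_ineq3[of "f x" "f z"] e by (intro divide_right_mono) auto
  finally show ?case by simp
qed

text \<open>A branch of \<open>y^(-1/n)\<close> through the prescribed value \<open>t\<close>.
  Normalising by \<open>t\<close> puts the argument of \<open>Ln\<close> at 1, away from its
  cut.\<close>

lemma root_branch:
  fixes y :: "complex \<Rightarrow> complex"
  assumes y: "(y has_field_derivative y') (at z)" and n: "n > 0" and t: "t ^ n * y z = 1"
  obtains T T' where "T z = t" "eventually (\<lambda>x. T x ^ n * y x = 1) (nhds z)" "(T has_field_derivative T') (at z)"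
    "of_nat n * T' = - (t ^ (n + 1) * y')"
proof -
  have ynz: "y z \<noteq> 0" using t by auto
  have tnz: "t \<noteq> 0" using t n by (auto simp: zero_power)
  define T where "T x = t * exp (- (Ln (y x * t ^ n) / of_nat n))" for x
  define T' where "T' = - (t ^ (n + 1) * y' / of_nat n)"
  have nn: "of_nat n \<noteq> (0::complex)" using n by simp
  have yt: "y z * t ^ n = 1" using t by (simp add: mult.commute)
  show ?thesis
  proof (rule that[of T T'])
    show "T z = t" unfolding T_def yt by simp
    show "of_nat n * T' = - (t ^ (n + 1) * y')" unfolding T'_def using nn by simp
    have "isCont y z" using y DERIV_isCont by blast
    then have "(y \<longlongrightarrow> y z) (nhds z)" by (simp add: isCont_def tendsto_at_iff_tendsto_nhds)
    then have "eventually (\<lambda>x. y x \<noteq> 0) (nhds z)" using ynz by (rule tendsto_imp_eventually_ne)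
    then show "eventually (\<lambda>x. T x ^ n * y x = 1) (nhds z)"
    proof eventually_elim
      case (elim x)
      have "T x ^ n = t ^ n * exp (of_nat n * (- (Ln (y x * t ^ n) / of_nat n)))"
        unfolding T_def power_mult_distrib exp_of_nat_mult by simp
      also have "of_nat n * (- (Ln (y x * t ^ n) / of_nat n)) = - Ln (y x * t ^ n)" using nn by simp
      also have "exp (- Ln (y x * t ^ n)) = inverse (y x * t ^ n)" using elim tnz by (simp add: exp_minus)
      finally show ?case using elim tnz by (simp add: field_simps)
    qed
    have "(T has_field_derivative t * (exp (- (Ln (y z * t ^ n) / of_nat n)) * - ((y' * t ^ n) / (y z * t ^ n) / of_nat n))) (at z)"
      unfolding T_def[abs_def] using y yt nn
      by (auto intro!: derivative_eq_intros)
    then show "(T has_field_derivative T') (at z)" unfolding yt T'_def by (simp add: mult_ac)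
  qed
qed

lemma eventually_nhds_triple:
  fixes a b c :: complex
  assumes "eventually P (nhds (a, b, c))"
  shows "\<exists>\<epsilon>>0. \<forall>x y z. norm (x - a) < \<epsilon> \<longrightarrow> norm (y - b) < \<epsilon> \<longrightarrow> norm (z - c) < \<epsilon> \<longrightarrow> P (x, y, z)"
proof -
  obtain e where e: "e > 0" "\<And>v. dist v (a, b, c) < e \<Longrightarrow> P v" using assms unfolding eventually_nhds_metric by blast
  show ?thesis
  proof (intro exI[of _ "e / 3"] conjI allI impI)
    fix x y z assume h: "norm (x - a) < e / 3" "norm (y - b) < e / 3" "norm (z - c) < e / 3"
    have "dist (x, y, z) (a, b, c) \<le> dist x a + dist (y, z) (b, c)"
      unfolding dist_Pair_Pair[of x] by (rule sqrt_sum_squares_le_sum) auto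
    also have "dist (y, z) (b, c) \<le> dist y b + dist z c"
      unfolding dist_Pair_Pair by (rule sqrt_sum_squares_le_sum) auto
    finally show "P (x, y, z)" using h by (intro e(2)) (auto simp: dist_norm)
  qed (use e in simp)
qed

section \<open>Exact solutions along one branch of \<open>\<tau>\<close>\<close>

context hamiltonian
begin

lemma continuous_A:
  assumes "continuous_on S Z" "\<And>s. s \<in> S \<Longrightarrow> Z s \<in> U" "(i, j) \<in> J"
  shows "continuous_on S (\<lambda>s. \<alpha> i j (Z s))" "continuous_on S (\<lambda>s. deriv (\<alpha> i j) (Z s))"
  using continuous_on_compose2[OF holomorphic_on_imp_continuous_on[OF hol\<alpha>[OF assms(3)]] assms(1)]
    continuous_on_compose2[OF holomorphic_on_imp_continuous_on[OF hol\<alpha>'[OF assms(3)]] assms(1)] assms(2)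
  by (auto simp: image_subset_iff)

lemma continuous_sums:
  fixes Z T X Y :: "'x :: topological_space \<Rightarrow> complex"
  assumes Z: "continuous_on S Z" "\<And>s. s \<in> S \<Longrightarrow> Z s \<in> U" and T: "continuous_on S T" and X: "continuous_on S X"
    and Y: "continuous_on S Y"
  shows "continuous_on S (\<lambda>s. hw (A (Z s)) (T s) (X s))"
    "continuous_on S (\<lambda>s. Dh (A (Z s)) (T s) (X s))"
    "continuous_on S (\<lambda>s. hh_dd (A (Z s)) (T s) (X s) (Y s))" "continuous_on S (\<lambda>s. hw_dd (A (Z s)) (T s) (X s) (Y s))"
    "continuous_on S (\<lambda>s. ht_dd (A (Z s)) (T s) (X s) (Y s))" "continuous_on S (\<lambda>s. hh_dd2 (A (Z s)) (T s) (X s) (Y s))"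
    "continuous_on S (\<lambda>s. hh_dd (A' (Z s)) (T s) (X s) (Y s))"
  unfolding hw_def Dh_def hh_dd_def hw_dd_def ht_dd_def hh_dd2_def dd_def case_prod_unfold
  by (intro continuous_intros T X Y continuous_A[OF Z]; simp)+

lemma continuous_PH:
  fixes Z T :: "'x :: topological_space \<Rightarrow> complex"
  assumes "PH U f" "continuous_on S Z" "\<And>s. s \<in> S \<Longrightarrow> Z s \<in> U" "continuous_on S T"
  shows "continuous_on S (\<lambda>s. f (Z s) (T s))"
proof -
  have "continuous_on S (\<lambda>s. (\<lambda>(z, \<tau>). f z \<tau>) (Z s, T s))"
    by (rule continuous_on_compose2[OF PH_continuous[OF assms(1)]]) (use assms in \<open>auto intro!: continuous_intros\<close>)
  then show ?thesis by simp
qed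

text \<open>The system in the coordinates \<open>(z, \<tau>, w)\<close>. By
  \<open>K - m = q + n\<close> and \<open>K - n = q + m\<close> a common factor
  \<open>n \<tau>^q\<close> is what clears all negative powers of \<open>\<tau>\<close>.\<close>

lemma exact_branch:
  assumes y1: "(y1 has_field_derivative rhs1 (A z) M N (y1 z) (y2 z)) (at z)"
    and y2: "(y2 has_field_derivative rhs2 (A z) M N (y1 z) (y2 z)) (at z)"
    and t: "t ^ n * y1 z = 1"
  obtains T T' X' where "T z = t" "eventually (\<lambda>x. T x ^ n * y1 x = 1) (nhds z)" "(T has_field_derivative T') (at z)"
    "((\<lambda>x. y2 x * T x ^ m) has_field_derivative X') (at z)"
    "of_nat n * t ^ q * T' = - (t * hw (A z) t (y2 z * t ^ m))"
    "of_nat n * t ^ q * X' = - Dh (A z) t (y2 z * t ^ m)"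
proof -
  obtain T T' where T: "T z = t" "eventually (\<lambda>x. T x ^ n * y1 x = 1) (nhds z)" "(T has_field_derivative T') (at z)"
    "of_nat n * T' = - (t ^ (n + 1) * rhs1 (A z) M N (y1 z) (y2 z))"
    by (rule root_branch[OF y1 n_pos t]) (rule that)
  define X' where "X' = rhs2 (A z) M N (y1 z) (y2 z) * t ^ m + y2 z * (of_nat m * t ^ (m - 1) * T')"
  have X: "((\<lambda>x. y2 x * T x ^ m) has_field_derivative X') (at z)"
    unfolding X'_def using y2 T(3) T(1) by (auto intro!: derivative_eq_intros simp: mult_ac)
  have Km: "K - m = q + n" "K - n = q + m" using K_split by auto
  have R1: "t ^ q * t ^ n * rhs1 (A z) M N (y1 z) (y2 z) = hw (A z) t (y2 z * t ^ m)"
    using rhs1_hw[OF t refl, of "A z" "y2 z"] unfolding Km power_add .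
  have R2: "t ^ q * t ^ m * rhs2 (A z) M N (y1 z) (y2 z) = - hi (A z) t (y2 z * t ^ m)"
    using rhs2_hi[OF t refl, of "A z" "y2 z"] unfolding Km power_add .
  have 1: "of_nat n * t ^ q * T' = - (t * hw (A z) t (y2 z * t ^ m))"
  proof -
    have "of_nat n * t ^ q * T' = t ^ q * (of_nat n * T')" by simp
    also have "\<dots> = - (t * (t ^ q * t ^ n * rhs1 (A z) M N (y1 z) (y2 z)))" unfolding T(4) by simp
    finally show ?thesis unfolding R1 .
  qed
  have "of_nat n * t ^ q * X' = - Dh (A z) t (y2 z * t ^ m)"
  proof -
    have tm: "t ^ (m - 1) * t = t ^ m" using power_minus_mult[of m t] m_pos by simp
    have "of_nat n * t ^ q * X' = of_nat n * (t ^ q * t ^ m * rhs2 (A z) M N (y1 z) (y2 z))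
       + y2 z * of_nat m * t ^ (m - 1) * (of_nat n * t ^ q * T')" unfolding X'_def by (simp add: algebra_simps)
    also have "\<dots> = - (of_nat n * hi (A z) t (y2 z * t ^ m)) - y2 z * of_nat m * (t ^ (m - 1) * t) * hw (A z) t (y2 z * t ^ m)"
      unfolding R2 1 by (simp add: algebra_simps)
    finally show ?thesis unfolding tm Dh_eq_hi by (simp add: algebra_simps)
  qed
  with T X 1 show ?thesis by (intro that) auto
qed

text \<open>The Hamiltonian structure enters here: the contributions of the two equations cancel,
  and only the explicit dependence on \<open>z\<close> remains.\<close>

lemma Hm_deriv:
  assumes y1: "(y1 has_field_derivative rhs1 (A z) M N (y1 z) (y2 z)) (at z)"
    and y2: "(y2 has_field_derivative rhs2 (A z) M N (y1 z) (y2 z)) (at z)" and z: "z \<in> U"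
  shows "((\<lambda>x. Hm (A x) (y1 x) (y2 x)) has_field_derivative Hm (A' z) (y1 z) (y2 z)) (at z)"
proof -
  let ?r1 = "rhs1 (A z) M N (y1 z) (y2 z)" and ?r2 = "rhs2 (A z) M N (y1 z) (y2 z)"
  have a: "(\<alpha> i j has_field_derivative deriv (\<alpha> i j) z) (at z)" if "(i, j) \<in> J" for i j
    using holomorphic_derivI[OF hol\<alpha>[OF that] U z] .
  have s1: "(\<Sum>k\<in>J. of_nat (snd k) * \<alpha> (fst k) (snd k) z * y1 z ^ fst k * y2 z ^ (snd k - 1)) = ?r1"
    unfolding rhs1_J case_prod_unfold ..
  have s2: "(\<Sum>k\<in>J. of_nat (fst k) * \<alpha> (fst k) (snd k) z * y1 z ^ (fst k - 1) * y2 z ^ snd k) = - ?r2"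
    unfolding rhs2_J case_prod_unfold by simp
  have "((\<lambda>x. \<Sum>k\<in>J. \<alpha> (fst k) (snd k) x * y1 x ^ fst k * y2 x ^ snd k) has_field_derivative
     (\<Sum>k\<in>J. deriv (\<alpha> (fst k) (snd k)) z * y1 z ^ fst k * y2 z ^ snd k
       + (of_nat (fst k) * \<alpha> (fst k) (snd k) z * y1 z ^ (fst k - 1) * y2 z ^ snd k) * ?r1
       + (of_nat (snd k) * \<alpha> (fst k) (snd k) z * y1 z ^ fst k * y2 z ^ (snd k - 1)) * ?r2)) (at z)"
    using a y1 y2 by (intro DERIV_sum) (auto intro!: derivative_eq_intros simp: algebra_simps)
  also have "(\<Sum>k\<in>J. deriv (\<alpha> (fst k) (snd k)) z * y1 z ^ fst k * y2 z ^ snd k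
       + (of_nat (fst k) * \<alpha> (fst k) (snd k) z * y1 z ^ (fst k - 1) * y2 z ^ snd k) * ?r1
       + (of_nat (snd k) * \<alpha> (fst k) (snd k) z * y1 z ^ fst k * y2 z ^ (snd k - 1)) * ?r2)
     = Hm (A' z) (y1 z) (y2 z) + (- ?r2) * ?r1 + ?r1 * ?r2"
    unfolding sum.distrib sum_distrib_right[symmetric] Hm_def case_prod_unfold s1 s2 ..
  finally show ?thesis unfolding Hm_def case_prod_unfold by simp
qed

end

section \<open>Invariant surfaces through the branches at infinity\<close>

text \<open>The \<open>slit\<close> condition makes the roots of \<open>h(z, 0, w)\<close> holomorphic functions of \<open>z\<close> on \<open>U\<close>.\<close>

locale local_hamiltonian = hamiltonian +
  fixes zi :: complex
  assumes zi: "zi \<in> U"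
    and slit: "\<And>z. z \<in> U \<Longrightarrow> (\<alpha> (M + 1) 0 z / \<alpha> 0 (N + 1) z) / (\<alpha> (M + 1) 0 zi / \<alpha> 0 (N + 1) zi) \<notin> \<real>\<^sub>\<le>\<^sub>0"
    and formal: "\<And>z0 c1 c2. z0 \<in> U \<Longrightarrow>
        c1 ^ (M * N - 1) = - inverse (\<alpha> 0 (N + 1) z0 * \<alpha> (M + 1) 0 z0 ^ N * of_nat (M * N - 1) ^ (N + 1)) \<Longrightarrow>
        c2 = of_nat (M * N - 1) * \<alpha> (M + 1) 0 z0 * c1 ^ M \<Longrightarrow> \<exists>Y1 Y2. formal_solution \<alpha> M N z0 c1 c2 Y1 Y2"
begin

definition Rt :: "complex set" where "Rt = {c. hh (A zi) 0 c = 0}"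

lemma finite_Rt: "finite Rt"
proof -
  have "Rt = {c. c ^ (N + 1) = - (\<alpha> (M + 1) 0 zi / \<alpha> 0 (N + 1) zi)}"
    unfolding Rt_def hh_zero using lead(2)[OF zi] by (auto simp: field_simps eq_neg_iff_add_eq_0)
  then show ?thesis using finite_nth_roots[of "N + 1"] by simp
qed

text \<open>Invariance goes \<open>q\<close> orders beyond \<open>K\<close> to absorb
  \<open>\<tau>' = O(\<tau>^(1-q))\<close>. The last clause makes \<open>W\<close> and
  \<open>H\<close> differ by a relative \<open>O(\<tau>^q)\<close> wherever \<open>H\<close> has its
  full size.\<close>

definition is_surface where
  "is_surface c P E1 Q1 \<longleftrightarrow> PH U P \<and> PH U E1 \<and> PH U Q1 \<and> P zi 0 = c \<and>
     (\<forall>z\<in>U. \<forall>\<tau>. Eop P z \<tau> = \<tau> ^ (K + q) * E1 z \<tau>) \<and> (\<forall>z\<in>U. \<forall>\<tau>. hh (A z) \<tau> (P z \<tau>) = \<tau> ^ q * Q1 z \<tau>)"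

lemma surface_exists:
  assumes c: "c \<in> Rt"
  shows "\<exists>P E1 Q1. is_surface c P E1 Q1"
proof -
  define ra where "ra z = (\<alpha> (M + 1) 0 z / \<alpha> 0 (N + 1) z) / (\<alpha> (M + 1) 0 zi / \<alpha> 0 (N + 1) zi)" for z
  \<comment> \<open>The root through \<open>c\<close> as a function of \<open>z\<close>: the
    \<open>(N+1)\<close>-th power of a root is minus the ratio of the leading coefficients, and
    \<open>ra\<close> is this ratio normalised to 1 at \<open>zi\<close>, with values off the
    slit.\<close>
  define w0 where "w0 z = c * exp (Ln (ra z) / of_nat (N + 1))" for z
  have JJ: "(M + 1, 0) \<in> J" "(0, N + 1) \<in> J" unfolding J_def by auto
  have hra: "ra holomorphic_on U" unfolding ra_def[abs_def]
    using lead zi by (intro holomorphic_intros hol\<alpha> JJ) auto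
  have hw0: "w0 holomorphic_on U" unfolding w0_def[abs_def]
    by (intro holomorphic_intros hra) (use slit in \<open>auto simp: ra_def simp del: of_nat_Suc of_nat_add\<close>)
  have c0: "\<alpha> (M + 1) 0 zi + \<alpha> 0 (N + 1) zi * c ^ (N + 1) = 0" using c unfolding Rt_def hh_zero by simp
  have w0r: "hh (A z) 0 (w0 z) = 0" if z: "z \<in> U" for z
  proof -
    have ranz: "ra z \<noteq> 0" using slit[OF z] unfolding ra_def by (metis nonpos_Reals_zero_I)
    have "w0 z ^ (N + 1) = c ^ (N + 1) * exp (of_nat (N + 1) * (Ln (ra z) / of_nat (N + 1)))"
      unfolding w0_def power_mult_distrib exp_of_nat_mult ..
    also have "of_nat (N + 1) * (Ln (ra z) / of_nat (N + 1)) = Ln (ra z)"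
      by (simp del: of_nat_Suc of_nat_add)
    finally have "w0 z ^ (N + 1) = c ^ (N + 1) * ra z" using ranz by simp
    moreover have "c ^ (N + 1) = - (\<alpha> (M + 1) 0 zi / \<alpha> 0 (N + 1) zi)"
      using c0 lead(2)[OF zi] by (simp add: field_simps eq_neg_iff_add_eq_0)
    ultimately have "w0 z ^ (N + 1) = - (\<alpha> (M + 1) 0 z / \<alpha> 0 (N + 1) z)"
      unfolding ra_def using lead[OF zi] by (simp del: power_Suc)
    then show ?thesis unfolding hh_zero using lead[OF z] by (simp del: power_Suc)
  qed
  have w0zi: "w0 zi = c" unfolding w0_def ra_def using lead[OF zi] by simp
  have "\<exists>P r. PH U P \<and> PH U r \<and> (\<forall>z\<in>U. P z 0 = w0 z) \<and> (\<forall>z\<in>U. \<forall>\<tau>. Eop P z \<tau> = \<tau> ^ Suc (K + q - 1) * r z \<tau>)"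
  proof (rule Eop_exists[OF hw0 w0r])
    fix P r z assume h: "PH U P" "PH U r" "\<And>z. z \<in> U \<Longrightarrow> P z 0 = w0 z" "\<And>z \<tau>. z \<in> U \<Longrightarrow> Eop P z \<tau> = \<tau> ^ K * r z \<tau>" "z \<in> U"
    show "r z 0 = 0"
      by (rule resonance_vanishes[OF h(5,1,2,4)]) (use h(3)[OF h(5)] w0r[OF h(5)] formal[OF h(5)] in auto)
  qed
  then obtain P E1 where P: "PH U P" "PH U E1" "\<And>z. z \<in> U \<Longrightarrow> P z 0 = w0 z"
    "\<And>z \<tau>. z \<in> U \<Longrightarrow> Eop P z \<tau> = \<tau> ^ (K + q) * E1 z \<tau>" using q_pos by auto
  \<comment> \<open>Along the surface \<open>K h - \<tau> dh/d\<tau>\<close> equals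
    \<open>Eop P - n \<tau>^q dz P\<close>, which is divisible by \<open>\<tau>^q\<close>; the Euler
    operator passes this on to \<open>h\<close> itself.\<close>
  have "\<exists>Q1. PH U Q1 \<and> (\<forall>z\<in>U. \<forall>\<tau>. hh (A z) \<tau> (P z \<tau>) = \<tau> ^ q * Q1 z \<tau>)"
  proof (rule PH_euler_divisible[OF U PH_hh(1)[OF P(1)], of "\<lambda>z \<tau>. \<tau> ^ K * E1 z \<tau> - of_nat n * dz P z \<tau>" q K])
    show "PH U (\<lambda>z \<tau>. \<tau> ^ K * E1 z \<tau> - of_nat n * dz P z \<tau>)"
      using P(1,2) PH_dz[OF U P(1)] by (intro PH_intros)
    show "q \<le> K" using K_split by simp
    fix z \<tau> assume z: "z \<in> U"
    have "((\<lambda>\<tau>. P z \<tau>) has_field_derivative dz P z \<tau> * 0 + dt P z \<tau> * 1) (at \<tau>)"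
      by (rule PH_chain[OF U P(1), of "\<lambda>_. z" 0 \<tau> "\<lambda>s. s" 1]) (use z in auto)
    from hh_chain[of "\<lambda>_. z" 0 \<tau> "\<lambda>s. s" 1, OF _ _ this] z
    have "((\<lambda>\<tau>. hh (A z) \<tau> (P z \<tau>)) has_field_derivative ht (A z) \<tau> (P z \<tau>) + hw (A z) \<tau> (P z \<tau>) * dt P z \<tau>) (at \<tau>)" by simp
    then have d: "dt (\<lambda>z \<tau>. hh (A z) \<tau> (P z \<tau>)) z \<tau> = ht (A z) \<tau> (P z \<tau>) + hw (A z) \<tau> (P z \<tau>) * dt P z \<tau>"
      unfolding dt_def by (rule DERIV_imp_deriv)
    have "of_nat K * hh (A z) \<tau> (P z \<tau>) - \<tau> * dt (\<lambda>z \<tau>. hh (A z) \<tau> (P z \<tau>)) z \<tau> = Eop P z \<tau> - \<tau> ^ q * (of_nat n * dz P z \<tau>)"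
      unfolding d Eop_def Dh_eq by (simp add: algebra_simps)
    then show "of_nat K * hh (A z) \<tau> (P z \<tau>) - \<tau> * dt (\<lambda>z \<tau>. hh (A z) \<tau> (P z \<tau>)) z \<tau> =
        \<tau> ^ q * (\<tau> ^ K * E1 z \<tau> - of_nat n * dz P z \<tau>)"
      unfolding P(4)[OF z] by (simp add: power_add algebra_simps)
  qed
  then obtain Q1 where "PH U Q1" "\<And>z \<tau>. z \<in> U \<Longrightarrow> hh (A z) \<tau> (P z \<tau>) = \<tau> ^ q * Q1 z \<tau>" by blast
  then show ?thesis unfolding is_surface_def
    by (intro exI[of _ P] exI[of _ E1] exI[of _ Q1]) (use P w0zi P(3)[OF zi] in simp)
qed

definition Ps where "Ps c = (SOME P. \<exists>E1 Q1. is_surface c P E1 Q1)"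

lemma Ps_surface: "c \<in> Rt \<Longrightarrow> \<exists>E1 Q1. is_surface c (Ps c) E1 Q1"
  using someI_ex[OF surface_exists[of c]] unfolding Ps_def by simp

definition Wf where "Wf c z \<tau> w = (hh (A z) \<tau> w - hh (A z) \<tau> (Ps c z \<tau>)) / \<tau> ^ K"

text \<open>All estimates near one root with a single radius and a single constant, so that they can
  be made uniform over the finitely many roots. The first bound expresses that the root is simple:
  \<open>w - P\<close> is controlled by the difference of \<open>h\<close>, hence by
  \<open>W\<close>.\<close>

definition near :: "complex \<Rightarrow> real \<Rightarrow> real \<Rightarrow> bool" where
  "near c \<epsilon> C \<longleftrightarrow> \<epsilon> > 0 \<and> C \<ge> 1 \<and> (\<forall>z \<tau> w. norm (z - zi) < \<epsilon> \<longrightarrow> norm \<tau> < \<epsilon> \<longrightarrow> norm (w - c) < \<epsilon> \<longrightarrow>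
     z \<in> U \<and> norm (w - Ps c z \<tau>) \<le> C * norm (hh (A z) \<tau> w - hh (A z) \<tau> (Ps c z \<tau>)) \<and>
     norm (hh_dd (A' z) \<tau> w (Ps c z \<tau>) + dz (Ps c) z \<tau> * hw_dd (A z) \<tau> w (Ps c z \<tau>)) \<le> C \<and>
     norm (Eop (Ps c) z \<tau>) \<le> C * norm \<tau> ^ (K + q) \<and> norm (hw (A z) \<tau> w) \<le> C \<and> hw (A z) \<tau> w \<noteq> 0 \<and>
     norm (Dh (A z) \<tau> w) \<le> C \<and> norm (hh (A z) \<tau> (Ps c z \<tau>)) \<le> C * norm \<tau> ^ q)"

lemma near_mono:
  assumes h: "near c \<epsilon> C" "0 < \<epsilon>'" "\<epsilon>' \<le> \<epsilon>" "C \<le> C'"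
  shows "near c \<epsilon>' C'"
  unfolding near_def
proof (intro conjI allI impI)
  show "C' \<ge> 1" "\<epsilon>' > 0" using h unfolding near_def by auto
  fix z \<tau> w :: complex assume s: "norm (z - zi) < \<epsilon>'" "norm \<tau> < \<epsilon>'" "norm (w - c) < \<epsilon>'"
  have "norm (z - zi) < \<epsilon>" "norm \<tau> < \<epsilon>" "norm (w - c) < \<epsilon>" using s h(3) by auto
  then have f: "z \<in> U \<and> norm (w - Ps c z \<tau>) \<le> C * norm (hh (A z) \<tau> w - hh (A z) \<tau> (Ps c z \<tau>)) \<and>
     norm (hh_dd (A' z) \<tau> w (Ps c z \<tau>) + dz (Ps c) z \<tau> * hw_dd (A z) \<tau> w (Ps c z \<tau>)) \<le> C \<and>
     norm (Eop (Ps c) z \<tau>) \<le> C * norm \<tau> ^ (K + q) \<and> norm (hw (A z) \<tau> w) \<le> C \<and> hw (A z) \<tau> w \<noteq> 0 \<and>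
     norm (Dh (A z) \<tau> w) \<le> C \<and> norm (hh (A z) \<tau> (Ps c z \<tau>)) \<le> C * norm \<tau> ^ q"
    using h(1) unfolding near_def by blast
  have m: "C * x \<le> C' * x" if "x \<ge> 0" for x using h(4) that by (rule mult_right_mono)
  show "z \<in> U" "hw (A z) \<tau> w \<noteq> 0" using f by auto
  show "norm (w - Ps c z \<tau>) \<le> C' * norm (hh (A z) \<tau> w - hh (A z) \<tau> (Ps c z \<tau>))"
    using f m[OF norm_ge_zero] order_trans by blast
  show "norm (hh_dd (A' z) \<tau> w (Ps c z \<tau>) + dz (Ps c) z \<tau> * hw_dd (A z) \<tau> w (Ps c z \<tau>)) \<le> C'"
    "norm (hw (A z) \<tau> w) \<le> C'" "norm (Dh (A z) \<tau> w) \<le> C'" using f h(4) by auto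
  show "norm (Eop (Ps c) z \<tau>) \<le> C' * norm \<tau> ^ (K + q)" "norm (hh (A z) \<tau> (Ps c z \<tau>)) \<le> C' * norm \<tau> ^ q"
    using f m[of "norm \<tau> ^ (K + q)"] m[of "norm \<tau> ^ q"] by auto
qed

lemma near_exists:
  assumes c: "c \<in> Rt"
  shows "\<exists>\<epsilon> C. near c \<epsilon> C"
proof -
  let ?P = "Ps c"
  obtain E1 Q1 where s: "PH U ?P" "PH U E1" "PH U Q1" "?P zi 0 = c"
     "\<And>z \<tau>. z \<in> U \<Longrightarrow> Eop ?P z \<tau> = \<tau> ^ (K + q) * E1 z \<tau>" "\<And>z \<tau>. z \<in> U \<Longrightarrow> hh (A z) \<tau> (?P z \<tau>) = \<tau> ^ q * Q1 z \<tau>"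
    using Ps_surface[OF c] unfolding is_surface_def by blast
  let ?D = "U \<times> (UNIV :: complex set) \<times> (UNIV :: complex set)"
  have D: "open ?D" "(zi, 0, c) \<in> ?D" using U zi by (auto intro!: open_Times)
  have Z: "continuous_on ?D fst" "\<And>s. s \<in> ?D \<Longrightarrow> fst s \<in> U" and T: "continuous_on ?D (\<lambda>s. fst (snd s))"
    and X: "continuous_on ?D (\<lambda>s. snd (snd s))" by (auto intro!: continuous_intros)
  have Y: "continuous_on ?D (\<lambda>s. ?P (fst s) (fst (snd s)))" by (rule continuous_PH[OF s(1) Z T])
  note cs = continuous_sums[OF Z T X Y]
  have bd: "\<exists>B. eventually (\<lambda>s. norm (f s) \<le> B) (nhds (zi, 0, c))" if "continuous_on ?D f"
    for f :: "complex \<times> complex \<times> complex \<Rightarrow> complex"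
  proof -
    have "isCont f (zi, 0, c)" using that D by (simp add: continuous_on_eq_continuous_at)
    then have "((\<lambda>s. norm (f s)) \<longlongrightarrow> norm (f (zi, 0, c))) (nhds (zi, 0, c))"
      by (intro tendsto_norm) (simp add: isCont_def tendsto_at_iff_tendsto_nhds)
    then have "eventually (\<lambda>s. norm (f s) < norm (f (zi, 0, c)) + 1) (nhds (zi, 0, c))" by (rule order_tendstoD) simp
    then show ?thesis by (intro exI) (erule eventually_mono, erule less_imp_le)
  qed
  have lb: "eventually (\<lambda>s. norm (f s) > norm (f (zi, 0, c)) / 2) (nhds (zi, 0, c))"
    if "continuous_on ?D f" "f (zi, 0, c) \<noteq> 0" for f :: "complex \<times> complex \<times> complex \<Rightarrow> complex"
  proof -
    have "isCont f (zi, 0, c)" using that D by (simp add: continuous_on_eq_continuous_at)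
    then have "((\<lambda>s. norm (f s)) \<longlongrightarrow> norm (f (zi, 0, c))) (nhds (zi, 0, c))"
      by (intro tendsto_norm) (simp add: isCont_def tendsto_at_iff_tendsto_nhds)
    then show ?thesis by (rule order_tendstoD) (use that(2) in simp)
  qed
  have cnz: "c \<noteq> 0" using c lead(1)[OF zi] unfolding Rt_def hh_zero by auto
  define h0 where "h0 = hw (A zi) 0 c"
  have h0: "h0 \<noteq> 0" unfolding h0_def hw_zero using lead(2)[OF zi] cnz by (simp del: of_nat_Suc of_nat_add)
  have l1: "eventually (\<lambda>s. norm (hh_dd (A (fst s)) (fst (snd s)) (snd (snd s)) (?P (fst s) (fst (snd s)))) > norm h0 / 2) (nhds (zi, 0, c))"
    using lb[OF cs(3)] h0 unfolding h0_def by (simp add: s(4) hh_dd_zero)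
  have l2: "eventually (\<lambda>s. norm (hw (A (fst s)) (fst (snd s)) (snd (snd s))) > norm h0 / 2) (nhds (zi, 0, c))"
    using lb[OF cs(1)] h0 unfolding h0_def by simp
  obtain B1 where B1: "eventually (\<lambda>s. norm (hh_dd (A' (fst s)) (fst (snd s)) (snd (snd s)) (?P (fst s) (fst (snd s)))
      + dz ?P (fst s) (fst (snd s)) * hw_dd (A (fst s)) (fst (snd s)) (snd (snd s)) (?P (fst s) (fst (snd s)))) \<le> B1) (nhds (zi, 0, c))"
    using bd[OF continuous_on_add[OF cs(7) continuous_on_mult[OF continuous_PH[OF PH_dz[OF U s(1)] Z T] cs(4)]]] by blast
  obtain B2 where B2: "eventually (\<lambda>s. norm (E1 (fst s) (fst (snd s))) \<le> B2) (nhds (zi, 0, c))"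
    using bd[OF continuous_PH[OF s(2) Z T]] by blast
  obtain B3 where B3: "eventually (\<lambda>s. norm (Q1 (fst s) (fst (snd s))) \<le> B3) (nhds (zi, 0, c))"
    using bd[OF continuous_PH[OF s(3) Z T]] by blast
  obtain B4 where B4: "eventually (\<lambda>s. norm (hw (A (fst s)) (fst (snd s)) (snd (snd s))) \<le> B4) (nhds (zi, 0, c))"
    using bd[OF cs(1)] by blast
  obtain B5 where B5: "eventually (\<lambda>s. norm (Dh (A (fst s)) (fst (snd s)) (snd (snd s))) \<le> B5) (nhds (zi, 0, c))"
    using bd[OF cs(2)] by blast
  define C where "C = max 1 (max B1 (max B2 (max B3 (max B4 (max B5 (2 / norm h0))))))"
  have C: "C \<ge> 1" "B1 \<le> C" "B2 \<le> C" "B3 \<le> C" "B4 \<le> C" "B5 \<le> C" "2 / norm h0 \<le> C"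
    unfolding C_def by (simp_all only: le_max_iff_disj order_refl simp_thms)
  have "eventually (\<lambda>s. s \<in> ?D) (nhds (zi, 0, c))" by (rule eventually_nhds_in_open[OF D])
  with l1 l2 B1 B2 B3 B4 B5
  have "eventually (\<lambda>s. case s of (z, \<tau>, w) \<Rightarrow> z \<in> U \<and> norm (w - ?P z \<tau>) \<le> C * norm (hh (A z) \<tau> w - hh (A z) \<tau> (?P z \<tau>)) \<and>
     norm (hh_dd (A' z) \<tau> w (?P z \<tau>) + dz ?P z \<tau> * hw_dd (A z) \<tau> w (?P z \<tau>)) \<le> C \<and>
     norm (Eop ?P z \<tau>) \<le> C * norm \<tau> ^ (K + q) \<and> norm (hw (A z) \<tau> w) \<le> C \<and> hw (A z) \<tau> w \<noteq> 0 \<and>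
     norm (Dh (A z) \<tau> w) \<le> C \<and> norm (hh (A z) \<tau> (?P z \<tau>)) \<le> C * norm \<tau> ^ q) (nhds (zi, 0, c))"
  proof eventually_elim
    case (elim s)
    obtain z \<tau> w where sz: "s = (z, \<tau>, w)" by (cases s) auto
    note e = elim[unfolded sz fst_conv snd_conv]
    have z: "z \<in> U" using e(8) by simp
    have "norm (w - ?P z \<tau>) * 1 \<le> norm (w - ?P z \<tau>) * (C * norm (hh_dd (A z) \<tau> w (?P z \<tau>)))"
    proof (rule mult_left_mono)
      have "1 = (2 / norm h0) * (norm h0 / 2)" using h0 by simp
      also have "\<dots> \<le> C * norm (hh_dd (A z) \<tau> w (?P z \<tau>))"
        using C e(1) by (intro mult_mono) auto
      finally show "1 \<le> C * norm (hh_dd (A z) \<tau> w (?P z \<tau>))" .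
    qed simp
    then have 1: "norm (w - ?P z \<tau>) \<le> C * norm (hh (A z) \<tau> w - hh (A z) \<tau> (?P z \<tau>))"
      unfolding hh_diff norm_mult by (simp add: mult_ac)
    have 2: "norm (Eop ?P z \<tau>) \<le> C * norm \<tau> ^ (K + q)"
      unfolding s(5)[OF z] norm_mult norm_power using e(4) C by (subst mult.commute) (intro mult_right_mono; simp)
    have 3: "norm (hh (A z) \<tau> (?P z \<tau>)) \<le> C * norm \<tau> ^ q"
      unfolding s(6)[OF z] norm_mult norm_power using e(5) C by (subst mult.commute) (intro mult_right_mono; simp)
    have 4: "hw (A z) \<tau> w \<noteq> 0" using e(2) by auto
    show ?case unfolding sz prod.case using z 1 2 3 4 e(3,6,7) C by simp
  qed
  from eventually_nhds_triple[OF this] obtain \<epsilon> where \<epsilon>: "\<epsilon> > 0"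
    "\<And>z \<tau> w. norm (z - zi) < \<epsilon> \<Longrightarrow> norm (\<tau> - 0) < \<epsilon> \<Longrightarrow> norm (w - c) < \<epsilon> \<Longrightarrow>
     z \<in> U \<and> norm (w - ?P z \<tau>) \<le> C * norm (hh (A z) \<tau> w - hh (A z) \<tau> (?P z \<tau>)) \<and>
     norm (hh_dd (A' z) \<tau> w (?P z \<tau>) + dz ?P z \<tau> * hw_dd (A z) \<tau> w (?P z \<tau>)) \<le> C \<and>
     norm (Eop ?P z \<tau>) \<le> C * norm \<tau> ^ (K + q) \<and> norm (hw (A z) \<tau> w) \<le> C \<and> hw (A z) \<tau> w \<noteq> 0 \<and>
     norm (Dh (A z) \<tau> w) \<le> C \<and> norm (hh (A z) \<tau> (?P z \<tau>)) \<le> C * norm \<tau> ^ q"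
    by (auto simp del: diff_0_right)
  show ?thesis
    unfolding near_def using \<epsilon>(1) C(1) \<epsilon>(2)[simplified diff_0_right] by - (rule exI[of _ \<epsilon>], rule exI[of _ C], blast)
qed

text \<open>Separation by \<open>2 * \<epsilon>\<close> makes the \<open>\<epsilon>\<close>-discs
  about distinct roots disjoint, so the root close to a given \<open>w\<close> is unique.\<close>

lemma near_uniform: "\<exists>\<epsilon> C. \<forall>c\<in>Rt. near c \<epsilon> C \<and> (\<forall>c'\<in>Rt. c \<noteq> c' \<longrightarrow> 2 * \<epsilon> \<le> norm (c - c'))"
proof -
  have "\<exists>\<epsilon> C. \<epsilon> > 0 \<and> (\<forall>c\<in>S. near c \<epsilon> C)" if "finite S" "S \<subseteq> Rt" for S
    using that
  proof (induction S rule: finite_induct)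
    case (insert c S)
    then obtain \<epsilon> C where 1: "\<epsilon> > 0" "\<forall>c\<in>S. near c \<epsilon> C" by auto
    obtain \<epsilon>' C' where 2: "near c \<epsilon>' C'" using near_exists[of c] insert.prems by blast
    have "\<epsilon>' > 0" using 2 unfolding near_def by simp
    then show ?case using 1 2 near_mono[of _ _ _ "min \<epsilon> \<epsilon>'" "max C C'"]
      by - (rule exI[of _ "min \<epsilon> \<epsilon>'"], rule exI[of _ "max C C'"], auto)
  qed (auto intro: exI[of _ 1])
  then obtain \<epsilon> C where 1: "\<epsilon> > 0" "\<forall>c\<in>Rt. near c \<epsilon> C" using finite_Rt by blast
  have "\<exists>e>0. \<forall>v\<in>V. e \<le> v" if "finite V" "\<forall>v\<in>V. v > 0" for V :: "real set"
    using that by (intro exI[of _ "Min (insert 1 V)"]) (auto simp: Min_gr_iff)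
  from this[of "(\<lambda>(c, c'). norm (c - c')) ` {(c, c') \<in> Rt \<times> Rt. c \<noteq> c'}"]
  obtain e where e: "e > 0" "\<And>c c'. c \<in> Rt \<Longrightarrow> c' \<in> Rt \<Longrightarrow> c \<noteq> c' \<Longrightarrow> e \<le> norm (c - c')"
    using finite_subset[of "{(c, c') \<in> Rt \<times> Rt. c \<noteq> c'}" "Rt \<times> Rt"] finite_Rt by fastforce
  show ?thesis
  proof (rule exI[of _ "min \<epsilon> (e / 2)"], rule exI[of _ C], intro ballI conjI impI)
    fix c assume c: "c \<in> Rt"
    show "near c (min \<epsilon> (e / 2)) C" using near_mono[of c \<epsilon> C "min \<epsilon> (e / 2)" C] 1 c e(1) by auto
    fix c' assume "c' \<in> Rt" "c \<noteq> c'"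
    then show "2 * min \<epsilon> (e / 2) \<le> norm (c - c')" using e(2)[OF c] by fastforce
  qed
qed

end

section \<open>Weighted size of a state, and growth of \<open>H\<close> away from the roots\<close>

context weights
begin

text \<open>Both terms have weight \<open>K\<close>, like the leading part of
  \<open>H\<close>.\<close>

definition TT :: "complex \<Rightarrow> complex \<Rightarrow> real" where
  "TT y1 y2 = norm y1 ^ (M + 1) + norm y2 ^ (N + 1)"

text \<open>With \<open>R = TT^(1/K)\<close> a monomial is at most \<open>R\<close> to the power of
  its weight; this is how all monomials are compared with \<open>TT\<close>.\<close>

lemma weighted_radius:
  assumes "TT y1 y2 \<ge> 1"
  obtains R where "R \<ge> 1" "R ^ K = TT y1 y2" "norm y1 \<le> R ^ n" "norm y2 \<le> R ^ m"
proof -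
  have K0: "K > 0" using K_split q_pos by simp
  define R where "R = root K (TT y1 y2)"
  have RK: "R ^ K = TT y1 y2" unfolding R_def using K0 assms by simp
  have R1: "R \<ge> 1" unfolding R_def using K0 assms by simp
  have "(R ^ n) ^ (M + 1) = R ^ K" "(R ^ m) ^ (N + 1) = R ^ K"
    using K_eq K_eq' by (metis power_mult)+
  then have e: "(R ^ n) ^ (M + 1) = TT y1 y2" "(R ^ m) ^ (N + 1) = TT y1 y2" using RK by simp_all
  have "norm y1 ^ (M + 1) \<le> (R ^ n) ^ (M + 1)" unfolding e TT_def by simp
  then have "norm y1 \<le> R ^ n" by - (rule power_le_imp_le_base[of _ M], use R1 in auto)
  moreover have "norm y2 ^ (N + 1) \<le> (R ^ m) ^ (N + 1)" unfolding e TT_def by simp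
  then have "norm y2 \<le> R ^ m" by - (rule power_le_imp_le_base[of _ N], use R1 in auto)
  ultimately show ?thesis using that R1 RK by blast
qed

lemma monomial_le_TT:
  assumes "(i, j) \<in> J" "TT y1 y2 \<ge> 1"
  shows "norm y1 ^ i * norm y2 ^ j \<le> TT y1 y2"
proof -
  obtain R where R: "R \<ge> 1" "R ^ K = TT y1 y2" "norm y1 \<le> R ^ n" "norm y2 \<le> R ^ m" using weighted_radius[OF assms(2)] by blast
  have "norm y1 ^ i * norm y2 ^ j \<le> (R ^ n) ^ i * (R ^ m) ^ j"
    using R by (intro mult_mono power_mono) auto
  also have "\<dots> = R ^ (i * n + j * m)" by (simp add: power_add power_mult[symmetric] mult.commute)
  also have "\<dots> \<le> R ^ K" using R(1) J_weight[OF assms(1)] by (rule power_increasing[rotated])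
  finally show ?thesis using R(2) by simp
qed

text \<open>Monomials of \<open>idxI M N\<close> have weight at most \<open>K - 1\<close>, so they
  fall short of \<open>TT\<close> by a factor \<open>R\<close>, and
  \<open>R \<ge> 1 / \<eta>\<close>.\<close>

lemma monomial_small:
  assumes "(i, j) \<in> idxI M N" "\<eta> > 0" "\<eta> \<le> 1" "TT y1 y2 \<ge> (1 / \<eta>) ^ K"
  shows "norm y1 ^ i * norm y2 ^ j \<le> \<eta> * TT y1 y2"
proof -
  have K0: "K > 0" using K_split q_pos by simp
  have "(1 / \<eta>) ^ K \<ge> 1" using assms by (intro one_le_power) auto
  then have "TT y1 y2 \<ge> 1" using assms(4) by linarith
  then obtain R where R: "R \<ge> 1" "R ^ K = TT y1 y2" "norm y1 \<le> R ^ n" "norm y2 \<le> R ^ m" using weighted_radius by metis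
  have "1 / \<eta> \<le> R"
    by (rule power_le_imp_le_base[of "1 / \<eta>" "K - 1" R]) (use assms(4) K0 R(1,2) in auto)
  then have \<eta>R: "1 \<le> \<eta> * R" using assms(2) by (simp add: field_simps)
  have "norm y1 ^ i * norm y2 ^ j \<le> (R ^ n) ^ i * (R ^ m) ^ j"
    using R by (intro mult_mono power_mono) auto
  also have "\<dots> = R ^ (i * n + j * m)" by (simp add: power_add power_mult[symmetric] mult.commute)
  also have "\<dots> \<le> R ^ (K - 1)" using idxI_weight[OF assms(1)] by (intro power_increasing R) auto
  also have "\<dots> = 1 * R ^ (K - 1)" by simp
  also have "\<dots> \<le> (\<eta> * R) * R ^ (K - 1)" using \<eta>R R(1) by (intro mult_right_mono) auto
  also have "\<dots> = \<eta> * R ^ K" using power_minus_mult[OF K0, of R] by (simp add: mult_ac)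
  finally show ?thesis using R(2) by simp
qed

end

context local_hamiltonian
begin

definition h0 :: "complex \<Rightarrow> complex \<Rightarrow> complex" where
  "h0 y1 y2 = \<alpha> (M + 1) 0 zi * y1 ^ (M + 1) + \<alpha> 0 (N + 1) zi * y2 ^ (N + 1)"

lemma Rt_nonempty: "Rt \<noteq> {}"
proof -
  have "- (\<alpha> (M + 1) 0 zi / \<alpha> 0 (N + 1) zi) \<noteq> 0" using lead[OF zi] by simp
  then have "\<exists>c. c ^ (N + 1) = - (\<alpha> (M + 1) 0 zi / \<alpha> 0 (N + 1) zi)" by (rule exists_nth_root) simp
  then obtain c where "c ^ (N + 1) = - (\<alpha> (M + 1) 0 zi / \<alpha> 0 (N + 1) zi)" by blast
  then have "hh (A zi) 0 c = 0" unfolding hh_zero using lead[OF zi] by (simp del: power_Suc)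
  then show ?thesis unfolding Rt_def by blast
qed

text \<open>Outside a large disc \<open>|h|\<close> is at least 1 because of its leading term; in
  that disc, with the discs about the roots removed, it has a positive minimum by
  compactness.\<close>

lemma close_to_root:
  assumes e: "e > 0"
  shows "\<exists>\<delta>>0. \<forall>w. norm (hh (A zi) 0 w) < \<delta> \<longrightarrow> (\<exists>c\<in>Rt. norm (w - c) < e)"
proof -
  let ?a = "\<alpha> (M + 1) 0 zi" and ?b = "\<alpha> 0 (N + 1) zi"
  define B where "B = 1 + (norm ?a + 1) / norm ?b"
  have b: "norm ?b > 0" using lead(2)[OF zi] by simp
  have B1: "B \<ge> 1" unfolding B_def by simp
  have far: "norm (hh (A zi) 0 w) \<ge> 1" if "norm w > B" for w
  proof -
    have w1: "norm w \<ge> 1" using that B1 by simp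
    have "norm ?a + 1 \<le> norm ?b * B" unfolding B_def using b by (simp add: field_simps)
    also have "\<dots> \<le> norm ?b * norm w" using that by (intro mult_left_mono) auto
    also have "\<dots> \<le> norm ?b * norm w ^ (N + 1)" using w1 self_le_power[OF w1, of "N + 1"] by (intro mult_left_mono) auto
    also have "\<dots> = norm (?b * w ^ (N + 1))" by (simp add: norm_mult norm_power)
    also have "\<dots> \<le> norm (?a + ?b * w ^ (N + 1)) + norm ?a"
      using norm_triangle_ineq4[of "?a + ?b * w ^ (N + 1)" ?a] by simp
    finally show ?thesis unfolding hh_zero by simp
  qed
  let ?S = "cball 0 B \<inter> (\<Inter>c\<in>Rt. - ball c e)"
  have "compact ?S" by (intro compact_Int_closed compact_cball closed_INT ballI) (simp add: closed_Compl)
  moreover have c: "continuous_on ?S (\<lambda>w. norm (hh (A zi) 0 w))" unfolding hh_zero by (intro continuous_intros)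
  ultimately obtain \<mu> where \<mu>: "\<mu> > 0" "\<And>w. w \<in> ?S \<Longrightarrow> \<mu> \<le> norm (hh (A zi) 0 w)"
  proof (cases "?S = {}")
    case False
    then obtain s where s: "s \<in> ?S" "\<And>w. w \<in> ?S \<Longrightarrow> norm (hh (A zi) 0 s) \<le> norm (hh (A zi) 0 w)"
      using continuous_attains_inf[OF \<open>compact ?S\<close> False c] by blast
    have "s \<notin> Rt" using s(1) e by auto
    then have "norm (hh (A zi) 0 s) > 0" unfolding Rt_def by simp
    then show ?thesis using that s(2) by blast
  qed (use that[of 1] in auto)
  show ?thesis
  proof (intro exI[of _ "min \<mu> 1"] conjI allI impI)
    fix w assume w: "norm (hh (A zi) 0 w) < min \<mu> 1"
    then have "norm w \<le> B" using far[of w] by force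
    then show "\<exists>c\<in>Rt. norm (w - c) < e" using \<mu>(2)[of w] w by (force simp: dist_norm norm_minus_commute)
  qed (use \<mu> in simp)
qed

text \<open>Outside the cone \<open>|h0| < e1 |y1|^(M+1)\<close> the leading part \<open>h0\<close>
  controls both terms of \<open>TT\<close>, while the lower monomials and the variation of the
  leading coefficients are small against \<open>TT\<close>. Hence \<open>H\<close> has full size
  there and dominates its \<open>z\<close>-derivative. Multiplying out the cone condition includes
  the states with \<open>y1 = 0\<close>.\<close>

lemma growth:
  assumes e1: "e1 > 0"
  shows "\<exists>ez>0. \<exists>C5\<ge>1. \<exists>T1\<ge>1. \<forall>z y1 y2. norm (z - zi) < ez \<longrightarrow> TT y1 y2 \<ge> T1 \<longrightarrow>
     \<not> norm (h0 y1 y2) < e1 * norm y1 ^ (M + 1) \<longrightarrow> TT y1 y2 \<le> C5 * norm (Hm (A z) y1 y2) \<and>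
     norm (Hm (A' z) y1 y2) \<le> C5 * norm (Hm (A z) y1 y2)"
proof -
  let ?a = "\<alpha> (M + 1) 0" and ?b = "\<alpha> 0 (N + 1)"
  have JJ: "(M + 1, 0) \<in> J" "(0, N + 1) \<in> J" "idxI M N \<subseteq> J" unfolding J_def by auto
  have b: "norm (?b zi) > 0" using lead(2)[OF zi] by simp
  define k0 where "k0 = 1 / e1 + (1 + norm (?a zi) / e1) / norm (?b zi)"
  have k0: "k0 > 0" unfolding k0_def using e1 b by (intro add_pos_nonneg) auto
  have h0low: "TT y1 y2 \<le> k0 * norm (h0 y1 y2)" if "\<not> norm (h0 y1 y2) < e1 * norm y1 ^ (M + 1)" for y1 y2
  proof -
    have 1: "norm y1 ^ (M + 1) \<le> norm (h0 y1 y2) / e1" using that e1 by (simp add: field_simps)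
    have "norm (?b zi) * norm y2 ^ (N + 1) = norm (?b zi * y2 ^ (N + 1))" by (simp add: norm_mult norm_power)
    also have "\<dots> \<le> norm (h0 y1 y2) + norm (?a zi * y1 ^ (M + 1))"
      unfolding h0_def using norm_triangle_ineq4[of "?a zi * y1 ^ (M + 1) + ?b zi * y2 ^ (N + 1)" "?a zi * y1 ^ (M + 1)"] by simp
    also have "norm (?a zi * y1 ^ (M + 1)) = norm (?a zi) * norm y1 ^ (M + 1)" by (simp add: norm_mult norm_power)
    also have "norm (h0 y1 y2) + norm (?a zi) * norm y1 ^ (M + 1) \<le> norm (h0 y1 y2) + norm (?a zi) * (norm (h0 y1 y2) / e1)"
      using 1 by (intro add_left_mono mult_left_mono) auto
    also have "\<dots> = (1 + norm (?a zi) / e1) * norm (h0 y1 y2)" by (simp add: algebra_simps)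
    finally have "norm y2 ^ (N + 1) \<le> (1 + norm (?a zi) / e1) / norm (?b zi) * norm (h0 y1 y2)" using b by (simp add: field_simps)
    then show ?thesis unfolding TT_def k0_def using 1 by (simp add: algebra_simps)
  qed
  \<comment> \<open>The variation of the leading coefficients and the lower monomials each cost at
    most \<open>\<eta>0 * TT\<close>; together this is half of the lower bound
    \<open>TT / k0\<close> for \<open>|h0|\<close>.\<close>
  define \<eta>0 where "\<eta>0 = 1 / (4 * k0)"
  have \<eta>0: "\<eta>0 > 0" unfolding \<eta>0_def using k0 by simp
  have tends: "(f \<longlongrightarrow> f zi) (nhds zi)" if "f holomorphic_on U" for f :: "complex \<Rightarrow> complex"
    using holomorphic_on_imp_continuous_on[OF that] U zi continuous_on_eq_continuous_at
    by (auto simp: isCont_def tendsto_at_iff_tendsto_nhds)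
  have evb: "\<exists>B. eventually (\<lambda>z. norm (f z) \<le> B) (nhds zi)" if "f holomorphic_on U" for f
  proof -
    have "eventually (\<lambda>z. norm (f z) < norm (f zi) + 1) (nhds zi)"
      using tendsto_norm[OF tends[OF that]] by (rule order_tendstoD) simp
    then show ?thesis by (intro exI) (erule eventually_mono, erule less_imp_le)
  qed
  have "\<forall>k\<in>J. \<exists>B. eventually (\<lambda>z. norm (\<alpha> (fst k) (snd k) z) \<le> B \<and> norm (deriv (\<alpha> (fst k) (snd k)) z) \<le> B) (nhds zi)"
  proof
    fix k assume "k \<in> J"
    then have k: "(fst k, snd k) \<in> J" by simp
    obtain B1 B2 where "eventually (\<lambda>z. norm (\<alpha> (fst k) (snd k) z) \<le> B1) (nhds zi)"
       "eventually (\<lambda>z. norm (deriv (\<alpha> (fst k) (snd k)) z) \<le> B2) (nhds zi)"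
      using evb[OF hol\<alpha>[OF k]] evb[OF hol\<alpha>'[OF k]] by blast
    then have "eventually (\<lambda>z. norm (\<alpha> (fst k) (snd k) z) \<le> max B1 B2 \<and> norm (deriv (\<alpha> (fst k) (snd k)) z) \<le> max B1 B2) (nhds zi)"
      by eventually_elim auto
    then show "\<exists>B. eventually (\<lambda>z. norm (\<alpha> (fst k) (snd k) z) \<le> B \<and> norm (deriv (\<alpha> (fst k) (snd k)) z) \<le> B) (nhds zi)" by blast
  qed
  then obtain Bf where Bf: "\<And>k. k \<in> J \<Longrightarrow> eventually (\<lambda>z. norm (\<alpha> (fst k) (snd k) z) \<le> Bf k \<and> norm (deriv (\<alpha> (fst k) (snd k)) z) \<le> Bf k) (nhds zi)"
    by metis
  define B where "B = 1 + (\<Sum>k\<in>J. \<bar>Bf k\<bar>)"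
  have BfB: "Bf k \<le> B" if "k \<in> J" for k
    using member_le_sum[of k J "\<lambda>k. \<bar>Bf k\<bar>"] that finite_J unfolding B_def by simp
  have B1: "B \<ge> 1" unfolding B_def by (simp add: sum_nonneg)
  have "eventually (\<lambda>z. \<forall>k\<in>J. norm (\<alpha> (fst k) (snd k) z) \<le> Bf k \<and> norm (deriv (\<alpha> (fst k) (snd k)) z) \<le> Bf k) (nhds zi)"
    using Bf finite_J by (simp add: eventually_ball_finite)
  moreover have "eventually (\<lambda>z. dist (?a z) (?a zi) < \<eta>0) (nhds zi)" "eventually (\<lambda>z. dist (?b z) (?b zi) < \<eta>0) (nhds zi)"
    using tends[OF hol\<alpha>[OF JJ(1)]] tends[OF hol\<alpha>[OF JJ(2)]] \<eta>0 unfolding tendsto_iff by blast+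
  ultimately have "eventually (\<lambda>z. (\<forall>k\<in>J. norm (\<alpha> (fst k) (snd k) z) \<le> B \<and> norm (deriv (\<alpha> (fst k) (snd k)) z) \<le> B) \<and>
     norm (?a z - ?a zi) \<le> \<eta>0 \<and> norm (?b z - ?b zi) \<le> \<eta>0) (nhds zi)"
    by eventually_elim (use BfB order_trans in \<open>fastforce simp: dist_norm\<close>)
  then obtain ez where ez: "ez > 0" "\<And>z. norm (z - zi) < ez \<Longrightarrow> (\<forall>k\<in>J. norm (\<alpha> (fst k) (snd k) z) \<le> B \<and> norm (deriv (\<alpha> (fst k) (snd k)) z) \<le> B) \<and>
     norm (?a z - ?a zi) \<le> \<eta>0 \<and> norm (?b z - ?b zi) \<le> \<eta>0" unfolding eventually_nhds_metric dist_norm by blast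
  define cI where "cI = real (card (idxI M N)) + 1"
  have cI: "cI \<ge> 1" unfolding cI_def by simp
  define \<eta>1 where "\<eta>1 = min 1 (\<eta>0 / (cI * B))"
  have \<eta>1: "\<eta>1 > 0" "\<eta>1 \<le> 1" "cI * B * \<eta>1 \<le> \<eta>0"
  proof -
    show "\<eta>1 > 0" "\<eta>1 \<le> 1" unfolding \<eta>1_def using \<eta>0 cI B1 by auto
    have "\<eta>1 \<le> \<eta>0 / (cI * B)" unfolding \<eta>1_def by simp
    moreover have "cI * B > 0" using cI B1 by simp
    ultimately show "cI * B * \<eta>1 \<le> \<eta>0" by (simp add: field_simps)
  qed
  define T1 where "T1 = (1 / \<eta>1) ^ K"
  have T1: "T1 \<ge> 1" unfolding T1_def using \<eta>1 by (intro one_le_power) auto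
  define cJ where "cJ = real (card J) * B"
  define C5 where "C5 = max 1 (max (2 * k0) (cJ * (2 * k0)))"
  have C5: "C5 \<ge> 1" "2 * k0 \<le> C5" "cJ * (2 * k0) \<le> C5" unfolding C5_def by auto
  show ?thesis
  proof (rule exI[of _ ez], rule conjI[OF ez(1)], rule exI[of _ C5], rule conjI[OF C5(1)], rule exI[of _ T1], rule conjI[OF T1], intro allI impI conjI)
    fix z y1 y2 assume z: "norm (z - zi) < ez" and T: "T1 \<le> TT y1 y2" and o: "\<not> norm (h0 y1 y2) < e1 * norm y1 ^ (M + 1)"
    have T1': "TT y1 y2 \<ge> 1" using T T1 by simp
    have "Hm (A z) y1 y2 - h0 y1 y2 = (?a z - ?a zi) * y1 ^ (M + 1) + (?b z - ?b zi) * y2 ^ (N + 1) + (\<Sum>(i, j)\<in>idxI M N. \<alpha> i j z * y1 ^ i * y2 ^ j)"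
      unfolding Hm_def J_sum h0_def by (simp add: algebra_simps)
    then have "norm (Hm (A z) y1 y2 - h0 y1 y2) \<le> \<eta>0 * norm y1 ^ (M + 1) + \<eta>0 * norm y2 ^ (N + 1) + \<eta>0 * TT y1 y2"
    proof (rule norm_sum3_le)
      show "norm ((?a z - ?a zi) * y1 ^ (M + 1)) \<le> \<eta>0 * norm y1 ^ (M + 1)" "norm ((?b z - ?b zi) * y2 ^ (N + 1)) \<le> \<eta>0 * norm y2 ^ (N + 1)"
        unfolding norm_mult norm_power using ez(2)[OF z] by (intro mult_right_mono; simp)+
      have "norm (\<Sum>(i, j)\<in>idxI M N. \<alpha> i j z * y1 ^ i * y2 ^ j) \<le> (\<Sum>k\<in>idxI M N. B * (\<eta>1 * TT y1 y2))"
      proof (rule sum_norm_le, clarify)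
        fix i j assume ij: "(i, j) \<in> idxI M N"
        have "norm (\<alpha> i j z) \<le> B" using ez(2)[OF z] ij JJ(3) by force
        then have "norm (\<alpha> i j z) * (norm y1 ^ i * norm y2 ^ j) \<le> B * (\<eta>1 * TT y1 y2)"
          by (rule mult_mono[OF _ monomial_small[OF ij \<eta>1(1,2) T[unfolded T1_def]]]) (use B1 in auto)
        then show "norm (\<alpha> i j z * y1 ^ i * y2 ^ j) \<le> B * (\<eta>1 * TT y1 y2)"
          by (simp only: norm_mult norm_power mult.assoc)
      qed
      also have "\<dots> \<le> (cI * B * \<eta>1) * TT y1 y2" unfolding cI_def using B1 \<eta>1(1) T1' by (simp add: algebra_simps)
      also have "\<dots> \<le> \<eta>0 * TT y1 y2" using \<eta>1(3) T1' by (intro mult_right_mono) auto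
      finally show "norm (\<Sum>(i, j)\<in>idxI M N. \<alpha> i j z * y1 ^ i * y2 ^ j) \<le> \<eta>0 * TT y1 y2" .
    qed
    then have d: "norm (Hm (A z) y1 y2 - h0 y1 y2) \<le> 2 * \<eta>0 * TT y1 y2" unfolding TT_def by (simp add: algebra_simps)
    have "TT y1 y2 / k0 \<le> norm (h0 y1 y2)" using h0low[OF o] k0 by (simp add: field_simps)
    also have "\<dots> \<le> norm (Hm (A z) y1 y2) + 2 * \<eta>0 * TT y1 y2"
      using d norm_triangle_ineq4[of "Hm (A z) y1 y2" "Hm (A z) y1 y2 - h0 y1 y2"] by simp
    finally have HT: "TT y1 y2 \<le> 2 * k0 * norm (Hm (A z) y1 y2)" unfolding \<eta>0_def using k0 by (simp add: field_simps)
    also have "\<dots> \<le> C5 * norm (Hm (A z) y1 y2)" using C5 by (intro mult_right_mono) auto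
    finally show "TT y1 y2 \<le> C5 * norm (Hm (A z) y1 y2)" .
    have "norm (Hm (A' z) y1 y2) \<le> (\<Sum>k\<in>J. B * TT y1 y2)" unfolding Hm_def
    proof (rule sum_norm_le, clarify)
      fix i j assume ij: "(i, j) \<in> J"
      have "norm (deriv (\<alpha> i j) z) \<le> B" using ez(2)[OF z] ij by force
      then have "norm (deriv (\<alpha> i j) z) * (norm y1 ^ i * norm y2 ^ j) \<le> B * TT y1 y2"
        by (rule mult_mono[OF _ monomial_le_TT[OF ij T1']]) (use B1 in auto)
      then show "norm (deriv (\<alpha> i j) z * y1 ^ i * y2 ^ j) \<le> B * TT y1 y2"
        by (simp only: norm_mult norm_power mult.assoc)
    qed
    also have "\<dots> = cJ * TT y1 y2" unfolding cJ_def by simp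
    also have "\<dots> \<le> cJ * (2 * k0 * norm (Hm (A z) y1 y2))" using HT B1 unfolding cJ_def by (intro mult_left_mono) auto
    also have "\<dots> \<le> C5 * norm (Hm (A z) y1 y2)"
      using mult_right_mono[OF C5(3), of "norm (Hm (A z) y1 y2)"] by (simp add: mult_ac)
    finally show "norm (Hm (A' z) y1 y2) \<le> C5 * norm (Hm (A z) y1 y2)" .
  qed
qed

end

section \<open>A bounded function along solutions\<close>

lemma
  fixes h y :: complex
  assumes "y \<noteq> 0"
  shows norm_quotient_power_less: "norm (h / y ^ k) < c \<longleftrightarrow> norm h < c * norm y ^ k"
    and le_norm_quotient_power: "c * norm y ^ k < norm h \<Longrightarrow> c \<le> norm (h / y ^ k)"
    and norm_quotient_power_le: "norm h < c * norm y ^ k \<Longrightarrow> norm (h / y ^ k) \<le> c"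
  using assms by (auto simp: norm_divide norm_power field_simps)

lemma affine_power_deriv:
  fixes X :: "complex \<Rightarrow> complex"
  assumes "(X has_field_derivative X') (at z)"
  shows "((\<lambda>x. a + b * X x ^ (k + 1)) has_field_derivative b * (of_nat (k + 1) * X z ^ k * X')) (at z)"
proof -
  have "((\<lambda>x. X x ^ (k + 1)) has_field_derivative of_nat (k + 1) * (X' * X z ^ (k + 1 - Suc 0))) (at z)"
    by (rule DERIV_power[OF assms])
  from DERIV_add[OF DERIV_const[of a] DERIV_cmult[OF this, of b]] show ?thesis by (simp add: mult_ac del: power_Suc)
qed

text \<open>The constants in their order of dependence: \<open>e\<close> and \<open>C\<close> belong
  to the roots, \<open>e1\<close> makes a small \<open>h\<close> imply a nearby root,
  \<open>ez\<close> and \<open>C5\<close> come from the growth estimate, and \<open>T0\<close> is so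
  large that in the cone of opening \<open>3 * e1\<close> every branch \<open>\<tau>\<close> is
  small. The cutoff acts between \<open>e1\<close> and \<open>2 * e1\<close>; up to
  \<open>3 * e1\<close> a nearby root still exists.\<close>

locale phase = local_hamiltonian +
  fixes e C e1 ez C4 C5 T0 :: real
  assumes nr: "\<And>c. c \<in> Rt \<Longrightarrow> near c e C" and sep: "\<And>c c'. c \<in> Rt \<Longrightarrow> c' \<in> Rt \<Longrightarrow> c \<noteq> c' \<Longrightarrow> 2 * e \<le> norm (c - c')"
    and pos: "e1 > 0" "ez > 0" "ez \<le> e" "C5 \<ge> 1" "T0 \<ge> 1"
    and rootc: "\<And>w. norm (hh (A zi) 0 w) < 3 * e1 \<Longrightarrow> \<exists>c\<in>Rt. norm (w - c) < e"
    and grow: "\<And>z y1 y2. norm (z - zi) < ez \<Longrightarrow> TT y1 y2 \<ge> T0 \<Longrightarrow> \<not> norm (h0 y1 y2) < e1 * norm y1 ^ (M + 1) \<Longrightarrow>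
       TT y1 y2 \<le> C5 * norm (Hm (A z) y1 y2) \<and> norm (Hm (A' z) y1 y2) \<le> C5 * norm (Hm (A z) y1 y2)"
    and small: "\<And>y1 y2 \<tau>. TT y1 y2 \<ge> T0 \<Longrightarrow> norm (h0 y1 y2) < 3 * e1 * norm y1 ^ (M + 1) \<Longrightarrow> \<tau> ^ n * y1 = 1 \<Longrightarrow>
       norm \<tau> < e \<and> norm \<tau> \<le> 1 \<and> 2 * (C * C5) * norm \<tau> ^ q \<le> 1 \<and> norm \<tau> ^ K * TT y1 y2 \<le> C4"

lemma (in local_hamiltonian) phase_exists:
  "\<exists>e C e1 ez C4 C5 T0. phase M N d n m q K \<alpha> U zi e C e1 ez C4 C5 T0"
proof -
  obtain e C where e: "\<And>c. c \<in> Rt \<Longrightarrow> near c e C" "\<And>c c'. c \<in> Rt \<Longrightarrow> c' \<in> Rt \<Longrightarrow> c \<noteq> c' \<Longrightarrow> 2 * e \<le> norm (c - c')"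
    using near_uniform by blast
  have eC: "e > 0" "C \<ge> 1" using e(1) Rt_nonempty unfolding near_def by auto
  obtain de where de: "de > 0" "\<And>w. norm (hh (A zi) 0 w) < de \<Longrightarrow> \<exists>c\<in>Rt. norm (w - c) < e" using close_to_root[OF eC(1)] by blast
  define e1 where "e1 = de / 3"
  have e1: "e1 > 0" "3 * e1 = de" unfolding e1_def using de by auto
  obtain ez C5 T1 where g: "ez > 0" "C5 \<ge> 1" "T1 \<ge> 1" "\<And>z y1 y2. norm (z - zi) < ez \<Longrightarrow> TT y1 y2 \<ge> T1 \<Longrightarrow>
     \<not> norm (h0 y1 y2) < e1 * norm y1 ^ (M + 1) \<Longrightarrow> TT y1 y2 \<le> C5 * norm (Hm (A z) y1 y2) \<and>
     norm (Hm (A' z) y1 y2) \<le> C5 * norm (Hm (A z) y1 y2)"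
    using growth[OF e1(1)] by blast
  let ?a = "\<alpha> (M + 1) 0 zi" and ?b = "\<alpha> 0 (N + 1) zi"
  have b: "norm ?b > 0" using lead(2)[OF zi] by simp
  define C4 where "C4 = 1 + (norm ?a + 3 * e1) / norm ?b"
  have C4: "C4 > 0" unfolding C4_def using b e1 by (intro add_pos_nonneg) auto
  define t0 where "t0 = min e (min 1 (1 / (2 * (C * C5))))"
  have CC: "C * C5 > 0" using eC g(2) by simp
  have t0: "t0 > 0" "t0 \<le> e" "t0 \<le> 1" "2 * (C * C5) * t0 \<le> 1"
  proof -
    show "t0 > 0" "t0 \<le> e" "t0 \<le> 1" unfolding t0_def using eC CC by auto
    have "t0 \<le> 1 / (2 * (C * C5))" unfolding t0_def by simp
    then show "2 * (C * C5) * t0 \<le> 1" using CC by (simp add: field_simps)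
  qed
  \<comment> \<open>In the cone \<open>|\<tau>|^K TT \<le> C4\<close>, so
    \<open>TT > C4 / t0^K\<close> forces \<open>|\<tau>| < t0\<close>.\<close>
  define T0 where "T0 = max T1 (C4 / t0 ^ K + 1)"
  have T0: "T0 \<ge> 1" "T0 \<ge> T1" "T0 > C4 / t0 ^ K" unfolding T0_def using g(3) by auto
  have sm: "norm \<tau> < e \<and> norm \<tau> \<le> 1 \<and> 2 * (C * C5) * norm \<tau> ^ q \<le> 1 \<and> norm \<tau> ^ K * TT y1 y2 \<le> C4"
    if T: "TT y1 y2 \<ge> T0" and I: "norm (h0 y1 y2) < 3 * e1 * norm y1 ^ (M + 1)" and t: "\<tau> ^ n * y1 = 1" for y1 y2 \<tau>
  proof -
    have "norm ?b * norm y2 ^ (N + 1) = norm (?b * y2 ^ (N + 1))" by (simp add: norm_mult norm_power)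
    also have "\<dots> \<le> norm (h0 y1 y2) + norm (?a * y1 ^ (M + 1))"
      unfolding h0_def using norm_triangle_ineq4[of "?a * y1 ^ (M + 1) + ?b * y2 ^ (N + 1)" "?a * y1 ^ (M + 1)"] by simp
    also have "norm (?a * y1 ^ (M + 1)) = norm ?a * norm y1 ^ (M + 1)" by (simp add: norm_mult norm_power)
    finally have "norm ?b * norm y2 ^ (N + 1) \<le> (norm ?a + 3 * e1) * norm y1 ^ (M + 1)"
      using I unfolding distrib_right by linarith
    then have "norm y2 ^ (N + 1) \<le> (norm ?a + 3 * e1) / norm ?b * norm y1 ^ (M + 1)" using b by (simp add: field_simps)
    then have TC: "TT y1 y2 \<le> C4 * norm y1 ^ (M + 1)" unfolding TT_def C4_def by (simp add: algebra_simps)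
    have "\<tau> ^ K * y1 ^ (M + 1) = (\<tau> ^ n * y1) ^ (M + 1)" unfolding K_eq power_mult power_mult_distrib ..
    then have "norm (\<tau> ^ K * y1 ^ (M + 1)) = 1" unfolding t by simp
    then have 1: "norm \<tau> ^ K * norm y1 ^ (M + 1) = 1" by (simp add: norm_mult norm_power)
    have "norm \<tau> ^ K * TT y1 y2 \<le> norm \<tau> ^ K * (C4 * norm y1 ^ (M + 1))" using TC by (intro mult_left_mono) auto
    also have "\<dots> = C4 * (norm \<tau> ^ K * norm y1 ^ (M + 1))" by simp
    finally have 2: "norm \<tau> ^ K * TT y1 y2 \<le> C4" unfolding 1 by simp
    have lt: "norm \<tau> < t0"
    proof (rule ccontr)
      assume "\<not> norm \<tau> < t0"
      then have "t0 ^ K \<le> norm \<tau> ^ K" using t0 by (intro power_mono) auto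
      then have "t0 ^ K * T0 \<le> norm \<tau> ^ K * TT y1 y2" using T T0 t0 by (intro mult_mono) auto
      then show False using 2 T0(3) t0(1) by (simp add: field_simps)
    qed
    have "norm \<tau> ^ q \<le> norm \<tau> ^ 1" using lt t0 q_pos by (intro power_decreasing) auto
    then have "2 * (C * C5) * norm \<tau> ^ q \<le> 2 * (C * C5) * t0" using lt CC by (intro mult_left_mono) auto
    then show ?thesis using lt t0 2 by auto
  qed
  have "phase M N d n m q K \<alpha> U zi e C e1 (min e ez) C4 C5 T0"
  proof (unfold_locales)
    fix w assume "norm (hh (A zi) 0 w) < 3 * e1" then show "\<exists>c\<in>Rt. norm (w - c) < e" using de(2) e1(2) by simp
  next
    fix z y1 y2 assume "norm (z - zi) < min e ez" "TT y1 y2 \<ge> T0" "\<not> norm (h0 y1 y2) < e1 * norm y1 ^ (M + 1)"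
    then show "TT y1 y2 \<le> C5 * norm (Hm (A z) y1 y2) \<and> norm (Hm (A' z) y1 y2) \<le> C5 * norm (Hm (A z) y1 y2)"
      using T0 by (intro g(4)) auto
  qed (use e e1 g T0 eC sm in auto)
  then show ?thesis by blast
qed

context phase
begin

lemma eC: "e > 0" "C \<ge> 1"
  using nr Rt_nonempty unfolding near_def by auto

definition sel where "sel w = (SOME c. c \<in> Rt \<and> norm (w - c) < e)"

lemma sel_eq: "c \<in> Rt \<Longrightarrow> norm (w - c) < e \<Longrightarrow> sel w = c"
proof -
  assume c: "c \<in> Rt" "norm (w - c) < e"
  have "sel w \<in> Rt \<and> norm (w - sel w) < e" unfolding sel_def by (rule someI[of _ c]) (use c in simp)
  moreover have "norm (c - sel w) \<le> norm (w - c) + norm (w - sel w)"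
    using norm_triangle_ineq4[of "w - sel w" "w - c"] by simp
  ultimately show ?thesis using sep[OF c(1), of "sel w"] c(2) by fastforce
qed

text \<open>\<open>ph2\<close> runs over all branches because the state singles out none of them;
  the factor \<open>n\<close> makes \<open>ph1\<close> comparable with a sum of \<open>n\<close>
  terms.\<close>

definition ph1 where "ph1 z y1 y2 = real n * ln (1 + norm (Hm (A z) y1 y2))"
definition ph2 where "ph2 z y1 y2 = (\<Sum>\<tau>\<in>{\<tau>. \<tau> ^ n * y1 = 1}. ln (1 + norm (Wf (sel (y2 * \<tau> ^ m)) z \<tau> (y2 * \<tau> ^ m))))"
text \<open>The case distinction precedes the quotient because at \<open>y1 = 0\<close> division by
  zero would give the value 0 and so the cutoff 1. Between \<open>2 * e1\<close> and
  \<open>3 * e1\<close> the cutoff vanishes, so the two cases join without a jump.\<close>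

definition Ph where "Ph z y1 y2 = (if norm (h0 y1 y2) < 3 * e1 * norm y1 ^ (M + 1)
   then ph1 z y1 y2 + cutoff e1 (norm (h0 y1 y2 / y1 ^ (M + 1))) * (ph2 z y1 y2 - ph1 z y1 y2) else ph1 z y1 y2)"

lemma h0_branch:
  assumes "\<tau> ^ n * y1 = 1"
  shows "h0 y1 y2 = y1 ^ (M + 1) * hh (A zi) 0 (y2 * \<tau> ^ m)"
proof -
  have "(y2 * \<tau> ^ m) ^ (N + 1) * y1 ^ (M + 1) = y2 ^ (N + 1) * (\<tau> ^ K * y1 ^ (M + 1))"
    unfolding K_eq' power_mult power_mult_distrib by (simp only: mult_ac)
  also have "\<tau> ^ K * y1 ^ (M + 1) = (\<tau> ^ n * y1) ^ (M + 1)" unfolding K_eq power_mult power_mult_distrib ..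
  finally have "y1 ^ (M + 1) * (y2 * \<tau> ^ m) ^ (N + 1) = y2 ^ (N + 1)" unfolding assms by (simp add: mult.commute)
  note eq = this
  have "y1 ^ (M + 1) * (a + b * (y2 * \<tau> ^ m) ^ (N + 1)) = a * y1 ^ (M + 1) + b * (y1 ^ (M + 1) * (y2 * \<tau> ^ m) ^ (N + 1))" for a b
    by (simp only: distrib_left mult_ac)
  then show ?thesis unfolding h0_def hh_zero eq by simp
qed

lemma branch_facts:
  assumes T: "TT y1 y2 \<ge> T0" and I: "norm (h0 y1 y2) < 3 * e1 * norm y1 ^ (M + 1)" and t: "\<tau> ^ n * y1 = 1"
  shows "sel (y2 * \<tau> ^ m) \<in> Rt" "norm (y2 * \<tau> ^ m - sel (y2 * \<tau> ^ m)) < e" "norm \<tau> < e" "\<tau> \<noteq> 0" "y1 \<noteq> 0"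
    "h0 y1 y2 / y1 ^ (M + 1) = hh (A zi) 0 (y2 * \<tau> ^ m)"
proof -
  show y: "y1 \<noteq> 0" "\<tau> \<noteq> 0" using t n_pos by (auto simp: zero_power)
  show q: "h0 y1 y2 / y1 ^ (M + 1) = hh (A zi) 0 (y2 * \<tau> ^ m)" unfolding h0_branch[OF t] using y by simp
  have "norm (hh (A zi) 0 (y2 * \<tau> ^ m)) < 3 * e1"
    unfolding q[symmetric] using I by (rule norm_quotient_power_less[OF y(1), THEN iffD2])
  then obtain c where "c \<in> Rt" "norm (y2 * \<tau> ^ m - c) < e" using rootc by blast
  then show "sel (y2 * \<tau> ^ m) \<in> Rt" "norm (y2 * \<tau> ^ m - sel (y2 * \<tau> ^ m)) < e" using sel_eq by auto
  show "norm \<tau> < e" using small[OF T I t] by blast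
qed

lemma roots_card:
  assumes "y1 \<noteq> (0::complex)" shows "finite {\<tau>. \<tau> ^ n * y1 = 1}" "card {\<tau>. \<tau> ^ n * y1 = 1} = n"
proof -
  have "{\<tau>. \<tau> ^ n * y1 = 1} = {\<tau>. \<tau> ^ n = inverse y1}" using assms by (auto simp: field_simps)
  then show "finite {\<tau>. \<tau> ^ n * y1 = 1}" "card {\<tau>. \<tau> ^ n * y1 = 1} = n"
    using finite_nth_roots[OF n_pos] card_nth_roots[OF _ n_pos, of "inverse y1"] assms by auto
qed

lemma near_facts:
  assumes "c \<in> Rt" "norm (z - zi) < ez" "norm \<tau> < e" "norm (w - c) < e"
  shows "z \<in> U" "norm (w - Ps c z \<tau>) \<le> C * norm (hh (A z) \<tau> w - hh (A z) \<tau> (Ps c z \<tau>))"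
     "norm (hh_dd (A' z) \<tau> w (Ps c z \<tau>) + dz (Ps c) z \<tau> * hw_dd (A z) \<tau> w (Ps c z \<tau>)) \<le> C"
     "norm (Eop (Ps c) z \<tau>) \<le> C * norm \<tau> ^ (K + q)" "norm (hw (A z) \<tau> w) \<le> C" "hw (A z) \<tau> w \<noteq> 0"
     "norm (Dh (A z) \<tau> w) \<le> C" "norm (hh (A z) \<tau> (Ps c z \<tau>)) \<le> C * norm \<tau> ^ q"
proof -
  have "norm (z - zi) < e" using assms(2) pos(3) by simp
  then show "z \<in> U" "norm (w - Ps c z \<tau>) \<le> C * norm (hh (A z) \<tau> w - hh (A z) \<tau> (Ps c z \<tau>))"
     "norm (hh_dd (A' z) \<tau> w (Ps c z \<tau>) + dz (Ps c) z \<tau> * hw_dd (A z) \<tau> w (Ps c z \<tau>)) \<le> C"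
     "norm (Eop (Ps c) z \<tau>) \<le> C * norm \<tau> ^ (K + q)" "norm (hw (A z) \<tau> w) \<le> C" "hw (A z) \<tau> w \<noteq> 0"
     "norm (Dh (A z) \<tau> w) \<le> C" "norm (hh (A z) \<tau> (Ps c z \<tau>)) \<le> C * norm \<tau> ^ q"
    using nr[OF assms(1)] assms(3,4) unfolding near_def by blast+
qed

text \<open>For an exact solution two terms survive: one proportional to
  \<open>(w - P) / \<tau>^K\<close>, bounded through \<open>|W|\<close> since the root is simple,
  and \<open>\<tau>' Eop / \<tau>^(K+1)\<close>, which is bounded because
  \<open>\<tau>' = O(\<tau>^(1-q))\<close> meets \<open>Eop = O(\<tau>^(K+q))\<close>.\<close>

lemma Wf_deriv_bound:
  assumes c: "c \<in> Rt" and z: "norm (z - zi) < ez" and t: "norm (T z) < e" "T z \<noteq> 0" and w: "norm (X z - c) < e"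
    and T: "(T has_field_derivative T') (at z)" and X: "(X has_field_derivative X') (at z)"
    and eT: "of_nat n * T z ^ q * T' = - (T z * hw (A z) (T z) (X z))"
    and eX: "of_nat n * T z ^ q * X' = - Dh (A z) (T z) (X z)"
  shows "\<exists>D. ((\<lambda>x. Wf c x (T x) (X x)) has_field_derivative D) (at z) \<and> norm D \<le> C\<^sup>2 * (1 + norm (Wf c z (T z) (X z)))"
proof -
  note nf = near_facts[OF c z t(1) w]
  obtain E1 Q1 where s: "PH U (Ps c)" using Ps_surface[OF c] unfolding is_surface_def by blast
  let ?P = "Ps c z (T z)"
  let ?b = "hh_dd (A' z) (T z) (X z) ?P + dz (Ps c) z (T z) * hw_dd (A z) (T z) (X z) ?P"
  let ?D = "(T z * 1 * ((X z - ?P) * ?b) + T' * Eop (Ps c) z (T z)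
       + (0 * T z * hw (A z) (T z) (X z) - 0 * Dh (A z) (T z) (X z)) / (of_nat n * T z ^ q) - dz (Ps c) z (T z) * 0) / T z ^ (K + 1)"
  have D: "((\<lambda>x. Wf c x (T x) (X x)) has_field_derivative ?D) (at z)"
    unfolding Wf_def
    by (rule surface_deviation_deriv[OF s DERIV_ident T X nf(1) t(2)]) (use eT eX in simp_all)
  have De: "?D = (X z - ?P) / T z ^ K * ?b + T' * Eop (Ps c) z (T z) / T z ^ (K + 1)"
    using t(2) by (simp add: add_divide_distrib)
  have "norm ((X z - ?P) / T z ^ K) \<le> C * norm (Wf c z (T z) (X z))"
    unfolding Wf_def norm_divide norm_power using nf(2) by (simp add: divide_right_mono)
  then have 1: "norm ((X z - ?P) / T z ^ K * ?b) \<le> (C * norm (Wf c z (T z) (X z))) * C"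
    unfolding norm_mult using nf(3) eC by (intro mult_mono) auto
  have 2: "norm (T' * Eop (Ps c) z (T z) / T z ^ (K + 1)) \<le> C\<^sup>2"
  proof -
    have "norm (of_nat n * T z ^ q * T') = norm (T z * hw (A z) (T z) (X z))" unfolding eT by simp
    then have a: "real n * (norm (T z) ^ q * norm T') = norm (T z) * norm (hw (A z) (T z) (X z))"
      by (simp add: norm_mult norm_power mult_ac)
    have "1 * (norm (T z) ^ q * norm T') \<le> real n * (norm (T z) ^ q * norm T')" using n_pos by (intro mult_right_mono) auto
    then have b: "norm (T z) ^ q * norm T' \<le> norm (T z) * C"
      unfolding a using nf(5) by (smt (verit) mult_left_mono norm_ge_zero)
    have "norm (T' * Eop (Ps c) z (T z)) \<le> norm T' * (C * norm (T z) ^ (K + q))"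
      unfolding norm_mult using nf(4) by (intro mult_left_mono) auto
    also have "\<dots> = C * norm (T z) ^ K * (norm (T z) ^ q * norm T')" by (simp add: power_add mult_ac)
    also have "\<dots> \<le> C * norm (T z) ^ K * (norm (T z) * C)" using b eC by (intro mult_left_mono) auto
    also have "\<dots> = C\<^sup>2 * norm (T z ^ (K + 1))" by (simp add: norm_mult norm_power power2_eq_square mult_ac)
    finally show ?thesis using t(2) by (simp add: norm_divide divide_le_eq)
  qed
  have "norm ?D \<le> (C * norm (Wf c z (T z) (X z))) * C + C\<^sup>2"
    unfolding De using norm_triangle_mono[OF 1 2] .
  also have "\<dots> = C\<^sup>2 * (1 + norm (Wf c z (T z) (X z)))" by (simp add: power2_eq_square algebra_simps)
  finally show ?thesis using D by blast
qed

context
  fixes z y1 y2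
  assumes z: "norm (z - zi) < ez"
    and d1: "(y1 has_field_derivative rhs1 (A z) M N (y1 z) (y2 z)) (at z)"
    and d2: "(y2 has_field_derivative rhs2 (A z) M N (y1 z) (y2 z)) (at z)"
    and TT: "TT (y1 z) (y2 z) \<ge> T0"
begin

lemma z_in_U: "z \<in> U"
proof -
  obtain c where "c \<in> Rt" using Rt_nonempty by blast
  from near_facts(1)[OF this z, of 0 c] eC show ?thesis by simp
qed

lemma tends_y: "(y1 \<longlongrightarrow> y1 z) (nhds z)" "(y2 \<longlongrightarrow> y2 z) (nhds z)"
  using DERIV_isCont[OF d1] DERIV_isCont[OF d2] by (simp_all add: isCont_def tendsto_at_iff_tendsto_nhds)

text \<open>The \<open>n\<close> roots \<open>\<tau>\<close> at \<open>z\<close> continue to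
  \<open>n\<close> holomorphic branches that stay distinct near \<open>z\<close>; by counting they
  are all the roots, and the root of \<open>h\<close> selected on each does not change. So
  \<open>ph2\<close> is locally a fixed sum of logarithms of the kind treated by
  \<open>calm_ln\<close>.\<close>

lemma ph2_calm:
  assumes I: "norm (h0 (y1 z) (y2 z)) < 3 * e1 * norm (y1 z) ^ (M + 1)"
  shows "calm (\<lambda>x. ph2 x (y1 x) (y2 x)) z (real n * (2 * (C\<^sup>2 + 1)))"
proof -
  let ?R = "{\<tau>. \<tau> ^ n * y1 z = 1}"
  have ynz: "y1 z \<noteq> 0" using I by auto
  have "\<forall>t\<in>?R. \<exists>p. fst p z = t \<and> eventually (\<lambda>x. fst p x ^ n * y1 x = 1) (nhds z) \<and> (fst p has_field_derivative fst (snd p)) (at z) \<and>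
    ((\<lambda>x. y2 x * fst p x ^ m) has_field_derivative snd (snd p)) (at z) \<and>
    of_nat n * t ^ q * fst (snd p) = - (t * hw (A z) t (y2 z * t ^ m)) \<and>
    of_nat n * t ^ q * snd (snd p) = - Dh (A z) t (y2 z * t ^ m)"
  proof
    fix t assume "t \<in> ?R"
    then have t: "t ^ n * y1 z = 1" by simp
    obtain Tb T' X' where "Tb z = t" "eventually (\<lambda>x. Tb x ^ n * y1 x = 1) (nhds z)"
          "(Tb has_field_derivative T') (at z)" "((\<lambda>x. y2 x * Tb x ^ m) has_field_derivative X') (at z)"
          "of_nat n * t ^ q * T' = - (t * hw (A z) t (y2 z * t ^ m))"
          "of_nat n * t ^ q * X' = - Dh (A z) t (y2 z * t ^ m)"
      by (rule exact_branch[OF d1 d2 t]) (rule that)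
    then show "\<exists>p. fst p z = t \<and> eventually (\<lambda>x. fst p x ^ n * y1 x = 1) (nhds z) \<and> (fst p has_field_derivative fst (snd p)) (at z) \<and>
    ((\<lambda>x. y2 x * fst p x ^ m) has_field_derivative snd (snd p)) (at z) \<and>
    of_nat n * t ^ q * fst (snd p) = - (t * hw (A z) t (y2 z * t ^ m)) \<and>
    of_nat n * t ^ q * snd (snd p) = - Dh (A z) t (y2 z * t ^ m)"
      by (intro exI[of _ "(Tb, T', X')"]) simp
  qed
  from bchoice[OF this] obtain f where f: "\<forall>t\<in>?R. fst (f t) z = t \<and> eventually (\<lambda>x. fst (f t) x ^ n * y1 x = 1) (nhds z) \<and> (fst (f t) has_field_derivative fst (snd (f t))) (at z) \<and>
    ((\<lambda>x. y2 x * fst (f t) x ^ m) has_field_derivative snd (snd (f t))) (at z) \<and>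
    of_nat n * t ^ q * fst (snd (f t)) = - (t * hw (A z) t (y2 z * t ^ m)) \<and>
    of_nat n * t ^ q * snd (snd (f t)) = - Dh (A z) t (y2 z * t ^ m)" ..
  define T where "T t = fst (f t)" for t
  define T' where "T' t = fst (snd (f t))" for t
  define X' where "X' t = snd (snd (f t))" for t
  have T: "T t z = t" "eventually (\<lambda>x. T t x ^ n * y1 x = 1) (nhds z)" "(T t has_field_derivative T' t) (at z)"
    "((\<lambda>x. y2 x * T t x ^ m) has_field_derivative X' t) (at z)"
    "of_nat n * t ^ q * T' t = - (t * hw (A z) t (y2 z * t ^ m))"
    "of_nat n * t ^ q * X' t = - Dh (A z) t (y2 z * t ^ m)" if "t \<in> ?R" for t
    using bspec[OF f that] unfolding T_def T'_def X'_def by blast+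
  have fin: "finite ?R" and card: "card ?R = n" using roots_card[OF ynz] by auto
  define c where "c t = sel (y2 z * t ^ m)" for t
  have c: "c t \<in> Rt" "norm (y2 z * t ^ m - c t) < e" "norm t < e" "t \<noteq> 0" if "t \<in> ?R" for t
    using branch_facts[OF TT I] that unfolding c_def by auto
  have tT: "(T t \<longlongrightarrow> t) (nhds z)" if "t \<in> ?R" for t
    using DERIV_isCont[OF T(3)[OF that], unfolded isCont_def tendsto_at_iff_tendsto_nhds] T(1)[OF that] by simp
  have "\<forall>t\<in>?R. eventually (\<lambda>x. T t x ^ n * y1 x = 1 \<and> norm (y2 x * T t x ^ m - c t) < e \<and> (\<forall>s\<in>?R. s \<noteq> t \<longrightarrow> T t x \<noteq> T s x)) (nhds z)"
  proof
    fix t assume t: "t \<in> ?R"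
    have "((\<lambda>x. norm (y2 x * T t x ^ m - c t)) \<longlongrightarrow> norm (y2 z * t ^ m - c t)) (nhds z)"
      by (intro tendsto_intros tends_y tT t)
    then have 1: "eventually (\<lambda>x. norm (y2 x * T t x ^ m - c t) < e) (nhds z)" using c(2)[OF t] by (rule order_tendstoD)
    have "eventually (\<lambda>x. s \<noteq> t \<longrightarrow> T t x \<noteq> T s x) (nhds z)" if s: "s \<in> ?R" for s
    proof (cases "s = t")
      case False
      have "((\<lambda>x. T t x - T s x) \<longlongrightarrow> t - s) (nhds z)" by (intro tendsto_intros tT t s)
      then have "eventually (\<lambda>x. T t x - T s x \<noteq> 0) (nhds z)" by (rule tendsto_imp_eventually_ne) (use False in simp)
      then show ?thesis by eventually_elim auto
    qed simp
    then have "eventually (\<lambda>x. \<forall>s\<in>?R. s \<noteq> t \<longrightarrow> T t x \<noteq> T s x) (nhds z)"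
      by (intro eventually_ball_finite[OF fin] ballI)
    with T(2)[OF t] 1 show "eventually (\<lambda>x. T t x ^ n * y1 x = 1 \<and> norm (y2 x * T t x ^ m - c t) < e \<and> (\<forall>s\<in>?R. s \<noteq> t \<longrightarrow> T t x \<noteq> T s x)) (nhds z)"
      by eventually_elim auto
  qed
  then have "eventually (\<lambda>x. \<forall>t\<in>?R. T t x ^ n * y1 x = 1 \<and> norm (y2 x * T t x ^ m - c t) < e \<and> (\<forall>s\<in>?R. s \<noteq> t \<longrightarrow> T t x \<noteq> T s x)) (nhds z)"
    by (rule eventually_ball_finite[OF fin])
  moreover have "eventually (\<lambda>x. y1 x \<noteq> 0) (nhds z)" using tends_y(1) ynz by (rule tendsto_imp_eventually_ne)
  ultimately have eq: "eventually (\<lambda>x. ph2 x (y1 x) (y2 x) = (\<Sum>t\<in>?R. ln (1 + norm (Wf (c t) x (T t x) (y2 x * T t x ^ m))))) (nhds z)"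
  proof eventually_elim
    case (elim x)
    have inj: "inj_on (\<lambda>t. T t x) ?R" using elim(1) by (auto simp: inj_on_def)
    have "(\<lambda>t. T t x) ` ?R \<subseteq> {\<tau>. \<tau> ^ n * y1 x = 1}" using elim(1) by auto
    then have im: "(\<lambda>t. T t x) ` ?R = {\<tau>. \<tau> ^ n * y1 x = 1}"
      using roots_card[OF elim(2)] card_image[OF inj] card by (intro card_subset_eq) auto
    show ?case unfolding ph2_def im[symmetric] sum.reindex[OF inj] o_def
    proof (intro sum.cong refl)
      fix t assume t: "t \<in> ?R"
      have "sel (y2 x * T t x ^ m) = c t" using elim(1) t c(1)[OF t] by (intro sel_eq) auto
      then show "ln (1 + norm (Wf (sel (y2 x * T t x ^ m)) x (T t x) (y2 x * T t x ^ m))) = ln (1 + norm (Wf (c t) x (T t x) (y2 x * T t x ^ m)))" by simp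
    qed
  qed
  have "calm (\<lambda>x. \<Sum>t\<in>?R. ln (1 + norm (Wf (c t) x (T t x) (y2 x * T t x ^ m)))) z (real (card ?R) * (2 * (C\<^sup>2 + 1)))"
  proof (rule calm_sum)
    fix t assume t: "t \<in> ?R"
    obtain D where D: "((\<lambda>x. Wf (c t) x (T t x) (y2 x * T t x ^ m)) has_field_derivative D) (at z)"
      "norm D \<le> C\<^sup>2 * (1 + norm (Wf (c t) z (T t z) (y2 z * T t z ^ m)))"
      using Wf_deriv_bound[OF c(1)[OF t] z, of "T t" "\<lambda>x. y2 x * T t x ^ m" "T' t" "X' t"] T[OF t] c[OF t] by auto
    show "calm (\<lambda>x. ln (1 + norm (Wf (c t) x (T t x) (y2 x * T t x ^ m)))) z (2 * (C\<^sup>2 + 1))"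
      by (rule calm_ln[OF D]) simp
  qed
  then show ?thesis unfolding card using eq by (rule calm_cong)
qed

lemma ph1_calm:
  assumes "\<not> norm (h0 (y1 z) (y2 z)) < e1 * norm (y1 z) ^ (M + 1)"
  shows "calm (\<lambda>x. ph1 x (y1 x) (y2 x)) z (real n * (2 * (C5 + 1)))"
proof -
  have "norm (Hm (A' z) (y1 z) (y2 z)) \<le> C5 * norm (Hm (A z) (y1 z) (y2 z))" using grow[OF z TT assms] by blast
  also have "\<dots> \<le> C5 * (1 + norm (Hm (A z) (y1 z) (y2 z)))" using pos by (intro mult_left_mono) auto
  finally have "calm (\<lambda>x. ln (1 + norm (Hm (A x) (y1 x) (y2 x)))) z (2 * (C5 + 1))"
    using pos by (intro calm_ln[OF Hm_deriv[OF d1 d2 z_in_U]]) auto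
  from calm_sum[of "{..<n}" "\<lambda>_ x. ln (1 + norm (Hm (A x) (y1 x) (y2 x)))", OF this]
  show ?thesis unfolding ph1_def by simp
qed

end

text \<open>On each branch \<open>W - H = - h(z, \<tau>, P) / \<tau>^K\<close> has size at most
  \<open>C |\<tau>|^q |y1|^(M+1)\<close>, and outside the inner cone this is at most
  \<open>C * C5 |\<tau>|^q |H|\<close>. By \<open>small\<close> it is at most
  \<open>|H| / 2\<close>, so the two logarithms differ by \<open>O(|\<tau>|^q)\<close>.\<close>

lemma ph_diff:
  assumes z: "norm (z - zi) < ez" and T: "TT y1 y2 \<ge> T0" and I: "norm (h0 y1 y2) < 3 * e1 * norm y1 ^ (M + 1)"
    and o: "\<not> norm (h0 y1 y2) < e1 * norm y1 ^ (M + 1)" and t: "t ^ n * y1 = 1"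
  shows "\<bar>ph2 z y1 y2 - ph1 z y1 y2\<bar> \<le> real n * (2 * (C * C5) * norm t ^ q)"
proof -
  let ?R = "{\<tau>. \<tau> ^ n * y1 = 1}" and ?H = "Hm (A z) y1 y2"
  have ynz: "y1 \<noteq> 0" using branch_facts[OF T I t] by blast
  have each: "\<bar>ln (1 + norm (Wf (sel (y2 * \<tau> ^ m)) z \<tau> (y2 * \<tau> ^ m))) - ln (1 + norm ?H)\<bar> \<le> 2 * (C * C5) * norm t ^ q"
    if \<tau>: "\<tau> \<in> ?R" for \<tau>
  proof -
    have \<tau>1: "\<tau> ^ n * y1 = 1" using \<tau> by simp
    note bf = branch_facts[OF T I \<tau>1]
    let ?c = "sel (y2 * \<tau> ^ m)" and ?w = "y2 * \<tau> ^ m"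
    note nf = near_facts[OF bf(1) z bf(3) bf(2)]
    have "norm \<tau> ^ n = norm t ^ n"
    proof -
      have "\<tau> ^ n = t ^ n" using \<tau>1 t ynz by (metis mult_right_cancel)
      then show ?thesis by (metis norm_power)
    qed
    then have nt: "norm \<tau> = norm t" using n_pos by (simp add: power_eq_iff_eq_base)
    have W: "Wf ?c z \<tau> ?w - ?H = - (hh (A z) \<tau> (Ps ?c z \<tau>) / \<tau> ^ K)"
      unfolding Wf_def Hm_hh[OF \<tau>1 refl, symmetric] using bf(4) by (simp add: diff_divide_distrib)
    have "\<tau> ^ K * y1 ^ (M + 1) = (\<tau> ^ n * y1) ^ (M + 1)" unfolding K_eq power_mult power_mult_distrib ..
    then have "y1 ^ (M + 1) = inverse (\<tau> ^ K)" unfolding \<tau>1 using bf(4) by (simp add: field_simps)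
    then have yK: "norm y1 ^ (M + 1) = 1 / norm \<tau> ^ K" by (metis inverse_eq_divide norm_inverse norm_power)
    have "norm (Wf ?c z \<tau> ?w - ?H) = norm (hh (A z) \<tau> (Ps ?c z \<tau>)) * norm y1 ^ (M + 1)"
      unfolding W yK by (simp add: norm_divide norm_power)
    also have "\<dots> \<le> (C * norm \<tau> ^ q) * TT y1 y2"
      using nf(8) eC unfolding TT_def by (intro mult_mono) auto
    also have "\<dots> \<le> (C * norm \<tau> ^ q) * (C5 * norm ?H)"
      using grow[OF z T o] eC by (intro mult_left_mono) auto
    finally have b: "norm (Wf ?c z \<tau> ?w - ?H) \<le> (C * C5 * norm \<tau> ^ q) * norm ?H" by (simp add: mult_ac)
    have s: "C * C5 * norm \<tau> ^ q \<le> 1 / 2" using small[OF T I \<tau>1] by simp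
    have b2: "\<bar>norm (Wf ?c z \<tau> ?w) - norm ?H\<bar> \<le> (C * C5 * norm \<tau> ^ q) * norm ?H"
      using b norm_triangle_ineq3[of "Wf ?c z \<tau> ?w" ?H] by linarith
    have nn: "0 \<le> C * C5 * norm \<tau> ^ q" using eC pos by simp
    have "(C * C5 * norm \<tau> ^ q) * norm ?H \<le> 1 / 2 * (1 + norm ?H)" using s nn by (intro mult_mono) auto
    then have "\<bar>ln (1 + norm (Wf ?c z \<tau> ?w)) - ln (1 + norm ?H)\<bar> \<le> 2 * \<bar>norm (Wf ?c z \<tau> ?w) - norm ?H\<bar> / (1 + norm ?H)"
      using b2 by (intro ln_norm_diff_le) auto
    also have "\<dots> \<le> 2 * ((C * C5 * norm \<tau> ^ q) * (1 + norm ?H)) / (1 + norm ?H)"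
    proof -
      have "(C * C5 * norm \<tau> ^ q) * norm ?H \<le> (C * C5 * norm \<tau> ^ q) * (1 + norm ?H)" using nn by (intro mult_left_mono) auto
      then show ?thesis using b2 by (intro divide_right_mono mult_left_mono) auto
    qed
    also have "\<dots> = 2 * (C * C5) * norm t ^ q"
    proof -
      have "1 + norm ?H \<noteq> 0" by (metis add_nonneg_eq_0_iff norm_ge_zero zero_le_one zero_neq_one)
      then show ?thesis unfolding nt by simp
    qed
    finally show ?thesis .
  qed
  have eq: "ph2 z y1 y2 - ph1 z y1 y2 = (\<Sum>\<tau>\<in>?R. ln (1 + norm (Wf (sel (y2 * \<tau> ^ m)) z \<tau> (y2 * \<tau> ^ m))) - ln (1 + norm ?H))"
    unfolding ph2_def ph1_def sum_subtractf using roots_card(2)[OF ynz] by simp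
  have "\<bar>ph2 z y1 y2 - ph1 z y1 y2\<bar> \<le> (\<Sum>\<tau>\<in>?R. 2 * (C * C5) * norm t ^ q)"
    unfolding eq by (rule order_trans[OF sum_abs sum_mono[OF each]])
  then show ?thesis using roots_card(2)[OF ynz] by simp
qed

text \<open>Outside the outer cone \<open>Ph\<close> is \<open>ph1\<close> and in the inner one it
  is \<open>ph2\<close>. In between the cutoff changes at a rate
  \<open>D1 / (e1 |\<tau>|^q)\<close>, and \<open>ph_diff\<close> supplies the compensating
  \<open>|\<tau>|^q\<close>.\<close>

lemma Ph_calm:
  "\<exists>C8\<ge>0. \<forall>z y1 y2. norm (z - zi) < ez \<longrightarrow> (y1 has_field_derivative rhs1 (A z) M N (y1 z) (y2 z)) (at z) \<longrightarrow>
     (y2 has_field_derivative rhs2 (A z) M N (y1 z) (y2 z)) (at z) \<longrightarrow> TT (y1 z) (y2 z) \<ge> T0 \<longrightarrow>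
     calm (\<lambda>x. Ph x (y1 x) (y2 x)) z C8"
proof -
  \<comment> \<open>\<open>Bw\<close> bounds \<open>|w|\<close> near the roots and \<open>D1\<close>
    bounds \<open>|\<tau>|^q\<close> times the derivative of \<open>h0 / y1^(M+1)\<close>. In
    \<open>Cc\<close>, the rate of the cutoff times the gap, the powers of \<open>|\<tau>|\<close>
    have cancelled.\<close>
  define Bw where "Bw = (\<Sum>c\<in>Rt. norm c) + e"
  define D1 where "D1 = norm (\<alpha> 0 (N + 1) zi) * (real (N + 1) * Bw ^ N) * C + 1"
  define Ca where "Ca = real n * (2 * (C5 + 1))"
  define Cb where "Cb = real n * (2 * (C\<^sup>2 + 1))"
  define Cc where "Cc = D1 / e1 * (real n * (2 * (C * C5)))"
  have Bw: "Bw \<ge> 0" unfolding Bw_def using eC by (simp add: sum_nonneg add_nonneg_nonneg less_imp_le)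
  have D1: "D1 > 0" unfolding D1_def using eC Bw by (intro add_nonneg_pos mult_nonneg_nonneg) auto
  have nn: "Ca \<ge> 0" "Cb \<ge> 0" "Cc \<ge> 0" unfolding Ca_def Cb_def Cc_def using pos eC D1 by auto
  show ?thesis
  proof (intro exI[of _ "Ca + Cb + Cc"] conjI allI impI)
    show "0 \<le> Ca + Cb + Cc" using nn by simp
    fix z y1 y2 assume z: "norm (z - zi) < ez" and d1: "(y1 has_field_derivative rhs1 (A z) M N (y1 z) (y2 z)) (at z)"
      and d2: "(y2 has_field_derivative rhs2 (A z) M N (y1 z) (y2 z)) (at z)" and T: "TT (y1 z) (y2 z) \<ge> T0"
    note ty = tends_y[OF z d1 d2 T]
    have th0: "((\<lambda>x. norm (h0 (y1 x) (y2 x))) \<longlongrightarrow> norm (h0 (y1 z) (y2 z))) (nhds z)"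
      unfolding h0_def by (intro tendsto_intros ty)
    have ty1: "((\<lambda>x. k * norm (y1 x) ^ (M + 1)) \<longlongrightarrow> k * norm (y1 z) ^ (M + 1)) (nhds z)" for k
      by (intro tendsto_intros ty)
    have ev: "eventually (\<lambda>x. k * norm (y1 x) ^ (M + 1) < norm (h0 (y1 x) (y2 x))) (nhds z)"
      if "k * norm (y1 z) ^ (M + 1) < norm (h0 (y1 z) (y2 z))" for k
      using order_tendstoD(1)[OF tendsto_diff[OF th0 ty1], of 0 k] that by (auto elim: eventually_mono)
    have ev': "eventually (\<lambda>x. norm (h0 (y1 x) (y2 x)) < k * norm (y1 x) ^ (M + 1)) (nhds z)"
      if "norm (h0 (y1 z) (y2 z)) < k * norm (y1 z) ^ (M + 1)" for k
      using order_tendstoD(1)[OF tendsto_diff[OF ty1 th0], of 0 k] that by (auto elim: eventually_mono)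
    show "calm (\<lambda>x. Ph x (y1 x) (y2 x)) z (Ca + Cb + Cc)"
    proof (cases "norm (h0 (y1 z) (y2 z)) < 3 * e1 * norm (y1 z) ^ (M + 1)")
      case False
      \<comment> \<open>The strict inequality at \<open>2 * e1\<close> persists near
        \<open>z\<close>, so \<open>Ph\<close> equals \<open>ph1\<close> in a neighbourhood. For
        \<open>y1 z = 0\<close> it follows from \<open>y2 z \<noteq> 0\<close>, which
        \<open>TT \<ge> T0 \<ge> 1\<close> enforces.\<close>
      have lt: "2 * e1 * norm (y1 z) ^ (M + 1) < norm (h0 (y1 z) (y2 z))"
      proof (cases "y1 z = 0")
        case True
        have "y2 z \<noteq> 0" using T pos(5) True unfolding TT_def by auto
        then show ?thesis using True lead(2)[OF zi] unfolding h0_def by simp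
      next
        case y: False
        have "2 * e1 * norm (y1 z) ^ (M + 1) < 3 * e1 * norm (y1 z) ^ (M + 1)"
          using pos y by (intro mult_strict_right_mono) auto
        then show ?thesis using False by linarith
      qed
      have "eventually (\<lambda>x. Ph x (y1 x) (y2 x) = ph1 x (y1 x) (y2 x)) (nhds z)"
        using ev[OF lt]
      proof eventually_elim
        case (elim x)
        show ?case
        proof (cases "norm (h0 (y1 x) (y2 x)) < 3 * e1 * norm (y1 x) ^ (M + 1)")
          case True
          then have ynz: "y1 x \<noteq> 0" by auto
          have "2 * e1 \<le> norm (h0 (y1 x) (y2 x) / y1 x ^ (M + 1))"
            using elim by (rule le_norm_quotient_power[OF ynz])
          then show ?thesis unfolding Ph_def using cutoff_0[OF pos(1)] by simp
        qed (simp add: Ph_def)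
      qed
      note eqP = this
      have o: "\<not> norm (h0 (y1 z) (y2 z)) < e1 * norm (y1 z) ^ (M + 1)"
      proof -
        have "e1 * norm (y1 z) ^ (M + 1) \<le> 2 * e1 * norm (y1 z) ^ (M + 1)" using pos by (intro mult_right_mono) auto
        then show ?thesis using lt by linarith
      qed
      have "calm (\<lambda>x. Ph x (y1 x) (y2 x)) z Ca"
        unfolding Ca_def by (rule calm_cong[OF ph1_calm[OF z d1 d2 T o] eqP])
      then show ?thesis by (rule calm_mono) (use nn in simp)
    next
      case I: True
      have ynz: "y1 z \<noteq> 0" using I by auto
      obtain t where t: "t ^ n * y1 z = 1"
        using exists_nth_root[of "inverse (y1 z)" n] ynz n_pos by (metis inverse_nonzero_iff_nonzero left_inverse)
      note bf = branch_facts[OF T I t]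
      have Pheq: "eventually (\<lambda>x. Ph x (y1 x) (y2 x) = ph1 x (y1 x) (y2 x) +
         cutoff e1 (norm (h0 (y1 x) (y2 x) / y1 x ^ (M + 1))) * (ph2 x (y1 x) (y2 x) - ph1 x (y1 x) (y2 x))) (nhds z)"
        using ev'[OF I] by eventually_elim (simp add: Ph_def)
      have c2: "calm (\<lambda>x. ph2 x (y1 x) (y2 x)) z Cb" unfolding Cb_def by (rule ph2_calm[OF z d1 d2 T I])
      show ?thesis
      proof (cases "norm (h0 (y1 z) (y2 z)) < e1 * norm (y1 z) ^ (M + 1)")
        case True
        have "eventually (\<lambda>x. y1 x \<noteq> 0) (nhds z)" using ty(1) ynz by (rule tendsto_imp_eventually_ne)
        with Pheq ev'[OF True] have "eventually (\<lambda>x. Ph x (y1 x) (y2 x) = ph2 x (y1 x) (y2 x)) (nhds z)"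
        proof eventually_elim
          case (elim x)
          have "norm (h0 (y1 x) (y2 x) / y1 x ^ (M + 1)) \<le> e1"
            using elim(2) by (rule norm_quotient_power_le[OF elim(3)])
          then show ?case using elim(1) cutoff_1[OF pos(1)] by simp
        qed
        with c2 have "calm (\<lambda>x. Ph x (y1 x) (y2 x)) z Cb" by (rule calm_cong)
        then show ?thesis by (rule calm_mono) (use nn in simp)
      next
        case o: False
        have c1: "calm (\<lambda>x. ph1 x (y1 x) (y2 x)) z Ca" unfolding Ca_def by (rule ph1_calm[OF z d1 d2 T o])
        obtain Tb T' X' where Tb': "Tb z = t" "eventually (\<lambda>x. Tb x ^ n * y1 x = 1) (nhds z)"
          "(Tb has_field_derivative T') (at z)" "((\<lambda>x. y2 x * Tb x ^ m) has_field_derivative X') (at z)"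
          "of_nat n * t ^ q * T' = - (t * hw (A z) t (y2 z * t ^ m))"
          "of_nat n * t ^ q * X' = - Dh (A z) t (y2 z * t ^ m)"
          by (rule exact_branch[OF d1 d2 t]) (rule that)
        note Tb = Tb'(1,2,4,6)
        let ?w = "y2 z * t ^ m" and ?b = "\<alpha> 0 (N + 1) zi"
        note nf = near_facts[OF bf(1) z bf(3) bf(2)]
        have tq: "norm t ^ q > 0" using bf(4) by simp
        define f' where "f' = ?b * (of_nat (N + 1) * ?w ^ N * X')"
        have "((\<lambda>x. \<alpha> (M + 1) 0 zi + ?b * (y2 x * Tb x ^ m) ^ (N + 1)) has_field_derivative f') (at z)"
          unfolding f'_def using affine_power_deriv[OF Tb(3), of _ _ N] Tb(1) by simp
        moreover have "eventually (\<lambda>x. h0 (y1 x) (y2 x) / y1 x ^ (M + 1) = \<alpha> (M + 1) 0 zi + ?b * (y2 x * Tb x ^ m) ^ (N + 1)) (nhds z)"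
          using Tb(2)
        proof eventually_elim
          case (elim x)
          then have "y1 x \<noteq> 0" by auto
          then show ?case unfolding h0_branch[OF elim] hh_zero by simp
        qed
        ultimately have df: "((\<lambda>x. h0 (y1 x) (y2 x) / y1 x ^ (M + 1)) has_field_derivative f') (at z)"
          by (simp add: DERIV_cong_ev)
        have "norm f' * norm t ^ q \<le> norm ?b * (real (N + 1) * Bw ^ N) * C"
        proof -
          have "norm (of_nat n * t ^ q * X') \<le> C" unfolding Tb(4) using nf(7) by simp
          then have "real n * (norm t ^ q * norm X') \<le> C" by (simp add: norm_mult norm_power mult_ac)
          moreover have "1 * (norm t ^ q * norm X') \<le> real n * (norm t ^ q * norm X')" using n_pos by (intro mult_right_mono) auto
          ultimately have x: "norm X' * norm t ^ q \<le> C" by (simp add: mult.commute)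
          have "norm ?w \<le> norm (sel ?w) + norm (?w - sel ?w)" using norm_triangle_ineq[of "sel ?w" "?w - sel ?w"] by simp
          also have "\<dots> \<le> Bw" unfolding Bw_def using bf(2) member_le_sum[OF bf(1), of norm] finite_Rt by simp
          finally have w: "norm ?w ^ N \<le> Bw ^ N" by (intro power_mono) auto
          have "norm f' * norm t ^ q = norm ?b * (real (N + 1) * norm ?w ^ N) * (norm X' * norm t ^ q)"
            unfolding f'_def norm_mult norm_power norm_of_nat by (simp only: mult_ac)
          also have "\<dots> \<le> norm ?b * (real (N + 1) * Bw ^ N) * C"
            using x w Bw by (intro mult_mono mult_nonneg_nonneg) auto
          finally show ?thesis .
        qed
        then have "norm f' * norm t ^ q < D1" unfolding D1_def by linarith
        then have f'b: "norm f' < D1 / norm t ^ q" using tq by (simp add: field_simps)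
        have cc: "calm (\<lambda>x. cutoff e1 (norm (h0 (y1 x) (y2 x) / y1 x ^ (M + 1)))) z (D1 / norm t ^ q / e1)"
          by (rule calm_cutoff[OF df f'b pos(1)])
        have "calm (\<lambda>x. ph1 x (y1 x) (y2 x) + cutoff e1 (norm (h0 (y1 x) (y2 x) / y1 x ^ (M + 1))) * (ph2 x (y1 x) (y2 x) - ph1 x (y1 x) (y2 x))) z (Ca + Cb + Cc)"
        proof (rule calm_blend[OF c1 c2 cc])
          show "\<bar>ph2 z (y1 z) (y2 z) - ph1 z (y1 z) (y2 z)\<bar> \<le> real n * (2 * (C * C5) * norm t ^ q)" by (rule ph_diff[OF z T I o t])
          show "D1 / norm t ^ q / e1 * (real n * (2 * (C * C5) * norm t ^ q)) \<le> Cc"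
            unfolding Cc_def using bf(4) pos by (simp add: field_simps)
        qed (use nn D1 tq pos cutoff_bounds in auto)
        then show ?thesis using Pheq by (rule calm_cong)
      qed
    qed
  qed
qed

text \<open>Outside the inner cone a bound on \<open>Ph\<close> bounds \<open>TT\<close>; so once
  \<open>TT\<close> is large the solution must be inside. The loss \<open>n\<close> covers the gap
  between \<open>ph1\<close> and \<open>ph2\<close> in the transition zone.\<close>

lemma Ph_lower:
  assumes z: "norm (z - zi) < ez" and T: "TT y1 y2 \<ge> T0" and o: "\<not> norm (h0 y1 y2) < e1 * norm y1 ^ (M + 1)"
  shows "real n * ln (1 + TT y1 y2 / C5) - real n \<le> Ph z y1 y2"
proof -
  have T5: "TT y1 y2 / C5 \<le> norm (Hm (A z) y1 y2)" using grow[OF z T o] pos by (simp add: field_simps)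
  have "TT y1 y2 / C5 \<ge> 0" using T pos by simp
  then have "ln (1 + TT y1 y2 / C5) \<le> ln (1 + norm (Hm (A z) y1 y2))" using T5 by simp
  then have p1: "real n * ln (1 + TT y1 y2 / C5) \<le> ph1 z y1 y2" unfolding ph1_def by (intro mult_left_mono) auto
  show ?thesis
  proof (cases "norm (h0 y1 y2) < 3 * e1 * norm y1 ^ (M + 1)")
    case I: True
    have ynz: "y1 \<noteq> 0" using I by auto
    obtain t where t: "t ^ n * y1 = 1"
      using exists_nth_root[of "inverse y1" n] ynz n_pos by (metis inverse_nonzero_iff_nonzero left_inverse)
    let ?c = "cutoff e1 (norm (h0 y1 y2 / y1 ^ (M + 1)))" and ?D = "ph2 z y1 y2 - ph1 z y1 y2"
    have "\<bar>?D\<bar> \<le> real n * (2 * (C * C5) * norm t ^ q)" by (rule ph_diff[OF z T I o t])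
    also have "\<dots> \<le> real n * 1" using small[OF T I t] by (intro mult_left_mono) auto
    finally have "\<bar>?c * ?D\<bar> \<le> 1 * real n" unfolding abs_mult using cutoff_bounds[of e1] by (intro mult_mono) auto
    then show ?thesis unfolding Ph_def using I p1 by simp
  qed (use p1 in \<open>simp add: Ph_def\<close>)
qed

text \<open>The summands of \<open>ph2\<close> are nonnegative, so a bound on the sum bounds
  \<open>W\<close> on every branch.\<close>

lemma Ph_inner:
  assumes I: "norm (h0 y1 y2) < e1 * norm y1 ^ (M + 1)" and t: "\<tau> ^ n * y1 = 1"
  shows "ln (1 + norm (Wf (sel (y2 * \<tau> ^ m)) z \<tau> (y2 * \<tau> ^ m))) \<le> Ph z y1 y2"
proof -
  have ynz: "y1 \<noteq> 0" using I by auto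
  have "e1 * norm y1 ^ (M + 1) \<le> 3 * e1 * norm y1 ^ (M + 1)" using pos by (intro mult_right_mono) auto
  then have I3: "norm (h0 y1 y2) < 3 * e1 * norm y1 ^ (M + 1)" using I by linarith
  have "norm (h0 y1 y2 / y1 ^ (M + 1)) \<le> e1" using I by (rule norm_quotient_power_le[OF ynz])
  then have "Ph z y1 y2 = ph2 z y1 y2" unfolding Ph_def using I3 cutoff_1[OF pos(1)] by simp
  moreover have "ln (1 + norm (Wf (sel (y2 * \<tau> ^ m)) z \<tau> (y2 * \<tau> ^ m))) \<le> ph2 z y1 y2"
    unfolding ph2_def
    using member_le_sum[of \<tau> "{\<tau>. \<tau> ^ n * y1 = 1}" "\<lambda>\<tau>. ln (1 + norm (Wf (sel (y2 * \<tau> ^ m)) z \<tau> (y2 * \<tau> ^ m)))"]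
      t roots_card(1)[OF ynz] by simp
  ultimately show ?thesis by simp
qed

end

section \<open>Regular equations at infinity\<close>

text \<open>If \<open>f = t^j G\<close>, comparison at 0 gives
  \<open>j G(0) = 0^(p+1-j) k(0)\<close>. So \<open>G(0) = 0\<close> for
  \<open>0 < j \<le> p\<close> and another factor splits off; for \<open>j = 0\<close> this is
  \<open>f 0 = 0\<close>, and at \<open>j = p + 1\<close> the relation determines
  \<open>G 0\<close>.\<close>

lemma factor_power:
  assumes \<rho>: "\<rho> > 0" and f: "f holomorphic_on ball 0 \<rho>" "f 0 = 0" and k: "k holomorphic_on ball 0 \<rho>"
    and d: "\<And>t. t \<in> ball 0 \<rho> \<Longrightarrow> (f has_field_derivative t ^ p * k t) (at t)"
  shows "\<exists>G. G holomorphic_on ball 0 \<rho> \<and> (\<forall>t\<in>ball 0 \<rho>. f t = t ^ (p + 1) * G t) \<and> of_nat (p + 1) * G 0 = k 0"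
proof -
  have key: "of_nat j * G 0 = 0 ^ (p + 1 - j) * k 0"
    if G: "G holomorphic_on ball 0 \<rho>" "\<And>t. t \<in> ball 0 \<rho> \<Longrightarrow> f t = t ^ j * G t" and j: "j \<le> p + 1" for G j
  proof -
    have eq: "of_nat j * G t + t * deriv G t = t ^ (p + 1 - j) * k t" if t: "t \<in> ball 0 \<rho>" "t \<noteq> 0" for t
    proof -
      have dG: "(G has_field_derivative deriv G t) (at t)" using G(1) t(1) open_ball holomorphic_derivI by blast
      then have "((\<lambda>t. t ^ j * G t) has_field_derivative of_nat j * t ^ (j - 1) * G t + t ^ j * deriv G t) (at t)"
        by (auto intro!: derivative_eq_intros)
      moreover have "eventually (\<lambda>s. f s = s ^ j * G s) (nhds t)"
        using eventually_nhds_in_open[OF open_ball t(1)] by eventually_elim (rule G(2))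
      ultimately have "(f has_field_derivative of_nat j * t ^ (j - 1) * G t + t ^ j * deriv G t) (at t)"
        by (simp add: DERIV_cong_ev)
      then have dd: "of_nat j * t ^ (j - 1) * G t + t ^ j * deriv G t = t ^ p * k t" using d[OF t(1)] DERIV_unique by blast
      have e1: "t * (of_nat j * t ^ (j - 1) * G t) = t ^ j * (of_nat j * G t)" by (cases j) auto
      have e2: "t * t ^ p = t ^ j * t ^ (p + 1 - j)"
        unfolding power_add[symmetric] power_Suc[symmetric] using j by simp
      have "t ^ j * (of_nat j * G t + t * deriv G t) = t * (of_nat j * t ^ (j - 1) * G t + t ^ j * deriv G t)"
        unfolding distrib_left e1 by (simp only: mult_ac)
      also have "\<dots> = (t * t ^ p) * k t" unfolding dd by (simp only: mult_ac)
      also have "\<dots> = t ^ j * (t ^ (p + 1 - j) * k t)" unfolding e2 by (simp only: mult_ac)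
      finally have "t ^ j * (of_nat j * G t + t * deriv G t) = t ^ j * (t ^ (p + 1 - j) * k t)" .
      then show ?thesis using t(2) by simp
    qed
    have c: "isCont h 0" if "h holomorphic_on ball 0 \<rho>" for h
      using that \<rho> holomorphic_on_imp_continuous_on continuous_on_eq_continuous_at[OF open_ball] by (metis centre_in_ball)
    have cG: "isCont G 0" "isCont (deriv G) 0" "isCont k 0" using c G(1) k holomorphic_deriv[OF G(1) open_ball] by blast+
    have 1: "((\<lambda>t. of_nat j * G t + t * deriv G t) \<longlongrightarrow> of_nat j * G 0 + 0 * deriv G 0) (at 0)"
      "((\<lambda>t. t ^ (p + 1 - j) * k t) \<longlongrightarrow> 0 ^ (p + 1 - j) * k 0) (at 0)"
      by (rule tendsto_add[OF tendsto_mult[OF tendsto_const cG(1)[unfolded isCont_def]]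
          tendsto_mult[OF tendsto_ident_at cG(2)[unfolded isCont_def]]],
        rule tendsto_mult[OF tendsto_power[OF tendsto_ident_at] cG(3)[unfolded isCont_def]])
    have "eventually (\<lambda>t. t \<in> ball 0 \<rho>) (nhds (0::complex))" by (rule eventually_nhds_in_open) (use \<rho> in auto)
    then have "eventually (\<lambda>t. of_nat j * G t + t * deriv G t = t ^ (p + 1 - j) * k t) (at 0)"
      unfolding eventually_at_filter by eventually_elim (use eq in auto)
    then have "((\<lambda>t. of_nat j * G t + t * deriv G t) \<longlongrightarrow> 0 ^ (p + 1 - j) * k 0) (at 0)"
      using 1(2) by (simp add: tendsto_cong)
    then have "of_nat j * G 0 + 0 * deriv G 0 = 0 ^ (p + 1 - j) * k 0" using 1(1) tendsto_unique[OF at_neq_bot] by blast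
    then show ?thesis by simp
  qed
  have "\<exists>G. G holomorphic_on ball 0 \<rho> \<and> (\<forall>t\<in>ball 0 \<rho>. f t = t ^ j * G t)" if "j \<le> p + 1" for j
    using that
  proof (induction j)
    case 0 then show ?case using f by (intro exI[of _ f]) auto
  next
    case (Suc j)
    then obtain G where G: "G holomorphic_on ball 0 \<rho>" "\<And>t. t \<in> ball 0 \<rho> \<Longrightarrow> f t = t ^ j * G t" by auto
    have "G 0 = 0"
    proof (cases "j = 0")
      case True then show ?thesis using G(2)[of 0] f(2) \<rho> by simp
    next
      case False
      have "(0::complex) ^ (p + 1 - j) = 0" using Suc.prems by (simp add: zero_power)
      then have "of_nat j * G 0 = 0" using key[OF G] Suc.prems by simp
      then show ?thesis using False by simp
    qed
    let ?h = "\<lambda>z. if z = 0 then deriv G 0 else (G z - G 0) / (z - 0)"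
    have "?h holomorphic_on ball 0 \<rho>" by (rule pole_lemma_open[OF G(1) open_ball])
    moreover have "f t = t ^ Suc j * ?h t" if "t \<in> ball 0 \<rho>" for t using G(2)[OF that] \<open>G 0 = 0\<close> by auto
    ultimately show ?case by blast
  qed
  then obtain G where G: "G holomorphic_on ball 0 \<rho>" "\<And>t. t \<in> ball 0 \<rho> \<Longrightarrow> f t = t ^ (p + 1) * G t" by blast
  from key[OF this] show ?thesis using G by auto
qed

lemma quotient_rearrange:
  fixes a b c e x :: complex
  assumes "b \<noteq> 0"
  shows "a * (c * (e * x)) / b = c * (e * (a * b)) * (x / (b * b))"
  using assms by (simp add: field_simps)

lemma multiply_out:
  fixes a :: complex
  shows "t * a * (- (k * b * (v * v) * h2) - v * h1 - p * v * h3 + c * e)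
    = - (k * (a * v) * (t * b * v) * h2) - t * (a * v) * h1 - t * p * ((a * v) * h3) + a * (t * c) * e"
  by (simp add: algebra_simps)

section \<open>The regular system with \<open>\<tau>\<close> as independent variable\<close>

context hamiltonian
begin

lemma rhs_holomorphic:
  assumes "Z holomorphic_on S" "\<And>s. s \<in> S \<Longrightarrow> Z s \<in> U" "f holomorphic_on S" "g holomorphic_on S"
  shows "(\<lambda>s. rhs1 (A (Z s)) M N (f s) (g s)) holomorphic_on S" "(\<lambda>s. rhs2 (A (Z s)) M N (f s) (g s)) holomorphic_on S"
  unfolding rhs1_J rhs2_J case_prod_unfold
  by (intro holomorphic_intros assms(3,4) holomorphic_A(1)[OF assms(1,2)]; simp)+

lemma rhs_continuous:
  fixes Z f g :: "'x :: topological_space \<Rightarrow> complex"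
  assumes "continuous_on S Z" "\<And>s. s \<in> S \<Longrightarrow> Z s \<in> U" "continuous_on S f" "continuous_on S g"
  shows "continuous_on S (\<lambda>s. rhs1 (A (Z s)) M N (f s) (g s))" "continuous_on S (\<lambda>s. rhs2 (A (Z s)) M N (f s) (g s))"
  unfolding rhs1_J rhs2_J case_prod_unfold
  by (intro continuous_intros assms(3,4) continuous_A(1)[OF assms(1,2)]; simp)+

text \<open>The factor \<open>c\<close> is the derivative of \<open>z\<close> in the chosen
  parameter, so one lemma covers the system in \<open>z\<close> itself, with \<open>c = 1\<close>,
  and its pullback to the parameter \<open>\<tau>\<close>.\<close>

lemma rhs_hol3:
  assumes Z: "Z holomorphic_on V" "open V" "B \<subseteq> V" "\<And>s. s \<in> V \<Longrightarrow> Z s \<in> U" and c: "c holomorphic_on V"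
  shows "hol3 (\<lambda>s x y. rhs1 (A (Z s)) M N x y * c s) B X Y" "hol3 (\<lambda>s x y. rhs2 (A (Z s)) M N x y * c s) B X Y"
proof -
  have cont: "continuous_on (B \<times> X \<times> Y) (\<lambda>p. Z (fst p))" "continuous_on (B \<times> X \<times> Y) (\<lambda>p. c (fst p))"
    using Z(3) by (auto intro!: continuous_on_compose2[OF holomorphic_on_imp_continuous_on[OF Z(1)]]
      continuous_on_compose2[OF holomorphic_on_imp_continuous_on[OF c]] continuous_intros)
  have ZU: "Z (fst p) \<in> U" if "p \<in> B \<times> X \<times> Y" for p using that Z(3,4) by auto
  have f: "continuous_on (B \<times> X \<times> Y) (\<lambda>p. fst (snd p))" "continuous_on (B \<times> X \<times> Y) (\<lambda>p. snd (snd p))"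
    by (auto intro!: continuous_intros)
  have comp: "(\<lambda>s. Z (e s)) holomorphic_on S" "(\<lambda>s. c (e s)) holomorphic_on S" if "e holomorphic_on S" "e ` S \<subseteq> B" for e S
    using holomorphic_on_compose_gen[OF that(1) Z(1)] holomorphic_on_compose_gen[OF that(1) c] that(2) Z(3) by (auto simp: o_def)
  show "hol3 (\<lambda>s x y. rhs1 (A (Z s)) M N x y * c s) B X Y"
    unfolding hol3_def
  proof (intro conjI allI impI)
    show "continuous_on (B \<times> X \<times> Y) (\<lambda>(s, x, y). rhs1 (A (Z s)) M N x y * c s)"
      unfolding case_prod_unfold by (intro continuous_on_mult rhs_continuous(1) cont f ZU)
    fix S e ff g assume h: "open S" "e holomorphic_on S" "ff holomorphic_on S" "g holomorphic_on S" "e ` S \<subseteq> B"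
    have "Z (e s) \<in> U" if "s \<in> S" for s using that h(5) Z(3,4) by auto
    then show "(\<lambda>s. rhs1 (A (Z (e s))) M N (ff s) (g s) * c (e s)) holomorphic_on S"
      by (intro holomorphic_on_mult rhs_holomorphic(1) comp h)
  qed
  show "hol3 (\<lambda>s x y. rhs2 (A (Z s)) M N x y * c s) B X Y"
    unfolding hol3_def
  proof (intro conjI allI impI)
    show "continuous_on (B \<times> X \<times> Y) (\<lambda>(s, x, y). rhs2 (A (Z s)) M N x y * c s)"
      unfolding case_prod_unfold by (intro continuous_on_mult rhs_continuous(2) cont f ZU)
    fix S e ff g assume h: "open S" "e holomorphic_on S" "ff holomorphic_on S" "g holomorphic_on S" "e ` S \<subseteq> B"
    have "Z (e s) \<in> U" if "s \<in> S" for s using that h(5) Z(3,4) by auto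
    then show "(\<lambda>s. rhs2 (A (Z (e s))) M N (ff s) (g s) * c (e s)) holomorphic_on S"
      by (intro holomorphic_on_mult rhs_holomorphic(2) comp h)
  qed
qed

text \<open>\<open>F1\<close> and \<open>F2\<close> are the derivatives of \<open>z\<close> and \<open>\<nu>\<close> with respect to \<open>\<tau>\<close> after the substitution
  \<open>y\<^sub>1 = \<tau>\<^sup>-\<^sup>n\<close>, \<open>y\<^sub>2 = \<tau>\<^sup>-\<^sup>m (P + \<tau>\<^sup>K \<nu>)\<close>; the negative powers of \<open>\<tau>\<close> cancel because \<open>Eop P\<close> is divisible by \<open>\<tau>\<^sup>K\<^sup>+\<^sup>q\<close>.\<close>

definition wP where "wP P \<tau> z \<nu> = P z \<tau> + \<tau> ^ K * (\<nu> :: complex)"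
definition F1 where "F1 P \<tau> z \<nu> = - (of_nat n * \<tau> ^ (q - 1)) / hw (A z) \<tau> (wP P \<tau> z \<nu>)"
definition F2 where "F2 P E1 \<tau> z \<nu> = (- (of_nat K * \<tau> ^ (K - 1) * \<nu>\<^sup>2 * hh_dd2 (A z) \<tau> (wP P \<tau> z \<nu>) (P z \<tau>))
    - \<nu> * ht_dd (A z) \<tau> (wP P \<tau> z \<nu>) (P z \<tau>) - dt P z \<tau> * \<nu> * hw_dd (A z) \<tau> (wP P \<tau> z \<nu>) (P z \<tau>)
    + \<tau> ^ (q - 1) * E1 z \<tau>) / hw (A z) \<tau> (wP P \<tau> z \<nu>)"

context
  fixes P E1 :: "complex \<Rightarrow> complex \<Rightarrow> complex"
  assumes P: "PH U P" and E1: "PH U E1" and E: "\<forall>z\<in>U. \<forall>\<tau>. Eop P z \<tau> = \<tau> ^ (K + q) * E1 z \<tau>"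
begin

lemma F_hol3:
  assumes B: "B \<subseteq> U" and nz: "\<And>\<tau> z \<nu>. \<tau> \<in> D \<Longrightarrow> z \<in> B \<Longrightarrow> \<nu> \<in> V \<Longrightarrow> hw (A z) \<tau> (wP P \<tau> z \<nu>) \<noteq> 0"
  shows "hol3 (F1 P) D B V" "hol3 (F2 P E1) D B V"
proof -
  let ?S = "D \<times> B \<times> V"
  have c: "continuous_on ?S (\<lambda>p. fst (snd p))" "\<And>p. p \<in> ?S \<Longrightarrow> fst (snd p) \<in> U" "continuous_on ?S fst" "continuous_on ?S (\<lambda>p. snd (snd p))"
    using B by (auto intro!: continuous_intros)
  have cP: "continuous_on ?S (\<lambda>p. P (fst (snd p)) (fst p))" by (rule continuous_PH[OF P c(1,2,3)])
  have cw: "continuous_on ?S (\<lambda>p. wP P (fst p) (fst (snd p)) (snd (snd p)))"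
    unfolding wP_def by (intro continuous_intros cP c)
  note cs = continuous_sums[OF c(1,2,3) cw cP]
  have nz': "hw (A (fst (snd p))) (fst p) (wP P (fst p) (fst (snd p)) (snd (snd p))) \<noteq> 0" if "p \<in> ?S" for p
    using that by (intro nz) auto
  have hc: "(\<lambda>s. F1 P (e s) (f s) (g s)) holomorphic_on S \<and> (\<lambda>s. F2 P E1 (e s) (f s) (g s)) holomorphic_on S"
    if S: "open S" and h: "e holomorphic_on S" "f holomorphic_on S" "g holomorphic_on S" "e ` S \<subseteq> D" "f ` S \<subseteq> B" "g ` S \<subseteq> V" for S e f g
  proof -
    have fU: "f s \<in> U" if "s \<in> S" for s using that h(5) B by auto
    have hP: "(\<lambda>s. P (f s) (e s)) holomorphic_on S" by (rule PH_holomorphic[OF U P S h(2,1) fU])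
    have hPt: "(\<lambda>s. dt P (f s) (e s)) holomorphic_on S" by (rule PH_holomorphic[OF U PH_dt[OF U P] S h(2,1) fU])
    have hE: "(\<lambda>s. E1 (f s) (e s)) holomorphic_on S" by (rule PH_holomorphic[OF U E1 S h(2,1) fU])
    have hw': "(\<lambda>s. wP P (e s) (f s) (g s)) holomorphic_on S" unfolding wP_def by (intro holomorphic_intros hP h)
    note hs = holomorphic_dd_sums[OF h(2) fU h(1) hw' hP]
    have n0: "hw (A (f s)) (e s) (wP P (e s) (f s) (g s)) \<noteq> 0" if "s \<in> S" for s using that h by (intro nz) auto
    have hq: "(\<lambda>s. hw (A (f s)) (e s) (wP P (e s) (f s) (g s))) holomorphic_on S"
      by (rule holomorphic_sums(2)[OF h(2) fU h(1) hw'])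
    show ?thesis unfolding F1_def F2_def
      by (intro conjI holomorphic_on_divide holomorphic_on_add holomorphic_on_diff holomorphic_on_minus holomorphic_on_mult
        holomorphic_on_power holomorphic_on_const h hs hq hPt hE n0)
  qed
  show "hol3 (F1 P) D B V"
    unfolding hol3_def
  proof (intro conjI allI impI)
    show "continuous_on ?S (\<lambda>(t, x, y). F1 P t x y)" unfolding case_prod_unfold F1_def
      by (intro continuous_intros c cs nz' ballI)
    fix S e f g assume "open S" "e holomorphic_on S" "f holomorphic_on S" "g holomorphic_on S" "e ` S \<subseteq> D" "f ` S \<subseteq> B" "g ` S \<subseteq> V"
    from hc[OF this] show "(\<lambda>s. F1 P (e s) (f s) (g s)) holomorphic_on S" by (rule conjunct1)
  qed
  show "hol3 (F2 P E1) D B V"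
    unfolding hol3_def
  proof (intro conjI allI impI)
    show "continuous_on ?S (\<lambda>(t, x, y). F2 P E1 t x y)" unfolding case_prod_unfold F2_def
      by (intro continuous_intros c cs nz' ballI continuous_PH[OF PH_dt[OF U P] c(1,2,3)] continuous_PH[OF E1 c(1,2,3)])
    fix S e f g assume "open S" "e holomorphic_on S" "f holomorphic_on S" "g holomorphic_on S" "e ` S \<subseteq> D" "f ` S \<subseteq> B" "g ` S \<subseteq> V"
    from hc[OF this] show "(\<lambda>s. F2 P E1 (e s) (f s) (g s)) holomorphic_on S" by (rule conjunct2)
  qed
qed

text \<open>The derivation of \<open>F1\<close> and \<open>F2\<close> read backwards: off
  \<open>\<tau> = 0\<close> a solution \<open>(z, \<nu>)\<close> yields a solution of the
  Hamiltonian system in the parameter \<open>\<tau>\<close>, where \<open>F1\<close> plays the part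
  of \<open>dz/d\<tau>\<close>.\<close>

lemma F_solution:
  assumes z: "(zF has_field_derivative F1 P \<tau> (zF \<tau>) (nF \<tau>)) (at \<tau>)" and \<nu>: "(nF has_field_derivative F2 P E1 \<tau> (zF \<tau>) (nF \<tau>)) (at \<tau>)"
    and \<tau>: "\<tau> \<noteq> 0" and zU: "zF \<tau> \<in> U" and nz: "hw (A (zF \<tau>)) \<tau> (wP P \<tau> (zF \<tau>) (nF \<tau>)) \<noteq> 0"
  shows "((\<lambda>\<tau>. 1 / \<tau> ^ n) has_field_derivative
      rhs1 (A (zF \<tau>)) M N (1 / \<tau> ^ n) (wP P \<tau> (zF \<tau>) (nF \<tau>) / \<tau> ^ m) * F1 P \<tau> (zF \<tau>) (nF \<tau>)) (at \<tau>)"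
    "((\<lambda>\<tau>. wP P \<tau> (zF \<tau>) (nF \<tau>) / \<tau> ^ m) has_field_derivative
      rhs2 (A (zF \<tau>)) M N (1 / \<tau> ^ n) (wP P \<tau> (zF \<tau>) (nF \<tau>) / \<tau> ^ m) * F1 P \<tau> (zF \<tau>) (nF \<tau>)) (at \<tau>)"
proof -
  let ?z = "zF \<tau>" and ?\<nu> = "nF \<tau>"
  define w where "w = wP P \<tau> ?z ?\<nu>"
  define p where "p = P ?z \<tau>"
  define h where "h = hw (A ?z) \<tau> w"
  have h: "h \<noteq> 0" using nz unfolding h_def w_def .
  have wp: "w - p = \<tau> ^ K * ?\<nu>" unfolding w_def p_def wP_def by simp
  define w' where "w' = dz P ?z \<tau> * F1 P \<tau> ?z ?\<nu> + dt P ?z \<tau> + (of_nat K * \<tau> ^ (K - 1) * ?\<nu> + \<tau> ^ K * F2 P E1 \<tau> ?z ?\<nu>)"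
  have "((\<lambda>\<tau>. P (zF \<tau>) \<tau>) has_field_derivative dz P ?z \<tau> * F1 P \<tau> ?z ?\<nu> + dt P ?z \<tau> * 1) (at \<tau>)"
    by (rule PH_chain[OF U P z DERIV_ident zU])
  moreover have "((\<lambda>\<tau>. \<tau> ^ K * nF \<tau>) has_field_derivative of_nat K * \<tau> ^ (K - 1) * ?\<nu> + \<tau> ^ K * F2 P E1 \<tau> ?z ?\<nu>) (at \<tau>)"
    using \<nu> by (auto intro!: derivative_eq_intros)
  ultimately have dw: "((\<lambda>\<tau>. wP P \<tau> (zF \<tau>) (nF \<tau>)) has_field_derivative w') (at \<tau>)"
    unfolding wP_def w'_def using DERIV_add by fastforce
  have F1e: "F1 P \<tau> ?z ?\<nu> * h = - (of_nat n * \<tau> ^ (q - 1))" unfolding F1_def w_def[symmetric] h_def[symmetric] using h by simp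
  have tq: "\<tau> * \<tau> ^ (q - 1) = \<tau> ^ q" using power_minus_mult[OF q_pos, of \<tau>] by (simp add: mult.commute)
  have K0: "K > 0" using K_split q_pos by simp
  have tK: "\<tau> * \<tau> ^ (K - 1) = \<tau> ^ K" using power_minus_mult[OF K0, of \<tau>] by (simp add: mult.commute)
  \<comment> \<open>Undoes the cancellations built into \<open>F2\<close> by turning divided
    differences back into differences between \<open>w\<close> and \<open>p\<close>. The term with
    \<open>hh_dd2\<close> appears because \<open>h(w) - h(p) - (w - p) h_w(w)\<close> is of second
    order in \<open>w - p\<close>.\<close>
  have F2e: "\<tau> ^ (K + 1) * (F2 P E1 \<tau> ?z ?\<nu> * h) = Dh (A ?z) \<tau> w - Dh (A ?z) \<tau> p - \<tau> * dt P ?z \<tau> * (h - hw (A ?z) \<tau> p)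
     - of_nat K * \<tau> ^ K * ?\<nu> * h + Eop P ?z \<tau>"
  proof -
    have g1: "hh_dd (A ?z) \<tau> w p - h = (p - w) * hh_dd2 (A ?z) \<tau> w p" unfolding h_def by (rule hh_dd_diff)
    have g2: "h - hw (A ?z) \<tau> p = (w - p) * hw_dd (A ?z) \<tau> w p" unfolding h_def by (rule hw_diff)
    have "F2 P E1 \<tau> ?z ?\<nu> * h = - (of_nat K * \<tau> ^ (K - 1) * ?\<nu>\<^sup>2 * hh_dd2 (A ?z) \<tau> w p)
       - ?\<nu> * ht_dd (A ?z) \<tau> w p - dt P ?z \<tau> * ?\<nu> * hw_dd (A ?z) \<tau> w p + \<tau> ^ (q - 1) * E1 ?z \<tau>"
      unfolding F2_def w_def[symmetric] p_def[symmetric] h_def[symmetric] using h by simp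
    then have "\<tau> ^ (K + 1) * (F2 P E1 \<tau> ?z ?\<nu> * h) = \<tau> * \<tau> ^ K * (- (of_nat K * \<tau> ^ (K - 1) * ?\<nu>\<^sup>2 * hh_dd2 (A ?z) \<tau> w p)
       - ?\<nu> * ht_dd (A ?z) \<tau> w p - dt P ?z \<tau> * ?\<nu> * hw_dd (A ?z) \<tau> w p + \<tau> ^ (q - 1) * E1 ?z \<tau>)" by simp
    also have "\<dots> = - (of_nat K * (\<tau> ^ K * ?\<nu>) * (\<tau> * \<tau> ^ (K - 1) * ?\<nu>) * hh_dd2 (A ?z) \<tau> w p)
       - \<tau> * (\<tau> ^ K * ?\<nu>) * ht_dd (A ?z) \<tau> w p - \<tau> * dt P ?z \<tau> * ((\<tau> ^ K * ?\<nu>) * hw_dd (A ?z) \<tau> w p) + \<tau> ^ K * (\<tau> * \<tau> ^ (q - 1)) * E1 ?z \<tau>"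
      unfolding power2_eq_square by (rule multiply_out)
    also have "\<dots> = of_nat K * (w - p) * ((p - w) * hh_dd2 (A ?z) \<tau> w p)
       - \<tau> * ((w - p) * ht_dd (A ?z) \<tau> w p) - \<tau> * dt P ?z \<tau> * ((w - p) * hw_dd (A ?z) \<tau> w p) + \<tau> ^ (K + q) * E1 ?z \<tau>"
      unfolding tq tK power_add minus_diff_eq[of w p, symmetric] wp by (simp add: algebra_simps)
    also have "\<dots> = of_nat K * (hh (A ?z) \<tau> w - hh (A ?z) \<tau> p) - of_nat K * (w - p) * h
       - \<tau> * (ht (A ?z) \<tau> w - ht (A ?z) \<tau> p) - \<tau> * dt P ?z \<tau> * (h - hw (A ?z) \<tau> p) + Eop P ?z \<tau>"
      unfolding g1[symmetric] ht_diff g2 hh_diff E[rule_format, OF zU] by (simp add: algebra_simps)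
    finally show ?thesis unfolding Dh_eq wp by (simp add: algebra_simps)
  qed
  \<comment> \<open>The quotient of the equations for \<open>w\<close> and \<open>\<tau>\<close>:
    \<open>dw/d\<tau> = Dh / (\<tau> h_w)\<close>.\<close>
  have w'e: "\<tau> * h * w' = Dh (A ?z) \<tau> w"
  proof -
    have "\<tau> * h * w' = \<tau> * dz P ?z \<tau> * (F1 P \<tau> ?z ?\<nu> * h) + \<tau> * dt P ?z \<tau> * h + of_nat K * (\<tau> * \<tau> ^ (K - 1)) * ?\<nu> * h
       + \<tau> ^ (K + 1) * (F2 P E1 \<tau> ?z ?\<nu> * h)" unfolding w'_def by (simp add: algebra_simps)
    also have "\<dots> = - (of_nat n * (\<tau> * \<tau> ^ (q - 1)) * dz P ?z \<tau>) + \<tau> * dt P ?z \<tau> * h + of_nat K * \<tau> ^ K * ?\<nu> * h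
       + \<tau> ^ (K + 1) * (F2 P E1 \<tau> ?z ?\<nu> * h)" unfolding F1e tK by (simp add: algebra_simps)
    also have "\<dots> = Dh (A ?z) \<tau> w" unfolding F2e tq Eop_def p_def by (simp add: algebra_simps)
    finally show ?thesis .
  qed
  have t1: "\<tau> ^ n * (1 / \<tau> ^ n) = 1" using \<tau> by simp
  have w1: "w = (w / \<tau> ^ m) * \<tau> ^ m" using \<tau> by simp
  have Km: "K - m = q + n" "K - n = q + m" using K_split by auto
  have R1: "\<tau> ^ (q + n) * rhs1 (A ?z) M N (1 / \<tau> ^ n) (w / \<tau> ^ m) = h"
    using rhs1_hw[OF t1 w1, of "A ?z"] unfolding Km h_def .
  have R2: "\<tau> ^ (q + m) * rhs2 (A ?z) M N (1 / \<tau> ^ n) (w / \<tau> ^ m) = - hi (A ?z) \<tau> w"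
    using rhs2_hi[OF t1 w1, of "A ?z"] unfolding Km .
  have d1: "((\<lambda>\<tau>. 1 / \<tau> ^ n) has_field_derivative - (of_nat n * \<tau> ^ (n - 1)) / (\<tau> ^ n * \<tau> ^ n)) (at \<tau>)"
    using \<tau> by (auto intro!: derivative_eq_intros)
  have tn: "\<tau> * \<tau> ^ (n - 1) = \<tau> ^ n" using power_minus_mult[OF n_pos, of \<tau>] by (simp add: mult.commute)
  have tm: "\<tau> * \<tau> ^ (m - 1) = \<tau> ^ m" using power_minus_mult[OF m_pos, of \<tau>] by (simp add: mult.commute)
  have e1: "- (of_nat n * \<tau> ^ (n - 1)) / (\<tau> ^ n * \<tau> ^ n) = rhs1 (A ?z) M N (1 / \<tau> ^ n) (w / \<tau> ^ m) * F1 P \<tau> ?z ?\<nu>"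
  proof -
    have "\<tau> * \<tau> ^ (q + n) * (rhs1 (A ?z) M N (1 / \<tau> ^ n) (w / \<tau> ^ m) * F1 P \<tau> ?z ?\<nu>) = \<tau> * (F1 P \<tau> ?z ?\<nu> * (\<tau> ^ (q + n) * rhs1 (A ?z) M N (1 / \<tau> ^ n) (w / \<tau> ^ m)))"
      by (simp only: mult_ac)
    also have "\<dots> = - (of_nat n * \<tau> ^ q)" unfolding R1 F1e tq[symmetric] by (simp only: mult_ac mult_minus_left mult_minus_right)
    also have "\<dots> = \<tau> * \<tau> ^ (q + n) * (- (of_nat n * \<tau> ^ (n - 1)) / (\<tau> ^ n * \<tau> ^ n))"
      using \<tau> unfolding power_add tn[symmetric] by (simp add: field_simps)
    finally show ?thesis using \<tau> by (simp only: mult_cancel_left) simp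
  qed
  show "((\<lambda>\<tau>. 1 / \<tau> ^ n) has_field_derivative
      rhs1 (A ?z) M N (1 / \<tau> ^ n) (wP P \<tau> ?z ?\<nu> / \<tau> ^ m) * F1 P \<tau> ?z ?\<nu>) (at \<tau>)"
    using d1 unfolding e1 w_def .
  have d2: "((\<lambda>\<tau>. wP P \<tau> (zF \<tau>) (nF \<tau>) / \<tau> ^ m) has_field_derivative (w' * \<tau> ^ m - w * (of_nat m * \<tau> ^ (m - 1))) / (\<tau> ^ m * \<tau> ^ m)) (at \<tau>)"
  proof -
    have "((\<lambda>\<tau>. \<tau> ^ m) has_field_derivative of_nat m * \<tau> ^ (m - 1)) (at \<tau>)" by (auto intro!: derivative_eq_intros)
    from DERIV_divide[OF dw this] \<tau> show ?thesis unfolding w_def by simp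
  qed
  have e2: "(w' * \<tau> ^ m - w * (of_nat m * \<tau> ^ (m - 1))) / (\<tau> ^ m * \<tau> ^ m) = rhs2 (A ?z) M N (1 / \<tau> ^ n) (w / \<tau> ^ m) * F1 P \<tau> ?z ?\<nu>"
  proof -
    have g3: "Dh (A ?z) \<tau> w = of_nat n * hi (A ?z) \<tau> w + of_nat m * (w * h)" unfolding h_def by (rule Dh_eq_hi)
    have "h * (\<tau> * (w' * \<tau> ^ m - w * (of_nat m * \<tau> ^ (m - 1)))) = (\<tau> * h * w') * \<tau> ^ m - of_nat m * (w * h) * (\<tau> * \<tau> ^ (m - 1))"
      by (simp add: algebra_simps)
    also have "\<dots> = (of_nat n * hi (A ?z) \<tau> w) * \<tau> ^ m" unfolding w'e tm g3 by (simp add: algebra_simps)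
    finally have 1: "h * (\<tau> * (w' * \<tau> ^ m - w * (of_nat m * \<tau> ^ (m - 1)))) = (of_nat n * hi (A ?z) \<tau> w) * \<tau> ^ m" .
    have "h * (\<tau> * \<tau> ^ (q + m)) * (rhs2 (A ?z) M N (1 / \<tau> ^ n) (w / \<tau> ^ m) * F1 P \<tau> ?z ?\<nu>)
        = \<tau> * ((F1 P \<tau> ?z ?\<nu> * h) * (\<tau> ^ (q + m) * rhs2 (A ?z) M N (1 / \<tau> ^ n) (w / \<tau> ^ m)))" by (simp only: mult_ac)
    also have "\<dots> = \<tau> ^ q * (of_nat n * hi (A ?z) \<tau> w)" unfolding R2 F1e tq[symmetric] by simp
    also have "\<dots> = \<tau> ^ q * (h * (\<tau> * (w' * \<tau> ^ m - w * (of_nat m * \<tau> ^ (m - 1))))) / \<tau> ^ m" unfolding 1 using \<tau> by simp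
    also have "\<dots> = h * (\<tau> * \<tau> ^ (q + m)) * ((w' * \<tau> ^ m - w * (of_nat m * \<tau> ^ (m - 1))) / (\<tau> ^ m * \<tau> ^ m))"
      unfolding power_add by (rule quotient_rearrange) (use \<tau> in simp)
    finally show ?thesis using \<tau> h by (simp only: mult_cancel_left) simp
  qed
  show "((\<lambda>\<tau>. wP P \<tau> (zF \<tau>) (nF \<tau>) / \<tau> ^ m) has_field_derivative
      rhs2 (A ?z) M N (1 / \<tau> ^ n) (wP P \<tau> ?z ?\<nu> / \<tau> ^ m) * F1 P \<tau> ?z ?\<nu>) (at \<tau>)"
    using d2[unfolded e2] unfolding w_def .
qed

end

end

section \<open>Blow-up at the endpoint\<close>

lemma continuation_germ:
  assumes "continuation_along \<alpha> M N \<Omega> \<gamma> r u v" "0 \<le> t" "t < 1"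
  shows "r t > 0" "u t holomorphic_on ball (\<gamma> t) (r t)" "v t holomorphic_on ball (\<gamma> t) (r t)"
    "\<And>z. z \<in> ball (\<gamma> t) (r t) \<Longrightarrow> (u t has_field_derivative rhs1 (\<lambda>i j. \<alpha> i j z) M N (u t z) (v t z)) (at z)"
    "\<And>z. z \<in> ball (\<gamma> t) (r t) \<Longrightarrow> (v t has_field_derivative rhs2 (\<lambda>i j. \<alpha> i j z) M N (u t z) (v t z)) (at z)"
  using assms unfolding continuation_along_def by auto

lemma continuation_compatible:
  assumes cont: "continuation_along \<alpha> M N \<Omega> \<gamma> r u v" and t: "0 \<le> t" "t < 1"
  obtains \<delta> where "\<delta> > 0" "\<And>s. 0 \<le> s \<Longrightarrow> s < 1 \<Longrightarrow> \<bar>s - t\<bar> < \<delta> \<Longrightarrow> \<gamma> s \<in> ball (\<gamma> t) (r t) \<and>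
    (\<forall>z\<in>ball (\<gamma> s) (r s) \<inter> ball (\<gamma> t) (r t). u s z = u t z \<and> v s z = v t z)"
proof -
  have "\<exists>\<delta>>0. \<forall>s\<in>{0..<1}. \<bar>s - t\<bar> < \<delta> \<longrightarrow> \<gamma> s \<in> ball (\<gamma> t) (r t) \<and>
    (\<forall>z\<in>ball (\<gamma> s) (r s) \<inter> ball (\<gamma> t) (r t). u s z = u t z \<and> v s z = v t z)"
    using cont t unfolding continuation_along_def by auto
  then obtain \<delta> where "\<delta> > 0" and "\<forall>s\<in>{0..<1}. \<bar>s - t\<bar> < \<delta> \<longrightarrow> \<gamma> s \<in> ball (\<gamma> t) (r t) \<and>
    (\<forall>z\<in>ball (\<gamma> s) (r s) \<inter> ball (\<gamma> t) (r t). u s z = u t z \<and> v s z = v t z)" by blast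
  then show thesis by (intro that[of \<delta>]) auto
qed

lemma path_close:
  assumes \<gamma>: "path (\<gamma> :: real \<Rightarrow> complex)" and t: "0 \<le> t" "t \<le> 1" and e: "e > 0"
  obtains \<delta> where "\<delta> > 0" "\<And>s. 0 \<le> s \<Longrightarrow> s \<le> 1 \<Longrightarrow> \<bar>s - t\<bar> < \<delta> \<Longrightarrow> norm (\<gamma> s - \<gamma> t) < e"
proof -
  have "continuous_on {0..1} \<gamma>" using \<gamma> unfolding path_def .
  then have "\<exists>\<delta>>0. \<forall>s\<in>{0..1}. dist s t < \<delta> \<longrightarrow> dist (\<gamma> s) (\<gamma> t) < e"
    using t e unfolding continuous_on_iff by auto
  then obtain \<delta> where "\<delta> > 0" "\<forall>s\<in>{0..1}. dist s t < \<delta> \<longrightarrow> dist (\<gamma> s) (\<gamma> t) < e" by blast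
  then show thesis by (intro that[of \<delta>]) (auto simp: dist_norm)
qed

lemma path_close_end:
  assumes \<gamma>: "path (\<gamma> :: real \<Rightarrow> complex)" and e: "e > 0"
  obtains s0 where "0 \<le> s0" "s0 < 1" "\<And>s. s0 \<le> s \<Longrightarrow> s < 1 \<Longrightarrow> norm (\<gamma> s - \<gamma> 1) < e"
proof -
  obtain \<delta> where \<delta>: "\<delta> > 0" "\<And>s. 0 \<le> s \<Longrightarrow> s \<le> 1 \<Longrightarrow> \<bar>s - 1\<bar> < \<delta> \<Longrightarrow> norm (\<gamma> s - \<gamma> 1) < e"
    using path_close[OF \<gamma> _ _ e, of 1] by auto
  show thesis
  proof (rule that[of "max 0 (1 - \<delta> / 2)"])
    show "norm (\<gamma> s - \<gamma> 1) < e" if "max 0 (1 - \<delta> / 2) \<le> s" "s < 1" for s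
      by (rule \<delta>(2)) (use that \<delta>(1) in auto)
  qed (use \<delta>(1) in auto)
qed

lemma continuous_along:
  assumes cont: "continuation_along \<alpha> M N \<Omega> \<gamma> r u v" and \<gamma>: "path \<gamma>"
  shows "continuous_on {0..<1} (\<lambda>s. u s (\<gamma> s))" "continuous_on {0..<1} (\<lambda>s. v s (\<gamma> s))"
proof -
  have c\<gamma>: "continuous_on {0..<1} \<gamma>" using \<gamma> unfolding path_def by (rule continuous_on_subset) auto
  have "((\<lambda>s. u s (\<gamma> s)) \<longlongrightarrow> u t (\<gamma> t)) (at t within {0..<1}) \<and> ((\<lambda>s. v s (\<gamma> s)) \<longlongrightarrow> v t (\<gamma> t)) (at t within {0..<1})"
    if t: "t \<in> {0..<1}" for t
  proof -
    have t': "0 \<le> t" "t < 1" using t by auto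
    note g = continuation_germ[OF cont t']
    obtain \<delta> where \<delta>: "\<delta> > 0" "\<And>s. 0 \<le> s \<Longrightarrow> s < 1 \<Longrightarrow> \<bar>s - t\<bar> < \<delta> \<Longrightarrow> \<gamma> s \<in> ball (\<gamma> t) (r t) \<and>
      (\<forall>z\<in>ball (\<gamma> s) (r s) \<inter> ball (\<gamma> t) (r t). u s z = u t z \<and> v s z = v t z)"
      by (rule continuation_compatible[OF cont t']) (rule that)
    have "eventually (\<lambda>s. s \<in> {0..<1} \<and> \<bar>s - t\<bar> < \<delta>) (at t within {0..<1})"
      unfolding eventually_at using \<delta>(1) by (auto simp: dist_norm intro!: exI[of _ \<delta>])
    then have ev: "eventually (\<lambda>s. u s (\<gamma> s) = u t (\<gamma> s) \<and> v s (\<gamma> s) = v t (\<gamma> s)) (at t within {0..<1})"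
    proof eventually_elim
      case (elim s)
      then have "0 \<le> s" "s < 1" by auto
      with elim \<delta>(2)[of s] continuation_germ(1)[OF cont, of s] show ?case by auto
    qed
    have lim: "(\<gamma> \<longlongrightarrow> \<gamma> t) (at t within {0..<1})" using c\<gamma> t unfolding continuous_on_def by auto
    have "\<gamma> t \<in> ball (\<gamma> t) (r t)" using g(1) by simp
    then have "isCont (u t) (\<gamma> t)" "isCont (v t) (\<gamma> t)" using g(4,5) DERIV_isCont by blast+
    then have "((\<lambda>s. u t (\<gamma> s)) \<longlongrightarrow> u t (\<gamma> t)) (at t within {0..<1})" "((\<lambda>s. v t (\<gamma> s)) \<longlongrightarrow> v t (\<gamma> t)) (at t within {0..<1})"
      using lim isCont_tendsto_compose by blast+
    moreover have "eventually (\<lambda>s. u t (\<gamma> s) = u s (\<gamma> s)) (at t within {0..<1})" "eventually (\<lambda>s. v t (\<gamma> s) = v s (\<gamma> s)) (at t within {0..<1})"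
      using ev by (auto elim: eventually_mono)
    ultimately show ?thesis by (blast intro: Lim_transform_eventually)
  qed
  then show "continuous_on {0..<1} (\<lambda>s. u s (\<gamma> s))" "continuous_on {0..<1} (\<lambda>s. v s (\<gamma> s))"
    unfolding continuous_on_def by blast+
qed

context hamiltonian
begin

lemma rhs_unique:
  assumes Z: "Z holomorphic_on V" "open V" "\<And>s. s \<in> V \<Longrightarrow> Z s \<in> U" and c: "c holomorphic_on V" and t1: "t1 \<in> V"
    and eq: "f' t1 = f t1" "g' t1 = g t1" and e: "e > 0"
    and d: "\<And>t. t \<in> ball t1 e \<Longrightarrow> (f has_field_derivative rhs1 (A (Z t)) M N (f t) (g t) * c t) (at t)"
      "\<And>t. t \<in> ball t1 e \<Longrightarrow> (g has_field_derivative rhs2 (A (Z t)) M N (f t) (g t) * c t) (at t)"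
      "\<And>t. t \<in> ball t1 e \<Longrightarrow> (f' has_field_derivative rhs1 (A (Z t)) M N (f' t) (g' t) * c t) (at t)"
      "\<And>t. t \<in> ball t1 e \<Longrightarrow> (g' has_field_derivative rhs2 (A (Z t)) M N (f' t) (g' t) * c t) (at t)"
  shows "\<exists>\<epsilon>>0. \<forall>t\<in>ball t1 \<epsilon>. f t = f' t \<and> g t = g' t"
proof -
  obtain b where b: "b > 0" "cball t1 b \<subseteq> V" using Z(2) t1 open_contains_cball by blast
  note h = rhs_hol3[OF Z(1,2) b(2) Z(3) c]
  show ?thesis
    by (rule ode_unique_near[OF h(1)[of "cball (f t1) (3 * 1)" "cball (g t1) (3 * 1)"] h(2)[of "cball (f t1) (3 * 1)" "cball (g t1) (3 * 1)"]
          zero_less_one zero_less_one _ _ _ eq e d]) (use b(1) in auto)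
qed

text \<open>If the size were below \<open>B\<close> at points arbitrarily close to the end,
  \<open>picard_uniform\<close> would start from such a point a solution on a disc of fixed radius,
  which covers the endpoint; by uniqueness it extends the continuation. So the size tends to
  infinity and is not merely unbounded.\<close>

lemma blow_up:
  assumes cont: "continuation_along \<alpha> M N \<Omega> \<gamma> r u v" and \<gamma>: "path \<gamma>" and zi: "\<gamma> 1 \<in> U"
    and non: "\<not> continuable_to_end \<gamma> r u v"
  shows "\<exists>s0. 0 \<le> s0 \<and> s0 < 1 \<and> (\<forall>s. s0 \<le> s \<longrightarrow> s < 1 \<longrightarrow> B \<le> TT (u s (\<gamma> s)) (v s (\<gamma> s)))"
proof (rule ccontr)
  assume neg: "\<not> ?thesis"
  define B1 where "B1 = max B 1"
  \<comment> \<open>\<open>TT < B\<close> keeps both unknowns within \<open>B1\<close>, and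
    \<open>picard_uniform\<close> admits initial values up to \<open>R / 2\<close>.\<close>
  define R where "R = 2 * B1"
  have R: "R > 0" unfolding R_def B1_def by simp
  obtain b where b: "b > 0" "cball (\<gamma> 1) b \<subseteq> U" using U zi open_contains_cball by blast
  note h = rhs_hol3[OF holomorphic_on_ident U b(2) _ holomorphic_on_const[of 1]]
  have "\<exists>\<rho>>0. \<forall>t1\<in>cball (\<gamma> 1) (b / 2). \<forall>x1\<in>cball 0 (R / 2). \<forall>y1\<in>cball 0 (R / 2).
     \<exists>f g. f holomorphic_on ball t1 \<rho> \<and> g holomorphic_on ball t1 \<rho> \<and> f t1 = x1 \<and> g t1 = y1 \<and>
     (\<forall>t\<in>ball t1 \<rho>. t \<in> cball (\<gamma> 1) b \<and> f t \<in> cball 0 R \<and> g t \<in> cball 0 R \<and>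
        (f has_field_derivative rhs1 (A t) M N (f t) (g t) * 1) (at t) \<and> (g has_field_derivative rhs2 (A t) M N (f t) (g t) * 1) (at t))"
    by (rule picard_uniform[OF h(1) h(2) b(1) R R])
  then obtain \<rho> where \<rho>: "\<rho> > 0" and pic: "\<And>t1 x1 y1. t1 \<in> cball (\<gamma> 1) (b / 2) \<Longrightarrow> x1 \<in> cball 0 (R / 2) \<Longrightarrow> y1 \<in> cball 0 (R / 2) \<Longrightarrow>
     \<exists>f g. f holomorphic_on ball t1 \<rho> \<and> g holomorphic_on ball t1 \<rho> \<and> f t1 = x1 \<and> g t1 = y1 \<and>
     (\<forall>t\<in>ball t1 \<rho>. t \<in> cball (\<gamma> 1) b \<and> f t \<in> cball 0 R \<and> g t \<in> cball 0 R \<and>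
        (f has_field_derivative rhs1 (A t) M N (f t) (g t) * 1) (at t) \<and> (g has_field_derivative rhs2 (A t) M N (f t) (g t) * 1) (at t))"
    by blast
  \<comment> \<open>With \<open>\<rho> / 4\<close> both the rest of the path and the disc of radius
    \<open>\<rho> / 2\<close> about the endpoint lie in the disc of radius \<open>\<rho>\<close>
    about any \<open>\<gamma> s1\<close> on this tail.\<close>
  obtain s0 where s0: "0 \<le> s0" "s0 < 1" "\<And>s. s0 \<le> s \<Longrightarrow> s < 1 \<Longrightarrow> norm (\<gamma> s - \<gamma> 1) < min (\<rho> / 4) (b / 2)"
    using path_close_end[OF \<gamma>, of "min (\<rho> / 4) (b / 2)"] \<rho> b(1) by auto
  obtain s1 where s1: "s0 \<le> s1" "s1 < 1" "TT (u s1 (\<gamma> s1)) (v s1 (\<gamma> s1)) < B" using neg s0(1,2) not_le by blast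
  have s1': "0 \<le> s1" using s0(1) s1(1) by simp
  have small: "norm x \<le> B1" if "norm x ^ (k + 1) < B" for x :: complex and k
  proof (rule ccontr)
    assume "\<not> norm x \<le> B1"
    then have "norm x > B1" "norm x \<ge> 1" unfolding B1_def by auto
    then have "norm x ^ 1 \<le> norm x ^ (k + 1)" by (intro power_increasing) auto
    then show False using that \<open>norm x > B1\<close> unfolding B1_def by auto
  qed
  have bd: "u s1 (\<gamma> s1) \<in> cball 0 (R / 2)" "v s1 (\<gamma> s1) \<in> cball 0 (R / 2)"
  proof -
    have "norm (u s1 (\<gamma> s1)) ^ (M + 1) \<ge> 0" "norm (v s1 (\<gamma> s1)) ^ (N + 1) \<ge> 0" by auto
    then have "norm (u s1 (\<gamma> s1)) ^ (M + 1) < B" "norm (v s1 (\<gamma> s1)) ^ (N + 1) < B" using s1(3) unfolding TT_def by linarith+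
    then show "u s1 (\<gamma> s1) \<in> cball 0 (R / 2)" "v s1 (\<gamma> s1) \<in> cball 0 (R / 2)"
      using small unfolding R_def by auto
  qed
  have n1: "norm (\<gamma> s1 - \<gamma> 1) < \<rho> / 4" "norm (\<gamma> s1 - \<gamma> 1) < b / 2" using s0(3)[OF s1(1,2)] by auto
  have t1: "\<gamma> s1 \<in> cball (\<gamma> 1) (b / 2)" using n1 by (simp add: dist_norm norm_minus_commute)
  obtain f g where fg: "f holomorphic_on ball (\<gamma> s1) \<rho>" "g holomorphic_on ball (\<gamma> s1) \<rho>" "f (\<gamma> s1) = u s1 (\<gamma> s1)" "g (\<gamma> s1) = v s1 (\<gamma> s1)"
    and dfg: "\<And>t. t \<in> ball (\<gamma> s1) \<rho> \<Longrightarrow> (f has_field_derivative rhs1 (A t) M N (f t) (g t) * 1) (at t)"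
      "\<And>t. t \<in> ball (\<gamma> s1) \<rho> \<Longrightarrow> (g has_field_derivative rhs2 (A t) M N (f t) (g t) * 1) (at t)"
    using pic[OF t1 bd] by blast
  note germ = continuation_germ[OF cont s1' s1(2)]
  have init: "\<exists>\<epsilon>>0. \<forall>z\<in>ball (\<gamma> s1) \<epsilon>. u s1 z = f z \<and> v s1 z = g z"
  proof (rule rhs_unique[OF holomorphic_on_ident U _ holomorphic_on_const[of 1]])
    show "\<gamma> s1 \<in> U" using b t1 by (auto simp: subset_iff)
    show "min \<rho> (r s1) > 0" using \<rho> germ(1) by simp
  qed (use germ(4,5) dfg fg in auto)
  have in_V: "\<gamma> s \<in> ball (\<gamma> s1) \<rho>" if "s1 \<le> s" "s < 1" for s
  proof -
    have "norm (\<gamma> s - \<gamma> 1) < \<rho> / 4" using s0(3)[of s] that s1 by auto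
    then show ?thesis using n1 norm_triangle_ineq4[of "\<gamma> s1 - \<gamma> 1" "\<gamma> s - \<gamma> 1"] \<rho> by (simp add: dist_norm)
  qed
  have agree: "\<exists>\<epsilon>>0. \<forall>z\<in>ball (\<gamma> s) \<epsilon>. u s z = f z \<and> v s z = g z" if "s1 \<le> s" "s < 1" for s
    by (rule continuation_identity[OF cont \<gamma> s1' s1(2) open_ball fg(1,2) in_V init that])
  have sub: "ball (\<gamma> 1) (\<rho> / 2) \<subseteq> ball (\<gamma> s1) \<rho>"
  proof
    fix z assume "z \<in> ball (\<gamma> 1) (\<rho> / 2)"
    then show "z \<in> ball (\<gamma> s1) \<rho>" using n1 norm_triangle_ineq[of "\<gamma> s1 - \<gamma> 1" "\<gamma> 1 - z"] \<rho> by (simp add: dist_norm)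
  qed
  have "\<exists>\<delta>>0. \<forall>s\<in>{0..<1}. 1 - \<delta> < s \<longrightarrow> (\<forall>z\<in>ball (\<gamma> s) (r s) \<inter> ball (\<gamma> 1) (\<rho> / 2). u s z = f z \<and> v s z = g z)"
  proof (intro conjI exI[of _ "1 - s1"] ballI impI)
    fix s z assume s: "s \<in> {0..<1::real}" "1 - (1 - s1) < s" and z: "z \<in> ball (\<gamma> s) (r s) \<inter> ball (\<gamma> 1) (\<rho> / 2)"
    have s': "s1 \<le> s" "s < 1" "0 \<le> s" using s by auto
    note gs = continuation_germ[OF cont s'(3,2)]
    let ?S = "ball (\<gamma> s) (r s) \<inter> ball (\<gamma> 1) (\<rho> / 2)"
    obtain \<epsilon> where \<epsilon>: "\<epsilon> > 0" "\<And>z. z \<in> ball (\<gamma> s) \<epsilon> \<Longrightarrow> u s z = f z \<and> v s z = g z" using agree[OF s'(1,2)] by blast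
    have S: "open ?S" "connected ?S" by (auto intro: convex_connected convex_Int)
    have "norm (\<gamma> s - \<gamma> 1) < \<rho> / 4" using s0(3)[of s] s' s1 by auto
    then have c: "\<gamma> s \<in> ?S" using gs(1) \<rho> by (simp add: dist_norm norm_minus_commute)
    have hs: "u s holomorphic_on ?S" "v s holomorphic_on ?S" "f holomorphic_on ?S" "g holomorphic_on ?S"
      using gs(2,3) fg(1,2) sub by (auto elim!: holomorphic_on_subset)
    show "u s z = f z" by (rule eq_on_ball_if_eq_near[OF hs(1,3) S c \<epsilon>(1) _ z]) (use \<epsilon>(2) in auto)
    show "v s z = g z" by (rule eq_on_ball_if_eq_near[OF hs(2,4) S c \<epsilon>(1) _ z]) (use \<epsilon>(2) in auto)
  qed (use s1 in simp)
  moreover have "f holomorphic_on ball (\<gamma> 1) (\<rho> / 2)" "g holomorphic_on ball (\<gamma> 1) (\<rho> / 2)"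
    using holomorphic_on_subset[OF fg(1) sub] holomorphic_on_subset[OF fg(2) sub] by blast+
  moreover have "\<rho> / 2 > 0" using \<rho> by simp
  ultimately have "continuable_to_end \<gamma> r u v" unfolding continuable_to_end_def by blast
  then show False using non by simp
qed

end

context phase
begin

lemma Ph_bounded:
  assumes cont: "continuation_along \<alpha> M N \<Omega> \<gamma> r u v" and \<gamma>: "path \<gamma>" "finite_length \<gamma>"
    and s0: "0 \<le> s0" "s0 < 1" and near: "\<And>s. s0 \<le> s \<Longrightarrow> s < 1 \<Longrightarrow> norm (\<gamma> s - zi) < ez \<and> T0 \<le> TT (u s (\<gamma> s)) (v s (\<gamma> s))"
  shows "\<exists>B. \<forall>s. s0 \<le> s \<and> s < 1 \<longrightarrow> Ph (\<gamma> s) (u s (\<gamma> s)) (v s (\<gamma> s)) \<le> B"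
proof -
  obtain C8 where C8: "C8 \<ge> 0" "\<And>z y1 y2. norm (z - zi) < ez \<Longrightarrow> (y1 has_field_derivative rhs1 (A z) M N (y1 z) (y2 z)) (at z) \<Longrightarrow>
     (y2 has_field_derivative rhs2 (A z) M N (y1 z) (y2 z)) (at z) \<Longrightarrow> TT (y1 z) (y2 z) \<ge> T0 \<Longrightarrow>
     calm (\<lambda>x. Ph x (y1 x) (y2 x)) z C8" using Ph_calm by blast
  show ?thesis
  proof (rule bounded_along_finite_length[OF \<gamma>(2) s0 C8(1)])
    fix t assume t: "s0 \<le> t" "t < 1"
    then have t': "0 \<le> t" "t < 1" using s0 by auto
    note g = continuation_germ[OF cont t']
    have tb: "\<gamma> t \<in> ball (\<gamma> t) (r t)" using g(1) by simp
    have "calm (\<lambda>x. Ph x (u t x) (v t x)) (\<gamma> t) C8"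
      by (rule C8(2)) (use near[OF t] g(4,5)[OF tb] in auto)
    then obtain \<epsilon> where \<epsilon>: "\<epsilon> > 0" "\<And>x. norm (x - \<gamma> t) < \<epsilon> \<Longrightarrow>
        \<bar>Ph x (u t x) (v t x) - Ph (\<gamma> t) (u t (\<gamma> t)) (v t (\<gamma> t))\<bar> \<le> C8 * norm (x - \<gamma> t)"
      unfolding calm_def eventually_nhds_metric by (auto simp: dist_norm)
    obtain \<delta>1 where \<delta>1: "\<delta>1 > 0" "\<And>s. 0 \<le> s \<Longrightarrow> s < 1 \<Longrightarrow> \<bar>s - t\<bar> < \<delta>1 \<Longrightarrow> \<gamma> s \<in> ball (\<gamma> t) (r t) \<and>
      (\<forall>z\<in>ball (\<gamma> s) (r s) \<inter> ball (\<gamma> t) (r t). u s z = u t z \<and> v s z = v t z)"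
      by (rule continuation_compatible[OF cont t']) (rule that)
    obtain \<delta>2 where \<delta>2: "\<delta>2 > 0" "\<And>s. 0 \<le> s \<Longrightarrow> s \<le> 1 \<Longrightarrow> \<bar>s - t\<bar> < \<delta>2 \<Longrightarrow> norm (\<gamma> s - \<gamma> t) < \<epsilon>"
      by (rule path_close[OF \<gamma>(1) t'(1) less_imp_le[OF t'(2)] \<epsilon>(1)]) (rule that)
    show "\<exists>\<delta>>0. \<forall>s. s0 \<le> s \<and> s < 1 \<and> \<bar>s - t\<bar> < \<delta> \<longrightarrow>
        \<bar>Ph (\<gamma> s) (u s (\<gamma> s)) (v s (\<gamma> s)) - Ph (\<gamma> t) (u t (\<gamma> t)) (v t (\<gamma> t))\<bar> \<le> C8 * norm (\<gamma> s - \<gamma> t)"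
    proof (intro exI[of _ "min \<delta>1 \<delta>2"] conjI allI impI)
      fix s assume s: "s0 \<le> s \<and> s < 1 \<and> \<bar>s - t\<bar> < min \<delta>1 \<delta>2"
      then have s': "0 \<le> s" "s < 1" using s0 by auto
      have "\<gamma> s \<in> ball (\<gamma> s) (r s)" using continuation_germ(1)[OF cont s'] by simp
      then have "u s (\<gamma> s) = u t (\<gamma> s)" "v s (\<gamma> s) = v t (\<gamma> s)" using \<delta>1(2)[OF s'] s by auto
      then show "\<bar>Ph (\<gamma> s) (u s (\<gamma> s)) (v s (\<gamma> s)) - Ph (\<gamma> t) (u t (\<gamma> t)) (v t (\<gamma> t))\<bar> \<le> C8 * norm (\<gamma> s - \<gamma> t)"
        using \<epsilon>(2) \<delta>2(2)[of s] s s' by simp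
    qed (use \<delta>1 \<delta>2 in simp)
  qed
qed

text \<open>\<open>B\<close> comes before \<open>\<eta>\<close>: the bound on
  \<open>(w - P) / \<tau>^K\<close> must hold while \<open>\<tau>\<close> tends to 0, since the
  radius of the charts is chosen in terms of it.\<close>

lemma asymptotics:
  assumes cont: "continuation_along \<alpha> M N \<Omega> \<gamma> r u v" and \<gamma>: "path \<gamma>" "finite_length \<gamma>" "\<gamma> 1 = zi"
    and non: "\<not> continuable_to_end \<gamma> r u v"
  shows "\<exists>B\<ge>0. \<forall>\<eta>>0. \<exists>s1. 0 \<le> s1 \<and> s1 < 1 \<and> (\<forall>s. s1 \<le> s \<longrightarrow> s < 1 \<longrightarrow> norm (\<gamma> s - zi) < \<eta> \<and> u s (\<gamma> s) \<noteq> 0 \<and>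
    (\<forall>\<tau>. \<tau> ^ n * u s (\<gamma> s) = 1 \<longrightarrow> norm \<tau> < \<eta> \<and>
      (\<exists>c\<in>Rt. norm (v s (\<gamma> s) * \<tau> ^ m - Ps c (\<gamma> s) \<tau>) \<le> B * norm \<tau> ^ K)))"
proof -
  have zU: "\<gamma> 1 \<in> U" using \<gamma>(3) zi by simp
  have big: "\<exists>s0. 0 \<le> s0 \<and> s0 < 1 \<and> (\<forall>s. s0 \<le> s \<longrightarrow> s < 1 \<longrightarrow> norm (\<gamma> s - zi) < \<eta> \<and> b \<le> TT (u s (\<gamma> s)) (v s (\<gamma> s)))"
    if \<eta>: "\<eta> > 0" for b \<eta>
  proof -
    obtain s1 where s1: "0 \<le> s1" "s1 < 1" "\<And>s. s1 \<le> s \<Longrightarrow> s < 1 \<Longrightarrow> b \<le> TT (u s (\<gamma> s)) (v s (\<gamma> s))"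
      using blow_up[OF cont \<gamma>(1) zU non] by blast
    obtain s2 where s2: "0 \<le> s2" "s2 < 1" "\<And>s. s2 \<le> s \<Longrightarrow> s < 1 \<Longrightarrow> norm (\<gamma> s - \<gamma> 1) < \<eta>" by (rule path_close_end[OF \<gamma>(1) \<eta>]) (rule that)
    show ?thesis
      by (intro exI[of _ "max s1 s2"]) (use s1 s2 \<gamma>(3) in auto)
  qed
  obtain s0 where s0: "0 \<le> s0" "s0 < 1" "\<And>s. s0 \<le> s \<Longrightarrow> s < 1 \<Longrightarrow> norm (\<gamma> s - zi) < ez \<and> T0 \<le> TT (u s (\<gamma> s)) (v s (\<gamma> s))"
    using big[OF pos(2), of T0] by blast
  obtain B where B: "\<And>s. s0 \<le> s \<Longrightarrow> s < 1 \<Longrightarrow> Ph (\<gamma> s) (u s (\<gamma> s)) (v s (\<gamma> s)) \<le> B"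
    using Ph_bounded[OF cont \<gamma>(1,2) s0] by blast
  show ?thesis
  proof (rule exI[of _ "C * exp B"], intro conjI allI impI)
    show "0 \<le> C * exp B" using eC by simp
    fix \<eta> :: real assume \<eta>: "\<eta> > 0"
    \<comment> \<open>By the second entry a state outside the inner cone would violate
      \<open>Ph \<le> B\<close> through \<open>Ph_lower\<close>; by the third,
      \<open>|\<tau>|^K TT \<le> C4\<close> yields \<open>|\<tau>| < \<eta>\<close>.\<close>
    define b where "b = Max {T0, C5 * exp ((B + n) / n), C4 / \<eta> ^ K + 1}"
    have b: "T0 \<le> b" "C5 * exp ((B + n) / n) \<le> b" "C4 / \<eta> ^ K < b" unfolding b_def by (simp_all add: less_max_iff_disj le_max_iff_disj)
    obtain s1 where s1: "0 \<le> s1" "s1 < 1" "\<And>s. s1 \<le> s \<Longrightarrow> s < 1 \<Longrightarrow> norm (\<gamma> s - zi) < \<eta> \<and> b \<le> TT (u s (\<gamma> s)) (v s (\<gamma> s))"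
      using big[OF \<eta>, of b] by blast
    have main: "norm (\<gamma> s - zi) < \<eta> \<and> u s (\<gamma> s) \<noteq> 0 \<and> (\<forall>\<tau>. \<tau> ^ n * u s (\<gamma> s) = 1 \<longrightarrow> norm \<tau> < \<eta> \<and>
      (\<exists>c\<in>Rt. norm (v s (\<gamma> s) * \<tau> ^ m - Ps c (\<gamma> s) \<tau>) \<le> C * exp B * norm \<tau> ^ K))"
      if s: "max s0 s1 \<le> s" "s < 1" for s
    proof -
      define y1 y2 where "y1 = u s (\<gamma> s)" and "y2 = v s (\<gamma> s)"
      have s': "s0 \<le> s" "s1 \<le> s" using s by auto
      have z: "norm (\<gamma> s - zi) < ez" using s0(3)[OF s'(1) s(2)] by simp
      have T: "b \<le> TT y1 y2" using s1(3)[OF s'(2) s(2)] unfolding y1_def y2_def by simp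
      have T0': "T0 \<le> TT y1 y2" using T b(1) by simp
      have PhB: "Ph (\<gamma> s) y1 y2 \<le> B" using B[OF s'(1) s(2)] unfolding y1_def y2_def .
      have inner: "norm (h0 y1 y2) < e1 * norm y1 ^ (M + 1)"
      proof (rule ccontr)
        assume "\<not> ?thesis"
        from Ph_lower[OF z T0' this] have "real n * ln (1 + TT y1 y2 / C5) \<le> B + n" using PhB by simp
        then have "ln (1 + TT y1 y2 / C5) \<le> (B + n) / n" using n_pos by (simp add: field_simps)
        moreover have p: "1 + TT y1 y2 / C5 > 0" using T0' pos by (simp add: add_pos_nonneg)
        ultimately have "1 + TT y1 y2 / C5 \<le> exp ((B + n) / n)" by (metis exp_le_cancel_iff exp_ln)
        moreover have "exp ((B + n) / n) \<le> TT y1 y2 / C5" using T b(2) pos by (simp add: field_simps)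
        ultimately show False by simp
      qed
      have y1: "y1 \<noteq> 0" using inner by auto
      have inner3: "norm (h0 y1 y2) < 3 * e1 * norm y1 ^ (M + 1)"
      proof -
        have "0 \<le> e1 * norm y1 ^ (M + 1)" using pos(1) by (intro mult_nonneg_nonneg zero_le_power) auto
        then show ?thesis using inner by linarith
      qed
      have "norm \<tau> < \<eta> \<and> (\<exists>c\<in>Rt. norm (y2 * \<tau> ^ m - Ps c (\<gamma> s) \<tau>) \<le> C * exp B * norm \<tau> ^ K)" if t: "\<tau> ^ n * y1 = 1" for \<tau>
      proof
        have "norm \<tau> ^ K * TT y1 y2 \<le> C4" using small[OF T0' inner3 t] by simp
        show "norm \<tau> < \<eta>"
        proof (rule ccontr)
          assume "\<not> norm \<tau> < \<eta>"
          then have "\<eta> ^ K \<le> norm \<tau> ^ K" using \<eta> by (intro power_mono) auto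
          then have "\<eta> ^ K * TT y1 y2 \<le> norm \<tau> ^ K * TT y1 y2" using T0' pos by (intro mult_right_mono) auto
          moreover have "C4 < \<eta> ^ K * TT y1 y2"
          proof -
            have "C4 / \<eta> ^ K < TT y1 y2" using b(3) T by (rule less_le_trans)
            then show ?thesis using \<eta> by (simp add: pos_divide_less_eq mult.commute)
          qed
          ultimately show False using \<open>norm \<tau> ^ K * TT y1 y2 \<le> C4\<close> by simp
        qed
        let ?w = "y2 * \<tau> ^ m" and ?c = "sel (y2 * \<tau> ^ m)"
        note bf = branch_facts[OF T0' inner3 t]
        have "ln (1 + norm (Wf ?c (\<gamma> s) \<tau> ?w)) \<le> B" using Ph_inner[OF inner t] PhB by (rule order_trans)
        moreover have "1 + norm (Wf ?c (\<gamma> s) \<tau> ?w) > 0" by (simp add: add_pos_nonneg)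
        ultimately have "1 + norm (Wf ?c (\<gamma> s) \<tau> ?w) \<le> exp B" by (metis exp_le_cancel_iff exp_ln)
        then have W: "norm (Wf ?c (\<gamma> s) \<tau> ?w) \<le> exp B" by simp
        have "norm (hh (A (\<gamma> s)) \<tau> ?w - hh (A (\<gamma> s)) \<tau> (Ps ?c (\<gamma> s) \<tau>)) = norm (Wf ?c (\<gamma> s) \<tau> ?w) * norm \<tau> ^ K"
          unfolding Wf_def norm_divide norm_power using bf(4) by simp
        also have "\<dots> \<le> exp B * norm \<tau> ^ K" using W by (intro mult_right_mono) auto
        finally have 1: "norm (hh (A (\<gamma> s)) \<tau> ?w - hh (A (\<gamma> s)) \<tau> (Ps ?c (\<gamma> s) \<tau>)) \<le> exp B * norm \<tau> ^ K" .
        have "norm (?w - Ps ?c (\<gamma> s) \<tau>) \<le> C * norm (hh (A (\<gamma> s)) \<tau> ?w - hh (A (\<gamma> s)) \<tau> (Ps ?c (\<gamma> s) \<tau>))"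
          by (rule near_facts(2)[OF bf(1) z bf(3,2)])
        also have "\<dots> \<le> C * (exp B * norm \<tau> ^ K)" using 1 eC by (intro mult_left_mono) auto
        finally have "norm (?w - Ps ?c (\<gamma> s) \<tau>) \<le> C * exp B * norm \<tau> ^ K" by (simp only: mult.assoc)
        then show "\<exists>c\<in>Rt. norm (y2 * \<tau> ^ m - Ps c (\<gamma> s) \<tau>) \<le> C * exp B * norm \<tau> ^ K" using bf(1) by blast
      qed
      then show ?thesis using s1(3)[OF s'(2) s(2)] y1 unfolding y1_def y2_def by blast
    qed
    show "\<exists>s1. 0 \<le> s1 \<and> s1 < 1 \<and> (\<forall>s. s1 \<le> s \<longrightarrow> s < 1 \<longrightarrow> norm (\<gamma> s - zi) < \<eta> \<and> u s (\<gamma> s) \<noteq> 0 \<and>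
    (\<forall>\<tau>. \<tau> ^ n * u s (\<gamma> s) = 1 \<longrightarrow> norm \<tau> < \<eta> \<and>
      (\<exists>c\<in>Rt. norm (v s (\<gamma> s) * \<tau> ^ m - Ps c (\<gamma> s) \<tau>) \<le> C * exp B * norm \<tau> ^ K)))"
      using main s0(1,2) s1(1,2) by (intro exI[of _ "max s0 s1"]) auto
  qed
qed

end

section \<open>Charts at infinity\<close>

context hamiltonian
begin

text \<open>A solution parametrised by \<open>\<tau>\<close>, with \<open>z = Z\<close> and
  \<open>w = X\<close>. The disc may contain 0, where \<open>y1\<close> has a pole, so the equations
  are asked for only off 0; \<open>k\<close> without zeros makes \<open>Z\<close> vanish to exact
  order \<open>q\<close> relative to its value there.\<close>

definition chart :: "complex \<Rightarrow> real \<Rightarrow> (complex \<Rightarrow> complex) \<Rightarrow> (complex \<Rightarrow> complex) \<Rightarrow> (complex \<Rightarrow> complex) \<Rightarrow> bool" where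
  "chart \<tau>1 \<rho> Z X k \<longleftrightarrow> Z holomorphic_on ball \<tau>1 \<rho> \<and> X holomorphic_on ball \<tau>1 \<rho> \<and> k holomorphic_on ball \<tau>1 \<rho> \<and>
     (\<forall>t\<in>ball \<tau>1 \<rho>. Z t \<in> U \<and> k t \<noteq> 0 \<and> (Z has_field_derivative t ^ (q - 1) * k t) (at t) \<and>
       (t \<noteq> 0 \<longrightarrow>
         ((\<lambda>t. 1 / t ^ n) has_field_derivative rhs1 (A (Z t)) M N (1 / t ^ n) (X t / t ^ m) * (t ^ (q - 1) * k t)) (at t) \<and>
         ((\<lambda>t. X t / t ^ m) has_field_derivative rhs2 (A (Z t)) M N (1 / t ^ n) (X t / t ^ m) * (t ^ (q - 1) * k t)) (at t)))"

lemma chart_mono: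
  assumes "chart \<tau>1 \<rho> Z X k" "\<rho>' \<le> \<rho>"
  shows "chart \<tau>1 \<rho>' Z X k"
proof -
  have sub: "ball \<tau>1 \<rho>' \<subseteq> ball \<tau>1 \<rho>" using assms(2) by (rule subset_ball)
  then show ?thesis using assms(1) unfolding chart_def by (blast intro: holomorphic_on_subset)
qed

end

context phase
begin

text \<open>The regular system is solved with initial value \<open>(x1 - P) / \<tau>1^K\<close> for
  \<open>\<nu>\<close>, which \<open>B\<close> bounds. The Picard radius does not depend on
  \<open>\<tau>1\<close>, so a start close enough to 0 has 0 in its disc.\<close>

lemma chart_exists:
  assumes c: "c \<in> Rt" and B: "B \<ge> 0"
  shows "\<exists>\<rho>>0. \<forall>\<tau>1 z1 x1. \<tau>1 \<noteq> 0 \<longrightarrow> norm \<tau>1 \<le> \<rho> \<longrightarrow> norm (z1 - zi) \<le> \<rho> \<longrightarrow> norm (x1 - Ps c z1 \<tau>1) \<le> B * norm \<tau>1 ^ K \<longrightarrow>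
     (\<exists>Z X k. chart \<tau>1 \<rho> Z X k \<and> Z \<tau>1 = z1 \<and> X \<tau>1 = x1)"
proof -
  define P where "P = Ps c"
  obtain E1 Q1 where s: "is_surface c P E1 Q1" using Ps_surface[OF c] unfolding P_def by blast
  have P: "PH U P" and E1: "PH U E1" and P0: "P zi 0 = c" and E: "\<forall>z\<in>U. \<forall>\<tau>. Eop P z \<tau> = \<tau> ^ (K + q) * E1 z \<tau>"
    using s unfolding is_surface_def by auto
  have e: "e > 0" by (rule eC)
  obtain e' where e': "e' > 0" "\<And>z \<tau>. norm (z - zi) < e' \<Longrightarrow> norm \<tau> < e' \<Longrightarrow> norm (P z \<tau> - c) < e / 2"
  proof -
    have "open (U \<times> (UNIV :: complex set))" using U by (intro open_Times) auto
    then have "isCont (\<lambda>(z, \<tau>). P z \<tau>) (zi, 0)"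
      using PH_continuous[OF P] continuous_on_eq_continuous_at zi by blast
    then have "((\<lambda>(z, \<tau>). P z \<tau>) \<longlongrightarrow> c) (nhds (zi, 0))"
      unfolding isCont_def tendsto_at_iff_tendsto_nhds using P0 by simp
    from tendstoD[OF this half_gt_zero[OF e]]
    have "eventually (\<lambda>p. dist (case p of (z, \<tau>) \<Rightarrow> P z \<tau>) c < e / 2) (nhds (zi, 0))" .
    then have "eventually (\<lambda>p. norm (P (fst p) (snd p) - c) < e / 2) (nhds (zi, 0))"
      by (simp add: case_prod_unfold dist_norm)
    then obtain S where S: "open S" "(zi, 0) \<in> S" "\<forall>p\<in>S. norm (P (fst p) (snd p) - c) < e / 2"
      unfolding eventually_nhds by blast
    obtain S1 S2 where S12': "open S1" "open S2" "(zi, 0) \<in> S1 \<times> S2" "S1 \<times> S2 \<subseteq> S"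
      by (rule open_prod_elim[OF S(1,2)]) (rule that)
    then have S12: "open S1" "open S2" "zi \<in> S1" "0 \<in> S2" "S1 \<times> S2 \<subseteq> S" by blast+
    obtain a1 where a1: "a1 > 0" "ball zi a1 \<subseteq> S1" using S12 open_contains_ball by blast
    obtain a2 where a2: "a2 > 0" "ball 0 a2 \<subseteq> S2" using S12 open_contains_ball by blast
    show thesis
    proof (rule that[of "min a1 a2"])
      show "norm (P z \<tau> - c) < e / 2" if "norm (z - zi) < min a1 a2" "norm \<tau> < min a1 a2" for z \<tau>
      proof -
        have "z \<in> S1" using that a1 by (auto simp: dist_norm norm_minus_commute)
        moreover have "\<tau> \<in> S2" using that a2 by (auto simp: dist_norm)
        ultimately have "(z, \<tau>) \<in> S" using S12 by auto
        then show ?thesis using S(3) by force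
      qed
    qed (use a1 a2 in simp)
  qed
  \<comment> \<open>\<open>R2 / 2 \<ge> B\<close> admits the initial value of \<open>\<nu>\<close>.
    The last entry of \<open>r\<close> then keeps \<open>\<tau>^K \<nu>\<close> below
    \<open>e / 2\<close>, so that \<open>w\<close> stays within \<open>e\<close> of the root, where
    \<open>h_w\<close> has no zero.\<close>
  define R2 where "R2 = 2 * B + 1"
  have R2: "R2 > 0" "B \<le> R2 / 2" unfolding R2_def using B by auto
  define r where "r = Min {e' / 2, e / 2, 1, e / (12 * R2)}"
  have r: "r > 0" "r < e'" "r < e" "r \<le> 1" "r \<le> e / (12 * R2)" unfolding r_def using e e' R2 by (auto simp: Min_less_iff)
  define R1 where "R1 = min (e' / 6) (ez / 6)"
  have R1: "R1 > 0" "3 * R1 < e'" "3 * R1 < ez" unfolding R1_def using e' pos by (auto simp: min_def)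
  have rK: "norm \<tau> ^ K * (3 * R2) < e / 2" if "norm \<tau> \<le> r" for \<tau> :: complex
  proof -
    have K0: "1 \<le> K" using K_split q_pos by simp
    have "norm \<tau> ^ K \<le> norm \<tau> ^ 1" using that r(4) K0 by (intro power_decreasing) auto
    then have "norm \<tau> ^ K * (3 * R2) \<le> r * (3 * R2)" using that R2 by (intro mult_right_mono) auto
    also have "\<dots> \<le> e / (12 * R2) * (3 * R2)" using r(5) R2 by (intro mult_right_mono) auto
    also have "\<dots> < e / 2" using R2 e by simp
    finally show ?thesis .
  qed
  have cl: "norm (wP P \<tau> z \<nu> - c) < e" "z \<in> U" "hw (A z) \<tau> (wP P \<tau> z \<nu>) \<noteq> 0"
    if "\<tau> \<in> cball 0 r" "z \<in> cball zi (3 * R1)" "\<nu> \<in> cball 0 (3 * R2)" for \<tau> z \<nu>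
  proof -
    have t: "norm \<tau> \<le> r" "norm (z - zi) \<le> 3 * R1" "norm \<nu> \<le> 3 * R2" using that by (auto simp: dist_norm norm_minus_commute)
    have "norm (P z \<tau> - c) < e / 2" by (rule e'(2)) (use t r R1 in auto)
    moreover have "norm (\<tau> ^ K * \<nu>) \<le> norm \<tau> ^ K * (3 * R2)" unfolding norm_mult norm_power using t by (intro mult_left_mono) auto
    moreover have "norm (wP P \<tau> z \<nu> - c) \<le> norm (P z \<tau> - c) + norm (\<tau> ^ K * \<nu>)"
      unfolding wP_def using norm_triangle_ineq[of "P z \<tau> - c" "\<tau> ^ K * \<nu>"] by (simp add: algebra_simps)
    ultimately show 1: "norm (wP P \<tau> z \<nu> - c) < e" using rK[OF t(1)] by linarith
    have z: "norm (z - zi) < ez" and t': "norm \<tau> < e" using t R1 r by auto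
    show "z \<in> U" by (rule near_facts(1)[OF c z t' 1])
    show "hw (A z) \<tau> (wP P \<tau> z \<nu>) \<noteq> 0" by (rule near_facts(6)[OF c z t' 1])
  qed
  have BU: "cball zi (3 * R1) \<subseteq> U" using cl(2)[of 0 _ 0] r R2 by auto
  note h3 = F_hol3[OF P E1 E BU cl(3), of "cball 0 r" "cball 0 (3 * R2)"]
  have "\<exists>\<rho>>0. \<forall>t1\<in>cball 0 (r / 2). \<forall>x1\<in>cball zi (R1 / 2). \<forall>y1\<in>cball 0 (R2 / 2).
     \<exists>f g. f holomorphic_on ball t1 \<rho> \<and> g holomorphic_on ball t1 \<rho> \<and> f t1 = x1 \<and> g t1 = y1 \<and>
     (\<forall>t\<in>ball t1 \<rho>. t \<in> cball 0 r \<and> f t \<in> cball zi R1 \<and> g t \<in> cball 0 R2 \<and>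
        (f has_field_derivative F1 P t (f t) (g t)) (at t) \<and> (g has_field_derivative F2 P E1 t (f t) (g t)) (at t))"
    by (rule picard_uniform[OF h3(1) h3(2) r(1) R1(1) R2(1)])
  then obtain \<rho> where \<rho>: "\<rho> > 0" and pic: "\<And>t1 x1 y1. t1 \<in> cball 0 (r / 2) \<Longrightarrow> x1 \<in> cball zi (R1 / 2) \<Longrightarrow> y1 \<in> cball 0 (R2 / 2) \<Longrightarrow>
     \<exists>f g. f holomorphic_on ball t1 \<rho> \<and> g holomorphic_on ball t1 \<rho> \<and> f t1 = x1 \<and> g t1 = y1 \<and>
     (\<forall>t\<in>ball t1 \<rho>. t \<in> cball 0 r \<and> f t \<in> cball zi R1 \<and> g t \<in> cball 0 R2 \<and>
        (f has_field_derivative F1 P t (f t) (g t)) (at t) \<and> (g has_field_derivative F2 P E1 t (f t) (g t)) (at t))"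
    by blast
  define \<eta> where "\<eta> = Min {\<rho>, r / 2, R1 / 2}"
  have \<eta>: "\<eta> > 0" "\<eta> \<le> \<rho>" "\<eta> \<le> r / 2" "\<eta> \<le> R1 / 2" unfolding \<eta>_def using \<rho> r R1 by auto
  show ?thesis
  proof (intro exI[of _ \<eta>] conjI allI impI)
    show "\<eta> > 0" by (rule \<eta>)
    fix \<tau>1 z1 x1 :: complex
    assume t1: "\<tau>1 \<noteq> 0" "norm \<tau>1 \<le> \<eta>" and z1: "norm (z1 - zi) \<le> \<eta>" and x1: "norm (x1 - Ps c z1 \<tau>1) \<le> B * norm \<tau>1 ^ K"
    define \<nu>1 where "\<nu>1 = (x1 - P z1 \<tau>1) / \<tau>1 ^ K"
    have "norm \<nu>1 \<le> B" unfolding \<nu>1_def P_def norm_divide norm_power using x1 t1 by (simp add: pos_divide_le_eq)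
    then have i: "\<tau>1 \<in> cball 0 (r / 2)" "z1 \<in> cball zi (R1 / 2)" "\<nu>1 \<in> cball 0 (R2 / 2)"
      using t1 z1 \<eta> R2 by (auto simp: dist_norm norm_minus_commute)
    obtain Z nF where Z: "Z holomorphic_on ball \<tau>1 \<rho>" "nF holomorphic_on ball \<tau>1 \<rho>" "Z \<tau>1 = z1" "nF \<tau>1 = \<nu>1"
      and bd: "\<And>t. t \<in> ball \<tau>1 \<rho> \<Longrightarrow> t \<in> cball 0 r \<and> Z t \<in> cball zi R1 \<and> nF t \<in> cball 0 R2"
      and d: "\<And>t. t \<in> ball \<tau>1 \<rho> \<Longrightarrow> (Z has_field_derivative F1 P t (Z t) (nF t)) (at t)"
        "\<And>t. t \<in> ball \<tau>1 \<rho> \<Longrightarrow> (nF has_field_derivative F2 P E1 t (Z t) (nF t)) (at t)"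
      using pic[OF i] by blast
    have bd': "t \<in> cball 0 r" "Z t \<in> cball zi (3 * R1)" "nF t \<in> cball 0 (3 * R2)" if "t \<in> ball \<tau>1 \<rho>" for t
      using bd[OF that] R1(1) R2(1) by auto
    have cl': "norm (wP P t (Z t) (nF t) - c) < e" "Z t \<in> U" "hw (A (Z t)) t (wP P t (Z t) (nF t)) \<noteq> 0" if "t \<in> ball \<tau>1 \<rho>" for t
      using cl[OF bd'[OF that]] by blast+
    define X where "X t = wP P t (Z t) (nF t)" for t
    define k where "k t = - of_nat n / hw (A (Z t)) t (X t)" for t
    have hX: "X holomorphic_on ball \<tau>1 \<rho>"
      unfolding X_def wP_def
      by (intro holomorphic_intros PH_holomorphic[OF U P open_ball Z(1) holomorphic_on_ident cl'(2)] Z(2))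
    have hk: "k holomorphic_on ball \<tau>1 \<rho>"
      unfolding k_def
      by (intro holomorphic_on_divide holomorphic_on_minus holomorphic_on_const
          holomorphic_sums(2)[OF Z(1) cl'(2) holomorphic_on_ident hX] cl'(3)[folded X_def])
    have F1k: "F1 P t (Z t) (nF t) = t ^ (q - 1) * k t" for t
      unfolding F1_def k_def X_def by simp
    have "chart \<tau>1 \<rho> Z X k"
      unfolding chart_def
    proof (intro conjI ballI impI Z(1) hX hk)
      fix t assume t: "t \<in> ball \<tau>1 \<rho>"
      show "Z t \<in> U" by (rule cl'(2)[OF t])
      show "k t \<noteq> 0" unfolding k_def X_def using cl'(3)[OF t] n_pos by simp
      show "(Z has_field_derivative t ^ (q - 1) * k t) (at t)" using d(1)[OF t] unfolding F1k .
      assume t0: "t \<noteq> 0"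
      note sol = F_solution[OF P E1 E d(1)[OF t] d(2)[OF t] t0 cl'(2)[OF t] cl'(3)[OF t], folded X_def, unfolded F1k]
      show "((\<lambda>t. 1 / t ^ n) has_field_derivative rhs1 (A (Z t)) M N (1 / t ^ n) (X t / t ^ m) * (t ^ (q - 1) * k t)) (at t)"
        by (rule sol(1))
      show "((\<lambda>t. X t / t ^ m) has_field_derivative rhs2 (A (Z t)) M N (1 / t ^ n) (X t / t ^ m) * (t ^ (q - 1) * k t)) (at t)"
        by (rule sol(2))
    qed
    moreover have "X \<tau>1 = x1" unfolding X_def wP_def Z(3,4) \<nu>1_def using t1 by simp
    ultimately show "\<exists>Z X k. chart \<tau>1 \<eta> Z X k \<and> Z \<tau>1 = z1 \<and> X \<tau>1 = x1" using Z(3) chart_mono \<eta>(2) by blast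
  qed
qed

lemma chart_uniform:
  assumes B: "B \<ge> 0"
  shows "\<exists>\<rho>>0. \<forall>c\<in>Rt. \<forall>\<tau>1 z1 x1. \<tau>1 \<noteq> 0 \<longrightarrow> norm \<tau>1 \<le> \<rho> \<longrightarrow> norm (z1 - zi) \<le> \<rho> \<longrightarrow>
     norm (x1 - Ps c z1 \<tau>1) \<le> B * norm \<tau>1 ^ K \<longrightarrow> (\<exists>Z X k. chart \<tau>1 \<rho> Z X k \<and> Z \<tau>1 = z1 \<and> X \<tau>1 = x1)"
proof -
  define Q where "Q c \<rho> \<longleftrightarrow> (\<forall>\<tau>1 z1 x1. \<tau>1 \<noteq> 0 \<longrightarrow> norm \<tau>1 \<le> \<rho> \<longrightarrow> norm (z1 - zi) \<le> \<rho> \<longrightarrow>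
     norm (x1 - Ps c z1 \<tau>1) \<le> B * norm \<tau>1 ^ K \<longrightarrow> (\<exists>Z X k. chart \<tau>1 \<rho> Z X k \<and> Z \<tau>1 = z1 \<and> X \<tau>1 = x1))" for c \<rho>
  have Q_mono: "Q c \<rho>'" if "Q c \<rho>" "\<rho>' \<le> \<rho>" for c \<rho> \<rho>'
    unfolding Q_def
  proof (intro allI impI)
    fix \<tau>1 z1 x1 :: complex
    assume "\<tau>1 \<noteq> 0" "norm \<tau>1 \<le> \<rho>'" "norm (z1 - zi) \<le> \<rho>'" "norm (x1 - Ps c z1 \<tau>1) \<le> B * norm \<tau>1 ^ K"
    then have "\<exists>Z X k. chart \<tau>1 \<rho> Z X k \<and> Z \<tau>1 = z1 \<and> X \<tau>1 = x1"
      using that(2) by (intro that(1)[unfolded Q_def, rule_format]) auto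
    then show "\<exists>Z X k. chart \<tau>1 \<rho>' Z X k \<and> Z \<tau>1 = z1 \<and> X \<tau>1 = x1" using chart_mono that(2) by blast
  qed
  have "\<forall>c\<in>Rt. \<exists>\<rho>. \<rho> > 0 \<and> Q c \<rho>" using chart_exists[OF _ B] unfolding Q_def by blast
  then obtain R where R: "\<And>c. c \<in> Rt \<Longrightarrow> R c > 0 \<and> Q c (R c)" by metis
  have "Min (R ` Rt) > 0" using R finite_Rt Rt_nonempty by simp
  moreover have "Q c (Min (R ` Rt))" if "c \<in> Rt" for c
    by (rule Q_mono[of c "R c"]) (use R that finite_Rt in auto)
  ultimately show ?thesis unfolding Q_def by blast
qed

end

section \<open>The path in the coordinate \<open>\<tau>\<close>, and the local uniformiser\<close>

lemma continuous_nth_root: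
  fixes y :: "real \<Rightarrow> complex"
  assumes "continuous_on {a..<b} y" "\<And>s. s \<in> {a..<b} \<Longrightarrow> y s \<noteq> 0" "n > 0"
  obtains \<tau> where "continuous_on {a..<b} \<tau>" "\<And>s. s \<in> {a..<b} \<Longrightarrow> \<tau> s ^ n * y s = 1"
proof -
  have "contractible {a..<b}" by (rule convex_imp_contractible) simp
  then obtain g where g: "continuous_on {a..<b} g" "\<And>s. s \<in> {a..<b} \<Longrightarrow> y s = exp (g s)"
    using continuous_logarithm_on_contractible[OF assms(1) _ assms(2)] by metis
  show thesis
  proof (rule that[of "\<lambda>s. exp (- g s / of_nat n)"])
    show "continuous_on {a..<b} (\<lambda>s. exp (- g s / of_nat n))" using assms(3) by (intro continuous_intros g(1)) auto
    show "exp (- g s / of_nat n) ^ n * y s = 1" if "s \<in> {a..<b}" for s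
      unfolding g(2)[OF that] exp_of_nat_mult[symmetric] exp_add[symmetric] using assms(3) by simp
  qed
qed

text \<open>\<open>Z - z0 = t^q G\<close> with \<open>G 0 \<noteq> 0\<close>, so
  \<open>\<omega> = t G^(1/q)\<close> is a \<open>q\<close>-th root with nonzero derivative at 0.
  \<open>T\<close> is its local inverse and \<open>H\<close> is \<open>T w / w\<close> with the
  singularity removed.\<close>

lemma local_uniformizer:
  assumes \<rho>: "\<rho> > 0" and Z: "Z holomorphic_on ball 0 \<rho>" "Z 0 = z0" and k: "k holomorphic_on ball 0 \<rho>" "k 0 \<noteq> 0"
    and d: "\<And>t. t \<in> ball 0 \<rho> \<Longrightarrow> (Z has_field_derivative t ^ (q - 1) * k t) (at t)" and q: "q > 0"
  obtains \<rho>1 \<sigma> \<omega> T H where "0 < \<rho>1" "0 < \<sigma>" "\<omega> holomorphic_on ball 0 \<rho>1" "T holomorphic_on ball 0 \<sigma>" "H holomorphic_on ball 0 \<sigma>"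
    "\<And>t. t \<in> ball 0 \<rho>1 \<Longrightarrow> t \<in> ball 0 \<rho> \<and> \<omega> t ^ q = Z t - z0 \<and> norm (\<omega> t) < \<sigma> \<and> T (\<omega> t) = t"
    "\<And>w. w \<in> ball 0 \<sigma> \<Longrightarrow> T w \<in> ball 0 \<rho> \<and> Z (T w) = z0 + w ^ q \<and> T w = w * H w \<and> H w \<noteq> 0"
proof -
  have "(\<lambda>t. Z t - z0) holomorphic_on ball 0 \<rho>" "Z 0 - z0 = 0"
    "\<And>t. t \<in> ball 0 \<rho> \<Longrightarrow> ((\<lambda>t. Z t - z0) has_field_derivative t ^ (q - 1) * k t) (at t)"
    using Z d by (auto intro!: holomorphic_intros derivative_eq_intros)
  from factor_power[OF \<rho> this(1,2) k(1) this(3)] q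
  obtain G where G: "G holomorphic_on ball 0 \<rho>" "\<And>t. t \<in> ball 0 \<rho> \<Longrightarrow> Z t - z0 = t ^ q * G t" "of_nat q * G 0 = k 0"
    by auto
  have G0: "G 0 \<noteq> 0" using G(3) k(2) by auto
  obtain b where b: "b ^ q = G 0" using exists_nth_root[OF G0 q] by blast
  have b0: "b \<noteq> 0" using b G0 q by (auto simp: zero_power)
  have "isCont G 0" using holomorphic_on_imp_continuous_on[OF G(1)] \<rho> continuous_on_eq_continuous_at[OF open_ball] by (metis centre_in_ball)
  then have "isCont (\<lambda>t. G t / G 0) 0" using G0 by (intro continuous_intros) auto
  then have "((\<lambda>t. G t / G 0) \<longlongrightarrow> G 0 / G 0) (nhds 0)" unfolding isCont_def by (rule tendsto_at_iff_tendsto_nhds[THEN iffD1])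
  from tendstoD[OF this zero_less_one] have "eventually (\<lambda>t. dist (G t / G 0) 1 < 1) (nhds 0)" using G0 by simp
  then obtain \<rho>2 where \<rho>2: "\<rho>2 > 0" "\<And>t. norm t < \<rho>2 \<Longrightarrow> norm (G t / G 0 - 1) < 1"
    unfolding eventually_nhds_metric by (auto simp: dist_norm)
  define r where "r = min \<rho> \<rho>2"
  have r: "r > 0" "r \<le> \<rho>" "r \<le> \<rho>2" unfolding r_def using \<rho> \<rho>2 by auto
  have sub: "ball 0 r \<subseteq> ball (0::complex) \<rho>" using r by auto
  have sl: "G t / G 0 \<notin> \<real>\<^sub>\<le>\<^sub>0" "G t \<noteq> 0" if t: "t \<in> ball 0 r" for t
  proof -
    have n1: "norm (G t / G 0 - 1) < 1" by (rule \<rho>2(2)) (use t r in auto)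
    have "\<bar>Re (G t / G 0 - 1)\<bar> < 1" using n1 abs_Re_le_cmod le_less_trans by blast
    then have "Re (G t / G 0) > 0" by (simp only: minus_complex.sel one_complex.sel)
    then show "G t / G 0 \<notin> \<real>\<^sub>\<le>\<^sub>0" by (auto simp: complex_nonpos_Reals_iff)
    then show "G t \<noteq> 0" by auto
  qed
  define g where "g t = b * exp (Ln (G t / G 0) / of_nat q)" for t
  have hg: "g holomorphic_on ball 0 r"
    unfolding g_def using G0 q sl(1) by (intro holomorphic_intros holomorphic_on_subset[OF G(1) sub]) auto
  have gq: "g t ^ q = G t" if "t \<in> ball 0 r" for t
  proof -
    have "exp (Ln (G t / G 0) / of_nat q) ^ q = G t / G 0"
      using q sl(2)[OF that] G0 by (simp add: exp_of_nat_mult[symmetric])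
    then show ?thesis unfolding g_def power_mult_distrib b using G0 by simp
  qed
  define \<omega> where "\<omega> t = t * g t" for t
  have h\<omega>: "\<omega> holomorphic_on ball 0 r" unfolding \<omega>_def by (intro holomorphic_intros hg)
  have \<omega>q: "\<omega> t ^ q = Z t - z0" if "t \<in> ball 0 r" for t
    using gq[OF that] G(2)[of t] that sub unfolding \<omega>_def power_mult_distrib by auto
  have "(g has_field_derivative deriv g 0) (at 0)" using hg r(1) open_ball centre_in_ball holomorphic_derivI by blast
  then have "(\<omega> has_field_derivative 1 * g 0 + deriv g 0 * 0) (at 0)" unfolding \<omega>_def by (intro DERIV_mult DERIV_ident)
  from DERIV_imp_deriv[OF this] have "deriv \<omega> 0 = g 0" by simp
  moreover have "g 0 \<noteq> 0" unfolding g_def using b0 by simp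
  ultimately have d\<omega>: "deriv \<omega> 0 \<noteq> 0" by simp
  obtain r1 where r1: "r1 > 0" "ball (0::complex) r1 \<subseteq> ball 0 r" "inj_on \<omega> (ball 0 r1)"
    by (rule has_complex_derivative_locally_injective[OF h\<omega> centre_in_ball[THEN iffD2, OF r(1)] open_ball d\<omega>]) (rule that)
  have h\<omega>1: "\<omega> holomorphic_on ball 0 r1" by (rule holomorphic_on_subset[OF h\<omega> r1(2)])
  obtain T where T: "T holomorphic_on \<omega> ` ball 0 r1" "\<And>t. t \<in> ball 0 r1 \<Longrightarrow> deriv \<omega> t * deriv T (\<omega> t) = 1" "\<And>t. t \<in> ball 0 r1 \<Longrightarrow> T (\<omega> t) = t"
    by (rule holomorphic_has_inverse[OF h\<omega>1 open_ball r1(3)]) (rule that)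
  have "open (\<omega> ` ball 0 r1)" by (rule open_mapping_thm3[OF h\<omega>1 open_ball r1(3)])
  moreover have \<omega>0: "\<omega> 0 = 0" unfolding \<omega>_def by simp
  moreover have "0 \<in> \<omega> ` ball 0 r1" using \<omega>0 r1(1) by (intro image_eqI[of _ _ 0]) auto
  ultimately obtain \<sigma> where \<sigma>: "\<sigma> > 0" "ball 0 \<sigma> \<subseteq> \<omega> ` ball 0 r1" using open_contains_ball by blast
  have hT: "T holomorphic_on ball 0 \<sigma>" by (rule holomorphic_on_subset[OF T(1) \<sigma>(2)])
  have T0: "T 0 = 0" using T(3)[of 0] r1(1) \<omega>0 by simp
  have \<omega>T: "T w \<in> ball 0 r1 \<and> \<omega> (T w) = w" if "w \<in> ball 0 \<sigma>" for w using that \<sigma>(2) T(3) by auto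
  define H where "H w = (if w = 0 then deriv T 0 else (T w - T 0) / (w - 0))" for w
  have hH: "H holomorphic_on ball 0 \<sigma>" unfolding H_def by (rule pole_lemma_open[OF hT open_ball])
  have TH: "T w = w * H w" for w unfolding H_def using T0 by simp
  have H0: "H w \<noteq> 0" if "w \<in> ball 0 \<sigma>" for w
  proof (cases "w = 0")
    case True
    then show ?thesis using T(2)[of 0] r1(1) unfolding H_def \<omega>0 by auto
  next
    case False
    then have "T w \<noteq> 0" using \<omega>T[OF that] \<omega>0 by auto
    then show ?thesis using TH[of w] by auto
  qed
  have "isCont \<omega> 0" using holomorphic_on_imp_continuous_on[OF h\<omega>1] r1(1) continuous_on_eq_continuous_at[OF open_ball] by (metis centre_in_ball)
  then have "(\<omega> \<longlongrightarrow> \<omega> 0) (nhds 0)" unfolding isCont_def by (rule tendsto_at_iff_tendsto_nhds[THEN iffD1])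
  from tendstoD[OF this \<sigma>(1)] have "eventually (\<lambda>t. dist (\<omega> t) 0 < \<sigma>) (nhds 0)" unfolding \<omega>0 .
  then obtain \<rho>3 where \<rho>3: "\<rho>3 > 0" "\<And>t. norm t < \<rho>3 \<Longrightarrow> norm (\<omega> t) < \<sigma>"
    unfolding eventually_nhds_metric by (auto simp: dist_norm)
  have sub3: "ball 0 (min r1 \<rho>3) \<subseteq> ball (0::complex) r1" by auto
  show thesis
  proof (rule that[of "min r1 \<rho>3" \<sigma> \<omega> T H])
    show "\<omega> holomorphic_on ball 0 (min r1 \<rho>3)" by (rule holomorphic_on_subset[OF h\<omega>1 sub3])
    show "t \<in> ball 0 \<rho> \<and> \<omega> t ^ q = Z t - z0 \<and> norm (\<omega> t) < \<sigma> \<and> T (\<omega> t) = t" if t: "t \<in> ball 0 (min r1 \<rho>3)" for t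
    proof -
      have 1: "t \<in> ball 0 r1" "norm t < \<rho>3" using t by auto
      then have 2: "t \<in> ball 0 r" using r1(2) by blast
      show ?thesis using \<omega>q[OF 2] \<rho>3(2)[OF 1(2)] T(3)[OF 1(1)] 2 sub by blast
    qed
    show "T w \<in> ball 0 \<rho> \<and> Z (T w) = z0 + w ^ q \<and> T w = w * H w \<and> H w \<noteq> 0" if w: "w \<in> ball 0 \<sigma>" for w
    proof -
      have 1: "T w \<in> ball 0 r" using \<omega>T[OF w] r1(2) by blast
      have "w ^ q = Z (T w) - z0" using \<omega>q[OF 1] \<omega>T[OF w] by simp
      then show ?thesis using 1 sub TH H0[OF w] by auto
    qed
  qed (use r1 \<rho>3 \<sigma> hT hH in auto)
qed

lemma continuous_on_close:
  assumes "continuous_on {a..<b} (h :: real \<Rightarrow> complex)" "a \<le> t" "t < b" "e > 0"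
  obtains \<delta> where "\<delta> > 0" "\<And>s. a \<le> s \<Longrightarrow> s < b \<Longrightarrow> \<bar>s - t\<bar> < \<delta> \<Longrightarrow> h s \<in> ball (h t) e"
proof -
  have "\<exists>\<delta>>0. \<forall>s\<in>{a..<b}. dist s t < \<delta> \<longrightarrow> dist (h s) (h t) < e"
    using assms unfolding continuous_on_iff by auto
  then obtain \<delta> where "\<delta> > 0" "\<forall>s\<in>{a..<b}. dist s t < \<delta> \<longrightarrow> dist (h s) (h t) < e" by blast
  then show thesis by (intro that[of \<delta>]) (auto simp: dist_norm norm_minus_commute)
qed

lemma ball_in_preimage:
  fixes Z :: "complex \<Rightarrow> complex"
  assumes "Z holomorphic_on S" "open S" "x \<in> S" "open B" "Z x \<in> B"
  obtains e where "e > 0" "\<And>y. y \<in> ball x e \<Longrightarrow> y \<in> S \<and> Z y \<in> B"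
proof -
  have "open (S \<inter> Z -` B)"
    by (rule continuous_open_preimage[OF holomorphic_on_imp_continuous_on[OF assms(1)] assms(2,4)])
  moreover have "x \<in> S \<inter> Z -` B" using assms by simp
  ultimately obtain e where "e > 0" "ball x e \<subseteq> S \<inter> Z -` B" using open_contains_ball by blast
  then show thesis using that[of e] by blast
qed

section \<open>A chart transported along the path\<close>

context hamiltonian
begin

text \<open>The chart is fixed by its value at one parameter, while \<open>\<tau>\<close> is a
  continuous root of \<open>1 / y1\<close> along the whole path; that the two stay together needs
  proof. To the right, \<open>Z\<close> is open, so \<open>\<gamma> s\<close> is some
  \<open>Z x\<close>, and \<open>x\<close> and \<open>\<tau> s\<close> have the same
  \<open>n\<close>-th power, hence coincide locally. To the left, a limit gives the point and the
  identity theorem the germ.\<close>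

lemma chart_follow:
  assumes ch: "chart \<tau>1 \<rho> Z X k" and cont: "continuation_along \<alpha> M N \<Omega> \<gamma> r u v" and \<gamma>: "path \<gamma>"
    and s1: "0 \<le> s1" "s1 < 1" and \<tau>c: "continuous_on {s1..<1} \<tau>" and \<tau>1: "\<tau> s1 = \<tau>1"
    and \<tau>: "\<And>s. s1 \<le> s \<Longrightarrow> s < 1 \<Longrightarrow> \<tau> s ^ n * u s (\<gamma> s) = 1 \<and> \<tau> s \<in> ball \<tau>1 \<rho>"
    and init: "Z \<tau>1 = \<gamma> s1" "X \<tau>1 = v s1 (\<gamma> s1) * \<tau>1 ^ m" and s: "s1 \<le> s" "s < 1"
  shows "Z (\<tau> s) = \<gamma> s \<and> (\<exists>\<epsilon>>0. \<forall>x\<in>ball (\<tau> s) \<epsilon>. u s (Z x) = 1 / x ^ n \<and> v s (Z x) = X x / x ^ m)"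
proof -
  define S where "S = ball \<tau>1 \<rho> - {0}"
  have S: "open S" unfolding S_def by auto
  have hol: "Z holomorphic_on ball \<tau>1 \<rho>" "X holomorphic_on ball \<tau>1 \<rho>" "k holomorphic_on ball \<tau>1 \<rho>"
    and ZU: "\<And>x. x \<in> ball \<tau>1 \<rho> \<Longrightarrow> Z x \<in> U" and k0: "\<And>x. x \<in> ball \<tau>1 \<rho> \<Longrightarrow> k x \<noteq> 0"
    and dZ: "\<And>x. x \<in> ball \<tau>1 \<rho> \<Longrightarrow> (Z has_field_derivative x ^ (q - 1) * k x) (at x)"
    and dY: "\<And>x. x \<in> S \<Longrightarrow> ((\<lambda>x. 1 / x ^ n) has_field_derivative rhs1 (A (Z x)) M N (1 / x ^ n) (X x / x ^ m) * (x ^ (q - 1) * k x)) (at x)"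
      "\<And>x. x \<in> S \<Longrightarrow> ((\<lambda>x. X x / x ^ m) has_field_derivative rhs2 (A (Z x)) M N (1 / x ^ n) (X x / x ^ m) * (x ^ (q - 1) * k x)) (at x)"
    using ch unfolding chart_def S_def by auto
  have SZ: "Z holomorphic_on S" and SX: "X holomorphic_on S" and S0: "0 \<notin> S" and SB: "S \<subseteq> ball \<tau>1 \<rho>"
    using hol unfolding S_def by (auto elim: holomorphic_on_subset)
  have \<tau>S: "\<tau> s \<in> S" if "s1 \<le> s" "s < 1" for s
  proof -
    have "\<tau> s \<noteq> 0" using \<tau>[OF that] n_pos by (auto simp: zero_power)
    then show ?thesis using \<tau>[OF that] unfolding S_def by simp
  qed
  define Q where "Q s \<longleftrightarrow> Z (\<tau> s) = \<gamma> s \<and> (\<exists>\<epsilon>>0. \<forall>x\<in>ball (\<tau> s) \<epsilon>. u s (Z x) = 1 / x ^ n \<and> v s (Z x) = X x / x ^ m)" for s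
  have nb: "\<exists>e>0. \<forall>x\<in>ball (\<tau> t) e. x \<in> S \<and> Z x \<in> ball (\<gamma> t) (r t)" if t: "s1 \<le> t" "t < 1" and e: "Z (\<tau> t) = \<gamma> t" for t
  proof -
    have "Z (\<tau> t) \<in> ball (\<gamma> t) (r t)" using e continuation_germ(1)[OF cont, of t] t s1 by simp
    from ball_in_preimage[OF SZ S \<tau>S[OF t] open_ball this] show ?thesis by metis
  qed
  have base: "Q s1"
  proof -
    have Z1: "Z (\<tau> s1) = \<gamma> s1" using init \<tau>1 by simp
    obtain e where e: "e > 0" "\<And>x. x \<in> ball (\<tau> s1) e \<Longrightarrow> x \<in> S \<and> Z x \<in> ball (\<gamma> s1) (r s1)"
      using nb[OF order_refl s1(2) Z1] by blast
    note g = continuation_germ[OF cont s1]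
    have t0: "\<tau> s1 \<in> S" by (rule \<tau>S[OF order_refl s1(2)])
    then have t1: "\<tau> s1 \<in> ball \<tau>1 \<rho>" "\<tau> s1 \<noteq> 0" using SB S0 by auto
    \<comment> \<open>Uniqueness is applied in the parameter \<open>x\<close>: pulled back by
      \<open>Z\<close>, the continued solution satisfies the system that the chart satisfies, with
      the same initial values.\<close>
    have "\<exists>\<epsilon>>0. \<forall>x\<in>ball (\<tau> s1) \<epsilon>. u s1 (Z x) = 1 / x ^ n \<and> v s1 (Z x) = X x / x ^ m"
    proof (rule rhs_unique[OF hol(1) open_ball ZU _ t1(1) _ _ e(1)])
      show "(\<lambda>x. x ^ (q - 1) * k x) holomorphic_on ball \<tau>1 \<rho>" by (intro holomorphic_intros hol)
      show "1 / \<tau> s1 ^ n = u s1 (Z (\<tau> s1))" using \<tau>[OF order_refl s1(2)] t1(2) unfolding Z1 by (simp add: field_simps)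
      show "X (\<tau> s1) / \<tau> s1 ^ m = v s1 (Z (\<tau> s1))" using init t1(2) unfolding \<tau>1 by (simp add: field_simps)
      fix x assume x: "x \<in> ball (\<tau> s1) e"
      have xS: "x \<in> S" and zx: "Z x \<in> ball (\<gamma> s1) (r s1)" using e(2)[OF x] by auto
      show "((\<lambda>x. 1 / x ^ n) has_field_derivative rhs1 (A (Z x)) M N (1 / x ^ n) (X x / x ^ m) * (x ^ (q - 1) * k x)) (at x)"
        "((\<lambda>x. X x / x ^ m) has_field_derivative rhs2 (A (Z x)) M N (1 / x ^ n) (X x / x ^ m) * (x ^ (q - 1) * k x)) (at x)"
        using dY[OF xS] by blast+
      have dz: "(Z has_field_derivative x ^ (q - 1) * k x) (at x)" using dZ xS SB by blast
      show "((\<lambda>x. u s1 (Z x)) has_field_derivative rhs1 (A (Z x)) M N (u s1 (Z x)) (v s1 (Z x)) * (x ^ (q - 1) * k x)) (at x)"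
        by (rule DERIV_chain2[OF g(4)[OF zx] dz])
      show "((\<lambda>x. v s1 (Z x)) has_field_derivative rhs2 (A (Z x)) M N (u s1 (Z x)) (v s1 (Z x)) * (x ^ (q - 1) * k x)) (at x)"
        by (rule DERIV_chain2[OF g(5)[OF zx] dz])
    qed
    then show ?thesis unfolding Q_def using Z1 by blast
  qed
  have key: "\<exists>\<delta>>0. \<forall>s. s1 \<le> s \<and> s < 1 \<and> \<bar>s - t\<bar> < \<delta> \<longrightarrow> Q s" if t: "s1 \<le> t" "t < 1" and Qt: "Q t" for t
  proof -
    have t': "0 \<le> t" "t < 1" using t s1 by auto
    have Zt: "Z (\<tau> t) = \<gamma> t" using Qt unfolding Q_def by simp
    obtain \<epsilon> where \<epsilon>: "\<epsilon> > 0" "\<And>x. x \<in> ball (\<tau> t) \<epsilon> \<Longrightarrow> u t (Z x) = 1 / x ^ n \<and> v t (Z x) = X x / x ^ m"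
      using Qt unfolding Q_def by blast
    obtain e where e: "e > 0" "\<And>x. x \<in> ball (\<tau> t) e \<Longrightarrow> x \<in> S \<and> Z x \<in> ball (\<gamma> t) (r t)" using nb[OF t Zt] by blast
    have tS: "\<tau> t \<in> S" by (rule \<tau>S[OF t])
    then have t0: "\<tau> t \<noteq> 0" using S0 by auto
    \<comment> \<open>Away from 0 both \<open>x ^ n\<close> and \<open>Z\<close> are locally
      injective: the first identifies \<open>\<tau> s\<close> with the preimage of
      \<open>\<gamma> s\<close>, the second makes the image of a small disc under \<open>Z\<close>
      open.\<close>
    obtain e2 where e2: "e2 > 0" "inj_on (\<lambda>x. x ^ n) (ball (\<tau> t) e2)"
    proof -
      have "((\<lambda>x. x ^ n) has_field_derivative of_nat n * \<tau> t ^ (n - 1)) (at (\<tau> t))" by (auto intro!: derivative_eq_intros)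
      then have "deriv (\<lambda>x. x ^ n) (\<tau> t) \<noteq> 0" using DERIV_imp_deriv t0 n_pos by fastforce
      moreover have "(\<lambda>x. x ^ n) holomorphic_on (UNIV :: complex set)" by (intro holomorphic_intros)
      ultimately show thesis
        by - (rule has_complex_derivative_locally_injective[OF _ UNIV_I open_UNIV], assumption, assumption, rule that)
    qed
    obtain e4 where e4: "e4 > 0" "inj_on Z (ball (\<tau> t) e4)"
    proof -
      have tb: "\<tau> t \<in> ball \<tau>1 \<rho>" using tS SB by blast
      have "deriv Z (\<tau> t) = \<tau> t ^ (q - 1) * k (\<tau> t)" by (rule DERIV_imp_deriv[OF dZ[OF tb]])
      then have "deriv Z (\<tau> t) \<noteq> 0" using t0 k0[OF tb] by simp
      then show thesis by - (rule has_complex_derivative_locally_injective[OF SZ tS S], assumption, rule that)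
    qed
    define e5 where "e5 = Min {\<epsilon>, e, e2, e4}"
    have e5: "e5 > 0" "ball (\<tau> t) e5 \<subseteq> ball (\<tau> t) \<epsilon>" "ball (\<tau> t) e5 \<subseteq> ball (\<tau> t) e" "ball (\<tau> t) e5 \<subseteq> ball (\<tau> t) e2" "ball (\<tau> t) e5 \<subseteq> ball (\<tau> t) e4"
      unfolding e5_def using \<epsilon> e e2 e4 by auto
    have b5: "x \<in> S \<and> Z x \<in> ball (\<gamma> t) (r t) \<and> u t (Z x) = 1 / x ^ n \<and> v t (Z x) = X x / x ^ m" if "x \<in> ball (\<tau> t) e5" for x
      using that e5 e(2) \<epsilon>(2) by blast
    have Z5: "Z holomorphic_on ball (\<tau> t) e5" using b5 by (intro holomorphic_on_subset[OF SZ]) blast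
    have "open (Z ` ball (\<tau> t) e5)" by (rule open_mapping_thm3[OF Z5 open_ball inj_on_subset[OF e4(2) e5(5)]])
    moreover have "\<gamma> t \<in> Z ` ball (\<tau> t) e5" using e5(1) Zt by (intro image_eqI[of _ _ "\<tau> t"]) auto
    ultimately obtain a where a: "a > 0" "ball (\<gamma> t) a \<subseteq> Z ` ball (\<tau> t) e5" using open_contains_ball by blast
    obtain \<delta>1 where \<delta>1: "\<delta>1 > 0" "\<And>s. 0 \<le> s \<Longrightarrow> s < 1 \<Longrightarrow> \<bar>s - t\<bar> < \<delta>1 \<Longrightarrow> \<gamma> s \<in> ball (\<gamma> t) (r t) \<and>
      (\<forall>z\<in>ball (\<gamma> s) (r s) \<inter> ball (\<gamma> t) (r t). u s z = u t z \<and> v s z = v t z)"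
      by (rule continuation_compatible[OF cont t']) (rule that)
    obtain \<delta>2 where \<delta>2: "\<delta>2 > 0" "\<And>s. 0 \<le> s \<Longrightarrow> s \<le> 1 \<Longrightarrow> \<bar>s - t\<bar> < \<delta>2 \<Longrightarrow> norm (\<gamma> s - \<gamma> t) < a"
      by (rule path_close[OF \<gamma> t'(1) less_imp_le[OF t'(2)] a(1)]) (rule that)
    obtain \<delta>3 where \<delta>3: "\<delta>3 > 0" "\<And>s. s1 \<le> s \<Longrightarrow> s < 1 \<Longrightarrow> \<bar>s - t\<bar> < \<delta>3 \<Longrightarrow> \<tau> s \<in> ball (\<tau> t) e5"
      by (rule continuous_on_close[OF \<tau>c t e5(1)]) (rule that)
    have "Q s" if s: "s1 \<le> s" "s < 1" "\<bar>s - t\<bar> < Min {\<delta>1, \<delta>2, \<delta>3}" for s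
    proof -
      have s': "0 \<le> s" "s \<le> 1" "\<bar>s - t\<bar> < \<delta>1" "\<bar>s - t\<bar> < \<delta>2" "\<bar>s - t\<bar> < \<delta>3" using s s1 by auto
      note comp = \<delta>1(2)[OF s'(1) s(2) s'(3)]
      have \<tau>s: "\<tau> s \<in> ball (\<tau> t) e5" by (rule \<delta>3(2)[OF s(1,2) s'(5)])
      have gs: "\<gamma> s \<in> ball (\<gamma> s) (r s)" using continuation_germ(1)[OF cont s'(1) s(2)] by simp
      have "\<gamma> s \<in> ball (\<gamma> t) a" using \<delta>2(2)[OF s'(1,2,4)] by (simp add: dist_norm norm_minus_commute)
      then obtain x where x: "x \<in> ball (\<tau> t) e5" "\<gamma> s = Z x" using a(2) by blast
      have x0: "x \<noteq> 0" using b5[OF x(1)] S0 by auto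
      have "u s (\<gamma> s) = 1 / x ^ n" using comp gs b5[OF x(1)] x(2) by auto
      then have "\<tau> s ^ n * (1 / x ^ n) = 1" using \<tau>[OF s(1,2)] by simp
      then have "\<tau> s ^ n = x ^ n" using x0 by (simp add: field_simps)
      then have "\<tau> s = x" using inj_onD[OF e2(2)] e5(4) \<tau>s x(1) by blast
      then have Zs: "Z (\<tau> s) = \<gamma> s" using x by simp
      have "Z (\<tau> s) \<in> ball (\<gamma> s) (r s)" using Zs gs by simp
      then obtain \<epsilon>' where \<epsilon>': "\<epsilon>' > 0" "\<And>y. y \<in> ball (\<tau> s) \<epsilon>' \<Longrightarrow> y \<in> ball (\<tau> t) e5 \<and> Z y \<in> ball (\<gamma> s) (r s)"
        by - (rule ball_in_preimage[OF Z5 open_ball \<tau>s open_ball], assumption, rule that)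
      have "u s (Z y) = 1 / y ^ n \<and> v s (Z y) = X y / y ^ m" if "y \<in> ball (\<tau> s) \<epsilon>'" for y
        using \<epsilon>'(2)[OF that] b5[of y] comp by auto
      then show ?thesis unfolding Q_def using Zs \<epsilon>'(1) by blast
    qed
    moreover have "Min {\<delta>1, \<delta>2, \<delta>3} > 0" using \<delta>1 \<delta>2 \<delta>3 by simp
    ultimately show ?thesis by blast
  qed
  have "Q s"
  proof (rule real_induct_atLeastLessThan[of Q s1 1, OF base _ _ s])
    fix t assume t: "s1 \<le> t" "t < 1" "Q t"
    obtain \<delta> where \<delta>: "\<delta> > 0" "\<And>s. s1 \<le> s \<Longrightarrow> s < 1 \<Longrightarrow> \<bar>s - t\<bar> < \<delta> \<Longrightarrow> Q s" using key[OF t] by blast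
    show "\<exists>\<delta>>0. \<forall>s. t < s \<and> s < t + \<delta> \<and> s < 1 \<longrightarrow> Q s"
      by (intro exI[of _ \<delta>]) (use \<delta> t in auto)
  next
    fix t assume t: "s1 < t" "t < 1" and Qs: "\<And>s. s1 \<le> s \<Longrightarrow> s < t \<Longrightarrow> Q s"
    have t': "0 \<le> t" "t < 1" "s1 \<le> t" using t s1 by auto
    have left: "\<exists>s. s1 \<le> s \<and> s < t \<and> \<bar>s - t\<bar> < \<delta>" if "\<delta> > 0" for \<delta>
      using that t by (intro exI[of _ "max s1 (t - \<delta> / 2)"]) auto
    have Zt: "Z (\<tau> t) = \<gamma> t"
    proof (rule ccontr)
      assume "Z (\<tau> t) \<noteq> \<gamma> t"
      then have d: "dist (Z (\<tau> t)) (\<gamma> t) / 2 > 0" by simp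
      have "continuous_on {s1..<1} (\<lambda>s. Z (\<tau> s))"
        by (rule continuous_on_compose2[OF holomorphic_on_imp_continuous_on[OF hol(1)] \<tau>c]) (use \<tau> in auto)
      then obtain \<delta>a where \<delta>a: "\<delta>a > 0" "\<And>s. s1 \<le> s \<Longrightarrow> s < 1 \<Longrightarrow> \<bar>s - t\<bar> < \<delta>a \<Longrightarrow> Z (\<tau> s) \<in> ball (Z (\<tau> t)) (dist (Z (\<tau> t)) (\<gamma> t) / 2)"
        by - (rule continuous_on_close[OF _ t'(3,2) d], assumption, rule that)
      obtain \<delta>b where \<delta>b: "\<delta>b > 0" "\<And>s. 0 \<le> s \<Longrightarrow> s \<le> 1 \<Longrightarrow> \<bar>s - t\<bar> < \<delta>b \<Longrightarrow> norm (\<gamma> s - \<gamma> t) < dist (Z (\<tau> t)) (\<gamma> t) / 2"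
        by (rule path_close[OF \<gamma> t'(1) less_imp_le[OF t'(2)] d]) (rule that)
      have "min \<delta>a \<delta>b > 0" using \<delta>a \<delta>b by simp
      from left[OF this] obtain s where s: "s1 \<le> s" "s < t" "\<bar>s - t\<bar> < \<delta>a" "\<bar>s - t\<bar> < \<delta>b" by auto
      have "dist (Z (\<tau> t)) (Z (\<tau> s)) < dist (Z (\<tau> t)) (\<gamma> t) / 2" using \<delta>a(2)[of s] s t by simp
      moreover have "dist (\<gamma> s) (\<gamma> t) < dist (Z (\<tau> t)) (\<gamma> t) / 2" using \<delta>b(2)[of s] s t s1 unfolding dist_norm by simp
      moreover have "Z (\<tau> s) = \<gamma> s" using Qs[OF s(1,2)] unfolding Q_def by simp
      ultimately show False using dist_triangle[of "Z (\<tau> t)" "\<gamma> t" "\<gamma> s"] by simp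
    qed
    obtain e where e: "e > 0" "\<And>x. x \<in> ball (\<tau> t) e \<Longrightarrow> x \<in> S \<and> Z x \<in> ball (\<gamma> t) (r t)" using nb[OF t'(3,2) Zt] by blast
    obtain \<delta>1 where \<delta>1: "\<delta>1 > 0" "\<And>s. 0 \<le> s \<Longrightarrow> s < 1 \<Longrightarrow> \<bar>s - t\<bar> < \<delta>1 \<Longrightarrow> \<gamma> s \<in> ball (\<gamma> t) (r t) \<and>
      (\<forall>z\<in>ball (\<gamma> s) (r s) \<inter> ball (\<gamma> t) (r t). u s z = u t z \<and> v s z = v t z)"
      by (rule continuation_compatible[OF cont t'(1,2)]) (rule that)
    obtain \<delta>3 where \<delta>3: "\<delta>3 > 0" "\<And>s. s1 \<le> s \<Longrightarrow> s < 1 \<Longrightarrow> \<bar>s - t\<bar> < \<delta>3 \<Longrightarrow> \<tau> s \<in> ball (\<tau> t) e"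
      by (rule continuous_on_close[OF \<tau>c t'(3,2) e(1)]) (rule that)
    have "min \<delta>1 \<delta>3 > 0" using \<delta>1 \<delta>3 by simp
    from left[OF this] obtain s where s: "s1 \<le> s" "s < t" "\<bar>s - t\<bar> < \<delta>1" "\<bar>s - t\<bar> < \<delta>3" by auto
    have s': "0 \<le> s" "s < 1" using s s1 t by auto
    note comp = \<delta>1(2)[OF s' s(3)]
    have \<tau>s: "\<tau> s \<in> ball (\<tau> t) e" by (rule \<delta>3(2)[OF s(1) s'(2) s(4)])
    have Zs: "Z (\<tau> s) = \<gamma> s" using Qs[OF s(1,2)] unfolding Q_def by simp
    obtain \<epsilon> where \<epsilon>: "\<epsilon> > 0" "\<And>x. x \<in> ball (\<tau> s) \<epsilon> \<Longrightarrow> u s (Z x) = 1 / x ^ n \<and> v s (Z x) = X x / x ^ m"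
      using Qs[OF s(1,2)] unfolding Q_def by blast
    have hB: "Z holomorphic_on ball (\<tau> t) e" "X holomorphic_on ball (\<tau> t) e" and B0: "\<And>x. x \<in> ball (\<tau> t) e \<Longrightarrow> x \<noteq> 0"
      using e(2) SZ SX S0 by (auto elim!: holomorphic_on_subset)
    have "Z (\<tau> s) \<in> ball (\<gamma> s) (r s)" using Zs continuation_germ(1)[OF cont s'] by simp
    then obtain \<epsilon>' where \<epsilon>': "\<epsilon>' > 0" "\<And>y. y \<in> ball (\<tau> s) \<epsilon>' \<Longrightarrow> y \<in> ball (\<tau> t) e \<and> Z y \<in> ball (\<gamma> s) (r s)"
      by - (rule ball_in_preimage[OF hB(1) open_ball \<tau>s open_ball], assumption, rule that)
    have agree: "u t (Z y) = 1 / y ^ n \<and> v t (Z y) = X y / y ^ m" if "y \<in> ball (\<tau> s) (min \<epsilon> \<epsilon>')" for y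
      using \<epsilon>'(2)[of y] \<epsilon>(2)[of y] e(2)[of y] comp that by auto
    note g = continuation_germ[OF cont t'(1,2)]
    have sub: "Z ` ball (\<tau> t) e \<subseteq> ball (\<gamma> t) (r t)" using e(2) by blast
    have h: "(\<lambda>y. u t (Z y)) holomorphic_on ball (\<tau> t) e" "(\<lambda>y. v t (Z y)) holomorphic_on ball (\<tau> t) e"
      "(\<lambda>y. 1 / y ^ n) holomorphic_on ball (\<tau> t) e" "(\<lambda>y. X y / y ^ m) holomorphic_on ball (\<tau> t) e"
      using holomorphic_on_compose_gen[OF hB(1) g(2) sub] holomorphic_on_compose_gen[OF hB(1) g(3) sub] B0
      by (auto simp: o_def intro!: holomorphic_intros hB)
    have m: "min \<epsilon> \<epsilon>' > 0" using \<epsilon> \<epsilon>' by simp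
    have "u t (Z y) = 1 / y ^ n" "v t (Z y) = X y / y ^ m" if y: "y \<in> ball (\<tau> t) e" for y
      by (rule eq_on_ball_if_eq_near[OF h(1,3) open_ball connected_ball \<tau>s m _ y], use agree in blast)
         (rule eq_on_ball_if_eq_near[OF h(2,4) open_ball connected_ball \<tau>s m _ y], use agree in blast)
    then show "Q t" unfolding Q_def using Zt e(1) by blast
  qed
  then show ?thesis unfolding Q_def .
qed

end

lemma laurent_sums:
  assumes h: "h holomorphic_on ball 0 \<sigma>" and w: "norm w < \<sigma>" "w \<noteq> 0"
  shows "(\<lambda>j. (deriv ^^ j) h 0 / fact j * w powi (int j - int n)) sums (h w / w ^ n)"
proof -
  have "w \<in> ball 0 \<sigma>" using w by simp
  from holomorphic_power_series[OF h this]
  have "(\<lambda>j. (deriv ^^ j) h 0 / fact j * w ^ j / w ^ n) sums (h w / w ^ n)" by (intro sums_divide) simp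
  then show ?thesis using w(2) by (simp add: power_int_diff)
qed

section \<open>Laurent series at the endpoint\<close>

context phase
begin

lemma series_representation:
  assumes cont: "continuation_along \<alpha> M N \<Omega> \<gamma> r u v" and \<gamma>: "path \<gamma>" "finite_length \<gamma>" "\<gamma> 1 = zi"
    and non: "\<not> continuable_to_end \<gamma> r u v"
  shows "\<exists>C1 C2 :: nat \<Rightarrow> complex. \<exists>\<sigma>>0. \<exists>\<delta>>0. \<exists>W :: real \<Rightarrow> complex.
       (\<forall>w. 0 < norm w \<and> norm w < \<sigma> \<longrightarrow>
          summable (\<lambda>j. C1 j * w powi (int j - int n)) \<and> summable (\<lambda>j. C2 j * w powi (int j - int m))) \<and>
       continuous_on {1 - \<delta> <..< 1} W \<and>
       (\<forall>s\<in>{1 - \<delta> <..< 1}. s \<ge> 0 \<and> W s ^ q = \<gamma> s - zi \<and> norm (W s) < \<sigma> \<and>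
          (\<gamma> s \<noteq> zi \<longrightarrow> (\<exists>\<epsilon>>0. \<forall>w\<in>ball (W s) \<epsilon>.
              u s (zi + w ^ q) = (\<Sum>j. C1 j * w powi (int j - int n)) \<and>
              v s (zi + w ^ q) = (\<Sum>j. C2 j * w powi (int j - int m)))))"
proof -
  obtain B where B: "B \<ge> 0" and asym: "\<And>\<eta>. \<eta> > 0 \<Longrightarrow> \<exists>s1. 0 \<le> s1 \<and> s1 < 1 \<and> (\<forall>s. s1 \<le> s \<longrightarrow> s < 1 \<longrightarrow>
      norm (\<gamma> s - zi) < \<eta> \<and> u s (\<gamma> s) \<noteq> 0 \<and> (\<forall>\<tau>. \<tau> ^ n * u s (\<gamma> s) = 1 \<longrightarrow> norm \<tau> < \<eta> \<and>
      (\<exists>c\<in>Rt. norm (v s (\<gamma> s) * \<tau> ^ m - Ps c (\<gamma> s) \<tau>) \<le> B * norm \<tau> ^ K)))"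
    using asymptotics[OF cont \<gamma> non] by blast
  obtain \<rho> where \<rho>: "\<rho> > 0" and charts: "\<And>c \<tau>1 z1 x1. c \<in> Rt \<Longrightarrow> \<tau>1 \<noteq> 0 \<Longrightarrow> norm \<tau>1 \<le> \<rho> \<Longrightarrow> norm (z1 - zi) \<le> \<rho> \<Longrightarrow>
     norm (x1 - Ps c z1 \<tau>1) \<le> B * norm \<tau>1 ^ K \<Longrightarrow> \<exists>Z X k. chart \<tau>1 \<rho> Z X k \<and> Z \<tau>1 = z1 \<and> X \<tau>1 = x1"
    using chart_uniform[OF B] by blast
  \<comment> \<open>With all later \<open>\<tau> s\<close> below \<open>\<rho> / 4\<close>, the disc
    of radius \<open>\<rho>\<close> about \<open>\<tau> s1\<close> contains them and also the disc
    of radius \<open>\<rho> / 2\<close> about 0.\<close>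
  have "\<rho> / 4 > 0" using \<rho> by simp
  from asym[OF this] obtain s1 where s1: "0 \<le> s1" "s1 < 1" and as: "\<And>s. s1 \<le> s \<Longrightarrow> s < 1 \<Longrightarrow>
      norm (\<gamma> s - zi) < \<rho> / 4 \<and> u s (\<gamma> s) \<noteq> 0 \<and> (\<forall>\<tau>. \<tau> ^ n * u s (\<gamma> s) = 1 \<longrightarrow> norm \<tau> < \<rho> / 4 \<and>
      (\<exists>c\<in>Rt. norm (v s (\<gamma> s) * \<tau> ^ m - Ps c (\<gamma> s) \<tau>) \<le> B * norm \<tau> ^ K))" by blast
  have "continuous_on {s1..<1} (\<lambda>s. u s (\<gamma> s))"
    by (rule continuous_on_subset[OF continuous_along(1)[OF cont \<gamma>(1)]]) (use s1 in auto)
  from continuous_nth_root[OF this _ n_pos] obtain \<tau> where \<tau>c: "continuous_on {s1..<1} \<tau>"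
    and \<tau>r: "\<And>s. s \<in> {s1..<1} \<Longrightarrow> \<tau> s ^ n * u s (\<gamma> s) = 1" using as by (metis atLeastLessThan_iff)
  have \<tau>n: "\<tau> s ^ n * u s (\<gamma> s) = 1" "norm (\<tau> s) < \<rho> / 4" "\<tau> s \<noteq> 0" if "s1 \<le> s" "s < 1" for s
  proof -
    show 1: "\<tau> s ^ n * u s (\<gamma> s) = 1" by (rule \<tau>r) (use that in auto)
    then show "norm (\<tau> s) < \<rho> / 4" using as[OF that] by blast
    show "\<tau> s \<noteq> 0" using 1 n_pos by (auto simp: zero_power)
  qed
  note t1 = \<tau>n[OF order_refl s1(2)]
  obtain c where c: "c \<in> Rt" "norm (v s1 (\<gamma> s1) * \<tau> s1 ^ m - Ps c (\<gamma> s1) (\<tau> s1)) \<le> B * norm (\<tau> s1) ^ K"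
    using as[OF order_refl s1(2)] t1(1) by blast
  have "norm (\<tau> s1) \<le> \<rho>" "norm (\<gamma> s1 - zi) \<le> \<rho>" using t1(2) as[OF order_refl s1(2)] \<rho> by auto
  from charts[OF c(1) t1(3) this c(2)]
  obtain Z X k where ch: "chart (\<tau> s1) \<rho> Z X k" and init: "Z (\<tau> s1) = \<gamma> s1" "X (\<tau> s1) = v s1 (\<gamma> s1) * \<tau> s1 ^ m" by blast
  have \<tau>b: "\<tau> s ^ n * u s (\<gamma> s) = 1 \<and> \<tau> s \<in> ball (\<tau> s1) \<rho>" if "s1 \<le> s" "s < 1" for s
    using \<tau>n[OF that] t1(2) norm_triangle_ineq4[of "\<tau> s1" "\<tau> s"] \<rho> by (simp add: dist_norm)
  have follow: "Z (\<tau> s) = \<gamma> s \<and> (\<exists>\<epsilon>>0. \<forall>x\<in>ball (\<tau> s) \<epsilon>. u s (Z x) = 1 / x ^ n \<and> v s (Z x) = X x / x ^ m)"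
    if "s1 \<le> s" "s < 1" for s
    by (rule chart_follow[OF ch cont \<gamma>(1) s1 \<tau>c refl \<tau>b init that])
  have sub: "ball 0 (\<rho> / 2) \<subseteq> ball (\<tau> s1) \<rho>"
  proof
    fix x :: complex assume "x \<in> ball 0 (\<rho> / 2)"
    then show "x \<in> ball (\<tau> s1) \<rho>" using t1(2) norm_triangle_ineq4[of "\<tau> s1" x] \<rho> by (simp add: dist_norm)
  qed
  have \<rho>2: "\<rho> / 2 > 0" using \<rho> by simp
  have z0: "0 \<in> ball (\<tau> s1) \<rho>" by (rule subsetD[OF sub]) (use \<rho> in simp)
  have hol: "Z holomorphic_on ball (\<tau> s1) \<rho>" "X holomorphic_on ball (\<tau> s1) \<rho>" "k holomorphic_on ball (\<tau> s1) \<rho>" and k0: "k 0 \<noteq> 0"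
    and dZ: "\<And>t. t \<in> ball (\<tau> s1) \<rho> \<Longrightarrow> (Z has_field_derivative t ^ (q - 1) * k t) (at t)"
    using ch z0 unfolding chart_def by auto
  have \<tau>small: "\<exists>s2. s1 \<le> s2 \<and> s2 < 1 \<and> (\<forall>s. s2 \<le> s \<longrightarrow> s < 1 \<longrightarrow> norm (\<gamma> s - zi) < \<eta> \<and> norm (\<tau> s) < \<eta>)" if \<eta>: "\<eta> > 0" for \<eta>
  proof -
    obtain s2 where s2: "0 \<le> s2" "s2 < 1" "\<And>s. s2 \<le> s \<Longrightarrow> s < 1 \<Longrightarrow> norm (\<gamma> s - zi) < \<eta> \<and> (\<forall>\<tau>. \<tau> ^ n * u s (\<gamma> s) = 1 \<longrightarrow> norm \<tau> < \<eta>)"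
      using asym[OF \<eta>] by blast
    show ?thesis
      by (intro exI[of _ "max s1 s2"]) (use s1 s2 \<tau>n(1) in auto)
  qed
  \<comment> \<open>\<open>\<tau> s\<close> tends to 0 while
    \<open>Z (\<tau> s) = \<gamma> s\<close> tends to \<open>zi\<close>.\<close>
  have Z0: "Z 0 = zi"
  proof (rule ccontr)
    assume "Z 0 \<noteq> zi"
    then have d: "dist (Z 0) zi / 2 > 0" by simp
    have "Z 0 \<in> ball (Z 0) (dist (Z 0) zi / 2)" using d by simp
    from ball_in_preimage[OF hol(1) open_ball z0 open_ball this]
    obtain e where e: "e > 0" "\<And>y. y \<in> ball 0 e \<Longrightarrow> Z y \<in> ball (Z 0) (dist (Z 0) zi / 2)" by metis
    have "min e (dist (Z 0) zi / 2) > 0" using e d by simp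
    from \<tau>small[OF this] obtain s where s: "s1 \<le> s" "s < 1" "norm (\<gamma> s - zi) < dist (Z 0) zi / 2" "norm (\<tau> s) < e" by auto
    have "dist (Z 0) (Z (\<tau> s)) < dist (Z 0) zi / 2" using e(2)[of "\<tau> s"] s(4) by simp
    moreover have "Z (\<tau> s) = \<gamma> s" using follow[OF s(1,2)] by simp
    ultimately show False using s(3) dist_triangle[of "Z 0" zi "\<gamma> s"] unfolding dist_norm by simp
  qed
  obtain \<rho>1 \<sigma> \<omega> T H where pos': "0 < \<rho>1" "0 < \<sigma>" and hw: "\<omega> holomorphic_on ball 0 \<rho>1" "T holomorphic_on ball 0 \<sigma>" "H holomorphic_on ball 0 \<sigma>"
    and \<omega>: "\<And>t. t \<in> ball 0 \<rho>1 \<Longrightarrow> t \<in> ball 0 (\<rho> / 2) \<and> \<omega> t ^ q = Z t - zi \<and> norm (\<omega> t) < \<sigma> \<and> T (\<omega> t) = t"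
    and T: "\<And>w. w \<in> ball 0 \<sigma> \<Longrightarrow> T w \<in> ball 0 (\<rho> / 2) \<and> Z (T w) = zi + w ^ q \<and> T w = w * H w \<and> H w \<noteq> 0"
    by (rule local_uniformizer[OF \<rho>2 holomorphic_on_subset[OF hol(1) sub] Z0 holomorphic_on_subset[OF hol(3) sub] k0 _ q_pos])
       (use dZ sub in blast, rule that)
  from \<tau>small[OF pos'(1)] obtain s2 where s2: "s1 \<le> s2" "s2 < 1" "\<And>s. s2 \<le> s \<Longrightarrow> s < 1 \<Longrightarrow> norm (\<tau> s) < \<rho>1" by blast
  \<comment> \<open>Since \<open>T w = w * H w\<close> with \<open>H\<close> free of zeros,
    \<open>\<tau>^(-n)\<close> is \<open>w^(-n)\<close> times the holomorphic \<open>h1\<close>, and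
    likewise for \<open>y2\<close>. The Taylor coefficients of \<open>h1\<close> and
    \<open>h2\<close> are the coefficients sought.\<close>
  define h1 where "h1 w = 1 / H w ^ n" for w
  define h2 where "h2 w = X (T w) / H w ^ m" for w
  have H0: "H w ^ j \<noteq> 0" if "w \<in> ball 0 \<sigma>" for w j using T[OF that] by simp
  have hh1: "h1 holomorphic_on ball 0 \<sigma>" unfolding h1_def by (intro holomorphic_intros hw H0)
  have "(\<lambda>w. X (T w)) holomorphic_on ball 0 \<sigma>"
  proof -
    have "T ` ball 0 \<sigma> \<subseteq> ball (\<tau> s1) \<rho>" using T sub by blast
    from holomorphic_on_compose_gen[OF hw(2) hol(2) this] show ?thesis unfolding o_def .
  qed
  then have hh2: "h2 holomorphic_on ball 0 \<sigma>" unfolding h2_def by (intro holomorphic_intros hw H0)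
  define C1 where "C1 j = (deriv ^^ j) h1 0 / fact j" for j
  define C2 where "C2 j = (deriv ^^ j) h2 0 / fact j" for j
  have ser: "(\<lambda>j. C1 j * w powi (int j - int n)) sums (1 / T w ^ n)" "(\<lambda>j. C2 j * w powi (int j - int m)) sums (X (T w) / T w ^ m)"
    if w: "norm w < \<sigma>" "w \<noteq> 0" for w
  proof -
    have Tw: "T w = w * H w" using T[of w] w by simp
    have "h1 w / w ^ n = 1 / T w ^ n" unfolding h1_def Tw power_mult_distrib by simp
    then show "(\<lambda>j. C1 j * w powi (int j - int n)) sums (1 / T w ^ n)" using laurent_sums[OF hh1 w, of n] unfolding C1_def by simp
    have "h2 w / w ^ m = X (T w) / T w ^ m" unfolding h2_def Tw power_mult_distrib by simp
    then show "(\<lambda>j. C2 j * w powi (int j - int m)) sums (X (T w) / T w ^ m)" using laurent_sums[OF hh2 w, of m] unfolding C2_def by simp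
  qed
  \<comment> \<open>The \<open>q\<close>-th root of \<open>\<gamma> s - zi\<close> that belongs to
    the branch \<open>\<tau>\<close>; it inherits continuity from \<open>\<tau>\<close>, and it is
    nonzero since \<open>\<tau> s\<close> is.\<close>
  define W where "W s = \<omega> (\<tau> s)" for s
  have W: "0 \<le> s \<and> W s ^ q = \<gamma> s - zi \<and> norm (W s) < \<sigma> \<and> (\<exists>\<epsilon>>0. \<forall>w\<in>ball (W s) \<epsilon>.
      u s (zi + w ^ q) = (\<Sum>j. C1 j * w powi (int j - int n)) \<and> v s (zi + w ^ q) = (\<Sum>j. C2 j * w powi (int j - int m)))"
    if s: "s2 < s" "s < 1" for s
  proof -
    have s': "s1 \<le> s" "s2 \<le> s" "0 \<le> s" using s s1 s2 by auto
    have "\<tau> s \<in> ball 0 \<rho>1" using s2(3)[OF s'(2) s(2)] by simp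
    note o = \<omega>[OF this, folded W_def]
    note f = follow[OF s'(1) s(2)]
    obtain \<epsilon> where \<epsilon>: "\<epsilon> > 0" "\<And>x. x \<in> ball (\<tau> s) \<epsilon> \<Longrightarrow> u s (Z x) = 1 / x ^ n \<and> v s (Z x) = X x / x ^ m" using f by blast
    have Ws: "W s \<in> ball 0 \<sigma>" using o by simp
    have "W s \<noteq> 0" using o T[OF Ws] \<tau>n(3)[OF s'(1) s(2)] by auto
    then have Ws': "W s \<in> ball 0 \<sigma> - {0}" using Ws by simp
    have "open (ball 0 \<sigma> - {0::complex})" by auto
    moreover have "T holomorphic_on ball 0 \<sigma> - {0}" using hw(2) by (rule holomorphic_on_subset) auto
    moreover have "T (W s) \<in> ball (\<tau> s) \<epsilon>" using o \<epsilon>(1) by simp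
    ultimately obtain e where e: "e > 0" "\<And>w. w \<in> ball (W s) e \<Longrightarrow> w \<in> ball 0 \<sigma> - {0} \<and> T w \<in> ball (\<tau> s) \<epsilon>"
      using ball_in_preimage[OF _ _ Ws' open_ball] by metis
    have "u s (zi + w ^ q) = (\<Sum>j. C1 j * w powi (int j - int n)) \<and> v s (zi + w ^ q) = (\<Sum>j. C2 j * w powi (int j - int m))"
      if w: "w \<in> ball (W s) e" for w
    proof -
      have w1: "w \<in> ball 0 \<sigma>" "w \<noteq> 0" "norm w < \<sigma>" using e(2)[OF w] by auto
      have "Z (T w) = zi + w ^ q" using T[OF w1(1)] by blast
      then show ?thesis using \<epsilon>(2)[of "T w"] e(2)[OF w] sums_unique[OF ser(1)[OF w1(3,2)]] sums_unique[OF ser(2)[OF w1(3,2)]] by simp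
    qed
    then have "\<exists>\<epsilon>>0. \<forall>w\<in>ball (W s) \<epsilon>. u s (zi + w ^ q) = (\<Sum>j. C1 j * w powi (int j - int n)) \<and>
       v s (zi + w ^ q) = (\<Sum>j. C2 j * w powi (int j - int m))" using e(1) by blast
    then show ?thesis using o f s'(3) by simp
  qed
  have "continuous_on {s2<..<1} W"
    unfolding W_def
  proof (rule continuous_on_compose2[OF holomorphic_on_imp_continuous_on[OF hw(1)]])
    show "continuous_on {s2<..<1} \<tau>" by (rule continuous_on_subset[OF \<tau>c]) (use s2 in auto)
    show "\<tau> ` {s2<..<1} \<subseteq> ball 0 \<rho>1" using s2(3) by auto
  qed
  moreover have "1 - (1 - s2) = s2" "1 - s2 > 0" using s2 by auto
  moreover have "\<forall>w. 0 < norm w \<and> norm w < \<sigma> \<longrightarrow> summable (\<lambda>j. C1 j * w powi (int j - int n)) \<and> summable (\<lambda>j. C2 j * w powi (int j - int m))"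
    using ser sums_summable by fastforce
  ultimately show ?thesis
    by - (rule exI[of _ C1], rule exI[of _ C2], rule exI[of _ \<sigma>], rule conjI[OF pos'(2)], rule exI[of _ "1 - s2"],
      rule conjI, assumption, rule exI[of _ W], use W in auto)
qed

end

theorem theorem1:
  fixes M N :: nat
    and \<Omega> :: "complex set"
    and \<alpha> :: "nat \<Rightarrow> nat \<Rightarrow> complex \<Rightarrow> complex"
    and \<gamma> :: "real \<Rightarrow> complex"
    and r :: "real \<Rightarrow> real"
    and u v :: "real \<Rightarrow> complex \<Rightarrow> complex"
  assumes MN: "M > 0" "N > 0" "M * N \<ge> 2"
    and dom: "open \<Omega>" "connected \<Omega>"
    and an_lead: "\<alpha> (M + 1) 0 analytic_on \<Omega>" "\<alpha> 0 (N + 1) analytic_on \<Omega>"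
    and an_I: "\<And>i j. (i, j) \<in> idxI M N \<Longrightarrow> \<alpha> i j analytic_on \<Omega>"
    and formal: "\<And>z0 c1 c2. z0 \<in> \<Omega> - Phi \<alpha> M N \<Omega> \<Longrightarrow>
        c1 ^ (M * N - 1) = - inverse (\<alpha> 0 (N + 1) z0 * \<alpha> (M + 1) 0 z0 ^ N * of_nat (M * N - 1) ^ (N + 1)) \<Longrightarrow>
        c2 = of_nat (M * N - 1) * \<alpha> (M + 1) 0 z0 * c1 ^ M \<Longrightarrow>
        \<exists>Y1 Y2. formal_solution \<alpha> M N z0 c1 c2 Y1 Y2"
    and curve: "path \<gamma>" "path_image \<gamma> \<subseteq> \<Omega>" "finite_length \<gamma>"
    and endpt: "pathfinish \<gamma> \<in> \<Omega> - Phi \<alpha> M N \<Omega>"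
    and cont: "continuation_along \<alpha> M N \<Omega> \<gamma> r u v"
    and noncont: "\<not> continuable_to_end \<gamma> r u v"
  shows "let d = gcd (M + 1) (gcd (N + 1) (M * N - 1)); q = (M * N - 1) div d;
             k1 = int ((N + 1) div d); k2 = int ((M + 1) div d); zinf = pathfinish \<gamma> in
     \<exists>C1 C2 :: nat \<Rightarrow> complex. \<exists>\<sigma>>0. \<exists>\<delta>>0. \<exists>W :: real \<Rightarrow> complex.
       (\<forall>w. 0 < norm w \<and> norm w < \<sigma> \<longrightarrow>
          summable (\<lambda>n. C1 n * w powi (int n - k1)) \<and> summable (\<lambda>n. C2 n * w powi (int n - k2))) \<and>
       continuous_on {1 - \<delta> <..< 1} W \<and>
       (\<forall>s\<in>{1 - \<delta> <..< 1}. s \<ge> 0 \<and> W s ^ q = \<gamma> s - zinf \<and> norm (W s) < \<sigma> \<and>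
          (\<gamma> s \<noteq> zinf \<longrightarrow> (\<exists>\<epsilon>>0. \<forall>w\<in>ball (W s) \<epsilon>.
              u s (zinf + w ^ q) = (\<Sum>n. C1 n * w powi (int n - k1)) \<and>
              v s (zinf + w ^ q) = (\<Sum>n. C2 n * w powi (int n - k2)))))"
proof -
  define zi where "zi = \<gamma> 1"
  define d where "d = gcd (M + 1) (gcd (N + 1) (M * N - 1))"
  define n where "n = (N + 1) div d"
  define m where "m = (M + 1) div d"
  define q where "q = (M * N - 1) div d"
  have dv: "d dvd N + 1" "d dvd M + 1" "d dvd M * N - 1" unfolding d_def by (blast intro: gcd_dvd1 gcd_dvd2 dvd_trans)+
  have d0: "d > 0" unfolding d_def by simp
  interpret weights M N d n m q "n * (M + 1)"
  proof
    show "N + 1 = d * n" "M + 1 = d * m" "M * N - 1 = d * q" unfolding n_def m_def q_def using dv by simp_all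
    then show "q > 0" using MN by (cases q) auto
  qed (use MN d0 in auto)
  define f where "f z = (\<alpha> (M + 1) 0 z / \<alpha> 0 (N + 1) z) / (\<alpha> (M + 1) 0 zi / \<alpha> 0 (N + 1) zi)" for z
  have zi: "zi \<in> \<Omega>" "\<alpha> (M + 1) 0 zi \<noteq> 0" "\<alpha> 0 (N + 1) zi \<noteq> 0"
    using endpt unfolding zi_def pathfinish_def Phi_def by auto
  have h: "\<alpha> (M + 1) 0 holomorphic_on \<Omega>" "\<alpha> 0 (N + 1) holomorphic_on \<Omega>"
    using an_lead analytic_imp_holomorphic by blast+
  define S where "S = (\<Omega> \<inter> \<alpha> (M + 1) 0 -` (- {0})) \<inter> (\<Omega> \<inter> \<alpha> 0 (N + 1) -` (- {0}))"
  have S: "open S" unfolding S_def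
    by (intro open_Int continuous_open_preimage holomorphic_on_imp_continuous_on h dom(1)) auto
  have SO: "z \<in> \<Omega> - Phi \<alpha> M N \<Omega>" if "z \<in> S" for z using that unfolding S_def Phi_def by auto
  have "f holomorphic_on S" unfolding f_def
    by (intro holomorphic_intros holomorphic_on_subset[OF h(1)] holomorphic_on_subset[OF h(2)]) (use zi in \<open>auto simp: S_def\<close>)
  then have cf: "continuous_on S f" by (rule holomorphic_on_imp_continuous_on)
  \<comment> \<open>Off the zeros of the leading coefficients, \<open>f\<close> is continuous with
    \<open>f zi = 1\<close>; removing the points where it meets the slit leaves an open
    neighbourhood of \<open>zi\<close> on which the roots of \<open>h(z, 0, w)\<close> are
    single-valued.\<close>
  define U where "U = S \<inter> f -` (- \<real>\<^sub>\<le>\<^sub>0)"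
  have UO: "U \<subseteq> \<Omega>" unfolding U_def S_def by auto
  interpret local_hamiltonian M N d n m q "n * (M + 1)" \<alpha> U zi
  proof
    show "open U" unfolding U_def by (rule continuous_open_preimage[OF cf S]) auto
    show "\<alpha> i j holomorphic_on U" if "(i, j) \<in> J" for i j
      using that an_lead an_I analytic_imp_holomorphic holomorphic_on_subset[OF _ UO] unfolding J_def by blast
    show "\<alpha> (M + 1) 0 z \<noteq> 0" "\<alpha> 0 (N + 1) z \<noteq> 0" if "z \<in> U" for z using that unfolding U_def S_def by auto
    have "f zi = 1" unfolding f_def using zi by simp
    then show "zi \<in> U" unfolding U_def S_def using zi by auto
    show "(\<alpha> (M + 1) 0 z / \<alpha> 0 (N + 1) z) / (\<alpha> (M + 1) 0 zi / \<alpha> 0 (N + 1) zi) \<notin> \<real>\<^sub>\<le>\<^sub>0" if "z \<in> U" for z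
      using that unfolding U_def f_def by auto
    show "\<exists>Y1 Y2. formal_solution \<alpha> M N z0 c1 c2 Y1 Y2"
      if "z0 \<in> U" "c1 ^ (M * N - 1) = - inverse (\<alpha> 0 (N + 1) z0 * \<alpha> (M + 1) 0 z0 ^ N * of_nat (M * N - 1) ^ (N + 1))"
        "c2 = of_nat (M * N - 1) * \<alpha> (M + 1) 0 z0 * c1 ^ M" for z0 c1 c2
      by (rule formal[OF SO that(2,3)]) (use that(1) in \<open>simp add: U_def\<close>)
  qed
  obtain e C e1 ez C4 C5 T0 where ph: "phase M N d n m q (n * (M + 1)) \<alpha> U zi e C e1 ez C4 C5 T0" using phase_exists by blast
  show ?thesis
    using phase.series_representation[OF ph cont curve(1,3) zi_def[symmetric] noncont]
    unfolding Let_def pathfinish_def d_def[symmetric] n_def[symmetric] m_def[symmetric] q_def[symmetric] zi_def[symmetric] .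
qed

end
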